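(* Let $\theta=1$. Let $\mu\in\mathfrak h^*$ satisfy $\mu_a-\mu_b\notin\mathbb Z$ for all $a\ne b$, and let $\lambda\in\mathfrak h^*$ be such that the numbers $\nu_a=\mu_a-\lambda_a-\frac n2$ ($a=1,\dots,p$) and $\nu_a=\lambda_a-\mu_a-\frac n2$ ($a=p+1,\dots,m$) are all non-negative integers. Let $v_\mu^\lambda$ denote the image of the vector $$\prod_{a=1}^p p_{an}^{\nu_a}\cdot\prod_{a=p+1}^m q_{a1}^{\nu_a}\in\bar{\mathrm A}$$ in $\bar{\mathrm J}\backslash\bar{\mathrm A}/\bar{\mathrm I}_{\mu,\delta^+}$. Then: (i) $v_\mu^\lambda$ does not belong to the zero coset in $\bar{\mathrm J}\backslash\bar{\mathrm A}/\bar{\mathrm I}_{\mu,\delta^+}$. (ii) $v_\mu^\lambda$ is of weight $\lambda$ under the action of $\mathfrak h$ on $\bar{\mathrm J}\backslash\bar{\mathrm A}/\bar{\mathrm I}_{\mu,\delta^+}$, and is of highest weight with respect to the action of $\mathrm Y(\mathfrak{gl}_n)$ on the same quotient space. (iii) For any $\sigma\in\mathfrak S_m$, the operator $\bar{\mathrm J}\backslash\bar{\mathrm A}/\bar{\mathrm I}_{\mu,\delta^+}\to\bar{\mathrm J}\backslash\bar{\mathrm A}/\bar{\mathrm I}_{\sigma\circ\mu,\sigma(\delta^+)}$ determined by $\check\xi_\sigma$ maps $v_\mu^\lambda$ to the image in $\bar{\mathrm J}\backslash\bar{\mathrm A}/\bar{\mathrm I}_{\sigma\circ\mu,\sigma(\delta^+)}$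 of $\sigma\big(\prod_{a\le p}p_{an}^{\nu_a}\prod_{a>p}q_{a1}^{\nu_a}\big)\in\bar{\mathrm A}$ multiplied by $\prod_{\eta\in\Delta_\sigma}z_\eta$. Here $\Delta_\sigma=\{\eta\in\Delta^+\mid\sigma(\eta)\notin\Delta^+\}$, and for $\eta=E_{bb}^*-E_{cc}^*\in\Delta^+$ with $1\le b<c\le m$ $$z_\eta=\begin{cases}\displaystyle\prod_{r=1}^{\nu_b}\frac{\mu_b^*-\mu_c^*-r}{\lambda_b^*-\lambda_c^*+r}&\text{if } b,c\in\{1,\dots,p\},\\[2ex]\displaystyle\prod_{r=1}^{\nu_c}\frac{\mu_b^*-\mu_c^*-r}{\lambda_b^*-\lambda_c^*+r}&\text{if } b,c\in\{p+1,\dots,m\},\\[2ex]\displaystyle\prod_{r=1}^{\min(\nu_b,\nu_c)}\frac{\mu_b^*-\mu_c^*-r+1}{\lambda_b^*-\lambda_c^*+r-1}&\text{if } b\le p<c\text{ and } n=1,\\[2ex]1&\text{if } b\le p<c\text{ and } n>1,\end{cases}$$ where $(\mu_1^*,\dots,\mu_m^* )$ are the labels of $\mu+\rho-\frac n2\delta'$ and $(\lambda_1^*,\dots,\lambda_m^* )$ are the labels of $\lambda+\rho+\frac n2\delta'$.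
   Context: **Yangian.** $\mathrm Y(\mathfrak{gl}_n)$ is the unital associative $\mathbb C$-algebra generated by $T_{ij}^{(1)},T_{ij}^{(2)},\dots$ ($1\le i,j\le n$) with relations $(u-v)[T_{ij}(u),T_{kl}(v)]=T_{kj}(u)T_{il}(v)-T_{kj}(v)T_{il}(u)$, where $T_{ij}(u)=\delta_{ij}+\sum_{s\ge1}T_{ij}^{(s)}u^{-s}$. A non-zero vector is of highest weight if it is annihilated by all coefficients of $T_{ij}(u)$ for $i<j$ and is an eigenvector of all coefficients of $T_{ii}(u)$, $1\le i\le n$. **Oscillator algebra ($\theta=1$).** Fix $n\ge1$, $p,q\ge0$, $m=p+q\ge1$. $\mathcal{HD}$ is the Weyl algebra of polynomial differential operators in the commuting variables $x_{ai}$, $1\le a\le m$, $1\le i\le n$, with derivations $\partial_{ai}$. Put $p_{ci}=-x_{ci}$, $q_{ci}=\partial_{ci}$ for $c\le p$ and $p_{ci}=\partial_{ci}$, $q_{ci}=x_{ci}$ for $c>p$; $\hat E_{ai,bj}=q_{ai}p_{bj}$. The homomorphism $\zeta_n:\mathrm U(\mathfrak{gl}_m)\to\mathcal{HD}$ is $\zeta_n(E_{ab})=\delta_{ab}\frac n2+\sum_{k=1}^n\hat E_{ak,bk}$. Let $X(u)=(u+E')^{-1}$, $E'$ being the $m\times m$ matrix with $(a,b)$ entry $E_{ba}\in\mathfrak{gl}_m$; its entries $X_{ab}(u)$ are series in $u^{-1}$ over $\mathrm U(\mathfrak{gl}_m)$. The homomorphism $\alpha_m:\mathrm Y(\mathfrak{gl}_n)\to\mathrm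 U(\mathfrak{gl}_m)\otimes\mathcal{HD}$ is $T_{ij}(u)\mapsto\delta_{ij}+\sum_{a,b}X_{ab}(u)\otimes\hat E_{ai,bj}$. **Weights.** $\mathfrak h\subset\mathfrak{gl}_m$ has basis $E_{aa}$ with dual basis $E_{aa}^*$; weights are identified with their sequences of labels. $\mathfrak n$ is spanned by $E_{ba}$ and $\mathfrak n'$ by $E_{ab}$, $a<b$. $\Delta^+=\{E_{bb}^*-E_{cc}^*:b<c\}$. $\mathfrak S_m$ acts on $\mathfrak h^*$ by $\sigma(E_{aa}^* )=E_{\sigma(a)\sigma(a)}^*$; $\rho=(0,-1,\dots,1-m)$; $\sigma\circ\mu=\sigma(\mu+\rho)-\rho$. For $\delta\in\{1,-1\}^m$ put $\overline\delta=(\delta_1,\dots,\delta_p,-\delta_{p+1},\dots,-\delta_m)$, $\sigma\cdot\delta=(\delta_{\sigma^{-1}(1)},\dots,\delta_{\sigma^{-1}(m)})$, $\sigma(\delta)=\overline{\sigma\cdot\overline\delta}$; $\delta^+=(1,\dots,1)$, $\delta'=\overline{\delta^+}=(1,\dots,1,-1,\dots,-1)$ ($p$ ones, $q$ minus ones), also regarded as a weight. **Algebra $\mathrm A$ and ideals.** $\mathrm A$ is the algebra generated by $\mathrm U(\mathfrak{gl}_m)$ and $\mathcal{HD}$ with cross relations $[X,Y]=[\zeta_n(X),Y]$, $X\in\mathfrak{gl}_m$, $Y\in\mathcal{HD}$; it is isomorphic to $\mathrm U(\mathfrak{gl}_m)\otimes\mathcal{HD}$ via $X\mapsto X\otimes1+1\otimes\zeta_n(X)$,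 $Y\mapsto1\otimes Y$, and through this $\alpha_m$ maps $\mathrm Y(\mathfrak{gl}_n)$ to $\mathrm A$, with image commuting with $\mathrm U(\mathfrak{gl}_m)\subset\mathrm A$. $\mathfrak S_m$ acts on $\mathrm A$ by $E_{ab}\mapsto E_{\sigma(a)\sigma(b)}$, $p_{ai}\mapsto p_{\sigma(a)i}$, $q_{ai}\mapsto q_{\sigma(a)i}$. $\overline{\mathrm U(\mathfrak h)}$ and $\bar{\mathrm A}$ are the rings of fractions of $\mathrm U(\mathfrak h)$ and $\mathrm A$ relative to the denominators $E_{aa}-E_{bb}+z$ ($a\ne b$, $z\in\mathbb Z$); elements of $\overline{\mathrm U(\mathfrak h)}$ are viewed as rational functions on $\mathfrak h^*$; the $\mathfrak S_m$-action extends to $\bar{\mathrm A}$. $\bar{\mathrm J}$ is the right ideal of $\bar{\mathrm A}$ generated by $\mathfrak n$. $\mathrm I_{\mu,\delta}$ is the left ideal of $\mathrm A$ generated by $x_{ak}$ ($\delta_a=-1$), $\partial_{ak}$ ($\delta_a=1$), $X-\zeta_n(X)$ ($X\in\mathfrak n'$), and $E_{aa}-\zeta_n(E_{aa})-\mu_a$ ($1\le a\le m$); $\bar{\mathrm I}_{\mu,\delta}=\overline{\mathrm U(\mathfrak h)}\,\mathrm I_{\mu,\delta}$. $\bar{\mathrm J}\backslash\bar{\mathrm A}/\bar{\mathrm I}_{\mu,\delta}$ denotes the vector space $\bar{\mathrm A}/(\bar{\mathrm J}+\bar{\mathrm I}_{\mu,\delta})$; $\mathfrak h$ and $\mathrm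 Y(\mathfrak{gl}_n)$ (via $\alpha_m$) act on it by left multiplication. **Zhelobenko operators.** For $1\le c\le m-1$ put $E_c=E_{c,c+1}$, $F_c=E_{c+1,c}$, $H_c=E_{cc}-E_{c+1,c+1}$, $\eta_c=E_{cc}^*-E_{c+1,c+1}^*$, $\widehat F_c(Y)=[F_c,Y]$, $H_c^{(s)}=H_c(H_c-1)\cdots(H_c-s+1)$, and $\xi_c(Y)=Y+\sum_{s\ge1}(s!H_c^{(s)})^{-1}E_c^s\widehat F_c^s(Y)$ for $Y\in\mathrm A$. Let $\bar\xi_c:\bar{\mathrm A}\to\bar{\mathrm J}\backslash\bar{\mathrm A}$ be the linear map $\bar\xi_c(XY)=Z\xi_c(Y)+\bar{\mathrm J}$ for $X\in\overline{\mathrm U(\mathfrak h)}$, $Y\in\mathrm A$, $Z(\mu)=X(\mu+\eta_c)$. With $\sigma_c=(c\;c+1)$, $\check\xi_c$ is the operator on $\bar{\mathrm J}\backslash\bar{\mathrm A}$ induced by $\bar\xi_c\sigma_c$; these satisfy the braid relations, and $\check\xi_\sigma=\check\xi_{c_1}\cdots\check\xi_{c_k}$ for a reduced decomposition $\sigma=\sigma_{c_1}\cdots\sigma_{c_k}$. For $\mu$ as in the claim $\check\xi_\sigma$ induces a linear map $\bar{\mathrm J}\backslash\bar{\mathrm A}/\bar{\mathrm I}_{\mu,\delta^+}\to\bar{\mathrm J}\backslash\bar{\mathrm A}/\bar{\mathrm I}_{\sigma\circ\mu,\sigma(\delta^+)}$. *)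

theory Defs
  imports
    Complex_Main
    "HOL-Library.Poly_Mapping"
    "HOL-Combinatorics.Transposition"
    "HOL-Combinatorics.Permutations"
    "HOL-Algebra.QuotRing"
    "HOL-Algebra.Generated_Groups"
begin

section \<open>Complex associative algebras given by generators and relations\<close>

text \<open>Words form a monoid under concatenation, so finitely supported functions on words with the
  convolution product are the free associative algebra.\<close>

instantiation list :: (type) monoid_add
begin
definition zero_list :: "'a list" where "zero_list = []"
definition plus_list :: "'a list \<Rightarrow> 'a list \<Rightarrow> 'a list" where "plus_list = (@)"
instance by standard (simp_all add: zero_list_def plus_list_def)
end

type_synonym 'g falg = "'g list \<Rightarrow>\<^sub>0 complex"

definition scal :: "complex \<Rightarrow> 'g falg" where
  "scal z = Poly_Mapping.single [] z"

definition gener :: "'g \<Rightarrow> 'g falg" where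
  "gener g = Poly_Mapping.single [g] 1"

definition comm :: "'g falg \<Rightarrow> 'g falg \<Rightarrow> 'g falg" where
  "comm x y = x * y - y * x"

definition free_algebra :: "'g set \<Rightarrow> 'g falg ring" where
  "free_algebra S =
     \<lparr>carrier = {f. \<forall>w\<in>Poly_Mapping.keys f. set w \<subseteq> S}, monoid.mult = (*), one = 1, zero = 0, add = (+)\<rparr>"

definition fsubst :: "('g \<Rightarrow> 'h falg) \<Rightarrow> 'g falg \<Rightarrow> 'h falg" where
  "fsubst \<phi> f =
     (\<Sum>w\<in>Poly_Mapping.keys f. scal (Poly_Mapping.lookup f w) * prod_list (map \<phi> w))"

definition presented :: "'g set \<Rightarrow> 'g falg set \<Rightarrow> 'g falg set ring" where
  "presented S R = free_algebra S Quot (Idl\<^bsub>free_algebra S\<^esub> R)"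

definition pclass :: "'g set \<Rightarrow> 'g falg set \<Rightarrow> 'g falg \<Rightarrow> 'g falg set" where
  "pclass S R f = (Idl\<^bsub>free_algebra S\<^esub> R) +>\<^bsub>free_algebra S\<^esub> f"

text \<open>The homomorphism from an algebra given by generators and relations to \<open>presented S R\<close>
  determined by the images of the generators.\<close>

definition phom :: "'h set \<Rightarrow> 'h falg set \<Rightarrow> ('g \<Rightarrow> 'h falg) \<Rightarrow> 'g falg set \<Rightarrow> 'h falg set" where
  "phom S R \<phi> C = the_elem ((\<lambda>f. pclass S R (fsubst \<phi> f)) ` C)"

definition left_ideal_gen :: "'a ring \<Rightarrow> 'a set \<Rightarrow> 'a set" where
  "left_ideal_gen R S = generate (add_monoid R) {r \<otimes>\<^bsub>R\<^esub> s |r s. r \<in> carrier R \<and> s \<in> S}"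

definition right_ideal_gen :: "'a ring \<Rightarrow> 'a set \<Rightarrow> 'a set" where
  "right_ideal_gen R S = generate (add_monoid R) {s \<otimes>\<^bsub>R\<^esub> r |r s. r \<in> carrier R \<and> s \<in> S}"

text \<open>Left multiplication by \<open>y\<close> on the cosets of an additive subgroup \<open>K\<close>;
  \<open>(K +> x)\<close> goes to \<open>K +> (y \<otimes> x)\<close> whenever \<open>y\<close> preserves \<open>K\<close>.\<close>

definition coset_act :: "'a ring \<Rightarrow> 'a set \<Rightarrow> 'a \<Rightarrow> 'a set \<Rightarrow> 'a set" where
  "coset_act R K y C = K <+>\<^bsub>R\<^esub> (y <#\<^bsub>R\<^esub> C)"


section \<open>The Yangian of \<open>gl\<^sub>n\<close>\<close>

datatype ygen = GT nat nat nat

definition yangian_gens :: "nat \<Rightarrow> ygen set" where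
  "yangian_gens n = {GT i j s |i j s. i \<in> {1..n} \<and> j \<in> {1..n} \<and> 1 \<le> s}"

text \<open>\<open>yT i j s\<close> is the coefficient of \<open>u\<^bsup>-s\<^esup>\<close> in the series \<open>T\<^sub>i\<^sub>j(u)\<close>.\<close>

definition yT :: "nat \<Rightarrow> nat \<Rightarrow> nat \<Rightarrow> ygen falg" where
  "yT i j s = (if s = 0 then (if i = j then 1 else 0) else gener (GT i j s))"

text \<open>The coefficients of \<open>u\<^bsup>-r\<^esup>v\<^bsup>-s\<^esup>\<close> in
  \<open>(u - v)[T\<^sub>i\<^sub>j(u), T\<^sub>k\<^sub>l(v)] = T\<^sub>k\<^sub>j(u)T\<^sub>i\<^sub>l(v) - T\<^sub>k\<^sub>j(v)T\<^sub>i\<^sub>l(u)\<close>; those with \<open>r\<close> or \<open>s\<close> equal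
  to \<open>-1\<close> vanish identically since the constant terms of the series are scalars.\<close>

definition yangian_rels :: "nat \<Rightarrow> ygen falg set" where
  "yangian_rels n =
     {comm (yT i j (Suc r)) (yT k l s) - comm (yT i j r) (yT k l (Suc s))
        - (yT k j r * yT i l s - yT k j s * yT i l r) |i j k l r s.
        i \<in> {1..n} \<and> j \<in> {1..n} \<and> k \<in> {1..n} \<and> l \<in> {1..n}}"

definition yangian :: "nat \<Rightarrow> ygen falg set ring" where
  "yangian n = presented (yangian_gens n) (yangian_rels n)"

definition yangian_T :: "nat \<Rightarrow> nat \<Rightarrow> nat \<Rightarrow> nat \<Rightarrow> ygen falg set" where
  "yangian_T n i j s = pclass (yangian_gens n) (yangian_rels n) (yT i j s)"

text \<open>Here \<open>act\<close> is the action of the Yangian on a vector space with zero vector \<open>z\<close> and scalar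
  multiplication \<open>smul\<close>.\<close>

definition yangian_highest_weight ::
    "nat \<Rightarrow> (ygen falg set \<Rightarrow> 'v \<Rightarrow> 'v) \<Rightarrow> 'v \<Rightarrow> (complex \<Rightarrow> 'v \<Rightarrow> 'v) \<Rightarrow> 'v \<Rightarrow> bool" where
  "yangian_highest_weight n act z smul v \<longleftrightarrow>
     v \<noteq> z \<and>
     (\<forall>i\<in>{1..n}. \<forall>j\<in>{1..n}. i < j \<longrightarrow> (\<forall>s. act (yangian_T n i j s) v = z)) \<and>
     (\<forall>i\<in>{1..n}. \<forall>s. \<exists>t. act (yangian_T n i i s) v = smul t v)"


section \<open>The algebras \<open>U(gl\<^sub>m) \<otimes> HD\<close>, \<open>A\<close> and its ring of fractions\<close>

text \<open>Throughout \<open>m = p + q\<close>. The generators stand for the matrix units \<open>E\<^sub>a\<^sub>b\<close>, the variables \<open>x\<^sub>a\<^sub>i\<close>,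
  the derivations \<open>\<partial>\<^sub>a\<^sub>i\<close>, and the inverses of \<open>E\<^sub>a\<^sub>a - E\<^sub>b\<^sub>b + z\<close>.\<close>

datatype gen = GE nat nat | GX nat nat | GD nat nat | GInv nat nat int

abbreviation eE :: "nat \<Rightarrow> nat \<Rightarrow> gen falg" where "eE a b \<equiv> gener (GE a b)"
abbreviation eX :: "nat \<Rightarrow> nat \<Rightarrow> gen falg" where "eX a i \<equiv> gener (GX a i)"
abbreviation eD :: "nat \<Rightarrow> nat \<Rightarrow> gen falg" where "eD a i \<equiv> gener (GD a i)"
abbreviation eInv :: "nat \<Rightarrow> nat \<Rightarrow> int \<Rightarrow> gen falg" where "eInv a b z \<equiv> gener (GInv a b z)"

definition pp :: "nat \<Rightarrow> nat \<Rightarrow> nat \<Rightarrow> gen falg" where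
  "pp p c i = (if c \<le> p then - eX c i else eD c i)"

definition qq :: "nat \<Rightarrow> nat \<Rightarrow> nat \<Rightarrow> gen falg" where
  "qq p c i = (if c \<le> p then eD c i else eX c i)"

definition Ehat :: "nat \<Rightarrow> nat \<Rightarrow> nat \<Rightarrow> nat \<Rightarrow> nat \<Rightarrow> gen falg" where
  "Ehat p a i b j = qq p a i * pp p b j"

text \<open>The image of \<open>E\<^sub>a\<^sub>b\<close> under the homomorphism \<open>\<zeta>\<^sub>n\<close>.\<close>

definition zeta :: "nat \<Rightarrow> nat \<Rightarrow> nat \<Rightarrow> nat \<Rightarrow> gen falg" where
  "zeta p n a b = (if a = b then scal (of_nat n / 2) else 0) + (\<Sum>k=1..n. Ehat p a k b k)"

definition gl_gens :: "nat \<Rightarrow> gen set" where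
  "gl_gens m = {GE a b |a b. a \<in> {1..m} \<and> b \<in> {1..m}}"

definition weyl_gens :: "nat \<Rightarrow> nat \<Rightarrow> gen set" where
  "weyl_gens m n = {GX a i |a i. a \<in> {1..m} \<and> i \<in> {1..n}} \<union> {GD a i |a i. a \<in> {1..m} \<and> i \<in> {1..n}}"

definition inv_gens :: "nat \<Rightarrow> gen set" where
  "inv_gens m = {GInv a b z |a b z. a \<in> {1..m} \<and> b \<in> {1..m} \<and> a \<noteq> b}"

definition gl_rels :: "nat \<Rightarrow> gen falg set" where
  "gl_rels m =
     {comm (eE a b) (eE c d) - ((if b = c then eE a d else 0) - (if d = a then eE c b else 0)) |a b c d.
        a \<in> {1..m} \<and> b \<in> {1..m} \<and> c \<in> {1..m} \<and> d \<in> {1..m}}"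

definition weyl_rels :: "nat \<Rightarrow> nat \<Rightarrow> gen falg set" where
  "weyl_rels m n =
     {comm (eX a i) (eX b j) |a b i j. a \<in> {1..m} \<and> b \<in> {1..m} \<and> i \<in> {1..n} \<and> j \<in> {1..n}} \<union>
     {comm (eD a i) (eD b j) |a b i j. a \<in> {1..m} \<and> b \<in> {1..m} \<and> i \<in> {1..n} \<and> j \<in> {1..n}} \<union>
     {comm (eD a i) (eX b j) - (if a = b \<and> i = j then 1 else 0) |a b i j.
        a \<in> {1..m} \<and> b \<in> {1..m} \<and> i \<in> {1..n} \<and> j \<in> {1..n}}"

definition tensor_rels :: "nat \<Rightarrow> nat \<Rightarrow> gen falg set" where
  "tensor_rels m n = {comm (gener g) (gener h) |g h. g \<in> gl_gens m \<and> h \<in> weyl_gens m n}"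

text \<open>Both sides of \<open>[X, Y] = [\<zeta>\<^sub>n(X), Y]\<close> are derivations in \<open>Y\<close>, so it suffices to impose it on
  generators.\<close>

definition cross_rels :: "nat \<Rightarrow> nat \<Rightarrow> nat \<Rightarrow> gen falg set" where
  "cross_rels p q n =
     {comm (eE a b) (gener h) - comm (zeta p n a b) (gener h) |a b h.
        a \<in> {1..p + q} \<and> b \<in> {1..p + q} \<and> h \<in> weyl_gens (p + q) n}"

definition inv_rels :: "nat \<Rightarrow> gen falg set" where
  "inv_rels m =
     {(eE a a - eE b b + of_int z) * eInv a b z - 1 |a b z. a \<in> {1..m} \<and> b \<in> {1..m} \<and> a \<noteq> b} \<union>
     {eInv a b z * (eE a a - eE b b + of_int z) - 1 |a b z. a \<in> {1..m} \<and> b \<in> {1..m} \<and> a \<noteq> b}"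

definition A_gens :: "nat \<Rightarrow> nat \<Rightarrow> nat \<Rightarrow> gen set" where
  "A_gens p q n = gl_gens (p + q) \<union> weyl_gens (p + q) n"

definition A_rels :: "nat \<Rightarrow> nat \<Rightarrow> nat \<Rightarrow> gen falg set" where
  "A_rels p q n = gl_rels (p + q) \<union> weyl_rels (p + q) n \<union> cross_rels p q n"

definition UHD_rels :: "nat \<Rightarrow> nat \<Rightarrow> nat \<Rightarrow> gen falg set" where
  "UHD_rels p q n = gl_rels (p + q) \<union> weyl_rels (p + q) n \<union> tensor_rels (p + q) n"

definition Abar_gens :: "nat \<Rightarrow> nat \<Rightarrow> nat \<Rightarrow> gen set" where
  "Abar_gens p q n = A_gens p q n \<union> inv_gens (p + q)"

definition Abar_rels :: "nat \<Rightarrow> nat \<Rightarrow> nat \<Rightarrow> gen falg set" where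
  "Abar_rels p q n = A_rels p q n \<union> inv_rels (p + q)"

definition A_alg :: "nat \<Rightarrow> nat \<Rightarrow> nat \<Rightarrow> gen falg set ring" where
  "A_alg p q n = presented (A_gens p q n) (A_rels p q n)"

text \<open>The denominators \<open>E\<^sub>a\<^sub>a - E\<^sub>b\<^sub>b + z\<close> generate an Ore set in \<open>A\<close>, so the ring of fractions is obtained
  by adjoining their inverses universally.\<close>

definition Abar :: "nat \<Rightarrow> nat \<Rightarrow> nat \<Rightarrow> gen falg set ring" where
  "Abar p q n = presented (Abar_gens p q n) (Abar_rels p q n)"

definition A_class :: "nat \<Rightarrow> nat \<Rightarrow> nat \<Rightarrow> gen falg \<Rightarrow> gen falg set" where
  "A_class p q n = pclass (A_gens p q n) (A_rels p q n)"

definition Abar_class :: "nat \<Rightarrow> nat \<Rightarrow> nat \<Rightarrow> gen falg \<Rightarrow> gen falg set" where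
  "Abar_class p q n = pclass (Abar_gens p q n) (Abar_rels p q n)"

definition A_to_Abar :: "nat \<Rightarrow> nat \<Rightarrow> nat \<Rightarrow> gen falg set \<Rightarrow> gen falg set" where
  "A_to_Abar p q n = phom (Abar_gens p q n) (Abar_rels p q n) gener"


section \<open>The homomorphism from the Yangian to \<open>A\<close>\<close>

text \<open>\<open>Xcoef m s a b\<close> is the coefficient of \<open>u\<^bsup>-s\<^esup>\<close> in the \<open>(a, b)\<close> entry of \<open>X(u) = (u + E')\<^bsup>-1\<^esup>\<close>,
  read off from \<open>(u + E') X(u) = 1\<close>, where \<open>E'\<close> has \<open>(a, c)\<close> entry \<open>E\<^sub>c\<^sub>a\<close>.\<close>

fun Xcoef :: "nat \<Rightarrow> nat \<Rightarrow> nat \<Rightarrow> nat \<Rightarrow> gen falg" where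
  "Xcoef m 0 a b = 0"
| "Xcoef m (Suc 0) a b = (if a = b then 1 else 0)"
| "Xcoef m (Suc (Suc s)) a b = - (\<Sum>c=1..m. eE c a * Xcoef m (Suc s) c b)"

fun alpha_gen :: "nat \<Rightarrow> nat \<Rightarrow> ygen \<Rightarrow> gen falg" where
  "alpha_gen p q (GT i j s) = (\<Sum>a=1..p + q. \<Sum>b=1..p + q. Xcoef (p + q) s a b * Ehat p a i b j)"

definition alpha_UHD :: "nat \<Rightarrow> nat \<Rightarrow> nat \<Rightarrow> ygen falg set \<Rightarrow> gen falg set" where
  "alpha_UHD p q n = phom (A_gens p q n) (UHD_rels p q n) (alpha_gen p q)"

text \<open>The inverse of the isomorphism \<open>A \<rightarrow> U(gl\<^sub>m) \<otimes> HD\<close>,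
  \<open>X \<mapsto> X \<otimes> 1 + 1 \<otimes> \<zeta>\<^sub>n(X)\<close>, \<open>Y \<mapsto> 1 \<otimes> Y\<close>: it sends \<open>X \<otimes> 1\<close> to \<open>X - \<zeta>\<^sub>n(X)\<close>.\<close>

fun UHD_to_A_gen :: "nat \<Rightarrow> nat \<Rightarrow> gen \<Rightarrow> gen falg" where
  "UHD_to_A_gen p n (GE a b) = eE a b - zeta p n a b"
| "UHD_to_A_gen p n g = gener g"

definition UHD_to_A :: "nat \<Rightarrow> nat \<Rightarrow> nat \<Rightarrow> gen falg set \<Rightarrow> gen falg set" where
  "UHD_to_A p q n = phom (A_gens p q n) (A_rels p q n) (UHD_to_A_gen p n)"

definition alpha :: "nat \<Rightarrow> nat \<Rightarrow> nat \<Rightarrow> ygen falg set \<Rightarrow> gen falg set" where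
  "alpha p q n y = UHD_to_A p q n (alpha_UHD p q n y)"


section \<open>Weights and the action of the symmetric group\<close>

text \<open>A weight is given by its labels at the indices \<open>1, \<dots>, m\<close>; the other values are irrelevant.\<close>

type_synonym weight = "nat \<Rightarrow> complex"

definition generic :: "nat \<Rightarrow> weight \<Rightarrow> bool" where
  "generic m \<mu> \<longleftrightarrow> (\<forall>a\<in>{1..m}. \<forall>b\<in>{1..m}. a \<noteq> b \<longrightarrow> \<mu> a - \<mu> b \<notin> \<int>)"

definition rho :: weight where
  "rho a = 1 - of_nat a"

definition perm_wt :: "(nat \<Rightarrow> nat) \<Rightarrow> weight \<Rightarrow> weight" where
  "perm_wt \<sigma> \<mu> = (\<lambda>a. \<mu> (inv_into UNIV \<sigma> a))"

definition dot_wt :: "(nat \<Rightarrow> nat) \<Rightarrow> weight \<Rightarrow> weight" where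
  "dot_wt \<sigma> \<mu> = (\<lambda>a. perm_wt \<sigma> (\<lambda>b. \<mu> b + rho b) a - rho a)"

definition sbar :: "nat \<Rightarrow> (nat \<Rightarrow> int) \<Rightarrow> (nat \<Rightarrow> int)" where
  "sbar p \<delta> a = (if a \<le> p then \<delta> a else - \<delta> a)"

definition perm_sign :: "nat \<Rightarrow> (nat \<Rightarrow> nat) \<Rightarrow> (nat \<Rightarrow> int) \<Rightarrow> (nat \<Rightarrow> int)" where
  "perm_sign p \<sigma> \<delta> = sbar p (\<lambda>a. sbar p \<delta> (inv_into UNIV \<sigma> a))"

definition delta_plus :: "nat \<Rightarrow> int" where
  "delta_plus a = 1"

text \<open>The pair \<open>(b, c)\<close> stands for the root \<open>E\<^sub>b\<^sub>b\<^sup>* - E\<^sub>c\<^sub>c\<^sup>*\<close>.\<close>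

definition pos_roots :: "nat \<Rightarrow> (nat \<times> nat) set" where
  "pos_roots m = {(b, c). b \<in> {1..m} \<and> c \<in> {1..m} \<and> b < c}"

definition Delta_inv :: "nat \<Rightarrow> (nat \<Rightarrow> nat) \<Rightarrow> (nat \<times> nat) set" where
  "Delta_inv m \<sigma> = {\<eta> \<in> pos_roots m. map_prod \<sigma> \<sigma> \<eta> \<notin> pos_roots m}"

fun perm_gen :: "nat \<Rightarrow> (nat \<Rightarrow> nat) \<Rightarrow> gen \<Rightarrow> gen falg" where
  "perm_gen p \<sigma> (GE a b) = eE (\<sigma> a) (\<sigma> b)"
| "perm_gen p \<sigma> (GX a i) = (if a \<le> p then - pp p (\<sigma> a) i else qq p (\<sigma> a) i)"
| "perm_gen p \<sigma> (GD a i) = (if a \<le> p then qq p (\<sigma> a) i else pp p (\<sigma> a) i)"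
| "perm_gen p \<sigma> (GInv a b z) = eInv (\<sigma> a) (\<sigma> b) z"

definition perm_act :: "nat \<Rightarrow> nat \<Rightarrow> nat \<Rightarrow> (nat \<Rightarrow> nat) \<Rightarrow> gen falg set \<Rightarrow> gen falg set" where
  "perm_act p q n \<sigma> = phom (Abar_gens p q n) (Abar_rels p q n) (perm_gen p \<sigma>)"

text \<open>\<open>cs\<close> is a reduced decomposition of \<open>\<sigma>\<close> into the transpositions \<open>\<sigma>\<^sub>c = (c c+1)\<close>.\<close>

definition word_perm :: "nat list \<Rightarrow> nat \<Rightarrow> nat" where
  "word_perm cs = foldr (\<lambda>c \<tau>. Transposition.transpose c (Suc c) \<circ> \<tau>) cs id"

definition reduced_decomposition :: "nat \<Rightarrow> (nat \<Rightarrow> nat) \<Rightarrow> nat list \<Rightarrow> bool" where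
  "reduced_decomposition m \<sigma> cs \<longleftrightarrow>
     set cs \<subseteq> {1..<m} \<and> word_perm cs = \<sigma> \<and>
     (\<forall>ds. set ds \<subseteq> {1..<m} \<and> word_perm ds = \<sigma> \<longrightarrow> length cs \<le> length ds)"


section \<open>Ideals and double coset spaces\<close>

definition Jbar :: "nat \<Rightarrow> nat \<Rightarrow> nat \<Rightarrow> gen falg set set" where
  "Jbar p q n = right_ideal_gen (Abar p q n)
     {Abar_class p q n (eE b a) |a b. a \<in> {1..p + q} \<and> b \<in> {1..p + q} \<and> a < b}"

definition I_ideal :: "nat \<Rightarrow> nat \<Rightarrow> nat \<Rightarrow> weight \<Rightarrow> (nat \<Rightarrow> int) \<Rightarrow> gen falg set set" where
  "I_ideal p q n \<mu> \<delta> = left_ideal_gen (A_alg p q n) (A_class p q n `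
     ({eX a k |a k. a \<in> {1..p + q} \<and> k \<in> {1..n} \<and> \<delta> a = -1} \<union>
      {eD a k |a k. a \<in> {1..p + q} \<and> k \<in> {1..n} \<and> \<delta> a = 1} \<union>
      {eE a b - zeta p n a b |a b. a \<in> {1..p + q} \<and> b \<in> {1..p + q} \<and> a < b} \<union>
      {eE a a - zeta p n a a - scal (\<mu> a) |a. a \<in> {1..p + q}}))"

text \<open>Expressions representing the elements of the ring of fractions of \<open>U(h)\<close>, and their values
  as rational functions at a generic point of the dual of \<open>h\<close>.\<close>

definition Uh_expr :: "nat \<Rightarrow> gen falg set" where
  "Uh_expr m = carrier (free_algebra ({GE a a |a. a \<in> {1..m}} \<union> inv_gens m))"

fun gen_val :: "weight \<Rightarrow> gen \<Rightarrow> complex" where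
  "gen_val \<mu> (GE a b) = \<mu> a"
| "gen_val \<mu> (GInv a b z) = inverse (\<mu> a - \<mu> b + of_int z)"
| "gen_val \<mu> (GX a i) = 0"
| "gen_val \<mu> (GD a i) = 0"

definition Uh_val :: "weight \<Rightarrow> gen falg \<Rightarrow> complex" where
  "Uh_val \<mu> f =
     (\<Sum>w\<in>Poly_Mapping.keys f. Poly_Mapping.lookup f w * prod_list (map (gen_val \<mu>) w))"

definition Ibar :: "nat \<Rightarrow> nat \<Rightarrow> nat \<Rightarrow> weight \<Rightarrow> (nat \<Rightarrow> int) \<Rightarrow> gen falg set set" where
  "Ibar p q n \<mu> \<delta> = generate (add_monoid (Abar p q n))
     {Abar_class p q n t \<otimes>\<^bsub>Abar p q n\<^esub> A_to_Abar p q n Y |t Y.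
        t \<in> Uh_expr (p + q) \<and> Y \<in> I_ideal p q n \<mu> \<delta>}"

text \<open>The double coset space is the space of additive cosets in \<open>Abar\<close> of the sum of \<open>Jbar\<close> and \<open>Ibar\<close>.\<close>

definition JIbar :: "nat \<Rightarrow> nat \<Rightarrow> nat \<Rightarrow> weight \<Rightarrow> (nat \<Rightarrow> int) \<Rightarrow> gen falg set set" where
  "JIbar p q n \<mu> \<delta> = Jbar p q n <+>\<^bsub>Abar p q n\<^esub> Ibar p q n \<mu> \<delta>"

definition double_coset ::
    "nat \<Rightarrow> nat \<Rightarrow> nat \<Rightarrow> weight \<Rightarrow> (nat \<Rightarrow> int) \<Rightarrow> gen falg set \<Rightarrow> gen falg set set" where
  "double_coset p q n \<mu> \<delta> x = JIbar p q n \<mu> \<delta> +>\<^bsub>Abar p q n\<^esub> x"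

definition dc_zero :: "nat \<Rightarrow> nat \<Rightarrow> nat \<Rightarrow> weight \<Rightarrow> (nat \<Rightarrow> int) \<Rightarrow> gen falg set set" where
  "dc_zero p q n \<mu> \<delta> = double_coset p q n \<mu> \<delta> \<zero>\<^bsub>Abar p q n\<^esub>"

definition dc_act ::
    "nat \<Rightarrow> nat \<Rightarrow> nat \<Rightarrow> weight \<Rightarrow> (nat \<Rightarrow> int) \<Rightarrow>
     gen falg set \<Rightarrow> gen falg set set \<Rightarrow> gen falg set set" where
  "dc_act p q n \<mu> \<delta> y C = coset_act (Abar p q n) (JIbar p q n \<mu> \<delta>) y C"

definition dc_smul ::
    "nat \<Rightarrow> nat \<Rightarrow> nat \<Rightarrow> weight \<Rightarrow> (nat \<Rightarrow> int) \<Rightarrow>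
     complex \<Rightarrow> gen falg set set \<Rightarrow> gen falg set set" where
  "dc_smul p q n \<mu> \<delta> z C = dc_act p q n \<mu> \<delta> (Abar_class p q n (scal z)) C"

definition dc_yangian_act ::
    "nat \<Rightarrow> nat \<Rightarrow> nat \<Rightarrow> weight \<Rightarrow> (nat \<Rightarrow> int) \<Rightarrow>
     ygen falg set \<Rightarrow> gen falg set set \<Rightarrow> gen falg set set" where
  "dc_yangian_act p q n \<mu> \<delta> y C = dc_act p q n \<mu> \<delta> (A_to_Abar p q n (alpha p q n y)) C"

definition dc_has_weight ::
    "nat \<Rightarrow> nat \<Rightarrow> nat \<Rightarrow> weight \<Rightarrow> (nat \<Rightarrow> int) \<Rightarrow> weight \<Rightarrow> gen falg set set \<Rightarrow> bool" where
  "dc_has_weight p q n \<mu> \<delta> lam C \<longleftrightarrow>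
     (\<forall>a\<in>{1..p + q}.
        dc_act p q n \<mu> \<delta> (Abar_class p q n (eE a a)) C = dc_smul p q n \<mu> \<delta> (lam a) C)"


section \<open>Zhelobenko operators\<close>

definition Fhat :: "nat \<Rightarrow> nat \<Rightarrow> nat \<Rightarrow> nat \<Rightarrow> gen falg set \<Rightarrow> gen falg set" where
  "Fhat p q n c Y =
     (A_class p q n (eE (Suc c) c) \<otimes>\<^bsub>A_alg p q n\<^esub> Y)
       \<ominus>\<^bsub>A_alg p q n\<^esub> (Y \<otimes>\<^bsub>A_alg p q n\<^esub> A_class p q n (eE (Suc c) c))"

definition Hfall :: "nat \<Rightarrow> nat \<Rightarrow> gen falg" where
  "Hfall c s = prod_list (map (\<lambda>k. eE c c - eE (Suc c) (Suc c) - of_nat k) [0..<s])"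

text \<open>The sum is finite because \<open>Fhat p q n c\<close> is locally nilpotent on \<open>A\<close>.\<close>

definition xi :: "nat \<Rightarrow> nat \<Rightarrow> nat \<Rightarrow> nat \<Rightarrow> gen falg set \<Rightarrow> gen falg set" where
  "xi p q n c Y =
     A_to_Abar p q n Y \<oplus>\<^bsub>Abar p q n\<^esub>
     (\<Oplus>\<^bsub>Abar p q n\<^esub>s\<in>{s. 1 \<le> s \<and> (Fhat p q n c ^^ s) Y \<noteq> \<zero>\<^bsub>A_alg p q n\<^esub>}.
        m_inv (Abar p q n) (Abar_class p q n (of_nat (fact s) * Hfall c s))
          \<otimes>\<^bsub>Abar p q n\<^esub> Abar_class p q n (eE c (Suc c) ^ s)
          \<otimes>\<^bsub>Abar p q n\<^esub> A_to_Abar p q n ((Fhat p q n c ^^ s) Y))"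

definition eta_wt :: "nat \<Rightarrow> weight" where
  "eta_wt c a = (if a = c then 1 else if a = Suc c then -1 else 0)"

text \<open>The linear map with \<open>X Y \<mapsto> Z \<xi>\<^sub>c(Y) + Jbar\<close>, where \<open>Z(\<mu>) = X(\<mu> + \<eta>\<^sub>c)\<close>; here \<open>t\<close> and \<open>t'\<close>
  represent \<open>X\<close> and \<open>Z\<close>.\<close>

definition xi_bar :: "nat \<Rightarrow> nat \<Rightarrow> nat \<Rightarrow> nat \<Rightarrow> gen falg set \<Rightarrow> gen falg set set" where
  "xi_bar p q n c = (THE f.
     f \<in> carrier (Abar p q n) \<rightarrow>\<^sub>E a_rcosets\<^bsub>Abar p q n\<^esub> (Jbar p q n) \<and>
     (\<forall>x\<in>carrier (Abar p q n). \<forall>y\<in>carrier (Abar p q n).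
        f (x \<oplus>\<^bsub>Abar p q n\<^esub> y) = f x <+>\<^bsub>Abar p q n\<^esub> f y) \<and>
     (\<forall>x\<in>carrier (Abar p q n). \<forall>z.
        f (Abar_class p q n (scal z) \<otimes>\<^bsub>Abar p q n\<^esub> x)
          = coset_act (Abar p q n) (Jbar p q n) (Abar_class p q n (scal z)) (f x)) \<and>
     (\<forall>t\<in>Uh_expr (p + q). \<forall>t'\<in>Uh_expr (p + q).
        (\<forall>\<mu>. generic (p + q) \<mu> \<longrightarrow> Uh_val \<mu> t' = Uh_val (\<lambda>a. \<mu> a + eta_wt c a) t) \<longrightarrow>
        (\<forall>Y\<in>carrier (A_alg p q n).
           f (Abar_class p q n t \<otimes>\<^bsub>Abar p q n\<^esub> A_to_Abar p q n Y)
             = Jbar p q n +>\<^bsub>Abar p q n\<^esub> (Abar_class p q n t' \<otimes>\<^bsub>Abar p q n\<^esub> xi p q n c Y))))"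

definition xi_check :: "nat \<Rightarrow> nat \<Rightarrow> nat \<Rightarrow> nat \<Rightarrow> gen falg set set \<Rightarrow> gen falg set set" where
  "xi_check p q n c C =
     the_elem ((\<lambda>x. xi_bar p q n c (perm_act p q n (Transposition.transpose c (Suc c)) x)) ` C)"

definition xi_check_word ::
    "nat \<Rightarrow> nat \<Rightarrow> nat \<Rightarrow> nat list \<Rightarrow> gen falg set set \<Rightarrow> gen falg set set" where
  "xi_check_word p q n cs = foldr (\<lambda>c g. xi_check p q n c \<circ> g) cs id"

text \<open>The map from a double coset space to the one with parameters \<open>\<mu>'\<close>, \<open>\<delta>'\<close> induced by
  \<open>xi_check_word p q n cs\<close>.\<close>

definition xi_check_induced ::
    "nat \<Rightarrow> nat \<Rightarrow> nat \<Rightarrow> nat list \<Rightarrow> weight \<Rightarrow> (nat \<Rightarrow> int) \<Rightarrow>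
     gen falg set set \<Rightarrow> gen falg set set" where
  "xi_check_induced p q n cs \<mu>' \<delta>' C =
     the_elem ((\<lambda>x. JIbar p q n \<mu>' \<delta>' <+>\<^bsub>Abar p q n\<^esub>
                     xi_check_word p q n cs (Jbar p q n +>\<^bsub>Abar p q n\<^esub> x)) ` C)"


section \<open>The vector and the scalar factors\<close>

definition v_elt :: "nat \<Rightarrow> nat \<Rightarrow> nat \<Rightarrow> (nat \<Rightarrow> nat) \<Rightarrow> gen falg set" where
  "v_elt p q n \<nu> = Abar_class p q n
     (prod_list (map (\<lambda>a. pp p a n ^ \<nu> a) [1..<p + 1]) *
      prod_list (map (\<lambda>a. qq p a 1 ^ \<nu> a) [p + 1..<p + q + 1]))"

definition v_coset :: "nat \<Rightarrow> nat \<Rightarrow> nat \<Rightarrow> weight \<Rightarrow> (nat \<Rightarrow> nat) \<Rightarrow> gen falg set set" where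
  "v_coset p q n \<mu> \<nu> = double_coset p q n \<mu> delta_plus (v_elt p q n \<nu>)"

definition mu_star :: "nat \<Rightarrow> nat \<Rightarrow> weight \<Rightarrow> weight" where
  "mu_star p n \<mu> a = \<mu> a + rho a - of_nat n / 2 * of_int (sbar p delta_plus a)"

definition lam_star :: "nat \<Rightarrow> nat \<Rightarrow> weight \<Rightarrow> weight" where
  "lam_star p n lam a = lam a + rho a + of_nat n / 2 * of_int (sbar p delta_plus a)"

definition z_factor ::
    "nat \<Rightarrow> nat \<Rightarrow> weight \<Rightarrow> weight \<Rightarrow> (nat \<Rightarrow> nat) \<Rightarrow> nat \<times> nat \<Rightarrow> complex" where
  "z_factor p n \<mu> lam \<nu> = (\<lambda>(b, c).
     let M = mu_star p n \<mu> b - mu_star p n \<mu> c;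
         L = lam_star p n lam b - lam_star p n lam c
     in if c \<le> p then \<Prod>r=1..\<nu> b. (M - of_nat r) / (L + of_nat r)
        else if p < b then \<Prod>r=1..\<nu> c. (M - of_nat r) / (L + of_nat r)
        else if n = 1 then \<Prod>r=1..min (\<nu> b) (\<nu> c). (M - of_nat r + 1) / (L + of_nat r - 1)
        else 1)"

end

theory Submission
 imports Defs
begin

text \<open>The monomials in the creation operators span the double coset space. The image of the Yangian
 commutes with \<open>gl_m\<close>, hence preserves weights, while the coefficients of \<open>T_ij(u)\<close> raise by \<open>i - j\<close> the
 eigenvalue of the grading element \<open>\<Sum> i q_ai p_ai\<close>. The vector is the only monomial of weight \<open>lam\<close> with
 the lowest eigenvalue, so \<open>T_ij(u)\<close> kills it for \<open>i < j\<close> and multiplies it by a series for \<open>i = j\<close>.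

 It is nonzero because \<open>gl_m\<close> acts on polynomials in auxiliary variables as on a Verma module; on the
 tensor product with the oscillator module there is a functional vanishing on the two ideals, but not
 on the monomial.

 For a simple reflection the Zhelobenko series involves two adjacent rows of variables only. On the
 vector it is a terminating hypergeometric sum, which the Chu-Vandermonde identity evaluates to one
 factor \<open>z_\<eta>\<close>. Each letter of a reduced word adds one inversion, which gives the product over
 \<open>\<Delta>_\<sigma>\<close>.\<close>

text \<open>No basis of A or of its ring of fractions is ever established: both are known only
  through generators and relations. Every well-definedness statement is therefore a check on
  relations, and non-vanishing has to come from an explicit representation. The operator of a simple
  root is built on words of the free algebra and shown to send relations into J. To identify it with
  the unique linear map X Y \<mapsto> Z \<xi>(Y) one also needs that a fraction of U(h) is
  determined by its values at generic weights. The generators p, q are preferred to x, \<partial>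
  because \<sigma> merely permutes their rows; the bar in the definition of \<sigma>(\<delta>) comes
  from this change, and the patterns \<open>ep\<close> below record the barred sign sequence. One
  reflection is shown to map the ideal of a pattern into that of the reflected pattern provided the
  latter does not have annihilating q in row c together with annihilating p in row c + 1. Starting
  from the constant sequence 1, this holds as long as every letter of the word adds an inversion,
  which is where reducedness enters.\<close>

section \<open>Complex algebras and evaluation of the free algebra\<close>

text \<open>The central structure map \<open>csc\<close> replaces a scalar multiplication. The class
  extends \<open>ring\<close> and \<open>monoid_mult\<close> rather than \<open>ring_1\<close>,
  because a quotient by relations may collapse to 0 = 1.\<close>

class calg = ring + monoid_mult +
 fixes csc :: "complex => 'a"
 assumes csc_add: "csc (a + b) = csc a + csc b"
  and csc_mult: "csc (a * b) = csc a * csc b"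
  and csc_1 [simp]: "csc 1 = 1"
  and csc_comm: "csc a * x = x * csc a"
begin

lemma csc_0 [simp]: "csc 0 = 0"
 using csc_add[of 0 0] by simp

lemma csc_uminus: "csc (- a) = - csc a"
 by (rule minus_unique[symmetric]) (simp flip: csc_add)

lemma csc_diff: "csc (a - b) = csc a - csc b"
 using csc_add[of "a - b" b] by simp

lemma csc_sum: "csc (sum f A) = (\<Sum>x\<in>A. csc (f x))"
 by (induction A rule: infinite_finite_induct) (simp_all add: csc_add)

lemma csc_left_comm: "x * (csc a * y) = csc a * (x * y)"
 by (metis csc_comm mult_assoc)

lemma csc_cancel: "z \<noteq> 0 ==> csc (inverse z) * (csc z * y) = y"
 by (simp flip: mult_assoc csc_mult)

end

instantiation complex :: calg
begin
definition csc_complex :: "complex => complex" where [simp]: "csc_complex z = z"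
instance by standard auto
end

instantiation poly_mapping :: (monoid_add, "{calg, ring_1}") calg
begin
definition csc_poly_mapping :: "complex => 'a \<Rightarrow>\<^sub>0 'b" where
 "csc_poly_mapping z = Poly_Mapping.single 0 (csc z)"
instance
proof
 fix a :: complex and x :: "'a \<Rightarrow>\<^sub>0 'b"
 have "Poly_Mapping.single 0 (csc a) * x = x * Poly_Mapping.single 0 (csc a)"
 proof (induction x rule: update_induct)
  case const
  thus ?case by simp
 next
  case (update x k v)
  have "Poly_Mapping.update k v x = x + Poly_Mapping.single k v"
   using update by (intro poly_mapping_eqI)
    (auto simp: lookup_update lookup_add lookup_single in_keys_iff when_def)
  thus ?case
   using update by (simp add: distrib_left distrib_right mult_single csc_comm)
 qed
 thus "csc a * x = x * csc a"
  by (simp add: csc_poly_mapping_def)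
qed (auto simp: csc_poly_mapping_def single_add mult_single csc_add csc_mult simp flip: single_one)
end

lemma falg_of_nat: "(of_nat k :: 'g falg) = csc (of_nat k)"
 by (induction k) (simp_all add: csc_add)

lemma falg_of_int: "(of_int k :: 'g falg) = csc (of_int k)"
 by (cases k rule: int_diff_cases) (simp add: csc_diff falg_of_nat)

lemma scal_eq_csc: "scal z = csc z"
 by (simp add: scal_def csc_poly_mapping_def zero_list_def)


definition feval :: "('g => 'r::calg) => 'g falg => 'r" where
 "feval \<phi> f = (\<Sum>w\<in>Poly_Mapping.keys f. csc (Poly_Mapping.lookup f w) * prod_list (map \<phi> w))"

text \<open>Linear extension of an arbitrary function on words. Unlike \<open>feval\<close> it is
  not multiplicative; the operator \<xi> will be defined through it.\<close>

definition flin :: "('g list => 'r::calg) => 'g falg => 'r" where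
 "flin \<phi> f = (\<Sum>w\<in>Poly_Mapping.keys f. csc (Poly_Mapping.lookup f w) * \<phi> w)"

abbreviation wrd :: "'g list => 'g falg" where
 "wrd w \<equiv> Poly_Mapping.single w 1"

lemma feval_flin: "feval \<phi> = flin (%w. prod_list (map \<phi> w))"
 by (simp add: feval_def flin_def fun_eq_iff)

lemma flin_superset:
 assumes "finite S" "Poly_Mapping.keys f \<subseteq> S"
 shows "flin \<phi> f = (\<Sum>w\<in>S. csc (Poly_Mapping.lookup f w) * \<phi> w)"
 unfolding flin_def using assms
 by (intro sum.mono_neutral_left) (auto simp: in_keys_iff)

lemma flin_0 [simp]: "flin \<phi> 0 = 0"
 by (simp add: flin_def)

lemma flin_add: "flin \<phi> (f + g) = flin \<phi> f + flin \<phi> g"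
proof -
 let ?S = "Poly_Mapping.keys f \<union> Poly_Mapping.keys g"
 have "flin \<phi> h = (\<Sum>w\<in>?S. csc (Poly_Mapping.lookup h w) * \<phi> w)" if "h \<in> {f, g, f + g}" for h
  using that Poly_Mapping.keys_add[of f g] by (intro flin_superset) auto
 thus ?thesis
  by (simp add: lookup_add csc_add distrib_right sum.distrib)
qed

lemma flin_single [simp]: "flin \<phi> (Poly_Mapping.single w c) = csc c * \<phi> w"
 by (cases "c = 0") (simp_all add: flin_def)

lemma falg_induct [case_names zero single add]:
 assumes "P 0" "!!w c. w \<in> Poly_Mapping.keys f ==> P (Poly_Mapping.single w c)"
  and "!!f g. P f ==> P g ==> P (f + g)"
 shows "P (f :: 'g falg)"
proof -
 have *: "P (\<Sum>w\<in>S. Poly_Mapping.single w (Poly_Mapping.lookup f w))"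
  if "finite S" "S \<subseteq> Poly_Mapping.keys f" for S
  using that by (induction rule: finite_induct) (auto intro: assms)
 have "f = (\<Sum>w\<in>Poly_Mapping.keys f. Poly_Mapping.single w (Poly_Mapping.lookup f w))"
  by (rule poly_mapping_eqI) (simp add: lookup_sum lookup_single when_def in_keys_iff)
 thus ?thesis
  using * by (metis finite_keys order_refl)
qed

lemma flin_scale: "flin \<phi> (csc c * f) = csc c * flin \<phi> f"
proof (induction f rule: falg_induct)
 case (single w d)
 thus ?case
  by (simp add: csc_poly_mapping_def mult_single csc_mult mult.assoc)
qed (simp_all add: distrib_left flin_add)

lemma flin_uminus: "flin \<phi> (- f) = - flin \<phi> f"
 by (rule minus_unique[symmetric]) (simp flip: flin_add)

lemma flin_diff: "flin \<phi> (f - g) = flin \<phi> f - flin \<phi> g"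
 using flin_add[of \<phi> f "- g"] by (simp add: flin_uminus)

lemma flin_sum: "flin \<phi> (sum f A) = (\<Sum>x\<in>A. flin \<phi> (f x))"
 by (induction A rule: infinite_finite_induct) (simp_all add: flin_add)

lemma flin_cong:
 "(!!w. w \<in> Poly_Mapping.keys f ==> \<phi> w = \<psi> w) ==> flin \<phi> f = flin \<psi> f"
 by (simp add: flin_def)

lemma flin_wrd_mult: "flin \<phi> (wrd u * f * wrd v) = flin (%w. \<phi> (u @ w @ v)) f"
proof (induction f rule: falg_induct)
 case (single w c)
 thus ?case by (simp add: mult_single plus_list_def)
qed (simp_all add: distrib_left distrib_right flin_add)

lemma flin_lmult: "flin (%w. y * \<phi> w) f = y * flin \<phi> f"
 by (simp add: flin_def sum_distrib_left csc_left_comm)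

lemma single_eq_wrd: "Poly_Mapping.single w c = csc c * wrd w"
 by (simp add: csc_poly_mapping_def mult_single)

lemma wrd_Nil [simp]: "wrd [] = 1"
 unfolding zero_list_def[symmetric] by (rule single_one)

lemma wrd_append: "wrd (u @ v) = wrd u * wrd v"
 by (simp add: mult_single plus_list_def)

lemma wrd_Cons: "wrd (g # v) = gener g * wrd v"
 by (simp add: gener_def mult_single plus_list_def)

lemma feval_add: "feval \<phi> (f + g) = feval \<phi> f + feval \<phi> g"
 and feval_diff: "feval \<phi> (f - g) = feval \<phi> f - feval \<phi> g"
 and feval_uminus: "feval \<phi> (- f) = - feval \<phi> f"
 and feval_sum: "feval \<phi> (sum h A) = (\<Sum>x\<in>A. feval \<phi> (h x))"
 and feval_0 [simp]: "feval \<phi> 0 = 0"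
 by (simp_all add: feval_flin flin_add flin_diff flin_uminus flin_sum)

lemma feval_single: "feval \<phi> (Poly_Mapping.single w c) = csc c * prod_list (map \<phi> w)"
 by (simp add: feval_flin)

lemma feval_mult: "feval \<phi> (f * g) = feval \<phi> f * feval \<phi> g"
proof (induction f rule: falg_induct)
 case (single w c)
 show ?case
 proof (induction g rule: falg_induct)
  case (single v d)
  have "csc d * (prod_list (map \<phi> w) * prod_list (map \<phi> v)) =
    prod_list (map \<phi> w) * (csc d * prod_list (map \<phi> v))"
   by (simp add: csc_left_comm)
  thus ?case
   by (simp add: feval_single mult_single plus_list_def csc_mult mult.assoc)
 qed (simp_all add: distrib_left feval_add)
qed (simp_all add: distrib_right feval_add)

lemma feval_gener [simp]: "feval \<phi> (gener g) = \<phi> g"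
 by (simp add: gener_def feval_single)

lemma feval_csc [simp]: "feval \<phi> (csc c) = csc c"
 by (simp add: csc_poly_mapping_def feval_single zero_list_def)

lemma feval_scal [simp]: "feval \<phi> (scal c) = csc c"
 by (simp add: scal_def feval_single)

lemma feval_1 [simp]: "feval \<phi> 1 = 1"
 using feval_csc[of \<phi> 1] by (simp del: feval_csc)

lemma feval_power: "feval \<phi> (x ^ k) = feval \<phi> x ^ k"
 by (induction k) (simp_all add: feval_mult)

lemma feval_prod_list: "feval \<phi> (prod_list xs) = prod_list (map (feval \<phi>) xs)"
 by (induction xs) (simp_all add: feval_mult)

lemma feval_of_nat [simp]: "feval \<phi> (of_nat k) = csc (of_nat k)"
 by (simp add: falg_of_nat)

lemma feval_of_int [simp]: "feval \<phi> (of_int k) = csc (of_int k)"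
 by (simp add: falg_of_int)

lemma feval_comm: "feval \<phi> (comm x y) = feval \<phi> x * feval \<phi> y - feval \<phi> y * feval \<phi> x"
 by (simp add: comm_def feval_diff feval_mult)

lemmas feval_simps = feval_add feval_diff feval_uminus feval_sum feval_mult feval_power
 feval_prod_list feval_comm

lemma fsubst_eq_feval: "fsubst = feval"
 by (simp add: fsubst_def feval_def fun_eq_iff scal_eq_csc)

lemma feval_gener_id: "feval gener f = f"
proof (induction f rule: falg_induct)
 case (single w c)
 have "prod_list (map gener w) = wrd w"
  by (induction w) (simp_all add: wrd_Cons)
 thus ?case by (metis feval_single single_eq_wrd)
qed (simp_all add: feval_add)

lemma feval_feval: "feval \<psi> (feval \<phi> f) = feval (%g. feval \<psi> (\<phi> g)) f"
 by (induction f rule: falg_induct)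
  (simp_all add: feval_add feval_single feval_mult feval_prod_list comp_def)

lemma feval_cong: "(!!w g. w \<in> Poly_Mapping.keys f ==> g \<in> set w ==> \<phi> g = \<psi> g) ==> feval \<phi> f = feval \<psi> f"
 unfolding feval_def by (intro sum.cong refl arg_cong2[of _ _ _ _ "(*)"] arg_cong[of _ _ prod_list] map_cong) auto


section \<open>Subalgebras and two-sided ideals of the free algebra\<close>

abbreviation alg :: "'g set => 'g falg set" where
 "alg S \<equiv> carrier (free_algebra S)"

lemma alg_def: "alg S = {f. \<forall>w\<in>Poly_Mapping.keys f. set w \<subseteq> S}"
 by (simp add: free_algebra_def)

lemma alg_0 [simp]: "0 \<in> alg S"
 by (simp add: alg_def)

lemma alg_single: "set w \<subseteq> S ==> Poly_Mapping.single w c \<in> alg S"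
 by (simp add: alg_def)

lemma alg_scal [simp]: "scal c \<in> alg S"
 by (simp add: alg_single scal_def)

lemma alg_csc [simp]: "csc c \<in> alg S"
 by (simp flip: scal_eq_csc)

lemma alg_1 [simp]: "1 \<in> alg S"
 using alg_csc[of 1 S] by (simp del: alg_csc)

lemma alg_gener [simp]: "g \<in> S ==> gener g \<in> alg S"
 by (simp add: gener_def alg_single)

lemma alg_add: "x \<in> alg S ==> y \<in> alg S ==> x + y \<in> alg S"
 using Poly_Mapping.keys_add[of x y] by (auto simp: alg_def)

lemma alg_uminus: "x \<in> alg S ==> - x \<in> alg S"
 by (auto simp: alg_def)

lemma alg_diff: "x \<in> alg S ==> y \<in> alg S ==> x - y \<in> alg S"
 using alg_add[of x S "- y"] by (simp add: alg_uminus)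

lemma alg_mult: "x \<in> alg S ==> y \<in> alg S ==> x * y \<in> alg S"
 using keys_mult[of x y] by (fastforce simp: alg_def plus_list_def)

lemma alg_sum: "(!!a. a \<in> A ==> h a \<in> alg S) ==> sum h A \<in> alg S"
 by (induction A rule: infinite_finite_induct) (simp_all add: alg_add)

lemma alg_power: "x \<in> alg S ==> x ^ k \<in> alg S"
 by (induction k) (simp_all add: alg_mult)

lemma alg_prod_list: "(!!x. x \<in> set xs ==> x \<in> alg S) ==> prod_list xs \<in> alg S"
 by (induction xs) (simp_all add: alg_mult)

lemma alg_of_nat [simp]: "of_nat k \<in> alg S"
 by (simp add: falg_of_nat)

lemma alg_of_int [simp]: "of_int k \<in> alg S"
 by (simp add: falg_of_int)

lemma alg_comm: "x \<in> alg S ==> y \<in> alg S ==> comm x y \<in> alg S"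
 by (simp add: comm_def alg_diff alg_mult)

lemmas alg_intros = alg_add alg_diff alg_uminus alg_mult alg_sum alg_power alg_prod_list alg_comm

lemma alg_mono: "S \<subseteq> T ==> x \<in> alg S ==> x \<in> alg T"
 by (auto simp: alg_def)

lemma alg_feval: "(!!g. g \<in> S ==> \<phi> g \<in> alg T) ==> f \<in> alg S ==> feval \<phi> f \<in> alg T"
 unfolding feval_def by (intro alg_sum alg_mult alg_csc alg_prod_list) (auto simp: alg_def)

lemma alg_induct [consumes 1, case_names zero single add]:
 assumes "f \<in> alg S" "P 0" "!!w c. set w \<subseteq> S ==> P (Poly_Mapping.single w c)"
  and "!!f g. P f ==> P g ==> P (f + g)"
 shows "P f"
 by (rule falg_induct[where P = P and f = f]) (use assms in "auto simp: alg_def")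

lemma alg_feval_id:
 assumes "f \<in> alg S" "!!g. g \<in> S ==> \<phi> g = gener g"
 shows "feval \<phi> f = f"
proof -
 have "feval \<phi> f = feval gener f"
  using assms by (intro feval_cong) (auto simp: alg_def)
 thus ?thesis by (simp add: feval_gener_id)
qed

lemma free_algebra_simps [simp]:
 "x \<otimes>\<^bsub>free_algebra S\<^esub> y = x * y" "x \<oplus>\<^bsub>free_algebra S\<^esub> y = x + y"
 "\<one>\<^bsub>free_algebra S\<^esub> = 1" "\<zero>\<^bsub>free_algebra S\<^esub> = 0"
 by (simp_all add: free_algebra_def)

lemma ring_free_algebra: "ring (free_algebra S)"
proof (rule ringI)
 show "abelian_group (free_algebra S)"
 proof (rule abelian_groupI)
  fix x assume "x \<in> alg S"
  thus "\<exists>y\<in>alg S. y \<oplus>\<^bsub>free_algebra S\<^esub> x = \<zero>\<^bsub>free_algebra S\<^esub>"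
   by (intro bexI[of _ "- x"]) (simp_all add: alg_uminus)
 qed (simp_all add: alg_add add_ac)
 show "Group.monoid (free_algebra S)"
  by (rule monoidI) (simp_all add: mult.assoc alg_mult)
qed (simp_all add: distrib_left distrib_right)

text \<open>The ideal is taken in the free algebra on the whole type of generators, where no carrier
  conditions occur.\<close>

inductive_set tideal :: "'g falg set => 'g falg set" for R where
 zero: "0 \<in> tideal R"
| rel: "r \<in> R ==> u * r * v \<in> tideal R"
| add: "x \<in> tideal R ==> y \<in> tideal R ==> x + y \<in> tideal R"

lemma tideal_base: "r \<in> R ==> r \<in> tideal R"
 using tideal.rel[of r R 1 1] by simp

lemma tideal_lmult: "x \<in> tideal R ==> y * x \<in> tideal R"
 by (induction rule: tideal.induct) (auto simp: distrib_left intro: tideal.intros simp flip: mult.assoc)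

lemma tideal_rmult: "x \<in> tideal R ==> x * y \<in> tideal R"
 by (induction rule: tideal.induct) (auto simp: distrib_right mult.assoc intro: tideal.intros tideal.rel[simplified mult.assoc])

lemma tideal_uminus: "x \<in> tideal R ==> - x \<in> tideal R"
 using tideal_lmult[of x R "- 1"] by simp

lemma feval_tideal:
 assumes "!!r. r \<in> R ==> feval \<phi> r = 0" "x \<in> tideal R"
 shows "feval \<phi> x = 0"
 using assms(2) by induction (simp_all add: assms(1) feval_simps)

text \<open>Adjoining the generators outside S to R makes the ideal of the free algebra on S the
  trace of an ideal of the full free algebra. For the inclusion from right to left one applies the
  retraction that kills the outer generators: it is multiplicative, maps all ideal generators into
  the left side and fixes \<open>alg S\<close>.\<close>

lemma Idl_free_algebra:
 assumes "R \<subseteq> alg S"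
 shows "Idl\<^bsub>free_algebra S\<^esub> R = alg S \<inter> tideal (R \<union> gener ` (- S))"
proof
 interpret ring "free_algebra S" by (rule ring_free_algebra)
 let ?T = "tideal (R \<union> gener ` (- S))"
 have "ideal (alg S \<inter> ?T) (free_algebra S)"
 proof (rule idealI)
  show "subgroup (alg S \<inter> ?T) (add_monoid (free_algebra S))"
  proof (rule add.subgroupI)
   show "alg S \<inter> ?T \<noteq> {}" using tideal.zero alg_0 by blast
   fix a assume a: "a \<in> alg S \<inter> ?T"
   hence "- a \<oplus>\<^bsub>free_algebra S\<^esub> a = \<zero>\<^bsub>free_algebra S\<^esub>" by simp
   hence "\<ominus>\<^bsub>free_algebra S\<^esub> a = - a"
    using a by (intro minus_equality) (auto simp: alg_uminus)
   thus "\<ominus>\<^bsub>free_algebra S\<^esub> a \<in> alg S \<inter> ?T"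
    using a by (simp add: alg_uminus tideal_uminus)
  qed (auto intro: tideal.add alg_add)
 qed (auto intro: ring_free_algebra tideal_lmult tideal_rmult alg_mult)
 thus "Idl\<^bsub>free_algebra S\<^esub> R \<subseteq> alg S \<inter> ?T"
  using assms by (intro genideal_minimal) (auto intro: tideal_base)
 interpret I: ideal "Idl\<^bsub>free_algebra S\<^esub> R" "free_algebra S"
  using assms by (rule genideal_ideal)
 define \<rho> where "\<rho> = feval (%g. if g \<in> S then gener g else 0 :: 'a falg)"
 have id: "\<rho> x = x" if "x \<in> alg S" for x
  unfolding \<rho>_def using that by (rule alg_feval_id) simp
 have alg: "\<rho> x \<in> alg S" for x
  unfolding \<rho>_def by (rule alg_feval[of UNIV]) (auto simp: alg_def[of UNIV])
 have "\<rho> x \<in> Idl\<^bsub>free_algebra S\<^esub> R" if "x \<in> ?T" for x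
  using that
 proof induction
  case zero
  thus ?case using I.zero_closed by (simp add: \<rho>_def)
 next
  case (rel r u v)
  have "\<rho> r \<in> Idl\<^bsub>free_algebra S\<^esub> R"
  proof (cases "r \<in> R")
   case True
   hence "r \<in> Idl\<^bsub>free_algebra S\<^esub> R" using genideal_self[OF assms] by auto
   thus ?thesis using True assms id by auto
  next
   case False
   thus ?thesis using rel I.zero_closed by (auto simp: \<rho>_def)
  qed
  hence "\<rho> u \<otimes>\<^bsub>free_algebra S\<^esub> \<rho> r \<otimes>\<^bsub>free_algebra S\<^esub> \<rho> v \<in> Idl\<^bsub>free_algebra S\<^esub> R"
   using alg by (intro I.I_r_closed I.I_l_closed)
  thus ?case by (simp add: \<rho>_def feval_mult)
 next
  case (add x y)
  thus ?case using I.a_closed[of "\<rho> x" "\<rho> y"] by (simp add: \<rho>_def feval_add)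
 qed
 thus "alg S \<inter> ?T \<subseteq> Idl\<^bsub>free_algebra S\<^esub> R"
  using id by fastforce
qed


section \<open>Presented algebras as types\<close>

text \<open>A type carries only the name of a presentation; the data are attached to it through
  \<open>itself\<close>. One quotient construction then serves all the algebras involved.\<close>

class ptag =
 fixes pgens :: "'a itself => gen set" and prels :: "'a itself => gen falg set"
 assumes prels_alg: "prels T \<subseteq> alg (pgens T)"

definition pideal :: "'k::ptag itself => gen falg set" where
 "pideal T = tideal (prels T \<union> gener ` (- pgens T))"

lemma pideal_0: "0 \<in> pideal T"
 by (simp add: pideal_def tideal.zero)

lemma pideal_add: "x \<in> pideal T ==> y \<in> pideal T ==> x + y \<in> pideal T"
 by (simp add: pideal_def tideal.add)

lemma pideal_uminus: "x \<in> pideal T ==> - x \<in> pideal T"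
 by (simp add: pideal_def tideal_uminus)

lemma pideal_lmult: "x \<in> pideal T ==> y * x \<in> pideal T"
 by (simp add: pideal_def tideal_lmult)

lemma pideal_rmult: "x \<in> pideal T ==> x * y \<in> pideal T"
 by (simp add: pideal_def tideal_rmult)

\<comment> \<open>Since \<open>pideal\<close> contains the generators outside the presentation, they
  become zero. The quotient is defined on all of \<open>gen falg\<close>, and carrier predicates
  disappear.\<close>
quotient_type (overloaded) 'k pal = "gen falg" / "%x y. x - y \<in> pideal TYPE('k::ptag)"
proof (rule equivpI)
 show "reflp (%x y. x - y \<in> pideal TYPE('k))"
  by (simp add: reflp_def pideal_0)
 show "symp (%x y. x - y \<in> pideal TYPE('k))"
 proof (rule sympI)
  fix x y assume "x - y \<in> pideal TYPE('k)"
  from pideal_uminus[OF this] show "y - x \<in> pideal TYPE('k)" by simp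
 qed
 show "transp (%x y. x - y \<in> pideal TYPE('k))"
 proof (rule transpI)
  fix x y z assume "x - y \<in> pideal TYPE('k)" "y - z \<in> pideal TYPE('k)"
  from pideal_add[OF this] show "x - z \<in> pideal TYPE('k)" by simp
 qed
qed

instantiation pal :: (ptag) calg
begin

lift_definition zero_pal :: "'a pal" is 0 .
lift_definition one_pal :: "'a pal" is 1 .
lift_definition csc_pal :: "complex => 'a pal" is csc .
lift_definition plus_pal :: "'a pal => 'a pal => 'a pal" is "(+)"
proof -
 fix a b c d :: "gen falg"
 assume "a - b \<in> pideal TYPE('a)" "c - d \<in> pideal TYPE('a)"
 from pideal_add[OF this] show "(a + c) - (b + d) \<in> pideal TYPE('a)"
  by (simp add: algebra_simps)
qed
lift_definition uminus_pal :: "'a pal => 'a pal" is uminus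
proof -
 fix a b :: "gen falg"
 assume "a - b \<in> pideal TYPE('a)"
 from pideal_uminus[OF this] show "- a - - b \<in> pideal TYPE('a)"
  by (simp add: algebra_simps)
qed
lift_definition minus_pal :: "'a pal => 'a pal => 'a pal" is minus
proof -
 fix a b c d :: "gen falg"
 assume "a - b \<in> pideal TYPE('a)" "c - d \<in> pideal TYPE('a)"
 from pideal_add[OF this(1) pideal_uminus[OF this(2)]]
 show "(a - c) - (b - d) \<in> pideal TYPE('a)"
  by (simp add: algebra_simps)
qed
lift_definition times_pal :: "'a pal => 'a pal => 'a pal" is "(*)"
proof -
 fix a b c d :: "gen falg"
 assume "a - b \<in> pideal TYPE('a)" "c - d \<in> pideal TYPE('a)"
 from pideal_add[OF pideal_rmult[OF this(1), of c] pideal_lmult[OF this(2), of b]]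
 show "a * c - b * d \<in> pideal TYPE('a)"
  by (simp add: algebra_simps)
qed

instance
proof
 fix a b c :: "'a pal" and z w :: complex
 show "a + b + c = a + (b + c)" by transfer (simp add: pideal_0 add.assoc)
 show "a + b = b + a" by transfer (simp add: pideal_0 add.commute)
 show "0 + a = a" by transfer (simp add: pideal_0)
 show "- a + a = 0" by transfer (simp add: pideal_0)
 show "a - b = a + - b" by transfer (simp add: pideal_0)
 show "a * b * c = a * (b * c)" by transfer (simp add: pideal_0 mult.assoc)
 show "(a + b) * c = a * c + b * c" by transfer (simp add: pideal_0 distrib_right)
 show "a * (b + c) = a * b + a * c" by transfer (simp add: pideal_0 distrib_left)
 show "1 * a = a" by transfer (simp add: pideal_0)
 show "a * 1 = a" by transfer (simp add: pideal_0)
 show "csc (z + w) = (csc z + csc w :: 'a pal)" by transfer (simp add: pideal_0 csc_add)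
 show "csc (z * w) = (csc z * csc w :: 'a pal)" by transfer (simp add: pideal_0 csc_mult)
 show "csc 1 = (1 :: 'a pal)" by transfer (simp add: pideal_0)
 show "csc z * a = a * csc z" by transfer (metis csc_comm pideal_0 diff_self)
qed
end

definition cls :: "gen falg => 'k::ptag pal" where
 "cls = abs_pal"

lemma cls_eq_iff: "cls x = (cls y :: 'k::ptag pal) \<longleftrightarrow> x - y \<in> pideal TYPE('k)"
 by (simp add: cls_def pal.abs_eq_iff)

lemma cls_eq_0_iff: "cls x = (0 :: 'k::ptag pal) \<longleftrightarrow> x \<in> pideal TYPE('k)"
 by (simp add: cls_def pal.abs_eq_iff zero_pal_def)

lemma cls_0 [simp]: "cls 0 = 0"
 and cls_1 [simp]: "cls 1 = 1"
 and cls_csc [simp]: "cls (csc z) = csc z"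
 and cls_add: "cls (x + y) = cls x + cls y"
 and cls_diff: "cls (x - y) = cls x - cls y"
 and cls_uminus: "cls (- x) = - cls x"
 and cls_mult: "cls (x * y) = cls x * cls y"
 by (simp_all add: cls_def zero_pal_def one_pal_def csc_pal_def plus_pal.abs_eq minus_pal.abs_eq
   uminus_pal.abs_eq times_pal.abs_eq)

lemma cls_feval: "cls = feval (%g. cls (gener g))"
proof
 fix f show "cls f = (feval (%g. cls (gener g)) f :: 'k::ptag pal)"
 proof (induction f rule: falg_induct)
  case (single w c)
  have "cls (wrd w) = (prod_list (map (%g. cls (gener g)) w) :: 'k pal)"
   by (induction w) (simp_all add: wrd_Cons cls_mult)
  thus ?case
   unfolding single_eq_wrd[of w c] cls_mult feval_mult by (simp add: feval_single)
 qed (simp_all add: cls_add feval_add)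
qed

lemma cls_feval_comp: "cls (feval \<phi> f) = feval (%g. cls (\<phi> g)) f"
proof -
 have "cls (feval \<phi> f) = feval (%g. cls (gener g)) (feval \<phi> f)"
  by (rule fun_cong[OF cls_feval])
 also have "\<dots> = feval (%g. cls (\<phi> g)) f"
  unfolding feval_feval by (simp flip: cls_feval)
 finally show ?thesis .
qed

lemma cls_sum: "cls (sum h A) = (\<Sum>x\<in>A. cls (h x))"
 by (induction A rule: infinite_finite_induct) (simp_all add: cls_add)

lemma cls_power: "cls (x ^ k) = cls x ^ k"
 by (induction k) (simp_all add: cls_mult)

lemma cls_prod_list: "cls (prod_list xs) = prod_list (map cls xs)"
 by (induction xs) (simp_all add: cls_mult)

lemma cls_scal [simp]: "cls (scal z) = csc z"
 by (simp add: scal_eq_csc)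

lemma cls_of_nat [simp]: "cls (of_nat k) = csc (of_nat k)"
 by (simp add: falg_of_nat)

lemma cls_of_int [simp]: "cls (of_int k) = csc (of_int k)"
 by (simp add: falg_of_int)

lemma cls_comm: "cls (comm x y) = cls x * cls y - cls y * cls x"
 by (simp add: comm_def cls_diff cls_mult)

lemmas cls_simps = cls_add cls_diff cls_uminus cls_mult cls_sum cls_power cls_prod_list cls_comm

lemma cls_rel: "r \<in> prels TYPE('k::ptag) ==> cls r = (0 :: 'k pal)"
 by (simp add: cls_eq_0_iff pideal_def tideal_base)

lemma cls_outside: "g \<notin> pgens TYPE('k::ptag) ==> cls (gener g) = (0 :: 'k pal)"
 by (simp add: cls_eq_0_iff pideal_def tideal_base)

lemma cls_surj_alg: "\<exists>x\<in>alg (pgens TYPE('k::ptag)). cls x = (X :: 'k pal)"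
proof -
 have "\<exists>y. X = cls y"
  by (rule pal.abs_induct[of "%X. \<exists>y. X = cls y"]) (auto simp: cls_def)
 then obtain y where y: "X = cls y" ..
 define x where "x = feval (%g. if g \<in> pgens TYPE('k) then gener g else 0 :: gen falg) y"
 have "x \<in> alg (pgens TYPE('k))"
  unfolding x_def by (rule alg_feval[of UNIV]) (auto simp: alg_def[of UNIV])
 moreover have "cls x = X"
  unfolding x_def y cls_feval_comp
  by (subst cls_feval) (auto simp: cls_outside intro!: feval_cong)
 ultimately show ?thesis by blast
qed

abbreviation pres :: "'k::ptag itself => gen falg set ring" where
 "pres T \<equiv> presented (pgens T) (prels T)"

text \<open>The bridge to the set-based quotient ring: \<open>emb\<close> is a bijection from the
  quotient type onto the carrier of \<open>pres\<close>, and every construction of the theorem is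
  transported along it.\<close>

definition emb :: "'k::ptag pal => gen falg set" where
 "emb X = {x \<in> alg (pgens TYPE('k)). cls x = X}"

lemma emb_inject [simp]: "emb X = emb Y \<longleftrightarrow> X = (Y :: 'k::ptag pal)"
 using cls_surj_alg[of X] by (auto simp: emb_def)

lemma inj_emb: "inj emb"
 by (simp add: inj_def)

lemma Idl_prels: "Idl\<^bsub>free_algebra (pgens T)\<^esub> (prels T) = alg (pgens T) \<inter> pideal T"
 by (simp add: Idl_free_algebra prels_alg pideal_def)

lemma ideal_prels: "ideal (alg (pgens T) \<inter> pideal T) (free_algebra (pgens T))"
 using ring.genideal_ideal[OF ring_free_algebra prels_alg] by (simp add: Idl_prels)

lemma rcos_eq_emb:
 assumes "f \<in> alg (pgens TYPE('k::ptag))"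
 shows "(alg (pgens TYPE('k)) \<inter> pideal TYPE('k)) +>\<^bsub>free_algebra (pgens TYPE('k))\<^esub> f = emb (cls f :: 'k pal)"
proof -
 have "x \<in> (\<Union>h\<in>alg (pgens TYPE('k)) \<inter> pideal TYPE('k). {h + f}) \<longleftrightarrow> x \<in> emb (cls f :: 'k pal)" for x
 proof
  assume "x \<in> emb (cls f :: 'k pal)"
  hence "x - f \<in> alg (pgens TYPE('k)) \<inter> pideal TYPE('k)"
   using assms by (simp add: emb_def cls_eq_iff alg_diff)
  thus "x \<in> (\<Union>h\<in>alg (pgens TYPE('k)) \<inter> pideal TYPE('k). {h + f})"
   by (intro UN_I[of "x - f"]) auto
 qed (use assms in "auto simp: emb_def cls_eq_iff alg_add")
 thus ?thesis
  by (auto simp: a_r_coset_def')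
qed

lemma pclass_eq_emb:
 assumes "f \<in> alg (pgens TYPE('k::ptag))"
 shows "pclass (pgens TYPE('k)) (prels TYPE('k)) f = emb (cls f :: 'k pal)"
 by (simp add: pclass_def Idl_prels rcos_eq_emb assms)

lemma ring_pres: "ring (pres T)"
 unfolding presented_def Idl_prels by (rule ideal.quotient_is_ring[OF ideal_prels])

lemma carrier_pres: "carrier (pres TYPE('k::ptag)) = range (emb :: 'k pal => _)"
proof -
 have "carrier (pres TYPE('k)) = (%f. emb (cls f :: 'k pal)) ` alg (pgens TYPE('k))"
  unfolding presented_def Idl_prels FactRing_def A_RCOSETS_def'
  by (auto simp: rcos_eq_emb image_iff)
 thus ?thesis using cls_surj_alg[where 'k = 'k] by (auto simp: image_iff) metis
qed

lemma emb_closed [simp]: "emb (X :: 'k::ptag pal) \<in> carrier (pres TYPE('k))"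
 by (simp add: carrier_pres)

lemma emb_mult: "emb X \<otimes>\<^bsub>pres TYPE('k)\<^esub> emb Y = emb (X * Y :: 'k::ptag pal)"
proof -
 obtain x y where xy: "x \<in> alg (pgens TYPE('k))" "cls x = X" "y \<in> alg (pgens TYPE('k))" "cls y = Y"
  using cls_surj_alg by metis
 thus ?thesis
  using ideal.rcoset_mult_add[OF ideal_prels[of "TYPE('k)"], of x y] rcos_eq_emb[of x, where 'k = 'k]
   rcos_eq_emb[of y, where 'k = 'k] rcos_eq_emb[of "x * y", where 'k = 'k]
  by (auto simp: presented_def Idl_prels FactRing_def alg_mult cls_mult)
qed

lemma emb_add: "emb X \<oplus>\<^bsub>pres TYPE('k)\<^esub> emb Y = emb (X + Y :: 'k::ptag pal)"
proof -
 interpret ideal "alg (pgens TYPE('k)) \<inter> pideal TYPE('k)" "free_algebra (pgens TYPE('k))"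
  by (rule ideal_prels)
 obtain x y where xy: "x \<in> alg (pgens TYPE('k))" "cls x = X" "y \<in> alg (pgens TYPE('k))" "cls y = Y"
  using cls_surj_alg by metis
 thus ?thesis
  using a_rcos_sum[of x y] rcos_eq_emb[of x, where 'k = 'k]
   rcos_eq_emb[of y, where 'k = 'k] rcos_eq_emb[of "x + y", where 'k = 'k]
  by (auto simp: presented_def Idl_prels FactRing_def alg_add cls_add)
qed

lemma emb_0: "\<zero>\<^bsub>pres TYPE('k::ptag)\<^esub> = emb (0 :: 'k pal)"
 unfolding presented_def Idl_prels FactRing_def
 by (auto simp: emb_def cls_eq_0_iff)

lemma emb_1: "\<one>\<^bsub>pres TYPE('k::ptag)\<^esub> = emb (1 :: 'k pal)"
 using rcos_eq_emb[of 1, where 'k = 'k] by (simp add: presented_def Idl_prels FactRing_def)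

lemma emb_uminus: "\<ominus>\<^bsub>pres TYPE('k)\<^esub> emb X = emb (- X :: 'k::ptag pal)"
proof -
 interpret ring "pres TYPE('k)" by (rule ring_pres)
 show ?thesis by (rule minus_equality) (simp_all add: emb_add emb_0)
qed

lemma emb_diff: "emb X \<ominus>\<^bsub>pres TYPE('k)\<^esub> emb Y = emb (X - Y :: 'k::ptag pal)"
 by (simp add: a_minus_def emb_uminus emb_add)

lemma emb_finsum:
 "finite A ==> (\<Oplus>\<^bsub>pres TYPE('k)\<^esub>s\<in>A. emb (h s)) = emb (\<Sum>s\<in>A. h s :: 'k::ptag pal)"
proof (induction A rule: finite_induct)
 interpret ring "pres TYPE('k)" by (rule ring_pres)
 { case empty thus ?case by (simp add: emb_0) }
 { case (insert x F) thus ?case by (simp add: emb_add) }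
qed

lemma emb_m_inv:
 assumes "X * Y = 1" "Y * X = (1 :: 'k::ptag pal)"
 shows "m_inv (pres TYPE('k)) (emb X) = emb Y"
proof -
 interpret ring "pres TYPE('k)" by (rule ring_pres)
 show ?thesis using assms by (intro inv_char) (simp_all add: emb_mult emb_1)
qed


section \<open>Additive spans and one-sided ideals\<close>

inductive_set asp :: "'a::ab_group_add set => 'a set" for X where
 zero: "0 \<in> asp X"
| base: "x \<in> X ==> x \<in> asp X"
| add: "x \<in> asp X ==> y \<in> asp X ==> x + y \<in> asp X"
| uminus: "x \<in> asp X ==> - x \<in> asp X"

lemma asp_diff: "x \<in> asp X ==> y \<in> asp X ==> x - y \<in> asp X"
 using asp.add[of x X "- y"] by (simp add: asp.uminus)

lemma asp_sum: "(!!a. a \<in> A ==> h a \<in> asp X) ==> sum h A \<in> asp X"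
 by (induction A rule: infinite_finite_induct) (auto intro: asp.intros)

lemma asp_image:
 assumes "x \<in> asp X" "!!x. x \<in> X ==> h x \<in> asp Y"
  and "!!x y. h (x + y) = h x + h y"
 shows "h x \<in> asp Y"
proof -
 have 0: "h 0 = 0" using assms(3)[of 0 0] by simp
 have "h (- x) = - h x" for x using assms(3)[of x "- x"] 0 by (simp add: eq_neg_iff_add_eq_0 add.commute)
 with assms(1) show ?thesis
  by induction (auto simp: 0 assms(2,3) intro: asp.intros)
qed

lemma asp_mono: "x \<in> asp X ==> X \<subseteq> asp Y ==> x \<in> asp Y"
 by (rule asp_image[where h = "%x. x" and X = X]) auto

lemma generate_emb:
 "generate (add_monoid (pres TYPE('k))) (emb ` X) = emb ` asp (X :: 'k::ptag pal set)"
proof (intro equalityI subsetI)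
 interpret ring "pres TYPE('k)" by (rule ring_pres)
 fix x assume "x \<in> generate (add_monoid (pres TYPE('k))) (emb ` X)"
 thus "x \<in> emb ` asp X"
 proof induction
  case (inv h)
  then obtain y where "h = emb y" "y \<in> X" by auto
  thus ?case
   using emb_uminus[of y] asp.uminus[OF asp.base[of y X]] by (auto simp: a_inv_def)
 next
  case (eng h1 h2)
  thus ?case by (auto simp: emb_add intro: imageI asp.add)
 qed (auto simp: emb_0 intro: asp.intros)
next
 interpret ring "pres TYPE('k)" by (rule ring_pres)
 fix x assume "x \<in> emb ` asp X"
 then obtain y where "x = emb y" "y \<in> asp X" by blast
 moreover have "y \<in> asp X ==> emb y \<in> generate (add_monoid (pres TYPE('k))) (emb ` X)"
 proof (induction rule: asp.induct)
  case zero
  thus ?case using generate.one[of "add_monoid (pres TYPE('k))" "emb ` X"] by (simp add: emb_0)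
 next
  case (add x y)
  thus ?case using generate.eng[OF add.IH] by (simp add: emb_add)
 next
  case (uminus x)
  have "emb ` X \<subseteq> carrier (pres TYPE('k))" by auto
  thus ?case using uminus.IH add.generate_m_inv_closed[of "emb ` X" "emb x"]
   by (simp add: emb_uminus[symmetric] a_inv_def)
 qed (auto intro: generate.incl)
 ultimately show "x \<in> generate (add_monoid (pres TYPE('k))) (emb ` X)" by simp
qed

lemma right_ideal_gen_emb:
 "right_ideal_gen (pres TYPE('k)) (emb ` X) = emb ` asp {s * r |s r. s \<in> (X :: 'k::ptag pal set)}"
proof -
 have "{s \<otimes>\<^bsub>pres TYPE('k)\<^esub> r |r s. r \<in> carrier (pres TYPE('k)) \<and> s \<in> emb ` X} = emb ` {s * r |s r. s \<in> X}"
 proof (intro equalityI subsetI)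
  fix y assume "y \<in> emb ` {s * r |s r. s \<in> X}"
  then obtain s r where "y = emb (s * r)" "s \<in> X" by auto
  hence "y = emb s \<otimes>\<^bsub>pres TYPE('k)\<^esub> emb r" "emb s \<in> emb ` X" by (auto simp: emb_mult)
  thus "y \<in> {s \<otimes>\<^bsub>pres TYPE('k)\<^esub> r |r s. r \<in> carrier (pres TYPE('k)) \<and> s \<in> emb ` X}"
   using emb_closed[of r] by blast
 qed (auto simp: carrier_pres emb_mult intro!: imageI, blast)
 thus ?thesis unfolding right_ideal_gen_def by (simp only: generate_emb)
qed

lemma left_ideal_gen_emb:
 "left_ideal_gen (pres TYPE('k)) (emb ` X) = emb ` asp {r * s |s r. s \<in> (X :: 'k::ptag pal set)}"
proof -
 have "{r \<otimes>\<^bsub>pres TYPE('k)\<^esub> s |r s. r \<in> carrier (pres TYPE('k)) \<and> s \<in> emb ` X} = emb ` {r * s |s r. s \<in> X}"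
 proof (intro equalityI subsetI)
  fix y assume "y \<in> emb ` {r * s |s r. s \<in> X}"
  then obtain s r where "y = emb (r * s)" "s \<in> X" by auto
  hence "y = emb r \<otimes>\<^bsub>pres TYPE('k)\<^esub> emb s" "emb s \<in> emb ` X" by (auto simp: emb_mult)
  thus "y \<in> {r \<otimes>\<^bsub>pres TYPE('k)\<^esub> s |r s. r \<in> carrier (pres TYPE('k)) \<and> s \<in> emb ` X}"
   using emb_closed[of r] by blast
 qed (auto simp: carrier_pres emb_mult intro!: imageI, blast)
 thus ?thesis unfolding left_ideal_gen_def by (simp only: generate_emb)
qed

lemma emb_rcos: "emb ` K +>\<^bsub>pres TYPE('k)\<^esub> emb x = emb ` (%k. k + x) ` (K :: 'k::ptag pal set)"
 by (auto simp: a_r_coset_def' emb_add)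

lemma emb_set_add:
 "emb ` K <+>\<^bsub>pres TYPE('k)\<^esub> emb ` L = emb ` {k + l |k l. k \<in> K \<and> l \<in> (L :: 'k::ptag pal set)}"
 by (auto simp: set_add_def' emb_add)

lemma emb_lcos: "emb y <#\<^bsub>pres TYPE('k)\<^esub> emb ` C = emb ` (%c. y * c) ` (C :: 'k::ptag pal set)"
 by (auto simp: l_coset_def emb_mult)


section \<open>Homomorphisms given on generators\<close>

text \<open>\<open>phom\<close> takes the only element of the image of a coset, so the value must
  not depend on the representative. The auxiliary \<open>\<psi>\<close> is zero on the outer
  generators, which lets the difference of two representatives be killed in the full free
  algebra.\<close>

lemma phom_pclass:
 fixes \<phi> :: "'g => gen falg"
 assumes "R \<subseteq> alg S" "f \<in> alg S" "!!g. g \<in> S ==> \<phi> g \<in> alg (pgens TYPE('k::ptag))"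
  and "!!r. r \<in> R ==> cls (feval \<phi> r) = (0 :: 'k pal)"
 shows "phom (pgens TYPE('k)) (prels TYPE('k)) \<phi> (pclass S R f) = emb (cls (feval \<phi> f) :: 'k pal)"
proof -
 define \<psi> where "\<psi> g = (if g \<in> S then cls (\<phi> g) else 0 :: 'k pal)" for g
 have \<psi>: "cls (feval \<phi> x) = feval \<psi> x" if "x \<in> alg S" for x
  unfolding cls_feval_comp \<psi>_def using that by (intro feval_cong) (auto simp: alg_def)
 have kill: "feval \<psi> x = 0" if "x \<in> tideal (R \<union> gener ` (- S))" for x
  using that
 proof (rule feval_tideal[rotated])
  fix r assume "r \<in> R \<union> gener ` (- S)"
  then consider "r \<in> R" | g where "g \<notin> S" "r = gener g" by auto
  thus "feval \<psi> r = 0"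
   by cases (use assms(1,4) \<psi>[of r] in "auto simp: \<psi>_def")
 qed
 have "pclass (pgens TYPE('k)) (prels TYPE('k)) (fsubst \<phi> g) = emb (cls (feval \<phi> f) :: 'k pal)"
  if "g \<in> pclass S R f" for g
 proof -
  have "g \<in> (\<Union>h\<in>alg S \<inter> tideal (R \<union> gener ` (- S)). {h + f})"
   using that by (simp add: pclass_def Idl_free_algebra[OF assms(1)] a_r_coset_def')
  then obtain h where h: "h \<in> alg S" "h \<in> tideal (R \<union> gener ` (- S))" "g = h + f"
   by blast
  have "feval \<phi> g \<in> alg (pgens TYPE('k))"
   using h assms(2,3) by (intro alg_feval[of S]) (auto intro: alg_add)
  moreover have "cls (feval \<phi> g) = (cls (feval \<phi> f) :: 'k pal)"
   using h kill[of h] \<psi>[OF h(1)] by (simp add: feval_add cls_add)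
  ultimately show ?thesis
   by (simp add: fsubst_eq_feval pclass_eq_emb)
 qed
 moreover have "f \<in> pclass S R f"
  using assms(2) tideal.zero[of "R \<union> gener ` (- S)"]
  by (auto simp: pclass_def Idl_free_algebra[OF assms(1)] a_r_coset_def' intro!: bexI[of _ 0])
 ultimately have "(%f. pclass (pgens TYPE('k)) (prels TYPE('k)) (fsubst \<phi> f)) ` pclass S R f =
   {emb (cls (feval \<phi> f) :: 'k pal)}" by blast
 thus ?thesis by (simp add: phom_def)
qed

text \<open>\<open>plift \<psi>\<close> is the homomorphism determined by the images \<open>\<psi>\<close> of the generators; it is
 meaningful only when \<open>\<psi>\<close> respects the relations.\<close>

definition plift :: "(gen => 'r::calg) => 'k::ptag pal => 'r" where
 "plift \<psi> X = feval \<psi> (SOME x. x \<in> alg (pgens TYPE('k)) \<and> cls x = X)"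

definition kills_rels :: "'k::ptag itself => (gen => 'r::calg) => bool" where
 "kills_rels T \<psi> \<longleftrightarrow> (\<forall>r\<in>prels T. feval \<psi> r = 0)"

lemma plift_cls:
 assumes "kills_rels TYPE('k::ptag) \<psi>" "x \<in> alg (pgens TYPE('k))"
 shows "plift \<psi> (cls x :: 'k pal) = feval \<psi> x"
proof -
 define y where "y = (SOME y. y \<in> alg (pgens TYPE('k)) \<and> cls y = (cls x :: 'k pal))"
 have y: "y \<in> alg (pgens TYPE('k)) \<and> cls y = (cls x :: 'k pal)"
  unfolding y_def by (rule someI[of _ x]) (use assms(2) in simp)
 define \<psi>' where "\<psi>' g = (if g \<in> pgens TYPE('k) then \<psi> g else 0)" for g
 have \<psi>': "feval \<psi>' z = feval \<psi> z" if "z \<in> alg (pgens TYPE('k))" for z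
  unfolding \<psi>'_def using that by (intro feval_cong) (auto simp: alg_def)
 have "y - x \<in> tideal (prels TYPE('k) \<union> gener ` (- pgens TYPE('k)))"
  using y by (simp add: cls_eq_iff pideal_def)
 hence "feval \<psi>' (y - x) = 0"
  by (rule feval_tideal[rotated])
   (use assms(1) \<psi>' prels_alg[of "TYPE('k)"] in "auto simp: \<psi>'_def kills_rels_def subset_iff")
 hence "feval \<psi> y = feval \<psi> x"
  using y assms(2) \<psi>' by (simp add: feval_diff)
 thus ?thesis by (simp add: plift_def y_def)
qed

lemma plift_hom:
 fixes X Y :: "'k::ptag pal"
 assumes "kills_rels TYPE('k) \<psi>"
 shows "plift \<psi> (X + Y) = plift \<psi> X + plift \<psi> Y" "plift \<psi> (X * Y) = plift \<psi> X * plift \<psi> Y"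
  "plift \<psi> (csc z :: 'k pal) = csc z" "plift \<psi> (1 :: 'k pal) = 1" "plift \<psi> (0 :: 'k pal) = 0"
  "plift \<psi> (- X) = - plift \<psi> X" "plift \<psi> (X - Y) = plift \<psi> X - plift \<psi> Y"
proof -
 obtain x y where "x \<in> alg (pgens TYPE('k))" "cls x = X" "y \<in> alg (pgens TYPE('k))" "cls y = Y"
  using cls_surj_alg by metis
 note xy = this(1,3) this(2,4)[symmetric]
 show "plift \<psi> (X + Y) = plift \<psi> X + plift \<psi> Y" "plift \<psi> (X * Y) = plift \<psi> X * plift \<psi> Y"
  "plift \<psi> (- X) = - plift \<psi> X" "plift \<psi> (X - Y) = plift \<psi> X - plift \<psi> Y"
  unfolding xy(3,4) using xy(1,2)
  by (simp_all add: plift_cls[OF assms] alg_intros feval_simps flip: cls_add cls_mult cls_uminus cls_diff)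
 show "plift \<psi> (csc z :: 'k pal) = csc z" "plift \<psi> (1 :: 'k pal) = 1" "plift \<psi> (0 :: 'k pal) = 0"
  using plift_cls[OF assms, of "csc z"] plift_cls[OF assms, of 1] plift_cls[OF assms, of 0] by simp_all
qed

section \<open>Commutators and generated subalgebras\<close>

definition cm :: "'r::ring => 'r => 'r" where
 "cm x y = x * y - y * x"

lemma cm_0 [simp]: "cm x 0 = 0" "cm 0 x = 0" and cm_self [simp]: "cm x x = 0"
 by (simp_all add: cm_def)

lemma cm_add: "cm x (y + z) = cm x y + cm x z"
 and cm_diff: "cm x (y - z) = cm x y - cm x z"
 and cm_uminus: "cm x (- y) = - cm x y"
 and cm_mult: "cm x (y * z) = cm x y * z + y * cm x z"
 and cm_add_left: "cm (x + y) z = cm x z + cm y z"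
 and cm_diff_left: "cm (x - y) z = cm x z - cm y z"
 and cm_uminus_left: "cm (- x) z = - cm x z"
 and cm_mult_left: "cm (x * y) z = x * cm y z + cm x z * y"
 and cm_swap: "cm x y = - cm y x"
 by (simp_all add: cm_def algebra_simps)

lemma cm_sum: "cm x (sum h A) = (\<Sum>a\<in>A. cm x (h a))"
 and cm_sum_left: "cm (sum h A) x = (\<Sum>a\<in>A. cm (h a) x)"
 by (simp_all add: cm_def sum_distrib_left sum_distrib_right sum_subtractf)

lemma cm_csc [simp]: "cm x (csc z) = 0" "cm (csc z) x = 0" "cm x 1 = 0" "cm 1 x = 0" for x :: "'r::calg"
 by (simp_all add: cm_def csc_comm)

lemma cm_csc_mult: "cm x (csc z * y) = csc z * cm x y"
 by (simp add: cm_mult)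

lemma cm_eq_0_iff: "cm x y = 0 \<longleftrightarrow> x * y = y * x"
 by (simp add: cm_def)

lemma cm_swap_mult: "x * y = y * x + cm x y"
 by (simp add: cm_def)

lemmas cm_simps = cm_add cm_diff cm_uminus cm_mult cm_add_left cm_diff_left cm_uminus_left cm_mult_left
 cm_sum cm_sum_left

text \<open>By the Leibniz rule each term of the expansion applies the derivation at least a times
  to y or at least b times to z. The induction on a + b spends one application at a time.\<close>

lemma cm_pow_mult_0:
 "(cm x ^^ a) y = 0 ==> (cm x ^^ b) z = 0 ==> (cm x ^^ (a + b)) (y * z) = 0"
proof (induction "a + b" arbitrary: a b y z)
 case (Suc k)
 have add: "(cm x ^^ k) (u + v) = (cm x ^^ k) u + (cm x ^^ k) v" for k u v
  by (induction k) (simp_all add: cm_add)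
 have zero: "(cm x ^^ k) 0 = 0" for k
  by (induction k) simp_all
 show ?case
 proof (cases "a = 0 \<or> b = 0")
  case True
  thus ?thesis using Suc.prems by (auto simp: zero)
 next
  case False
  then obtain a' b' where ab: "a = Suc a'" "b = Suc b'" by (meson not0_implies_Suc)
  have "(cm x ^^ k) (cm x y * z) = 0"
   using Suc.hyps(1)[of a' b "cm x y" z] Suc.hyps(2) Suc.prems ab by (simp add: funpow_swap1)
  moreover have "(cm x ^^ k) (y * cm x z) = 0"
   using Suc.hyps(1)[of a b' y "cm x z"] Suc.hyps(2) Suc.prems ab by (simp add: funpow_swap1)
  ultimately show ?thesis
   unfolding Suc.hyps(2)[symmetric] funpow_Suc_right comp_def cm_mult add by simp
 qed
qed simp

lemma cm_pow_add: "(cm x ^^ k) (u + v) = (cm x ^^ k) u + (cm x ^^ k) v"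
 by (induction k) (simp_all add: cm_add)

lemma cm_pow_0 [simp]: "(cm x ^^ k) 0 = 0"
 by (induction k) simp_all

lemma cm_pow_csc_mult: "(cm x ^^ k) (csc z * v) = csc z * (cm x ^^ k) v"
 by (induction k) (simp_all add: cm_csc_mult)

inductive_set salg :: "'r::calg set => 'r set" for X where
 csc: "csc z \<in> salg X"
| base: "x \<in> X ==> x \<in> salg X"
| add: "x \<in> salg X ==> y \<in> salg X ==> x + y \<in> salg X"
| mult: "x \<in> salg X ==> y \<in> salg X ==> x * y \<in> salg X"

lemma salg_0 [simp]: "0 \<in> salg X" and salg_1 [simp]: "1 \<in> salg X"
 using salg.csc[of 0 X] salg.csc[of 1 X] by simp_all

lemma salg_uminus: "x \<in> salg X ==> - x \<in> salg X"
 using salg.mult[OF salg.csc[of "- 1" X], of x] by (simp add: csc_uminus)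

lemma salg_diff: "x \<in> salg X ==> y \<in> salg X ==> x - y \<in> salg X"
 using salg.add[of x X "- y"] by (simp add: salg_uminus)

lemma salg_sum: "(!!a. a \<in> A ==> h a \<in> salg X) ==> sum h A \<in> salg X"
 by (induction A rule: infinite_finite_induct) (auto intro: salg.intros)

lemma salg_power: "x \<in> salg X ==> x ^ k \<in> salg X"
 by (induction k) (auto intro: salg.intros)

lemma salg_prod_list: "(!!x. x \<in> set xs ==> x \<in> salg X) ==> prod_list xs \<in> salg X"
 by (induction xs) (auto intro: salg.intros)

lemmas salg_intros = salg.csc salg.add salg.mult salg_uminus salg_diff salg_sum salg_power salg_prod_list

lemma salg_mono: "x \<in> salg X ==> X \<subseteq> salg Y ==> x \<in> salg Y"
 by (induction rule: salg.induct) (auto intro: salg.intros)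

lemma salg_cm_0: "x \<in> salg X ==> (!!x. x \<in> X ==> cm y x = 0) ==> cm y x = 0"
 by (induction rule: salg.induct) (simp_all add: cm_simps)

lemma salg_cm: "x \<in> salg X ==> (!!x. x \<in> X ==> cm y x \<in> salg X) ==> cm y x \<in> salg X"
 by (induction rule: salg.induct) (simp_all add: cm_simps salg_intros)

lemma salg_cls: "cls ` alg S = salg ((%g. cls (gener g)) ` S)"
proof (intro equalityI subsetI)
 fix y assume "y \<in> cls ` alg S"
 then obtain x where "y = cls x" "x \<in> alg S" by auto
 moreover have "cls x \<in> salg ((%g. cls (gener g)) ` S)" if "x \<in> alg S" for x
  using that
 proof (induction rule: alg_induct)
  case (single w c)
  hence "cls (gener g) \<in> salg ((%g. cls (gener g)) ` S)" if "g \<in> set w" for g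
   using that by (intro salg.base) auto
  thus ?case
   by (subst cls_feval) (auto simp: feval_single intro!: salg_intros)
 qed (auto simp: cls_add intro: salg_intros)
 ultimately show "y \<in> salg ((%g. cls (gener g)) ` S)" by simp
next
 fix y assume "y \<in> salg ((%g. cls (gener g)) ` S)"
 thus "y \<in> cls ` alg S"
 proof induction
  case (csc z)
  thus ?case using imageI[OF alg_csc[of z S], of cls] by simp
 next
  case (add x y)
  thus ?case by (auto simp flip: cls_add intro: imageI alg_add)
 next
  case (mult x y)
  thus ?case by (auto simp flip: cls_mult intro: imageI alg_mult)
 qed auto
qed


section \<open>The Weyl algebra with two commuting copies of gl_m\<close>

text \<open>In the canonical pairs p, q the distinction between the first p and the last q rows is
  gone: -x and \<partial> satisfy the same relation as \<partial> and x. The relations are symmetric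
  under permutations of the rows.\<close>

locale weyl =
 fixes m n :: nat and P Q :: "nat => nat => 'r::calg"
 assumes PP: "[|a \<in> {1..m}; b \<in> {1..m}; i \<in> {1..n}; j \<in> {1..n}|] ==> cm (P a i) (P b j) = 0"
  and QQ: "[|a \<in> {1..m}; b \<in> {1..m}; i \<in> {1..n}; j \<in> {1..n}|] ==> cm (Q a i) (Q b j) = 0"
  and PQ: "[|a \<in> {1..m}; b \<in> {1..m}; i \<in> {1..n}; j \<in> {1..n}|] ==>
   cm (P a i) (Q b j) = (if a = b \<and> i = j then 1 else 0)"
begin

lemma QP: "[|a \<in> {1..m}; b \<in> {1..m}; i \<in> {1..n}; j \<in> {1..n}|] ==>
  cm (Q b j) (P a i) = - (if a = b \<and> i = j then 1 else 0)"
 using PQ cm_swap[of "Q b j" "P a i"] by simp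

definition z :: "nat => nat => 'r" where
 "z a b = csc (if a = b then of_nat n / 2 else 0) + (\<Sum>k=1..n. Q a k * P b k)"

lemma cm_z_Q:
 assumes "a \<in> {1..m}" "b \<in> {1..m}" "c \<in> {1..m}" "i \<in> {1..n}"
 shows "cm (z a b) (Q c i) = (if b = c then Q a i else 0)"
proof -
 have "cm (z a b) (Q c i) = (\<Sum>k=1..n. cm (Q a k * P b k) (Q c i))"
  by (simp add: z_def cm_add_left cm_sum_left)
 also have "\<dots> = (\<Sum>k=1..n. if k = i then (if b = c then Q a i else 0) else 0)"
  by (rule sum.cong) (use assms in "auto simp: cm_mult_left PQ QQ")
 finally show ?thesis using assms by simp
qed

lemma cm_z_P:
 assumes "a \<in> {1..m}" "b \<in> {1..m}" "c \<in> {1..m}" "i \<in> {1..n}"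
 shows "cm (z a b) (P c i) = - (if a = c then P b i else 0)"
proof -
 have "cm (z a b) (P c i) = (\<Sum>k=1..n. cm (Q a k * P b k) (P c i))"
  by (simp add: z_def cm_add_left cm_sum_left)
 also have "\<dots> = (\<Sum>k=1..n. if k = i then - (if a = c then P b i else 0) else 0)"
  by (rule sum.cong) (use assms in "auto simp: cm_mult_left QP PP")
 finally show ?thesis using assms by simp
qed

text \<open>Only the action of x on the canonical generators enters, so the lemma covers the
  elements \<open>z a b\<close> themselves as well as the elements \<open>e a b\<close> of
  A.\<close>

lemma derivation_z:
 assumes "!!k. k \<in> {1..n} ==> cm x (Q c k) = (if b = c then Q a k else 0)"
  and "!!k. k \<in> {1..n} ==> cm x (P d k) = - (if a = d then P b k else 0)"
 shows "cm x (z c d) = (if b = c then z a d else 0) - (if d = a then z c b else 0)"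
proof -
 have "cm x (z c d) = (\<Sum>k=1..n. cm x (Q c k * P d k))"
  by (simp add: z_def cm_add cm_sum)
 also have "\<dots> = (\<Sum>k=1..n. (if b = c then Q a k * P d k else 0) - (if d = a then Q c k * P b k else 0))"
  by (rule sum.cong) (use assms in "auto simp: cm_mult")
 also have "\<dots> = (if b = c then \<Sum>k=1..n. Q a k * P d k else 0) - (if d = a then \<Sum>k=1..n. Q c k * P b k else 0)"
  by (simp add: sum_subtractf)
 finally show ?thesis by (auto simp: z_def)
qed

lemma cm_z_z:
 "[|a \<in> {1..m}; b \<in> {1..m}; c \<in> {1..m}; d \<in> {1..m}|] ==>
  cm (z a b) (z c d) = (if b = c then z a d else 0) - (if d = a then z c b else 0)"
 by (rule derivation_z) (simp_all add: cm_z_Q cm_z_P)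

end

locale gl_action =
 fixes m :: nat and e :: "nat => nat => 'r::calg"
 assumes gl: "[|a \<in> {1..m}; b \<in> {1..m}; c \<in> {1..m}; d \<in> {1..m}|] ==>
   cm (e a b) (e c d) = (if b = c then e a d else 0) - (if d = a then e c b else 0)"

locale osc = weyl m n P Q + gl_action m e
 for m n :: nat and P Q e :: "nat => nat => 'r::calg" +
 assumes eQ: "[|a \<in> {1..m}; b \<in> {1..m}; c \<in> {1..m}; i \<in> {1..n}|] ==>
   cm (e a b) (Q c i) = (if b = c then Q a i else 0)"
  and eP: "[|a \<in> {1..m}; b \<in> {1..m}; c \<in> {1..m}; i \<in> {1..n}|] ==>
   cm (e a b) (P c i) = - (if a = c then P b i else 0)"
begin

text \<open>Under the isomorphism of A with U(gl_m) \<otimes> HD these are the elements E_ab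
  \<otimes> 1: a second copy of gl_m, which commutes with all oscillator variables.\<close>

definition eh :: "nat => nat => 'r" where
 "eh a b = e a b - z a b"

lemma cm_eh_Q [simp]:
 "[|a \<in> {1..m}; b \<in> {1..m}; c \<in> {1..m}; i \<in> {1..n}|] ==> cm (eh a b) (Q c i) = 0"
 and cm_eh_P [simp]:
 "[|a \<in> {1..m}; b \<in> {1..m}; c \<in> {1..m}; i \<in> {1..n}|] ==> cm (eh a b) (P c i) = 0"
 by (simp_all add: eh_def cm_diff_left eQ eP cm_z_Q cm_z_P)

lemma cm_e_z:
 "[|a \<in> {1..m}; b \<in> {1..m}; c \<in> {1..m}; d \<in> {1..m}|] ==>
  cm (e a b) (z c d) = (if b = c then z a d else 0) - (if d = a then z c b else 0)"
 by (rule derivation_z) (simp_all add: eQ eP)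

lemma cm_eh_z [simp]:
 "[|a \<in> {1..m}; b \<in> {1..m}; c \<in> {1..m}; d \<in> {1..m}|] ==> cm (eh a b) (z c d) = 0"
 by (simp add: eh_def cm_diff_left cm_e_z cm_z_z)

lemma cm_e_eh:
 "[|a \<in> {1..m}; b \<in> {1..m}; c \<in> {1..m}; d \<in> {1..m}|] ==>
  cm (e a b) (eh c d) = (if b = c then eh a d else 0) - (if d = a then eh c b else 0)"
 by (simp add: eh_def cm_diff gl cm_e_z)

lemma cm_eh_eh:
 "[|a \<in> {1..m}; b \<in> {1..m}; c \<in> {1..m}; d \<in> {1..m}|] ==>
  cm (eh a b) (eh c d) = (if b = c then eh a d else 0) - (if d = a then eh c b else 0)"
 using cm_e_eh[of a b c d] cm_swap[of "z a b" "eh c d"] by (simp add: eh_def[of a b] cm_diff_left)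

definition HDg :: "'r set" where
 "HDg = {P a i |a i. a \<in> {1..m} \<and> i \<in> {1..n}} \<union> {Q a i |a i. a \<in> {1..m} \<and> i \<in> {1..n}}"

definition HD :: "'r set" where
 "HD = salg HDg"

definition Ag :: "'r set" where
 "Ag = {e a b |a b. a \<in> {1..m} \<and> b \<in> {1..m}} \<union> HDg"

definition AA :: "'r set" where
 "AA = salg Ag"

lemma P_HD: "a \<in> {1..m} ==> i \<in> {1..n} ==> P a i \<in> HD"
 and Q_HD: "a \<in> {1..m} ==> i \<in> {1..n} ==> Q a i \<in> HD"
 unfolding HD_def by (auto simp: HDg_def intro!: salg.base)

lemma HD_AA: "y \<in> HD ==> y \<in> AA"
 unfolding HD_def AA_def by (erule salg_mono) (auto simp: Ag_def intro: salg.base)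

lemma e_AA: "a \<in> {1..m} ==> b \<in> {1..m} ==> e a b \<in> AA"
 unfolding AA_def by (auto simp: Ag_def intro!: salg.base)

lemma z_HD: "a \<in> {1..m} ==> b \<in> {1..m} ==> z a b \<in> HD"
 using P_HD Q_HD unfolding z_def HD_def by (auto intro!: salg_intros)

lemma eh_AA: "a \<in> {1..m} ==> b \<in> {1..m} ==> eh a b \<in> AA"
 using HD_AA[OF z_HD] e_AA unfolding eh_def AA_def by (auto intro: salg_diff)

lemma cm_eh_HD [simp]:
 assumes "y \<in> HD" "a \<in> {1..m}" "b \<in> {1..m}"
 shows "cm (eh a b) y = 0"
 using assms(1) unfolding HD_def
 by (rule salg_cm_0) (use assms(2,3) in "auto simp: HDg_def")

lemma eh_HD_comm: "y \<in> HD ==> a \<in> {1..m} ==> b \<in> {1..m} ==> eh a b * y = y * eh a b"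
 using cm_eh_HD cm_eq_0_iff by blast

lemma cm_e_HD:
 "y \<in> HD ==> a \<in> {1..m} ==> b \<in> {1..m} ==> cm (e a b) y = cm (z a b) y"
 using cm_eh_HD[of y a b] by (simp add: eh_def cm_diff_left)

lemma HD_closed_cm:
 assumes "y \<in> HD" "a \<in> {1..m}" "b \<in> {1..m}"
 shows "cm (e a b) y \<in> HD"
 using assms(1) unfolding HD_def
proof (rule salg_cm)
 fix x assume "x \<in> HDg"
 thus "cm (e a b) x \<in> salg HDg"
  using assms(2,3) P_HD[of b] Q_HD[of a] unfolding HD_def[symmetric]
  by (auto simp: HDg_def eQ eP) (auto simp: HD_def intro!: salg_uminus)
qed

text \<open>The third power of the derivation kills every generator, the longest chain being E_c,
  H_c, F_c up to scalars. Products are handled by \<open>cm_pow_mult_0\<close>.\<close>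

lemma AA_nilpotent:
 assumes "y \<in> AA" and c: "c \<in> {1..<m}"
 shows "\<exists>N. (cm (e (Suc c) c) ^^ N) y = 0"
 using assms(1) unfolding AA_def
proof induction
 case (csc z)
 thus ?case by (intro exI[of _ 1]) simp
next
 case (base x)
 have "(cm (e (Suc c) c) ^^ 3) x = 0"
  using base c
  by (auto simp: Ag_def HDg_def numeral_3_eq_3 gl eQ eP cm_diff cm_uminus split: if_splits)
 thus ?case ..
next
 case (add x y)
 then obtain N M where "(cm (e (Suc c) c) ^^ N) x = 0" "(cm (e (Suc c) c) ^^ M) y = 0" by blast
 hence "(cm (e (Suc c) c) ^^ (M + N)) x = 0" "(cm (e (Suc c) c) ^^ (N + M)) y = 0"
  by (simp_all add: funpow_add)
 thus ?case by (intro exI[of _ "N + M"]) (simp add: cm_pow_add add.commute)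
next
 case (mult x y)
 thus ?case by (blast intro: cm_pow_mult_0)
qed

end

section \<open>Fixing the parameters; the three presented algebras\<close>

definition conclusion :: "nat => nat => nat => weight => weight => (nat => nat) => bool" where
 "conclusion p q n \<mu> lam \<nu> \<longleftrightarrow>
  v_coset p q n \<mu> \<nu> \<noteq> dc_zero p q n \<mu> delta_plus \<and>
  (dc_has_weight p q n \<mu> delta_plus lam (v_coset p q n \<mu> \<nu>) \<and>
  yangian_highest_weight n (dc_yangian_act p q n \<mu> delta_plus) (dc_zero p q n \<mu> delta_plus)
   (dc_smul p q n \<mu> delta_plus) (v_coset p q n \<mu> \<nu>)) \<and>
  (\<forall>\<sigma> cs. \<sigma> permutes {1..p + q} \<and> reduced_decomposition (p + q) \<sigma> cs -->
   xi_check_induced p q n cs (dot_wt \<sigma> \<mu>) (perm_sign p \<sigma> delta_plus) (v_coset p q n \<mu> \<nu>) =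
   dc_smul p q n (dot_wt \<sigma> \<mu>) (perm_sign p \<sigma> delta_plus)
    (\<Prod>\<eta>\<in>Delta_inv (p + q) \<sigma>. z_factor p n \<mu> lam \<nu> \<eta>)
    (double_coset p q n (dot_wt \<sigma> \<mu>) (perm_sign p \<sigma> delta_plus)
     (perm_act p q n \<sigma> (v_elt p q n \<nu>))))"

definition claim :: "nat => nat => nat => bool" where
 "claim p q n \<longleftrightarrow> (\<forall>\<mu> lam \<nu>. 1 \<le> n --> 1 \<le> p + q -->
  (\<forall>a\<in>{1..p + q}. \<forall>b\<in>{1..p + q}. a \<noteq> b --> \<mu> a - \<mu> b \<notin> \<int>) -->
  (\<forall>a\<in>{1..p}. of_nat (\<nu> a) = \<mu> a - lam a - of_nat n / 2) -->
  (\<forall>a\<in>{p + 1..p + q}. of_nat (\<nu> a) = lam a - \<mu> a - of_nat n / 2) -->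
  conclusion p q n \<mu> lam \<nu>)"

text \<open>Types cannot depend on the numbers \<open>p\<close>, \<open>q\<close>, \<open>n\<close>. The quotient rings are therefore made into
 types for one particular triple, chosen to be a counterexample to the theorem if there is one;
 proving the theorem for this triple proves it for all.\<close>

definition params :: "nat \<times> nat \<times> nat" where
 "params = (SOME k. case k of (p, q, n) => \<not> claim p q n)"

definition p0 :: nat where "p0 = fst params"
definition q0 :: nat where "q0 = fst (snd params)"
definition n0 :: nat where "n0 = snd (snd params)"

abbreviation m0 :: nat where "m0 \<equiv> p0 + q0"
abbreviation "M0 \<equiv> {1..m0}"
abbreviation "N0 \<equiv> {1..n0}"
abbreviation "Abar0 \<equiv> Abar p0 q0 n0"
abbreviation "A_gens0 \<equiv> A_gens p0 q0 n0"
abbreviation "Abar_class0 \<equiv> Abar_class p0 q0 n0"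
abbreviation "Abar_gens0 \<equiv> Abar_gens p0 q0 n0"
abbreviation "v_coset0 \<equiv> v_coset p0 q0 n0"
abbreviation "Jbar0 \<equiv> Jbar p0 q0 n0"
abbreviation "A_to_Abar0 \<equiv> A_to_Abar p0 q0 n0"
abbreviation "dc_smul0 \<equiv> dc_smul p0 q0 n0"
abbreviation "xi0 \<equiv> xi p0 q0 n0"
abbreviation "dc_zero0 \<equiv> dc_zero p0 q0 n0"
abbreviation "A_rels0 \<equiv> A_rels p0 q0 n0"
abbreviation "A_alg0 \<equiv> A_alg p0 q0 n0"

lemma claim_generic: "claim p0 q0 n0 ==> claim p q n"
proof (rule ccontr)
 assume c: "claim p0 q0 n0" and "\<not> claim p q n"
 hence "\<exists>k. case k of (p, q, n) => \<not> claim p q n" by auto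
 hence "case params of (p, q, n) => \<not> claim p q n"
  unfolding params_def by (rule someI_ex)
 with c show False by (simp add: p0_def q0_def n0_def case_prod_beta)
qed

datatype tU = TU
datatype tA = TA
datatype tB = TB

lemma pp_alg: "c \<in> {1..m} ==> i \<in> {1..n} ==> weyl_gens m n \<subseteq> S ==> pp p c i \<in> alg S"
 and qq_alg: "c \<in> {1..m} ==> i \<in> {1..n} ==> weyl_gens m n \<subseteq> S ==> qq p c i \<in> alg S"
 by (auto simp: pp_def qq_def weyl_gens_def intro!: alg_uminus alg_gener)

lemma zeta_alg: "a \<in> {1..m} ==> b \<in> {1..m} ==> weyl_gens m n \<subseteq> S ==> zeta p n a b \<in> alg S"
 unfolding zeta_def Ehat_def by (intro alg_intros) (auto intro: pp_alg qq_alg alg_scal simp del: One_nat_def)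

lemma gl_rels_alg: "gl_gens m \<subseteq> S ==> gl_rels m \<subseteq> alg S"
 by (auto simp: gl_rels_def gl_gens_def intro!: alg_intros alg_gener)

lemma weyl_rels_alg: "weyl_gens m n \<subseteq> S ==> weyl_rels m n \<subseteq> alg S"
 by (auto simp: weyl_rels_def weyl_gens_def intro!: alg_intros alg_gener)

lemma A_rels_alg: "A_rels p q n \<subseteq> alg (A_gens p q n)"
 unfolding A_rels_def
proof (intro Un_least gl_rels_alg weyl_rels_alg)
 show "cross_rels p q n \<subseteq> alg (A_gens p q n)"
  unfolding cross_rels_def A_gens_def
  by (auto intro!: alg_intros alg_gener zeta_alg[of _ "p + q" _ n]) (auto simp: gl_gens_def)
qed (auto simp: A_gens_def)

lemma UHD_rels_alg: "UHD_rels p q n \<subseteq> alg (A_gens p q n)"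
 unfolding UHD_rels_def
proof (intro Un_least gl_rels_alg weyl_rels_alg)
 show "tensor_rels (p + q) n \<subseteq> alg (A_gens p q n)"
  unfolding tensor_rels_def A_gens_def by (auto intro!: alg_intros alg_gener)
qed (auto simp: A_gens_def)

lemma inv_rels_alg: "gl_gens m \<subseteq> S ==> inv_gens m \<subseteq> S ==> inv_rels m \<subseteq> alg S"
 unfolding inv_rels_def by (auto simp: gl_gens_def inv_gens_def intro!: alg_intros alg_gener)

lemma Abar_rels_alg: "Abar_rels p q n \<subseteq> alg (Abar_gens p q n)"
 unfolding Abar_rels_def
proof (intro Un_least inv_rels_alg)
 show "A_rels p q n \<subseteq> alg (Abar_gens p q n)"
  using A_rels_alg[of p q n] alg_mono[of "A_gens p q n" "Abar_gens p q n"]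
  by (auto simp: Abar_gens_def)
qed (auto simp: Abar_gens_def A_gens_def)

instantiation tU :: ptag begin
definition pgens_tU :: "tU itself => gen set" where "pgens_tU T = A_gens0"
definition prels_tU :: "tU itself => gen falg set" where "prels_tU T = UHD_rels p0 q0 n0"
instance by standard (simp add: pgens_tU_def prels_tU_def UHD_rels_alg)
end

instantiation tA :: ptag begin
definition pgens_tA :: "tA itself => gen set" where "pgens_tA T = A_gens0"
definition prels_tA :: "tA itself => gen falg set" where "prels_tA T = A_rels0"
instance by standard (simp add: pgens_tA_def prels_tA_def A_rels_alg)
end

instantiation tB :: ptag begin
definition pgens_tB :: "tB itself => gen set" where "pgens_tB T = Abar_gens0"
definition prels_tB :: "tB itself => gen falg set" where "prels_tB T = Abar_rels p0 q0 n0"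
instance by standard (simp add: pgens_tB_def prels_tB_def Abar_rels_alg)
end

type_synonym U0 = "tU pal"
type_synonym A0 = "tA pal"
type_synonym B0 = "tB pal"

lemma cls_comm_rel: "comm x y - w \<in> prels TYPE('k::ptag) ==> cm (cls x) (cls y) = (cls w :: 'k pal)"
 using cls_rel[of "comm x y - w", where 'k = 'k] by (simp add: cls_simps cm_def)

text \<open>Polymorphic in the tag, so that the same names denote the generators in all three
  algebras and each algebra becomes an instance of the locales above.\<close>

definition ec :: "nat => nat => 'k::ptag pal" where "ec a b = cls (eE a b)"
definition Pc :: "nat => nat => 'k::ptag pal" where "Pc a i = cls (pp p0 a i)"
definition Qc :: "nat => nat => 'k::ptag pal" where "Qc a i = cls (qq p0 a i)"

lemma weyl_cls:
 assumes "weyl_rels m0 n0 \<subseteq> prels TYPE('k::ptag)"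
 shows "weyl m0 n0 (Pc :: _ => _ => 'k pal) Qc"
proof -
 have XX: "cm (cls (eX a i)) (cls (eX b j)) = (0 :: 'k pal)"
  and DD: "cm (cls (eD a i)) (cls (eD b j)) = (0 :: 'k pal)"
  and DX: "cm (cls (eD a i)) (cls (eX b j)) = (if a = b \<and> i = j then 1 else 0 :: 'k pal)"
  if "a \<in> M0" "b \<in> M0" "i \<in> N0" "j \<in> N0" for a b i j
 proof -
  have "comm (eX a i) (eX b j) \<in> weyl_rels m0 n0" "comm (eD a i) (eD b j) \<in> weyl_rels m0 n0"
   "comm (eD a i) (eX b j) - (if a = b \<and> i = j then 1 else 0) \<in> weyl_rels m0 n0"
   unfolding weyl_rels_def using that by blast+
  thus "cm (cls (eX a i)) (cls (eX b j)) = (0 :: 'k pal)"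
   "cm (cls (eD a i)) (cls (eD b j)) = (0 :: 'k pal)"
   "cm (cls (eD a i)) (cls (eX b j)) = (if a = b \<and> i = j then 1 else 0 :: 'k pal)"
   using assms cls_comm_rel[of "eX a i" "eX b j" 0, where 'k = 'k]
    cls_comm_rel[of "eD a i" "eD b j" 0, where 'k = 'k] cls_comm_rel[of "eD a i" "eX b j" "if a = b \<and> i = j then 1 else 0", where 'k = 'k]
   by (auto simp del: One_nat_def)
 qed
 have XD: "cm (cls (eX b j)) (cls (eD a i)) = - (if a = b \<and> i = j then 1 else 0 :: 'k pal)"
  if "a \<in> M0" "b \<in> M0" "i \<in> N0" "j \<in> N0" for a b i j
  using DX[OF that] cm_swap[of "cls (eX b j) :: 'k pal" "cls (eD a i)"] by simp
 show ?thesis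
 proof
  fix a b i j assume r: "a \<in> M0" "b \<in> M0" "i \<in> N0" "j \<in> N0"
  show "cm (Pc a i) (Pc b j) = (0 :: 'k pal)" "cm (Qc a i) (Qc b j) = (0 :: 'k pal)"
   "cm (Pc a i) (Qc b j) = (if a = b \<and> i = j then 1 else 0 :: 'k pal)"
   using r by (auto simp: Pc_def Qc_def pp_def qq_def cls_uminus cm_uminus cm_uminus_left XX DD DX XD)
 qed
qed

lemma gl_cls:
 assumes "gl_rels m0 \<subseteq> prels TYPE('k::ptag)"
 shows "gl_action m0 (ec :: _ => _ => 'k pal)"
proof
 fix a b c d assume r: "a \<in> M0" "b \<in> M0" "c \<in> M0" "d \<in> M0"
 hence "comm (eE a b) (eE c d) - ((if b = c then eE a d else 0) - (if d = a then eE c b else 0))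
   \<in> prels TYPE('k)"
  using assms unfolding gl_rels_def by blast
 from cls_comm_rel[OF this] show "cm (ec a b) (ec c d) = (if b = c then ec a d else 0 :: 'k pal)
   - (if d = a then ec c b else 0)"
  by (auto simp: ec_def cls_simps)
qed

lemma weyl_z: "weyl m0 n0 (Pc :: _ => _ => 'k::ptag pal) Qc ==>
  cls (zeta p0 n0 a b) = (weyl.z n0 Pc Qc a b :: 'k pal)"
 by (simp add: zeta_def weyl.z_def cls_simps Ehat_def Pc_def Qc_def)

lemma osc_cls:
 assumes "A_rels0 \<subseteq> prels TYPE('k::ptag)"
 shows "osc m0 n0 (Pc :: _ => _ => 'k pal) Qc ec"
proof -
 interpret weyl m0 n0 "Pc :: _ => _ => 'k pal" Qc
  by (rule weyl_cls) (use assms in "auto simp: A_rels_def")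
 interpret gl_action m0 "ec :: _ => _ => 'k pal"
  by (rule gl_cls) (use assms in "auto simp: A_rels_def")
 have *: "cm (ec a b) (cls (gener h)) = cm (z a b) (cls (gener h) :: 'k pal)"
  if "a \<in> M0" "b \<in> M0" "h \<in> weyl_gens m0 n0" for a b h
 proof -
  have "comm (eE a b) (gener h) - comm (zeta p0 n0 a b) (gener h) \<in> prels TYPE('k)"
   using that assms unfolding A_rels_def cross_rels_def by blast
  from cls_comm_rel[OF this] show ?thesis
   by (simp add: ec_def cls_simps weyl_z[OF weyl_axioms] cm_def)
 qed
 show ?thesis
 proof
  fix a b c i assume r: "a \<in> M0" "b \<in> M0" "c \<in> M0" "i \<in> N0"
  hence h: "GX c i \<in> weyl_gens m0 n0" "GD c i \<in> weyl_gens m0 n0"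
   by (auto simp: weyl_gens_def)
  have "cm (ec a b) (Qc c i) = (cm (z a b) (Qc c i) :: 'k pal)"
   using *[OF r(1,2) h(1)] *[OF r(1,2) h(2)] by (simp add: Qc_def qq_def)
  thus "cm (ec a b) (Qc c i) = (if b = c then Qc a i else 0 :: 'k pal)"
   using r by (simp add: cm_z_Q)
  have "cm (ec a b) (Pc c i) = (cm (z a b) (Pc c i) :: 'k pal)"
   using *[OF r(1,2) h(1)] *[OF r(1,2) h(2)] by (simp add: Pc_def pp_def cls_uminus cm_uminus)
  thus "cm (ec a b) (Pc c i) = - (if a = c then Pc b i else 0 :: 'k pal)"
   using r by (simp add: cm_z_P)
 qed
qed

interpretation UU: weyl m0 n0 "Pc :: _ => _ => U0" Qc
 by (rule weyl_cls) (auto simp: prels_tU_def UHD_rels_def)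

interpretation UU: gl_action m0 "ec :: _ => _ => U0"
 by (rule gl_cls) (auto simp: prels_tU_def UHD_rels_def)

interpretation A: osc m0 n0 "Pc :: _ => _ => A0" Qc ec
 by (rule osc_cls) (auto simp: prels_tA_def)

interpretation B: osc m0 n0 "Pc :: _ => _ => B0" Qc ec
 by (rule osc_cls) (auto simp: prels_tB_def Abar_rels_def)

lemma UU_tensor:
 assumes "a \<in> M0" "b \<in> M0" "c \<in> M0" "i \<in> N0"
 shows "cm (ec a b) (Pc c i :: U0) = 0" "cm (ec a b) (Qc c i :: U0) = 0"
proof -
 have *: "cm (ec a b) (cls (gener h)) = (0 :: U0)" if "h \<in> weyl_gens m0 n0" for h
 proof -
  have "comm (eE a b) (gener h) \<in> tensor_rels m0 n0"
   using assms(1,2) that unfolding tensor_rels_def gl_gens_def by blast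
  hence "comm (eE a b) (gener h) - 0 \<in> prels TYPE(tU)"
   by (simp add: prels_tU_def UHD_rels_def)
  from cls_comm_rel[OF this] show ?thesis by (simp add: ec_def)
 qed
 have "GX c i \<in> weyl_gens m0 n0" "GD c i \<in> weyl_gens m0 n0"
  using assms by (auto simp: weyl_gens_def)
 from this[THEN *] show "cm (ec a b) (Pc c i :: U0) = 0" "cm (ec a b) (Qc c i :: U0) = 0"
  by (simp_all add: Pc_def Qc_def pp_def qq_def cls_uminus cm_uminus)
qed

declare One_nat_def [simp del]

section \<open>Matrix powers and the defining relations of the Yangian\<close>

lemma sum_swap_13:
 "(\<Sum>c\<in>I. \<Sum>b\<in>I. \<Sum>a\<in>I. \<Sum>d\<in>I. f a b c d) = (\<Sum>a\<in>I. \<Sum>b\<in>I. \<Sum>c\<in>I. \<Sum>d\<in>I. f a b c d :: 'a::comm_monoid_add)"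
proof -
 have "(\<Sum>c\<in>I. \<Sum>b\<in>I. \<Sum>a\<in>I. \<Sum>d\<in>I. f a b c d) = (\<Sum>b\<in>I. \<Sum>c\<in>I. \<Sum>a\<in>I. \<Sum>d\<in>I. f a b c d)"
  by (rule sum.swap)
 also have "\<dots> = (\<Sum>b\<in>I. \<Sum>a\<in>I. \<Sum>c\<in>I. \<Sum>d\<in>I. f a b c d)"
  by (intro sum.cong refl sum.swap)
 also have "\<dots> = (\<Sum>a\<in>I. \<Sum>b\<in>I. \<Sum>c\<in>I. \<Sum>d\<in>I. f a b c d)"
  by (rule sum.swap)
 finally show ?thesis .
qed

lemma sum_if_mult:
 fixes f :: "'a => 'r::ring"
 assumes "finite I"
 shows "(\<Sum>k\<in>I. (if k = c then x else 0) * f k) = (if c \<in> I then x * f c else 0)"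
  "(\<Sum>k\<in>I. (if c = k then x else 0) * f k) = (if c \<in> I then x * f c else 0)"
  "(\<Sum>k\<in>I. f k * (if k = c then x else 0)) = (if c \<in> I then f c * x else 0)"
  "(\<Sum>k\<in>I. f k * (if c = k then x else 0)) = (if c \<in> I then f c * x else 0)"
proof -
 have "(\<Sum>k\<in>I. (if k = c then x else 0) * f k) = (\<Sum>k\<in>I. if k = c then x * f c else 0)"
  "(\<Sum>k\<in>I. f k * (if k = c then x else 0)) = (\<Sum>k\<in>I. if k = c then f c * x else 0)"
  by (auto intro!: sum.cong)
 thus "(\<Sum>k\<in>I. (if k = c then x else 0) * f k) = (if c \<in> I then x * f c else 0)"
  "(\<Sum>k\<in>I. (if c = k then x else 0) * f k) = (if c \<in> I then x * f c else 0)"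
  "(\<Sum>k\<in>I. f k * (if k = c then x else 0)) = (if c \<in> I then f c * x else 0)"
  "(\<Sum>k\<in>I. f k * (if c = k then x else 0)) = (if c \<in> I then f c * x else 0)"
  using assms by (simp_all add: eq_commute[of c])
qed

text \<open>\<open>G\<close> is the matrix \<open>-E'\<close>, so that the coefficient of \<open>u\<^bsup>-s-1\<^esup>\<close> in \<open>(u + E')\<^bsup>-1\<^esup>\<close> is its power \<open>Gp s\<close>.\<close>

context gl_action
begin

definition G :: "nat => nat => 'r" where
 "G a b = - e b a"

primrec Gp :: "nat => nat => nat => 'r" where
 "Gp 0 a b = (if a = b then 1 else 0)"
| "Gp (Suc s) a b = (\<Sum>c=1..m. G a c * Gp s c b)"

lemma cm_G_G:
 "[|a \<in> {1..m}; b \<in> {1..m}; c \<in> {1..m}; d \<in> {1..m}|] ==>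
  cm (G a b) (G c d) = (if c = b then G a d else 0) - (if a = d then G c b else 0)"
 by (simp add: G_def cm_uminus cm_uminus_left gl)

lemma Gp_add:
 assumes "a \<in> {1..m}" "b \<in> {1..m}"
 shows "(\<Sum>k=1..m. Gp r a k * Gp s k b) = Gp (r + s) a b"
 using assms
proof (induction r arbitrary: a)
 case 0
 thus ?case by (simp add: sum_if_mult)
next
 case (Suc r)
 have "(\<Sum>k=1..m. Gp (Suc r) a k * Gp s k b) = (\<Sum>k=1..m. \<Sum>c=1..m. G a c * (Gp r c k * Gp s k b))"
  by (simp add: sum_distrib_right mult.assoc)
 also have "\<dots> = (\<Sum>c=1..m. G a c * (\<Sum>k=1..m. Gp r c k * Gp s k b))"
  by (subst sum.swap) (simp add: sum_distrib_left)
 finally show ?case using Suc by simp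
qed

text \<open>Powers of a matrix transform under a derivation in the same way as its entries. The
  element x is left general because the lemma is applied to entries of \<open>G\<close> and, inside
  A, to the full generators \<open>e\<close>.\<close>

lemma cm_Gp:
 assumes x: "!!a b. [|a \<in> {1..m}; b \<in> {1..m}|] ==>
   cm x (G a b) = (if a = q then G p b else 0) - (if p = b then G a q else 0)"
  and "p \<in> {1..m}" "q \<in> {1..m}" "c \<in> {1..m}" "d \<in> {1..m}"
 shows "cm x (Gp s c d) = (if c = q then Gp s p d else 0) - (if p = d then Gp s c q else 0)"
 using assms(4,5)
proof (induction s arbitrary: c)
 case 0
 thus ?case by simp
next
 case (Suc s)
 have "cm x (Gp (Suc s) c d) = (\<Sum>k=1..m. cm x (G c k) * Gp s k d + G c k * cm x (Gp s k d))"
  by (simp add: cm_sum cm_mult)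
 also have "\<dots> = (\<Sum>k=1..m. (if c = q then G p k * Gp s k d else 0) - (if p = k then G c q else 0) * Gp s k d
   + (G c k * (if k = q then Gp s p d else 0) - (if p = d then G c k * Gp s k q else 0)))"
  by (rule sum.cong) (use Suc x in "auto simp: left_diff_distrib right_diff_distrib")
 also have "\<dots> = (if c = q then Gp (Suc s) p d else 0) - (if p = d then Gp (Suc s) c q else 0)"
  using assms(2,3) by (simp add: sum.distrib sum_subtractf sum_if_mult)
 finally show ?case .
qed

lemma cm_G_Gp:
 "[|a \<in> {1..m}; b \<in> {1..m}; c \<in> {1..m}; d \<in> {1..m}|] ==>
  cm (G a b) (Gp s c d) = (if c = b then Gp s a d else 0) - (if a = d then Gp s c b else 0)"
 by (rule cm_Gp) (simp_all add: cm_G_G)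

text \<open>\<open>Gp r c b\<close> is moved to the left of \<open>G a k\<close>; after that the sum
  over k is a matrix product in each term.\<close>

lemma G_Gp_Gp:
 assumes "a \<in> {1..m}" "b \<in> {1..m}" "c \<in> {1..m}" "d \<in> {1..m}"
 shows "(\<Sum>k=1..m. G a k * (Gp r c b * Gp s k d)) =
  Gp r a b * Gp s c d - (if a = b then Gp (r + s) c d else 0) + Gp r c b * Gp (Suc s) a d"
proof -
 have "(\<Sum>k=1..m. G a k * (Gp r c b * Gp s k d)) =
   (\<Sum>k=1..m. (if c = k then Gp r a b else 0) * Gp s k d - (if a = b then Gp r c k * Gp s k d else 0)
    + Gp r c b * (G a k * Gp s k d))"
 proof (rule sum.cong[OF refl])
  fix k assume "k \<in> {1..m}"
  hence "G a k * Gp r c b = Gp r c b * G a k +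
    ((if c = k then Gp r a b else 0) - (if a = b then Gp r c k else 0))"
   using assms by (subst cm_swap_mult) (simp add: cm_G_Gp)
  hence "G a k * (Gp r c b * Gp s k d) = (Gp r c b * G a k +
    ((if c = k then Gp r a b else 0) - (if a = b then Gp r c k else 0))) * Gp s k d"
   by (simp flip: mult.assoc)
  thus "G a k * (Gp r c b * Gp s k d) = (if c = k then Gp r a b else 0) * Gp s k d
    - (if a = b then Gp r c k * Gp s k d else 0) + Gp r c b * (G a k * Gp s k d)"
   by (cases "c = k"; cases "a = b") (simp_all add: algebra_simps)
 qed
 also have "\<dots> = Gp r a b * Gp s c d - (if a = b then \<Sum>k=1..m. Gp r c k * Gp s k d else 0)
   + Gp r c b * Gp (Suc s) a d"
  using assms by (simp add: sum.distrib sum_subtractf sum_if_mult sum_distrib_left)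
 finally show ?thesis using assms by (simp add: Gp_add)
qed

text \<open>The coefficients of the resolvent (u + E')^{-1} satisfy the same quadratic relation as
  the Yangian generators. The induction splits one factor \<open>G\<close> off the first power;
  \<open>cross\<close> collects the commutators of this factor with the second power.\<close>

lemma cm_Gp_Gp:
 assumes "a \<in> {1..m}" "b \<in> {1..m}" "c \<in> {1..m}" "d \<in> {1..m}"
 shows "cm (Gp (Suc r) a b) (Gp s c d) - cm (Gp r a b) (Gp (Suc s) c d) =
  Gp r c b * Gp s a d - Gp s c b * Gp r a d"
 using assms
proof (induction r arbitrary: a c)
 case 0
 hence "Gp (Suc 0) a b = G a b" by (simp add: sum_if_mult)
 with 0 show ?case by (auto simp: cm_G_Gp simp del: Gp.simps(2))
next
 case (Suc r)
 have expand: "cm (Gp (Suc t) a b) y = (\<Sum>k=1..m. G a k * cm (Gp t k b) y + cm (G a k) y * Gp t k b)" for t y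
  by (simp add: cm_sum_left cm_mult_left)
 have cross: "(\<Sum>k=1..m. cm (G a k) (Gp u c d) * Gp t k b) =
   Gp u a d * Gp t c b - (if a = d then Gp (u + t) c b else 0)" for t u
 proof -
  have "(\<Sum>k=1..m. cm (G a k) (Gp u c d) * Gp t k b) =
    (\<Sum>k=1..m. (if c = k then Gp u a d else 0) * Gp t k b - (if a = d then Gp u c k * Gp t k b else 0))"
   by (rule sum.cong) (use Suc.prems in "auto simp: cm_G_Gp left_diff_distrib")
  thus ?thesis
   using Suc.prems by (simp add: sum_subtractf sum_if_mult Gp_add del: One_nat_def)
 qed
 have "cm (Gp (Suc (Suc r)) a b) (Gp s c d) - cm (Gp (Suc r) a b) (Gp (Suc s) c d) =
   (\<Sum>k=1..m. G a k * (cm (Gp (Suc r) k b) (Gp s c d) - cm (Gp r k b) (Gp (Suc s) c d)))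
   + ((\<Sum>k=1..m. cm (G a k) (Gp s c d) * Gp (Suc r) k b) - (\<Sum>k=1..m. cm (G a k) (Gp (Suc s) c d) * Gp r k b))"
  unfolding expand by (simp add: sum.distrib right_diff_distrib sum_subtractf del: Gp.simps(2))
 also have "(\<Sum>k=1..m. G a k * (cm (Gp (Suc r) k b) (Gp s c d) - cm (Gp r k b) (Gp (Suc s) c d))) =
   (\<Sum>k=1..m. G a k * (Gp r c b * Gp s k d - Gp s c b * Gp r k d))"
  using Suc.IH Suc.prems by (intro sum.cong refl) (simp del: Gp.simps(2))
 also have "\<dots> = (\<Sum>k=1..m. G a k * (Gp r c b * Gp s k d)) - (\<Sum>k=1..m. G a k * (Gp s c b * Gp r k d))"
  by (simp add: right_diff_distrib sum_subtractf)
 also have "\<dots> = Gp r a b * Gp s c d + Gp r c b * Gp (Suc s) a d - Gp s a b * Gp r c d - Gp s c b * Gp (Suc r) a d"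
  using Suc.prems by (simp add: G_Gp_Gp add.commute[of s r] del: Gp.simps(2))
 also have "(\<Sum>k=1..m. cm (G a k) (Gp s c d) * Gp (Suc r) k b) - (\<Sum>k=1..m. cm (G a k) (Gp (Suc s) c d) * Gp r k b) =
   Gp s a d * Gp (Suc r) c b - Gp (Suc s) a d * Gp r c b"
  unfolding cross by simp
 also have "Gp r a b * Gp s c d + Gp r c b * Gp (Suc s) a d - Gp s a b * Gp r c d - Gp s c b * Gp (Suc r) a d
   + (Gp s a d * Gp (Suc r) c b - Gp (Suc s) a d * Gp r c b) =
   Gp (Suc r) c b * Gp s a d - Gp s c b * Gp (Suc r) a d"
 proof -
  \<comment> \<open>The products still stand in the wrong order. What is missing is the induction
    hypothesis with the rows a and c exchanged, hence the generalisation over both.\<close>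
  have "cm (Gp (Suc r) c b) (Gp s a d) - cm (Gp r c b) (Gp (Suc s) a d) =
    Gp r a b * Gp s c d - Gp s a b * Gp r c d"
   using Suc.IH[of c a] Suc.prems by blast
  thus ?thesis by (simp add: cm_def algebra_simps del: Gp.simps(2))
 qed
 finally show ?case .
qed

end


locale uhd = weyl m n P Q + gl_action m e
 for m n :: nat and P Q e :: "nat => nat => 'r::calg" +
 assumes eQ0: "[|a \<in> {1..m}; b \<in> {1..m}; c \<in> {1..m}; i \<in> {1..n}|] ==> cm (e a b) (Q c i) = 0"
  and eP0: "[|a \<in> {1..m}; b \<in> {1..m}; c \<in> {1..m}; i \<in> {1..n}|] ==> cm (e a b) (P c i) = 0"
begin

lemma Gp_salg: "a \<in> {1..m} ==> b \<in> {1..m} ==> Gp s a b \<in> salg {e a b |a b. a \<in> {1..m} \<and> b \<in> {1..m}}"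
proof (induction s arbitrary: a)
 case (Suc s)
 have "G a c \<in> salg {e a b |a b. a \<in> {1..m} \<and> b \<in> {1..m}}" if "c \<in> {1..m}" for c
  using Suc.prems that unfolding G_def by (intro salg_uminus salg.base) blast
 thus ?case using Suc by (auto intro!: salg_sum salg.mult)
qed simp

lemma Gp_Q: "a \<in> {1..m} ==> b \<in> {1..m} ==> c \<in> {1..m} ==> i \<in> {1..n} ==> Q c i * Gp s a b = Gp s a b * Q c i"
 unfolding cm_eq_0_iff[symmetric]
 by (rule salg_cm_0[OF Gp_salg]) (use eQ0 cm_swap[of "Q c i"] in auto)

lemma Gp_P: "a \<in> {1..m} ==> b \<in> {1..m} ==> c \<in> {1..m} ==> i \<in> {1..n} ==> P c i * Gp s a b = Gp s a b * P c i"
 unfolding cm_eq_0_iff[symmetric]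
 by (rule salg_cm_0[OF Gp_salg]) (use eP0 cm_swap[of "P c i"] in auto)

definition tt :: "nat => nat => nat => 'r" where
 "tt s i j = (\<Sum>a=1..m. \<Sum>b=1..m. Gp s a b * (Q a i * P b j))"

text \<open>Normal ordering with a single possible contraction, that of \<open>P b j\<close> with
  \<open>Q c k\<close>. It forces b = c, and the sum over this index composes the two matrix
  powers.\<close>

lemma tt_mult:
 assumes "i \<in> {1..n}" "j \<in> {1..n}" "k \<in> {1..n}" "l \<in> {1..n}"
 shows "tt r i j * tt s k l =
  (\<Sum>a=1..m. \<Sum>b=1..m. \<Sum>c=1..m. \<Sum>d=1..m. Gp r a b * Gp s c d * (Q a i * Q c k * P b j * P d l)) +
  (if j = k then tt (r + s) i l else 0)"
proof -
 have "tt r i j * tt s k l = (\<Sum>a=1..m. \<Sum>b=1..m. \<Sum>c=1..m. \<Sum>d=1..m.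
   Gp r a b * (Q a i * P b j) * (Gp s c d * (Q c k * P d l)))"
  unfolding tt_def by (simp only: sum_distrib_right) (simp only: sum_distrib_left)
 also have "\<dots> = (\<Sum>a=1..m. \<Sum>b=1..m. \<Sum>c=1..m. \<Sum>d=1..m.
   Gp r a b * Gp s c d * (Q a i * Q c k * P b j * P d l) +
   (if b = c then Gp r a b else 0) * (if j = k then Gp s c d * (Q a i * P d l) else 0))"
 proof (intro sum.cong refl)
  fix a b c d assume r: "a \<in> {1..m}" "b \<in> {1..m}" "c \<in> {1..m}" "d \<in> {1..m}"
  have "Gp r a b * (Q a i * P b j) * (Gp s c d * (Q c k * P d l)) =
    Gp r a b * (Q a i * (P b j * Gp s c d) * (Q c k * P d l))"
   by (simp add: mult.assoc)
  also have "\<dots> = Gp r a b * ((Q a i * Gp s c d) * (P b j * Q c k) * P d l)"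
   using Gp_P[of c d b j s] r assms by (simp add: mult.assoc)
  also have "\<dots> = Gp r a b * Gp s c d * (Q a i * (P b j * Q c k) * P d l)"
   using Gp_Q[of c d a i s] r assms by (simp add: mult.assoc)
  also have "P b j * Q c k = Q c k * P b j + (if b = c \<and> j = k then 1 else 0)"
   using r assms by (subst cm_swap_mult) (simp add: PQ)
  finally show "Gp r a b * (Q a i * P b j) * (Gp s c d * (Q c k * P d l)) =
    Gp r a b * Gp s c d * (Q a i * Q c k * P b j * P d l) +
    (if b = c then Gp r a b else 0) * (if j = k then Gp s c d * (Q a i * P d l) else 0)"
   by (auto simp: algebra_simps)
 qed
 also have "\<dots> = (\<Sum>a=1..m. \<Sum>b=1..m. \<Sum>c=1..m. \<Sum>d=1..m. Gp r a b * Gp s c d * (Q a i * Q c k * P b j * P d l)) +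
   (\<Sum>a=1..m. \<Sum>b=1..m. \<Sum>c=1..m. (if b = c then Gp r a b else 0) * (\<Sum>d=1..m. if j = k then Gp s c d * (Q a i * P d l) else 0))"
  by (simp add: sum.distrib sum_distrib_left)
 also have "(\<Sum>a=1..m. \<Sum>b=1..m. \<Sum>c=1..m. (if b = c then Gp r a b else 0) * (\<Sum>d=1..m. if j = k then Gp s c d * (Q a i * P d l) else 0)) =
   (\<Sum>a=1..m. \<Sum>b=1..m. Gp r a b * (\<Sum>d=1..m. if j = k then Gp s b d * (Q a i * P d l) else 0))"
  by (intro sum.cong refl) (simp add: sum_if_mult)
 also have "\<dots> = (\<Sum>a=1..m. \<Sum>d=1..m. if j = k then (\<Sum>b=1..m. Gp r a b * Gp s b d) * (Q a i * P d l) else 0)"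
 proof (cases "j = k")
  case True
  have "(\<Sum>b=1..m. Gp r a b * (\<Sum>d=1..m. Gp s b d * (Q a i * P d l))) =
    (\<Sum>d=1..m. (\<Sum>b=1..m. Gp r a b * Gp s b d) * (Q a i * P d l))" for a
   by (simp only: sum_distrib_left sum_distrib_right mult.assoc) (rule sum.swap)
  thus ?thesis using True by simp
 qed simp
 also have "\<dots> = (if j = k then tt (r + s) i l else 0)"
  unfolding tt_def by (simp add: Gp_add)
 finally show ?thesis .
qed

lemma cm_tt:
 assumes "i \<in> {1..n}" "j \<in> {1..n}" "k \<in> {1..n}" "l \<in> {1..n}"
 shows "cm (tt r i j) (tt s k l) =
  (\<Sum>a=1..m. \<Sum>b=1..m. \<Sum>c=1..m. \<Sum>d=1..m. cm (Gp r a b) (Gp s c d) * (Q a i * Q c k * P b j * P d l)) +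
  (if j = k then tt (r + s) i l else 0) - (if l = i then tt (r + s) k j else 0)"
proof -
 have "(\<Sum>a=1..m. \<Sum>b=1..m. \<Sum>c=1..m. \<Sum>d=1..m. Gp s a b * Gp r c d * (Q a k * Q c i * P b l * P d j)) =
   (\<Sum>c=1..m. \<Sum>d=1..m. \<Sum>a=1..m. \<Sum>b=1..m. Gp s a b * Gp r c d * (Q a k * Q c i * P b l * P d j))"
 proof -
  have "(\<Sum>a=1..m. \<Sum>b=1..m. \<Sum>c=1..m. \<Sum>d=1..m. h a b c d) = (\<Sum>c=1..m. \<Sum>d=1..m. \<Sum>a=1..m. \<Sum>b=1..m. h a b c d)"
   for h :: "nat => nat => nat => nat => 'r"
  proof -
   have "(\<Sum>a=1..m. \<Sum>b=1..m. \<Sum>c=1..m. \<Sum>d=1..m. h a b c d) = (\<Sum>a=1..m. \<Sum>c=1..m. \<Sum>d=1..m. \<Sum>b=1..m. h a b c d)"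
    by (rule sum.cong[OF refl], subst sum.swap, rule sum.cong[OF refl], rule sum.swap)
   also have "\<dots> = (\<Sum>c=1..m. \<Sum>d=1..m. \<Sum>a=1..m. \<Sum>b=1..m. h a b c d)"
    by (subst sum.swap, rule sum.cong[OF refl], rule sum.swap)
   finally show ?thesis .
  qed
  thus ?thesis .
 qed
 also have "\<dots> = (\<Sum>c=1..m. \<Sum>d=1..m. \<Sum>a=1..m. \<Sum>b=1..m. Gp s a b * Gp r c d * (Q c i * Q a k * P d j * P b l))"
 proof (intro sum.cong refl)
  fix a b c d assume r: "a \<in> {1..m}" "b \<in> {1..m}" "c \<in> {1..m}" "d \<in> {1..m}"
  have "Q a k * Q c i = Q c i * Q a k" "P b l * P d j = P d j * P b l"
   using QQ[of a c k i] PP[of b d l j] r assms by (simp_all add: cm_def)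
  thus "Gp s a b * Gp r c d * (Q a k * Q c i * P b l * P d j) =
    Gp s a b * Gp r c d * (Q c i * Q a k * P d j * P b l)"
   by (metis mult.assoc)
 qed
 finally have *: "(\<Sum>a=1..m. \<Sum>b=1..m. \<Sum>c=1..m. \<Sum>d=1..m. Gp s a b * Gp r c d * (Q a k * Q c i * P b l * P d j)) =
   (\<Sum>a=1..m. \<Sum>b=1..m. \<Sum>c=1..m. \<Sum>d=1..m. Gp s c d * Gp r a b * (Q a i * Q c k * P b j * P d l))" .
 show ?thesis
  unfolding cm_def[of "tt r i j"] tt_mult[OF assms] tt_mult[OF assms(3,4,1,2)] *
  by (simp add: cm_def left_diff_distrib sum_subtractf add.commute[of s r])
qed

definition TT :: "nat => nat => nat => 'r" where
 "TT s i j = (case s of 0 => if i = j then 1 else 0 | Suc s' => tt s' i j)"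

lemma cm_Gp_0: "cm (Gp 0 a b) x = 0" "cm x (Gp 0 a b) = 0"
 by simp_all

text \<open>If both indices are positive, the contraction terms depend on the sum of the exponents
  only and cancel, on the left between the two commutators and on the right between the two
  products; the rest is \<open>cm_Gp_Gp\<close> multiplied by a normally ordered monomial. If one
  index is zero, a contraction term is all that remains.\<close>

lemma yangian_relation:
 assumes "i \<in> {1..n}" "j \<in> {1..n}" "k \<in> {1..n}" "l \<in> {1..n}"
 shows "cm (TT (Suc r) i j) (TT s k l) - cm (TT r i j) (TT (Suc s) k l) =
  TT r k j * TT s i l - TT s k j * TT r i l"
proof -
 consider "r = 0" "s = 0" | s' where "r = 0" "s = Suc s'" | r' where "r = Suc r'" "s = 0"
  | r' s' where "r = Suc r'" "s = Suc s'" by (metis not0_implies_Suc)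
 thus ?thesis
 proof cases
  case 1
  thus ?thesis by (simp add: TT_def)
 next
  case 2
  thus ?thesis by (simp add: TT_def cm_tt[OF assms] cm_Gp_0 del: Gp.simps)
 next
  case 3
  thus ?thesis by (simp add: TT_def cm_tt[OF assms] cm_Gp_0 del: Gp.simps)
 next
  case 4
  let ?w = "%a b c d. Q a i * Q c k * P b j * P d l"
  have "cm (TT (Suc r) i j) (TT s k l) - cm (TT r i j) (TT (Suc s) k l) =
    (\<Sum>a=1..m. \<Sum>b=1..m. \<Sum>c=1..m. \<Sum>d=1..m.
     (cm (Gp (Suc r') a b) (Gp s' c d) - cm (Gp r' a b) (Gp (Suc s') c d)) * ?w a b c d)"
   using 4 by (simp add: TT_def cm_tt[OF assms] left_diff_distrib sum_subtractf del: Gp.simps)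
  also have "\<dots> = (\<Sum>a=1..m. \<Sum>b=1..m. \<Sum>c=1..m. \<Sum>d=1..m.
     (Gp r' c b * Gp s' a d - Gp s' c b * Gp r' a d) * ?w a b c d)"
   by (intro sum.cong refl arg_cong2[of _ _ _ _ "(*)"] cm_Gp_Gp)
  also have "\<dots> = (\<Sum>a=1..m. \<Sum>b=1..m. \<Sum>c=1..m. \<Sum>d=1..m. Gp r' c b * Gp s' a d * ?w a b c d) -
    (\<Sum>a=1..m. \<Sum>b=1..m. \<Sum>c=1..m. \<Sum>d=1..m. Gp s' c b * Gp r' a d * ?w a b c d)"
   by (simp add: left_diff_distrib sum_subtractf)
  also have "\<dots> = tt r' k j * tt s' i l - tt s' k j * tt r' i l"
  proof -
   have *: "(\<Sum>a=1..m. \<Sum>b=1..m. \<Sum>c=1..m. \<Sum>d=1..m. Gp t a b * Gp u c d * (Q a k * Q c i * P b j * P d l)) =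
     (\<Sum>a=1..m. \<Sum>b=1..m. \<Sum>c=1..m. \<Sum>d=1..m. Gp t c b * Gp u a d * ?w a b c d)" for t u
   proof -
    have "(\<Sum>a=1..m. \<Sum>b=1..m. \<Sum>c=1..m. \<Sum>d=1..m. Gp t a b * Gp u c d * (Q a k * Q c i * P b j * P d l)) =
     (\<Sum>a=1..m. \<Sum>b=1..m. \<Sum>c=1..m. \<Sum>d=1..m. Gp t c b * Gp u a d * (Q c k * Q a i * P b j * P d l))"
     by (rule sum_swap_13[of "%a b c d. Gp t c b * Gp u a d * (Q c k * Q a i * P b j * P d l)"])
    also have "\<dots> = (\<Sum>a=1..m. \<Sum>b=1..m. \<Sum>c=1..m. \<Sum>d=1..m. Gp t c b * Gp u a d * ?w a b c d)"
    proof (intro sum.cong refl)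
     fix a b c d assume r: "a \<in> {1..m}" "b \<in> {1..m}" "c \<in> {1..m}" "d \<in> {1..m}"
     have "Q c k * Q a i = Q a i * Q c k"
      using QQ[of c a k i] r assms by (simp add: cm_def)
     thus "Gp t c b * Gp u a d * (Q c k * Q a i * P b j * P d l) = Gp t c b * Gp u a d * ?w a b c d"
      by simp
    qed
    finally show ?thesis .
   qed
   show ?thesis
    unfolding tt_mult[OF assms(3,2,1,4)] * by (simp add: add.commute[of s' r'])
  qed
  finally show ?thesis using 4 by (simp add: TT_def)
 qed
qed

end

context osc
begin

sublocale hat: uhd m n P Q eh
 by unfold_locales (simp_all add: cm_eh_eh del: One_nat_def)

text \<open>The row indices of \<open>Q\<close> and \<open>P\<close> are contracted with those of
  the matrix power, and all three factors transform under gl_m by the same rule, so the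
  contributions cancel in pairs.\<close>

lemma cm_e_tt:
 assumes "c \<in> {1..m}" "d \<in> {1..m}" "i \<in> {1..n}" "j \<in> {1..n}"
 shows "cm (e c d) (hat.tt s i j) = 0"
proof -
 have Gp: "cm (e c d) (hat.Gp s a b) = (if b = d then hat.Gp s a c else 0) - (if a = c then hat.Gp s d b else 0)"
  if "a \<in> {1..m}" "b \<in> {1..m}" for a b
 proof -
  have "cm (- e c d) (hat.Gp s a b) = (if a = c then hat.Gp s d b else 0) - (if d = b then hat.Gp s a c else 0)"
   by (rule hat.cm_Gp) (use assms that in "auto simp: hat.G_def cm_uminus cm_uminus_left cm_e_eh")
  thus ?thesis by (simp add: cm_uminus_left minus_equation_iff[of "cm _ _"] eq_commute[of d b])
 qed
 have "cm (e c d) (hat.tt s i j) = (\<Sum>a=1..m. \<Sum>b=1..m.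
   cm (e c d) (hat.Gp s a b) * (Q a i * P b j) + hat.Gp s a b * (cm (e c d) (Q a i) * P b j + Q a i * cm (e c d) (P b j)))"
  by (simp add: hat.tt_def cm_sum cm_mult)
 also have "\<dots> = (\<Sum>a=1..m. \<Sum>b=1..m.
   (if b = d then hat.Gp s a c else 0) * (Q a i * P b j) - (if a = c then hat.Gp s d b else 0) * (Q a i * P b j)
   + ((if a = d then hat.Gp s a b else 0) * (Q c i * P b j) - (if b = c then hat.Gp s a b else 0) * (Q a i * P d j)))"
  by (intro sum.cong refl) (use assms in "auto simp: Gp eQ eP algebra_simps")
 also have "\<dots> = (\<Sum>a=1..m. hat.Gp s a c * (Q a i * P d j)) - (\<Sum>b=1..m. hat.Gp s d b * (Q c i * P b j))
   + ((\<Sum>b=1..m. hat.Gp s d b * (Q c i * P b j)) - (\<Sum>a=1..m. hat.Gp s a c * (Q a i * P d j)))"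
 proof -
  have "(\<Sum>a=1..m. \<Sum>b=1..m. (if a = c then hat.Gp s d b else 0) * (Q a i * P b j)) =
    (\<Sum>b=1..m. hat.Gp s d b * (Q c i * P b j))"
   using assms by (subst sum.swap) (simp add: sum_if_mult)
  moreover have "(\<Sum>a=1..m. \<Sum>b=1..m. (if a = d then hat.Gp s a b else 0) * (Q c i * P b j)) =
    (\<Sum>b=1..m. hat.Gp s d b * (Q c i * P b j))"
   using assms sum_if_mult(1)[of "{1..m}" d] by (subst sum.swap) (auto intro!: sum.cong simp: if_distrib[of "%x. x * _"] cong: if_cong)
  moreover have "(\<Sum>a=1..m. \<Sum>b=1..m. (if b = d then hat.Gp s a c else 0) * (Q a i * P b j)) =
    (\<Sum>a=1..m. hat.Gp s a c * (Q a i * P d j))"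
   using assms by (simp add: sum_if_mult)
  moreover have "(\<Sum>a=1..m. \<Sum>b=1..m. (if b = c then hat.Gp s a b else 0) * (Q a i * P d j)) =
    (\<Sum>a=1..m. hat.Gp s a c * (Q a i * P d j))"
   using assms by (auto intro!: sum.cong simp: if_distrib[of "%x. x * _"] cong: if_cong)
  ultimately show ?thesis by (simp only: sum.distrib sum_subtractf)
 qed
 also have "\<dots> = 0" by simp
 finally show ?thesis .
qed

end

section \<open>The homomorphism from the Yangian into A and its localization\<close>

interpretation U: uhd m0 n0 "Pc :: _ => _ => U0" Qc ec
 by unfold_locales (use UU_tensor in auto)

lemma Xcoef_alg: "a \<in> {1..m} ==> b \<in> {1..m} ==> gl_gens m \<subseteq> S ==> Xcoef m s a b \<in> alg S"
proof (induction m s a b rule: Xcoef.induct)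
 case (3 m s a b)
 thus ?case
  by (auto simp: gl_gens_def intro!: alg_uminus alg_sum alg_mult alg_gener)
qed auto

lemma alpha_gen_alg: "g \<in> yangian_gens n ==> alpha_gen p q g \<in> alg (A_gens p q n)"
 by (auto simp: yangian_gens_def Ehat_def A_gens_def
   intro!: alg_sum alg_mult Xcoef_alg pp_alg[of _ "p + q" _ n] qq_alg[of _ "p + q" _ n])

lemma yT_alg: "i \<in> {1..n} ==> j \<in> {1..n} ==> yT i j s \<in> alg (yangian_gens n)"
 by (auto simp: yT_def yangian_gens_def intro!: alg_gener)

lemma yangian_rels_alg: "yangian_rels n \<subseteq> alg (yangian_gens n)"
 by (auto simp: yangian_rels_def intro!: alg_intros yT_alg)

text \<open>The recursion of \<open>Xcoef\<close> multiplies by -E' on the left, as that of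
  \<open>Gp\<close> does. The series of the inverse matrix starts with u^{-1}, whence the shift of
  the index by one.\<close>

lemma Xcoef_cls:
 "a \<in> M0 ==> b \<in> M0 ==> cls (Xcoef m0 (Suc s) a b) = UU.Gp s a b"
proof (induction s arbitrary: a)
 case (Suc s)
 thus ?case
  by (auto simp: cls_uminus cls_sum cls_mult UU.G_def sum_negf[symmetric] intro!: sum.cong simp flip: ec_def)
qed simp

lemma alpha_yT:
 assumes "i \<in> N0" "j \<in> N0"
 shows "cls (feval (alpha_gen p0 q0) (yT i j s)) = U.TT s i j"
proof (cases s)
 case (Suc s')
 thus ?thesis
  by (auto simp: yT_def U.TT_def U.tt_def cls_sum cls_mult Xcoef_cls Ehat_def Pc_def Qc_def intro!: sum.cong)
qed (simp add: yT_def U.TT_def)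

lemma alpha_respects:
 assumes "r \<in> yangian_rels n0"
 shows "cls (feval (alpha_gen p0 q0) r) = (0 :: U0)"
proof -
 obtain i j k l u v where r: "r = comm (yT i j (Suc u)) (yT k l v) - comm (yT i j u) (yT k l (Suc v))
    - (yT k j u * yT i l v - yT k j v * yT i l u)"
  "i \<in> N0" "j \<in> N0" "k \<in> N0" "l \<in> N0"
  using assms by (auto simp: yangian_rels_def)
 thus ?thesis
  using U.yangian_relation[OF r(2-5), of u v]
  by (simp add: feval_simps cls_simps alpha_yT cm_def)
qed

lemma alpha_UHD_T:
 assumes "i \<in> N0" "j \<in> N0"
 shows "alpha_UHD p0 q0 n0 (yangian_T n0 i j s) =
  pclass A_gens0 (UHD_rels p0 q0 n0) (feval (alpha_gen p0 q0) (yT i j s))"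
proof -
 have "alpha_UHD p0 q0 n0 (yangian_T n0 i j s) = emb (cls (feval (alpha_gen p0 q0) (yT i j s)) :: U0)"
  unfolding alpha_UHD_def yangian_T_def pgens_tU_def[symmetric, of "TYPE(tU)"] prels_tU_def[symmetric, of "TYPE(tU)"]
  by (rule phom_pclass) (use assms in "auto intro: subsetD[OF yangian_rels_alg] yT_alg alpha_gen_alg alpha_respects simp: pgens_tU_def")
 also have "\<dots> = pclass (pgens TYPE(tU)) (prels TYPE(tU)) (feval (alpha_gen p0 q0) (yT i j s))"
  by (rule pclass_eq_emb[symmetric])
   (use assms in "auto simp: pgens_tU_def intro!: alg_feval[OF alpha_gen_alg] yT_alg")
 finally show ?thesis by (simp add: pgens_tU_def prels_tU_def)
qed

lemma weyl_gens_cases: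
 assumes "h \<in> weyl_gens m0 n0"
 obtains c i where "c \<in> M0" "i \<in> N0" "cls (gener h) = (Pc c i :: 'k::ptag pal) \<or>
  cls (gener h) = (- Pc c i :: 'k pal) \<or> cls (gener h) = (Qc c i :: 'k pal)"
 using assms that unfolding weyl_gens_def Pc_def Qc_def pp_def qq_def
 by (auto simp: cls_uminus)

lemma UHD_to_A_weyl [simp]: "UHD_to_A_gen p n (GX a i) = gener (GX a i)" "UHD_to_A_gen p n (GD a i) = gener (GD a i)"
 by simp_all

lemma feval_UHD_pp [simp]: "feval (UHD_to_A_gen p n) (pp p a i) = pp p a i"
 and feval_UHD_qq [simp]: "feval (UHD_to_A_gen p n) (qq p a i) = qq p a i"
 by (simp_all add: pp_def qq_def feval_uminus)

lemma cls_zeta: "cls (zeta p0 n0 a b) = A.z a b"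
 by (rule weyl_z) (rule A.weyl_axioms)

lemma UHD_to_A_respects:
 assumes "r \<in> UHD_rels p0 q0 n0"
 shows "cls (feval (UHD_to_A_gen p0 n0) r) = (0 :: A0)"
proof -
 consider "r \<in> gl_rels m0" | "r \<in> weyl_rels m0 n0" | "r \<in> tensor_rels m0 n0"
  using assms by (auto simp: UHD_rels_def)
 thus ?thesis
 proof cases
  case 1
  then obtain a b c d where r: "r = comm (eE a b) (eE c d) - ((if b = c then eE a d else 0) - (if d = a then eE c b else 0))"
   "a \<in> M0" "b \<in> M0" "c \<in> M0" "d \<in> M0"
   by (auto simp: gl_rels_def)
  have eh: "cls (eE a b - zeta p0 n0 a b) = A.eh a b" for a b
   by (simp add: cls_diff A.eh_def ec_def cls_zeta)
  show ?thesis
   using A.cm_eh_eh[OF r(2-5)] unfolding r(1)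
   by (auto simp: feval_simps cls_simps eh[unfolded cls_diff] cm_def)
 next
  case 2
  have "feval (UHD_to_A_gen p0 n0) r = r"
   by (rule alg_feval_id[of _ "weyl_gens m0 n0"])
    (use 2 weyl_rels_alg[of m0 n0 "weyl_gens m0 n0"] in "auto simp: weyl_gens_def")
  moreover have "r \<in> prels TYPE(tA)" using 2 by (simp add: prels_tA_def A_rels_def)
  ultimately show ?thesis using cls_rel[of r, where 'k = tA] by simp
 next
  case 3
  then obtain a b h where r: "r = comm (eE a b) (gener h)" "a \<in> M0" "b \<in> M0" "h \<in> weyl_gens m0 n0"
   by (auto simp: tensor_rels_def gl_gens_def)
  have h: "UHD_to_A_gen p0 n0 h = gener h"
   using r(4) by (auto simp: weyl_gens_def)
  have eh: "cls (eE a b - zeta p0 n0 a b) = A.eh a b"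
   by (simp add: cls_diff A.eh_def ec_def cls_zeta)
  have "cm (A.eh a b) (cls (gener h)) = 0"
   by (rule weyl_gens_cases[OF r(4), where 'k = tA]) (use r(2,3) in "auto simp: cm_uminus")
  thus ?thesis
   unfolding r(1) by (simp add: feval_comm h cls_diff[of "_ * _"] cls_mult eh cm_def)
 qed
qed

lemma UHD_to_A_gen_alg: "g \<in> A_gens p q n ==> UHD_to_A_gen p n g \<in> alg (A_gens p q n)"
proof (cases g)
 case (GE a b)
 assume "g \<in> A_gens p q n"
 with GE have "a \<in> {1..p + q}" "b \<in> {1..p + q}" by (auto simp: A_gens_def gl_gens_def weyl_gens_def)
 thus ?thesis
  using GE by (auto simp: A_gens_def gl_gens_def intro!: alg_diff alg_gener zeta_alg[of _ "p + q" _ n])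
qed auto

lemma Xcoef_hat:
 "a \<in> M0 ==> b \<in> M0 ==>
  cls (feval (UHD_to_A_gen p0 n0) (Xcoef m0 (Suc s) a b)) = A.hat.Gp s a b"
proof (induction s arbitrary: a)
 case (Suc s)
 have eh: "cls (eE c d - zeta p0 n0 c d) = A.eh c d" for c d
  by (simp add: cls_diff A.eh_def ec_def cls_zeta)
 from Suc show ?case
  by (auto simp: feval_simps cls_uminus cls_sum cls_mult A.hat.G_def eh sum_negf[symmetric]
    intro!: sum.cong)
qed simp

lemma alpha_T:
 assumes "i \<in> N0" "j \<in> N0"
 shows "alpha p0 q0 n0 (yangian_T n0 i j s) = emb (A.hat.TT s i j)"
proof -
 have "alpha p0 q0 n0 (yangian_T n0 i j s) = phom A_gens0 A_rels0 (UHD_to_A_gen p0 n0)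
   (pclass A_gens0 (UHD_rels p0 q0 n0) (feval (alpha_gen p0 q0) (yT i j s)))"
  by (simp add: alpha_def UHD_to_A_def alpha_UHD_T[OF assms])
 also have "\<dots> = emb (cls (feval (UHD_to_A_gen p0 n0) (feval (alpha_gen p0 q0) (yT i j s))) :: A0)"
  unfolding pgens_tA_def[symmetric, of "TYPE(tA)"] prels_tA_def[symmetric, of "TYPE(tA)"]
  by (rule phom_pclass)
   (use assms in "auto intro!: UHD_rels_alg alg_feval[OF alpha_gen_alg] yT_alg UHD_to_A_gen_alg UHD_to_A_respects
    simp: pgens_tA_def")
 also have "cls (feval (UHD_to_A_gen p0 n0) (feval (alpha_gen p0 q0) (yT i j s))) = A.hat.TT s i j"
 proof (cases s)
  case (Suc s')
  thus ?thesis
   by (auto simp: yT_def A.hat.TT_def A.hat.tt_def feval_sum feval_mult cls_sum cls_mult Xcoef_hat Ehat_def Pc_def Qc_def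
     intro!: sum.cong)
 qed (simp add: yT_def A.hat.TT_def)
 finally show ?thesis .
qed

definition iota :: "A0 => B0" where
 "iota = plift (%g. cls (gener g))"

lemma iota_kills: "kills_rels TYPE(tA) (%g. cls (gener g) :: B0)"
 unfolding kills_rels_def cls_feval[symmetric]
 using cls_rel[where 'k = tB] by (auto simp: prels_tA_def prels_tB_def Abar_rels_def)

lemmas iota_hom = plift_hom[OF iota_kills, folded iota_def]

lemma iota_cls: "x \<in> alg A_gens0 ==> iota (cls x) = cls x"
 using plift_cls[OF iota_kills, of x] by (simp add: iota_def pgens_tA_def flip: cls_feval)

lemma A_to_Abar_emb: "A_to_Abar0 (emb X) = emb (iota X)"
proof -
 obtain x where x: "x \<in> alg A_gens0" "cls x = X"
  using cls_surj_alg[of X] by (auto simp: pgens_tA_def)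
 have "A_to_Abar0 (emb X) = phom Abar_gens0 (Abar_rels p0 q0 n0) gener
   (pclass A_gens0 A_rels0 x)"
  using pclass_eq_emb[of x, where 'k = tA] x by (simp add: A_to_Abar_def pgens_tA_def prels_tA_def)
 also have "\<dots> = emb (cls (feval gener x) :: B0)"
  unfolding pgens_tB_def[symmetric, of "TYPE(tB)"] prels_tB_def[symmetric, of "TYPE(tB)"]
 proof (rule phom_pclass)
  fix r assume "r \<in> A_rels0"
  thus "cls (feval gener r) = (0 :: B0)"
   using cls_rel[of r, where 'k = tB] by (simp add: feval_gener_id prels_tB_def Abar_rels_def)
 qed (use x A_rels_alg in "auto simp: pgens_tB_def Abar_gens_def intro!: alg_gener")
 finally show ?thesis using x by (auto simp: feval_gener_id iota_cls)
qed

lemma iota_sum: "iota (sum h S) = (\<Sum>x\<in>S. iota (h x))"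
 by (induction S rule: infinite_finite_induct) (simp_all add: iota_hom)

lemma iota_ec: "a \<in> M0 ==> b \<in> M0 ==> iota (ec a b) = ec a b"
 unfolding ec_def by (rule iota_cls) (auto simp: A_gens_def gl_gens_def intro!: alg_gener)

lemma iota_Pc: "a \<in> M0 ==> i \<in> N0 ==> iota (Pc a i) = Pc a i"
 unfolding Pc_def by (rule iota_cls) (auto simp: A_gens_def intro!: pp_alg[of a m0 i n0])

lemma iota_Qc: "a \<in> M0 ==> i \<in> N0 ==> iota (Qc a i) = Qc a i"
 unfolding Qc_def by (rule iota_cls) (auto simp: A_gens_def intro!: qq_alg[of a m0 i n0])

lemma iota_z: "a \<in> M0 ==> b \<in> M0 ==> iota (A.z a b) = B.z a b"
 by (simp add: A.z_def B.z_def iota_hom iota_sum iota_Pc iota_Qc)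

lemma iota_eh: "a \<in> M0 ==> b \<in> M0 ==> iota (A.eh a b) = B.eh a b"
 by (simp add: A.eh_def B.eh_def iota_hom iota_ec iota_z)

lemma iota_Gp: "a \<in> M0 ==> b \<in> M0 ==> iota (A.hat.Gp s a b) = B.hat.Gp s a b"
proof (induction s arbitrary: a)
 case (Suc s)
 thus ?case
  by (auto simp: iota_sum iota_hom A.hat.G_def B.hat.G_def iota_eh intro!: sum.cong)
qed (simp add: iota_hom)

lemma alpha_Abar:
 assumes "i \<in> N0" "j \<in> N0"
 shows "A_to_Abar0 (alpha p0 q0 n0 (yangian_T n0 i j s)) = emb (B.hat.TT s i j)"
proof -
 have "iota (A.hat.TT s i j) = B.hat.TT s i j"
  using assms by (cases s) (auto simp: A.hat.TT_def B.hat.TT_def A.hat.tt_def B.hat.tt_def iota_sum iota_hom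
    iota_Gp iota_Pc iota_Qc intro!: sum.cong)
 thus ?thesis by (simp add: alpha_T[OF assms] A_to_Abar_emb)
qed

section \<open>Weights of the generators and denominators\<close>

definition iv :: "nat => nat => int => B0" where
 "iv a b z = cls (eInv a b z)"

definition den :: "nat => nat => int => B0" where
 "den a b z = ec a a - ec b b + csc (of_int z)"

lemma den_iv:
 assumes "a \<in> M0" "b \<in> M0" "a \<noteq> b"
 shows "den a b z * iv a b z = 1" "iv a b z * den a b z = 1"
proof -
 have "(eE a a - eE b b + of_int z) * eInv a b z - 1 \<in> prels TYPE(tB)"
  "eInv a b z * (eE a a - eE b b + of_int z) - 1 \<in> prels TYPE(tB)"
  using assms unfolding prels_tB_def Abar_rels_def inv_rels_def by blast+
 from this[THEN cls_rel] show "den a b z * iv a b z = 1" "iv a b z * den a b z = 1"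
  by (simp_all add: cls_simps den_def iv_def ec_def)
qed

text \<open>Since x is -p in the rows up to \<open>p0\<close> and q in the others, the sign of its
  weight depends on the row; likewise for \<partial>. Denominators lie in degree 0.\<close>

fun gwt :: "gen => nat => int" where
 "gwt (GE a b) c = (if c = a then 1 else 0) - (if c = b then 1 else 0)"
| "gwt (GX a i) c = (if c = a then (if a \<le> p0 then - 1 else 1) else 0)"
| "gwt (GD a i) c = (if c = a then (if a \<le> p0 then 1 else - 1) else 0)"
| "gwt (GInv a b z) c = 0"

lemma XD_PQ: "cls (eX a i) = (if a \<le> p0 then - Pc a i else Qc a i)"
 "cls (eD a i) = (if a \<le> p0 then Qc a i else Pc a i)"
 by (simp_all add: Pc_def Qc_def pp_def qq_def cls_uminus)

lemma ec_gwt: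
 assumes "g \<in> A_gens0" "c \<in> M0"
 shows "cm (ec c c) (cls (gener g)) = csc (of_int (gwt g c)) * (cls (gener g) :: B0)"
proof (cases g)
 case (GE a b)
 hence "a \<in> M0" "b \<in> M0"
  using assms by (auto simp: A_gens_def gl_gens_def weyl_gens_def)
 thus ?thesis
  using GE assms(2) B.gl[of c c a b] by (auto simp: csc_uminus simp flip: ec_def)
next
 case (GX a i)
 hence "a \<in> M0" "i \<in> N0"
  using assms by (auto simp: A_gens_def gl_gens_def weyl_gens_def)
 thus ?thesis
  using GX assms(2) B.eQ[of c c a i] B.eP[of c c a i] by (auto simp: csc_uminus XD_PQ cm_uminus)
next
 case (GD a i)
 hence "a \<in> M0" "i \<in> N0"
  using assms by (auto simp: A_gens_def gl_gens_def weyl_gens_def)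
 thus ?thesis
  using GD assms(2) B.eQ[of c c a i] B.eP[of c c a i] by (auto simp: csc_uminus XD_PQ cm_uminus)
qed (use assms in "auto simp: A_gens_def gl_gens_def weyl_gens_def")

text \<open>\<open>wtd w y\<close> says that \<open>y\<close> has weight \<open>w\<close> under the adjoint action of \<open>h\<close>.\<close>

definition wtd :: "(nat => int) => B0 => bool" where
 "wtd w y \<longleftrightarrow> (\<forall>c\<in>M0. cm (ec c c) y = csc (of_int (w c)) * y)"

lemma wtd_gener: "g \<in> A_gens0 ==> wtd (gwt g) (cls (gener g))"
 by (simp add: wtd_def ec_gwt)

lemma wtd_mult: "wtd v x ==> wtd w y ==> wtd (%c. v c + w c) (x * y)"
 by (auto simp: wtd_def cm_mult csc_add distrib_right mult.assoc csc_left_comm)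

lemma wtd_ec: "wtd w y ==> c \<in> M0 ==> y * ec c c = (ec c c - csc (of_int (w c))) * y"
 by (simp add: wtd_def cm_def algebra_simps)

lemma wtd_den:
 "wtd w y ==> a \<in> M0 ==> b \<in> M0 ==> y * den a b z = den a b (z - w a + w b) * y"
 by (simp add: den_def distrib_left right_diff_distrib wtd_ec distrib_right left_diff_distrib csc_add csc_diff csc_comm)

lemma wtd_iv:
 assumes "wtd w y" "a \<in> M0" "b \<in> M0" "a \<noteq> b"
 shows "y * iv a b z = iv a b (z - w a + w b) * y"
proof -
 have "y * iv a b z = iv a b (z - w a + w b) * (den a b (z - w a + w b) * y) * iv a b z"
  using den_iv(2)[OF assms(2-4)] by (simp flip: mult.assoc)
 also have "\<dots> = iv a b (z - w a + w b) * y * (den a b z * iv a b z)"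
  by (simp only: wtd_den[OF assms(1-3), symmetric] mult.assoc)
 finally show ?thesis using den_iv(1)[OF assms(2-4)] by simp
qed

lemma wtd_0_ec: "c \<in> M0 ==> wtd (%_. 0) (ec c c)"
 by (auto simp: wtd_def B.gl)

lemma wtd_0_iv: 
 assumes "a \<in> M0" "b \<in> M0" "a \<noteq> b"
 shows "wtd (%_. 0) (iv a b z)"
 unfolding wtd_def
proof
 fix c assume "c \<in> M0"
 hence "ec c c * iv a b z = iv a b z * ec c c"
  using wtd_iv[OF wtd_0_ec assms, of c z] by simp
 thus "cm (ec c c) (iv a b z) = csc (of_int 0) * iv a b z"
  by (simp add: cm_def)
qed

definition Uhg :: "B0 set" where
 "Uhg = (%g. cls (gener g)) ` ({GE a a |a. a \<in> M0} \<union> inv_gens m0)"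

definition Uh :: "B0 set" where
 "Uh = salg Uhg"

lemma Uh_eq: "Uh = cls ` Uh_expr m0"
 by (simp add: Uh_def Uhg_def Uh_expr_def salg_cls)

lemma Uhg_eq: "Uhg = {ec a a |a. a \<in> M0} \<union> {iv a b z |a b z. a \<in> M0 \<and> b \<in> M0 \<and> a \<noteq> b}"
 unfolding Uhg_def image_Un inv_gens_def ec_def iv_def by blast

lemma ec_Uh: "a \<in> M0 ==> ec a a \<in> Uh"
 and iv_Uh: "a \<in> M0 ==> b \<in> M0 ==> a \<noteq> b ==> iv a b z \<in> Uh"
 and den_Uh: "a \<in> M0 ==> b \<in> M0 ==> den a b z \<in> Uh"
proof -
 show ec: "a \<in> M0 ==> ec a a \<in> Uh" for a
  unfolding Uh_def by (rule salg.base) (auto simp: Uhg_eq)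
 show "a \<in> M0 ==> b \<in> M0 ==> a \<noteq> b ==> iv a b z \<in> Uh"
  unfolding Uh_def by (rule salg.base) (auto simp: Uhg_eq)
 show "a \<in> M0 ==> b \<in> M0 ==> den a b z \<in> Uh"
  using ec unfolding Uh_def den_def by (intro salg_intros) auto
qed

lemma Uh_mult: "s \<in> Uh ==> t \<in> Uh ==> s * t \<in> Uh"
 and Uh_add: "s \<in> Uh ==> t \<in> Uh ==> s + t \<in> Uh"
 and Uh_csc: "csc z \<in> Uh"
 by (simp_all add: Uh_def salg_intros)

lemma wtd_0_Uhg: "t \<in> Uhg ==> wtd (%_. 0) t"
 using wtd_0_ec wtd_0_iv by (auto simp: Uhg_eq)

lemma Uh_wtd_comm:
 assumes "s \<in> Uh" "wtd (%_. 0) y"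
 shows "s * y = y * s"
proof -
 have "cm y s = 0"
  using assms(1) unfolding Uh_def
 proof (rule salg_cm_0)
  fix x assume "x \<in> Uhg"
  thus "cm y x = 0"
   using wtd_ec[OF assms(2)] wtd_iv[OF assms(2)] by (auto simp: Uhg_eq cm_eq_0_iff)
 qed
 thus ?thesis by (simp add: cm_def)
qed

lemma Uh_comm:
 assumes "s \<in> Uh" "t \<in> Uh"
 shows "s * t = t * s"
proof -
 have "cm s t = 0"
  using assms(2) unfolding Uh_def
  by (rule salg_cm_0) (use Uh_wtd_comm[OF assms(1)] wtd_0_Uhg in "auto simp: cm_eq_0_iff")
 thus ?thesis by (simp add: cm_def)
qed

text \<open>The substitution behind the translation of rational functions by an integral weight.
  Only the images of \<open>GE a a\<close> and of the denominators matter; the values at variables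
  and derivations are placeholders.\<close>

fun sft :: "(nat => int) => gen => gen falg" where
 "sft w (GE a b) = eE a b + csc (of_int (w a))"
| "sft w (GInv a b z) = eInv a b (z + w a - w b)"
| "sft w (GX a i) = 0"
| "sft w (GD a i) = 0"

definition sh :: "(nat => int) => gen falg => gen falg" where
 "sh w = feval (sft w)"

lemma sh_Uh_expr: "t \<in> Uh_expr m ==> sh w t \<in> Uh_expr m"
 unfolding sh_def Uh_expr_def by (rule alg_feval) (auto simp: inv_gens_def intro!: alg_add alg_gener)

lemma Uh_val_feval: "Uh_val \<mu> = feval (gen_val \<mu>)"
 by (simp add: Uh_val_def feval_def fun_eq_iff)

lemma Uh_expr_induct [consumes 1, case_names csc E Inv add mult]:
 assumes "t \<in> Uh_expr m" "!!z. P (csc z)" "!!a. a \<in> {1..m} ==> P (eE a a)"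
  "!!a b z. a \<in> {1..m} ==> b \<in> {1..m} ==> a \<noteq> b ==> P (eInv a b z)"
  "!!s t. s \<in> Uh_expr m ==> t \<in> Uh_expr m ==> P s ==> P t ==> P (s + t)"
  "!!s t. s \<in> Uh_expr m ==> t \<in> Uh_expr m ==> P s ==> P t ==> P (s * t)"
 shows "P t"
proof -
 let ?S = "{GE a a |a. a \<in> {1..m}} \<union> inv_gens m"
 have "t \<in> alg ?S \<and> P t"
  using assms(1) unfolding Uh_expr_def
 proof (induction rule: alg_induct)
  case zero
  show ?case using assms(2)[of 0] by simp
 next
  case (single w c)
  have "wrd w \<in> alg ?S \<and> P (wrd w)"
   using single
  proof (induction w)
   case Nil
   thus ?case using assms(2)[of 1] by (simp del: csc_poly_mapping_def)
  next
   case (Cons g w)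
   hence "gener g \<in> alg ?S" "P (gener g)"
    using assms(3,4) by (auto simp: inv_gens_def intro!: alg_gener)
   thus ?case using Cons assms(6) by (simp add: wrd_Cons alg_mult Uh_expr_def)
  qed
  thus ?case
   unfolding single_eq_wrd[of w c] using assms(2,6) by (auto simp: alg_mult Uh_expr_def)
 next
  case (add f g)
  thus ?case using assms(5) by (auto simp: alg_add Uh_expr_def)
 qed
 thus ?thesis ..
qed

lemma Uh_val_sh: "t \<in> Uh_expr m ==> Uh_val \<mu> (sh w t) = Uh_val (%a. \<mu> a + of_int (w a)) t"
 by (induction rule: Uh_expr_induct) (simp_all add: Uh_val_feval sh_def feval_simps algebra_simps)

lemma sh_mult:
 assumes "t \<in> Uh_expr m0" "wtd w y"
 shows "y * cls t = cls (sh (%a. - w a) t) * y"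
 using assms(1)
proof (induction rule: Uh_expr_induct)
 case (csc z)
 thus ?case by (simp add: sh_def csc_comm)
next
 case (E a)
 thus ?case using wtd_ec[OF assms(2)] by (simp add: sh_def cls_simps csc_uminus flip: ec_def)
next
 case (Inv a b z)
 thus ?case using wtd_iv[OF assms(2)] by (simp add: sh_def flip: iv_def)
next
 case (add s t)
 thus ?case by (simp add: sh_def feval_add cls_add distrib_left distrib_right)
next
 case (mult s t)
 thus ?case unfolding sh_def feval_mult cls_mult by (metis mult.assoc)
qed

lemma wtd_Uh:
 assumes "t \<in> Uh" "wtd w y"
 obtains t' where "t' \<in> Uh" "y * t = t' * y"
 using assms sh_mult[OF _ assms(2)] sh_Uh_expr unfolding Uh_eq by blast

lemma AA_cls: "B.AA = cls ` alg A_gens0" "A.AA = cls ` alg A_gens0"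
proof -
 have *: "osc.AA m0 n0 Pc Qc (ec :: _ => _ => 'k::ptag pal) = cls ` alg A_gens0"
  if "osc m0 n0 (Pc :: _ => _ => 'k pal) Qc ec"
 proof -
  interpret osc m0 n0 "Pc :: _ => _ => 'k pal" Qc ec by fact
  show ?thesis
  proof (intro equalityI subsetI)
   fix y :: "'k pal" assume "y \<in> AA"
   moreover have "Ag \<subseteq> salg ((%g. cls (gener g)) ` A_gens0)"
    unfolding salg_cls[symmetric] Ag_def HDg_def ec_def Pc_def Qc_def
    by (auto simp: A_gens_def gl_gens_def intro!: imageI alg_gener pp_alg[of _ m0 _ n0] qq_alg[of _ m0 _ n0])
   ultimately show "y \<in> cls ` alg A_gens0"
    unfolding salg_cls AA_def by (auto intro: salg_mono)
  next
   fix y :: "'k pal" assume "y \<in> cls ` alg A_gens0"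
   moreover have "cls (gener g) \<in> AA" if g: "g \<in> A_gens0" for g
   proof -
    consider a b where "g = GE a b" "a \<in> M0" "b \<in> M0" | "g \<in> weyl_gens m0 n0"
     using g by (auto simp: A_gens_def gl_gens_def)
    thus ?thesis
    proof cases
     case 1
     thus ?thesis using e_AA by (simp add: ec_def)
    next
     case 2
     from weyl_gens_cases[OF this, where 'k = 'k] show ?thesis
      using P_HD Q_HD HD_AA salg_uminus unfolding AA_def by metis
    qed
   qed
   ultimately show "y \<in> AA"
    unfolding salg_cls AA_def by (auto intro: salg_mono)
  qed
 qed
 show "B.AA = cls ` alg A_gens0" by (rule *) (rule B.osc_axioms)
 show "A.AA = cls ` alg A_gens0" by (rule *) (rule A.osc_axioms)
qed

text \<open>A letter of definite weight only shifts a denominator when passing it, so fractions can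
  be collected on the left. This replaces the Ore condition for the localization given by generators
  and relations.\<close>

lemma B0_span: "x \<in> asp {t * y |t y. t \<in> Uh \<and> y \<in> B.AA}"
proof -
 let ?W = "asp {t * y |t y. t \<in> Uh \<and> y \<in> B.AA}"
 have gen: "cls (gener g) * u \<in> ?W" if "g \<in> Abar_gens0" "u \<in> ?W" for g u
  using that(2)
 proof (rule asp_image[where h = "%u. cls (gener g) * u"])
  fix v assume "v \<in> {t * y |t y. t \<in> Uh \<and> y \<in> B.AA}"
  then obtain t y where v: "v = t * y" "t \<in> Uh" "y \<in> B.AA" by blast
  show "cls (gener g) * v \<in> ?W"
  proof (cases "g \<in> A_gens0")
   case True
   then obtain t' where "t' \<in> Uh" "cls (gener g) * t = t' * cls (gener g)"
    using wtd_Uh[OF v(2) wtd_gener] by blast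
   moreover have "cls (gener g) * y \<in> B.AA"
    using True v(3) unfolding AA_cls by (auto intro!: imageI alg_mult simp flip: cls_mult)
   ultimately show ?thesis
    unfolding v(1) by (intro asp.base) (auto simp flip: mult.assoc, metis mult.assoc)
  next
   case False
   hence "cls (gener g) \<in> Uh"
    using that(1) unfolding Uh_eq by (auto simp: Abar_gens_def Uh_expr_def intro!: imageI alg_gener)
   hence "cls (gener g) * t \<in> Uh" using v(2) by (rule Uh_mult)
   thus ?thesis
    unfolding v(1) using v(3) by (intro asp.base) (auto simp flip: mult.assoc)
  qed
 qed (simp add: distrib_left)
 have "cls f \<in> ?W" if "f \<in> alg Abar_gens0" for f
  using that
 proof (induction rule: alg_induct)
  case (single w c)
  have "cls (wrd w) * csc c \<in> ?W"
   using single
  proof (induction w)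
   case Nil
   have "csc c * 1 \<in> ?W"
    by (rule asp.base) (use Uh_csc[of c] salg_1[of B.Ag] in "unfold B.AA_def, blast")
   thus ?case by simp
  next
   case (Cons g w)
   thus ?case using gen[of g] by (simp add: wrd_Cons cls_mult mult.assoc)
  qed
  thus ?case unfolding single_eq_wrd[of w c] cls_mult by (simp add: csc_comm)
 qed (auto simp: cls_add intro: asp.intros)
 thus ?thesis
  using cls_surj_alg[of x] by (auto simp: pgens_tB_def)
qed

section \<open>Fractions of U(h) as functions of generic weights\<close>

lemma generic_exists: "generic m (%a. of_nat a * \<i>)"
 unfolding generic_def
proof (intro ballI impI)
 fix a b :: nat assume "a \<noteq> b"
 show "of_nat a * \<i> - of_nat b * \<i> \<notin> \<int>"
 proof
  assume "of_nat a * \<i> - of_nat b * \<i> \<in> \<int>"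
  then obtain k where "of_nat a * \<i> - of_nat b * \<i> = of_int k" by (auto elim: Ints_cases)
  hence "Im (of_nat a * \<i> - of_nat b * \<i>) = 0" by (simp only: complex_Im_of_int)
  thus False using \<open>a \<noteq> b\<close> by simp
 qed
qed

text \<open>The candidates are \<mu> k + 1/(j + 2). Two of them differ by less than 1, so each of
  the finitely many conditions excludes at most one candidate.\<close>

lemma infinite_generic:
 assumes "generic m \<mu>" "k \<in> {1..m}"
 shows "infinite {z. generic m (\<mu>(k := z))}"
proof -
 define f :: "nat => complex" where "f j = \<mu> k + of_real (1 / (real j + 2))" for j
 define bad where "bad b = {j. f j - \<mu> b \<in> \<int>}" for b
 have sub: "j = i" if "i \<in> bad b" "j \<in> bad b" for i j b
 proof -
  have "(f i - \<mu> b) - (f j - \<mu> b) \<in> \<int>"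
   using that unfolding bad_def by (intro Ints_diff[of "f i - \<mu> b" "f j - \<mu> b"]) auto
  hence "complex_of_real (1 / (real i + 2) - 1 / (real j + 2)) \<in> \<int>"
   by (simp add: f_def)
  then obtain t where "complex_of_real (1 / (real i + 2) - 1 / (real j + 2)) = of_int t"
   by (auto elim: Ints_cases)
  hence "complex_of_real (1 / (real i + 2) - 1 / (real j + 2)) = complex_of_real (of_int t)"
   by simp
  hence t: "1 / (real i + 2) - 1 / (real j + 2) = of_int t"
   using of_real_eq_iff by blast
  have "0 < 1 / (real i + 2)" "1 / (real i + 2) < 1" "0 < 1 / (real j + 2)" "1 / (real j + 2) < 1"
   by auto
  hence "\<bar>real_of_int t\<bar> < 1" using t by linarith
  hence "t = 0" by linarith
  with t show ?thesis by simp
 qed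
 have "finite (bad b)" for b
 proof (cases "bad b = {}")
  case False
  then obtain i where "i \<in> bad b" by blast
  hence "bad b \<subseteq> {i}" using sub by blast
  thus ?thesis by (rule finite_subset) simp
 qed simp
 hence "infinite (UNIV - (\<Union>b\<in>{1..m}. bad b))"
  by (intro Diff_infinite_finite) auto
 moreover have "inj f" by (auto simp: inj_def f_def)
 ultimately have "infinite (f ` (UNIV - (\<Union>b\<in>{1..m}. bad b)))"
  by (metis finite_imageD inj_on_subset subset_UNIV)
 moreover have "f ` (UNIV - (\<Union>b\<in>{1..m}. bad b)) \<subseteq> {z. generic m (\<mu>(k := z))}"
 proof (intro subsetI CollectI)
  fix z assume "z \<in> f ` (UNIV - (\<Union>b\<in>{1..m}. bad b))"
  hence z: "z - \<mu> b \<notin> \<int>" if "b \<in> {1..m}" for b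
   using that by (auto simp: bad_def)
  have z': "\<mu> b - z \<notin> \<int>" if "b \<in> {1..m}" for b
   using z[OF that] Ints_minus[of "\<mu> b - z"] by auto
  show "generic m (\<mu>(k := z))"
   using assms(1) z z' unfolding generic_def by auto
 qed
 ultimately show ?thesis using finite_subset by blast
qed

abbreviation Ed :: "nat set => gen set" where
 "Ed S \<equiv> (%a. GE a a) ` S"

lemma Ed_Uh_expr: "u \<in> alg (Ed {1..m}) ==> u \<in> Uh_expr m"
 unfolding Uh_expr_def by (erule alg_mono[rotated]) auto

text \<open>The denominator d is a polynomial in the E_aa which is invertible from the left in the
  localized algebra; this allows it to be cancelled after the polynomial u has been shown to
  vanish.\<close>

lemma clear_denominators:
 assumes "t \<in> Uh_expr m0"
 shows "\<exists>d u x. d \<in> alg (Ed M0) \<and> u \<in> alg (Ed M0) \<and> x * cls d = (1 :: B0) \<and>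
  cls d * cls t = (cls u :: B0) \<and>
  (\<forall>\<mu>. generic m0 \<mu> --> Uh_val \<mu> d * Uh_val \<mu> t = Uh_val \<mu> u)"
 using assms
proof (induction rule: Uh_expr_induct)
 case (csc z)
 show ?case by (rule exI[of _ 1], rule exI[of _ "csc z"], rule exI[of _ 1]) (simp add: Uh_val_feval)
next
 case (E a)
 show ?case
  by (rule exI[of _ 1], rule exI[of _ "eE a a"], rule exI[of _ 1]) (use E in "simp add: Uh_val_feval")
next
 case (Inv a b z)
 show ?case
 proof (rule exI[of _ "eE a a - eE b b + of_int z"], rule exI[of _ "1 :: gen falg"], rule exI[of _ "iv a b z"], intro conjI allI impI)
  show "eE a a - eE b b + of_int z \<in> alg (Ed M0)"
   using Inv by (auto intro!: alg_intros alg_gener)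
  show "iv a b z * cls (eE a a - eE b b + of_int z) = 1"
   using den_iv(2)[OF Inv] by (simp add: den_def ec_def cls_simps)
  show "cls (eE a a - eE b b + of_int z) * cls (eInv a b z) = (cls 1 :: B0)"
   using den_iv(1)[OF Inv] by (simp add: den_def iv_def ec_def cls_simps)
  fix \<mu> assume "generic m0 \<mu>"
  hence "\<mu> a - \<mu> b \<notin> \<int>" using Inv by (simp add: generic_def)
  moreover have "\<mu> a - \<mu> b = - of_int z" if "\<mu> a - \<mu> b + of_int z = 0"
   using that by (simp add: add_eq_0_iff2)
  ultimately have "\<mu> a - \<mu> b + of_int z \<noteq> 0" by (metis Ints_minus Ints_of_int)
  thus "Uh_val \<mu> (eE a a - eE b b + of_int z) * Uh_val \<mu> (eInv a b z) = Uh_val \<mu> 1"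
   by (simp add: Uh_val_feval feval_simps)
 qed simp
next
 case (add s t)
 then obtain d u x d' u' x' where
  IH: "d \<in> alg (Ed M0)" "u \<in> alg (Ed M0)" "x * cls d = (1 :: B0)" "cls d * cls s = (cls u :: B0)"
  "!!\<mu>. generic m0 \<mu> ==> Uh_val \<mu> d * Uh_val \<mu> s = Uh_val \<mu> u"
  "d' \<in> alg (Ed M0)" "u' \<in> alg (Ed M0)" "x' * cls d' = (1 :: B0)" "cls d' * cls t = (cls u' :: B0)"
  "!!\<mu>. generic m0 \<mu> ==> Uh_val \<mu> d' * Uh_val \<mu> t = Uh_val \<mu> u'"
  by blast
 have cc: "cls d * cls d' = (cls d' * cls d :: B0)"
  by (rule Uh_comm) (use IH Ed_Uh_expr in "auto simp: Uh_eq")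
 show ?case
 proof (rule exI[of _ "d * d'"], rule exI[of _ "d' * u + d * u'"], rule exI[of _ "x' * x"], intro conjI allI impI)
  have "x' * x * cls (d * d') = x' * (x * cls d) * cls d'" by (simp add: cls_mult mult.assoc)
  thus "x' * x * cls (d * d') = 1" using IH by simp
  have "cls (d * d') * cls (s + t) = cls d' * (cls d * cls s) + cls d * (cls d' * cls t :: B0)"
   by (simp add: cls_simps distrib_left mult.assoc[symmetric] cc)
  thus "cls (d * d') * cls (s + t) = (cls (d' * u + d * u') :: B0)"
   using IH by (simp add: cls_simps)
  fix \<mu> assume "generic m0 \<mu>"
  thus "Uh_val \<mu> (d * d') * Uh_val \<mu> (s + t) = Uh_val \<mu> (d' * u + d * u')"
   by (simp add: Uh_val_feval feval_simps flip: IH(5,10)[unfolded Uh_val_feval]) (simp add: algebra_simps)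
 qed (use IH in "auto intro!: alg_intros")
next
 case (mult s t)
 then obtain d u x d' u' x' where
  IH: "d \<in> alg (Ed M0)" "u \<in> alg (Ed M0)" "x * cls d = (1 :: B0)" "cls d * cls s = (cls u :: B0)"
  "!!\<mu>. generic m0 \<mu> ==> Uh_val \<mu> d * Uh_val \<mu> s = Uh_val \<mu> u"
  "d' \<in> alg (Ed M0)" "u' \<in> alg (Ed M0)" "x' * cls d' = (1 :: B0)" "cls d' * cls t = (cls u' :: B0)"
  "!!\<mu>. generic m0 \<mu> ==> Uh_val \<mu> d' * Uh_val \<mu> t = Uh_val \<mu> u'"
  by blast
 have cc: "cls d' * cls s = (cls s * cls d' :: B0)"
  by (rule Uh_comm) (use IH Ed_Uh_expr mult in "auto simp: Uh_eq")
 show ?case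
 proof (rule exI[of _ "d * d'"], rule exI[of _ "u * u'"], rule exI[of _ "x' * x"], intro conjI allI impI)
  have "x' * x * cls (d * d') = x' * (x * cls d) * cls d'" by (simp add: cls_mult mult.assoc)
  thus "x' * x * cls (d * d') = 1" using IH by simp
  have "cls (d * d') * cls (s * t) = cls d * (cls d' * cls s) * (cls t :: B0)"
   by (simp add: cls_simps mult.assoc)
  also have "\<dots> = (cls d * cls s) * (cls d' * cls t)"
   unfolding cc by (simp add: mult.assoc)
  finally show "cls (d * d') * cls (s * t) = (cls (u * u') :: B0)"
   using IH by (simp add: cls_simps)
  fix \<mu> assume "generic m0 \<mu>"
  thus "Uh_val \<mu> (d * d') * Uh_val \<mu> (s * t) = Uh_val \<mu> (u * u')"
   by (simp add: Uh_val_feval feval_simps flip: IH(5,10)[unfolded Uh_val_feval])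
 qed (use IH in "auto intro!: alg_intros")
qed

lemma sum_atMost_shift:
 "N \<noteq> 0 ==> f 0 = 0 ==> (\<Sum>j\<le>N. f j) = (\<Sum>j\<le>N - 1. f (Suc j) :: 'b::comm_monoid_add)"
 by (cases N) (simp_all add: sum.atMost_Suc_shift del: sum.atMost_Suc)

text \<open>Expansion in powers of the one variable E_kk. The length N of the sum is left free above
  a bound, so that expansions of different degrees can be added.\<close>

lemma Ed_polynomial:
 assumes "u \<in> alg (Ed (insert k S))" "insert k S \<subseteq> M0"
 shows "\<exists>M c. (\<forall>j. c j \<in> alg (Ed S)) \<and> (\<forall>N\<ge>M. cls u = (\<Sum>j\<le>N. cls (c j) * ec k k ^ j :: B0)) \<and>
  (\<forall>N\<ge>M. \<forall>\<mu>. Uh_val \<mu> u = (\<Sum>j\<le>N. Uh_val \<mu> (c j) * \<mu> k ^ j))"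
 using assms(1)
proof (induction rule: alg_induct)
 case zero
 show ?case by (intro exI[of _ 0] exI[of _ "%_. 0"]) (simp add: Uh_val_feval)
next
 case (single w z)
 thus ?case
 proof (induction w)
  case Nil
  have "(\<Sum>j\<le>N. cls (if j = 0 then csc z else 0) * ec k k ^ j) = (csc z :: B0)" for N
   by (rule trans[OF sum.mono_neutral_right[of _ "{0}"]]) auto
  moreover have "(\<Sum>j\<le>N. Uh_val \<mu> (if j = 0 then csc z else 0) * \<mu> k ^ j) = z" for N \<mu>
   by (rule trans[OF sum.mono_neutral_right[of _ "{0}"]]) (auto simp: Uh_val_feval)
  moreover have "cls (Poly_Mapping.single [] z) = (csc z :: B0)"
   using cls_scal[of z] by (simp add: scal_def)
  moreover have "Uh_val \<mu> (Poly_Mapping.single [] z) = z" for \<mu>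
   by (simp add: Uh_val_feval feval_single)
  ultimately show ?case
   by (intro exI[of _ 0] exI[of _ "%j. if j = 0 then csc z else 0"]) auto
 next
  case (Cons g w)
  from Cons.prems have "set w \<subseteq> Ed (insert k S)" by simp
  from Cons.IH[OF this] obtain M c where IH: "\<forall>j. c j \<in> alg (Ed S)"
    "!!N. N \<ge> M ==> cls (Poly_Mapping.single w z) = (\<Sum>j\<le>N. cls (c j) * ec k k ^ j :: B0)"
    "!!N \<mu>. N \<ge> M ==> Uh_val \<mu> (Poly_Mapping.single w z) = (\<Sum>j\<le>N. Uh_val \<mu> (c j) * \<mu> k ^ j)"
   by blast
  have eq: "Poly_Mapping.single (g # w) z = gener g * Poly_Mapping.single w z" for g :: gen
   by (simp add: gener_def mult_single plus_list_def)
  have cU: "cls (c j) \<in> Uh" for j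
   using IH(1) assms(2) alg_mono[of "Ed S" "Ed M0" "c j"] Ed_Uh_expr[of "c j" m0] unfolding Uh_eq by blast
  from Cons.prems consider "g = GE k k" | a where "a \<in> S" "g = GE a a" by auto
  thus ?case
  proof cases
   case 1
   have kU: "ec k k \<in> Uh" using assms(2) by (intro ec_Uh) auto
   have "ec k k * (cls (c j) * ec k k ^ j) = (cls (c j) * ec k k ^ Suc j :: B0)" for j
    using Uh_comm[OF kU cU[of j]] by (metis mult.assoc power_Suc)
   moreover have "ec k k * (\<Sum>j\<le>N - 1. cls (c j) * ec k k ^ j) =
     (\<Sum>j\<le>N. cls (case j of 0 => 0 | Suc j => c j) * ec k k ^ j :: B0)"
    "\<mu> k * (\<Sum>j\<le>N - 1. Uh_val \<mu> (c j) * \<mu> k ^ j) =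
     (\<Sum>j\<le>N. Uh_val \<mu> (case j of 0 => 0 | Suc j => c j) * \<mu> k ^ j)"
    if N: "N \<ge> Suc M" for N \<mu>
    using calculation sum_atMost_shift[of N "%j. cls (case j of 0 => 0 | Suc j => c j) * ec k k ^ j :: B0"]
     sum_atMost_shift[of N "%j. Uh_val \<mu> (case j of 0 => 0 | Suc j => c j) * \<mu> k ^ j"] N
    by (simp_all add: sum_distrib_left Uh_val_feval mult_ac)
   moreover have "cls (Poly_Mapping.single w z) = (\<Sum>j\<le>N - 1. cls (c j) * ec k k ^ j :: B0)"
    "Uh_val \<mu> (Poly_Mapping.single w z) = (\<Sum>j\<le>N - 1. Uh_val \<mu> (c j) * \<mu> k ^ j)"
    if "N \<ge> Suc M" for N \<mu>
    using IH(2)[of "N - 1"] IH(3)[of "N - 1" \<mu>] that by auto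
   moreover have "cls (Poly_Mapping.single (g # w) z) = ec k k * (cls (Poly_Mapping.single w z) :: B0)"
    "Uh_val \<mu> (Poly_Mapping.single (g # w) z) = \<mu> k * Uh_val \<mu> (Poly_Mapping.single w z)" for \<mu>
    by (simp_all add: eq 1 cls_mult ec_def Uh_val_feval feval_mult)
   ultimately show ?thesis
    using IH(1)
    by (intro exI[of _ "Suc M"] exI[of _ "%j. case j of 0 => 0 | Suc j => c j"])
     (simp split: nat.split)
  next
   case 2
   thus ?thesis
    using IH
    by (intro exI[of _ M] exI[of _ "%j. gener g * c j"])
     (auto simp: eq cls_mult Uh_val_feval feval_mult sum_distrib_left mult.assoc intro!: sum.cong alg_mult alg_gener)
  qed
 qed
next
 case (add u v)
 then obtain M c M' c' where "\<forall>j. c j \<in> alg (Ed S)"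
   "!!N. N \<ge> M ==> cls u = (\<Sum>j\<le>N. cls (c j) * ec k k ^ j :: B0)"
   "!!N \<mu>. N \<ge> M ==> Uh_val \<mu> u = (\<Sum>j\<le>N. Uh_val \<mu> (c j) * \<mu> k ^ j)"
   "\<forall>j. c' j \<in> alg (Ed S)"
   "!!N. N \<ge> M' ==> cls v = (\<Sum>j\<le>N. cls (c' j) * ec k k ^ j :: B0)"
   "!!N \<mu>. N \<ge> M' ==> Uh_val \<mu> v = (\<Sum>j\<le>N. Uh_val \<mu> (c' j) * \<mu> k ^ j)"
  by blast
 thus ?case
  by (intro exI[of _ "max M M'"] exI[of _ "%j. c j + c' j"])
   (auto simp: cls_add Uh_val_feval feval_add distrib_right sum.distrib intro: alg_add)
qed

text \<open>Induction on the number of variables: for fixed remaining labels the values form a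
  polynomial in the label k with infinitely many roots, so each coefficient vanishes at all generic
  weights. The conclusion concerns the class in the localized algebra, as the letters do not commute
  in the free algebra.\<close>

lemma Ed_zero:
 assumes "finite S" "S \<subseteq> M0" "u \<in> alg (Ed S)" "!!\<mu>. generic m0 \<mu> ==> Uh_val \<mu> u = 0"
 shows "cls u = (0 :: B0)"
 using assms
proof (induction S arbitrary: u rule: finite_induct)
 case empty
 from empty(2) have "\<exists>z. u = csc z"
 proof (induction rule: alg_induct)
  case zero
  show ?case by (intro exI[of _ 0]) simp
 next
  case (single w c)
  thus ?case by (intro exI[of _ c]) (simp add: csc_poly_mapping_def zero_list_def)
 qed (auto simp flip: csc_add)
 thus ?case
  using empty(3)[OF generic_exists] by (auto simp: Uh_val_feval)
next
 case (insert k S)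
 obtain N c where c: "\<forall>j. c j \<in> alg (Ed S)" "cls u = (\<Sum>j\<le>N. cls (c j) * ec k k ^ j :: B0)"
   "!!\<mu>. Uh_val \<mu> u = (\<Sum>j\<le>N. Uh_val \<mu> (c j) * \<mu> k ^ j)"
  using Ed_polynomial[OF insert.prems(2,1)] by blast
 have "cls (c j) = (0 :: B0)" if "j \<le> N" for j
 proof (rule insert.IH)
  fix \<mu> assume \<mu>: "generic m0 \<mu>"
  have "{z. generic m0 (\<mu>(k := z))} \<subseteq> {z. (\<Sum>j\<le>N. Uh_val \<mu> (c j) * z ^ j) = 0}"
  proof (intro subsetI CollectI)
   fix z assume "z \<in> {z. generic m0 (\<mu>(k := z))}"
   hence g: "generic m0 (\<mu>(k := z))" by simp
   have "(\<Sum>j\<le>N. Uh_val (\<mu>(k := z)) (c j) * z ^ j) = 0"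
    using insert.prems(3)[OF g] c(3)[of "\<mu>(k := z)"] by (simp only: fun_upd_same)
   moreover have "Uh_val (\<mu>(k := z)) (c j) = Uh_val \<mu> (c j)" for j
    unfolding Uh_val_feval
   proof (rule feval_cong)
    fix w g assume "w \<in> Poly_Mapping.keys (c j)" "g \<in> set w"
    hence "g \<in> Ed S" using c(1) by (auto simp: alg_def)
    thus "gen_val (\<mu>(k := z)) g = gen_val \<mu> g" using insert.hyps(2) by auto
   qed
   ultimately show "(\<Sum>j\<le>N. Uh_val \<mu> (c j) * z ^ j) = 0" by simp
  qed
  hence "infinite {z. (\<Sum>j\<le>N. Uh_val \<mu> (c j) * z ^ j) = 0}"
   using infinite_generic[OF \<mu>, of k] insert.prems(1) finite_subset by blast
  thus "Uh_val \<mu> (c j) = 0"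
   using polyfun_roots_finite[of "%j. Uh_val \<mu> (c j)" j N] that by blast
 qed (use insert.prems c in auto)
 thus ?case by (simp add: c(2))
qed

text \<open>This makes it legitimate to prescribe a fraction by its values: the element Z with
  Z(\<mu>) = X(\<mu> + \<eta>) is unique.\<close>

lemma Uh_zero:
 assumes "t \<in> Uh_expr m0" "!!\<mu>. generic m0 \<mu> ==> Uh_val \<mu> t = 0"
 shows "cls t = (0 :: B0)"
proof -
 obtain d u x where "d \<in> alg (Ed M0)" and d: "u \<in> alg (Ed M0)" "x * cls d = (1 :: B0)" "cls d * cls t = (cls u :: B0)"
  "!!\<mu>. generic m0 \<mu> ==> Uh_val \<mu> d * Uh_val \<mu> t = Uh_val \<mu> u"
  using clear_denominators[OF assms(1)] by blast
 have "cls u = (0 :: B0)"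
  by (rule Ed_zero[OF _ _ d(1)]) (use d(4) assms(2) in auto)
 hence "x * cls d * cls t = 0" using d(3) by (simp add: mult.assoc)
 thus ?thesis using d(2) by simp
qed

lemma Uh_val_cong:
 assumes "t \<in> Uh_expr m0" "t' \<in> Uh_expr m0" "!!\<mu>. generic m0 \<mu> ==> Uh_val \<mu> t = Uh_val \<mu> t'"
 shows "cls t = (cls t' :: B0)"
proof -
 have "cls (t - t') = (0 :: B0)"
  by (rule Uh_zero) (use assms in "auto simp: Uh_expr_def Uh_val_feval feval_diff intro: alg_diff")
 thus ?thesis by (simp add: cls_diff)
qed

section \<open>The ideals J and I and their sum\<close>

context osc
begin

definition Jg :: "'r set" where
 "Jg = {e b a |a b. a \<in> {1..m} \<and> b \<in> {1..m} \<and> a < b}"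

definition JT :: "'r set" where
 "JT = asp {s * r |s r. s \<in> Jg}"

text \<open>\<open>ep a\<close> stands for \<open>\<delta>\<^sub>a = 1\<close> after passing from \<open>\<delta>\<close> to its image under the bar.\<close>

definition Ig :: "(nat => complex) => (nat => bool) => 'r set" where
 "Ig \<mu> ep = {Q a k |a k. a \<in> {1..m} \<and> k \<in> {1..n} \<and> ep a} \<union>
  {P a k |a k. a \<in> {1..m} \<and> k \<in> {1..n} \<and> \<not> ep a} \<union>
  {eh a b |a b. a \<in> {1..m} \<and> b \<in> {1..m} \<and> a < b} \<union>
  {eh a a - csc (\<mu> a) |a. a \<in> {1..m}}"

definition IT :: "(nat => complex) => (nat => bool) => 'r set" where
 "IT \<mu> ep = asp {r * s |s r. s \<in> Ig \<mu> ep}"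

definition KT :: "(nat => complex) => (nat => bool) => 'r set" where
 "KT \<mu> ep = {k + l |k l. k \<in> JT \<and> l \<in> IT \<mu> ep}"

lemma JT_0 [simp]: "0 \<in> JT" and JT_add: "x \<in> JT ==> y \<in> JT ==> x + y \<in> JT"
 and JT_uminus: "x \<in> JT ==> - x \<in> JT" and JT_diff: "x \<in> JT ==> y \<in> JT ==> x - y \<in> JT"
 and JT_sum: "(!!a. a \<in> S ==> h a \<in> JT) ==> sum h S \<in> JT"
 by (simp_all add: JT_def asp.intros asp_diff asp_sum)

lemma IT_0 [simp]: "0 \<in> IT \<mu> ep" and IT_add: "x \<in> IT \<mu> ep ==> y \<in> IT \<mu> ep ==> x + y \<in> IT \<mu> ep"
 and IT_uminus: "x \<in> IT \<mu> ep ==> - x \<in> IT \<mu> ep" and IT_diff: "x \<in> IT \<mu> ep ==> y \<in> IT \<mu> ep ==> x - y \<in> IT \<mu> ep"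
 and IT_sum: "(!!a. a \<in> S ==> h a \<in> IT \<mu> ep) ==> sum h S \<in> IT \<mu> ep"
 by (simp_all add: IT_def asp.intros asp_diff asp_sum)

lemma IT_lmult: "x \<in> IT \<mu> ep ==> y * x \<in> IT \<mu> ep"
 unfolding IT_def
 by (erule asp_image) (auto simp: distrib_left intro!: asp.base, metis mult.assoc)

lemma e_JT: "a \<in> {1..m} ==> b \<in> {1..m} ==> a < b ==> e b a * r \<in> JT"
 unfolding JT_def Jg_def by (rule asp.base) blast

lemma Ig_IT: "s \<in> Ig \<mu> ep ==> r * s \<in> IT \<mu> ep"
 unfolding IT_def by (rule asp.base) auto

lemma JT_KT: "x \<in> JT ==> x \<in> KT \<mu> ep" and IT_KT: "x \<in> IT \<mu> ep ==> x \<in> KT \<mu> ep"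
 unfolding KT_def by (intro CollectI exI[of _ x] exI[of _ 0], simp)
  (intro CollectI exI[of _ 0] exI[of _ x], simp)

lemma KT_add: "x \<in> KT \<mu> ep ==> y \<in> KT \<mu> ep ==> x + y \<in> KT \<mu> ep"
proof -
 assume "x \<in> KT \<mu> ep" "y \<in> KT \<mu> ep"
 then obtain k l k' l' where "x = k + l" "y = k' + l'" "k \<in> JT" "k' \<in> JT" "l \<in> IT \<mu> ep" "l' \<in> IT \<mu> ep"
  unfolding KT_def by blast
 thus ?thesis
  unfolding KT_def by (intro CollectI exI[of _ "k + k'"] exI[of _ "l + l'"]) (simp add: JT_add IT_add)
qed

lemma KT_uminus: "x \<in> KT \<mu> ep ==> - x \<in> KT \<mu> ep"
proof -
 assume "x \<in> KT \<mu> ep"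
 then obtain k l where "x = k + l" "k \<in> JT" "l \<in> IT \<mu> ep"
  unfolding KT_def by blast
 thus ?thesis
  unfolding KT_def by (intro CollectI exI[of _ "- k"] exI[of _ "- l"]) (simp add: JT_uminus IT_uminus)
qed

lemma KT_0 [simp]: "0 \<in> KT \<mu> ep"
 using JT_KT[OF JT_0] .

lemma KT_diff: "x \<in> KT \<mu> ep ==> y \<in> KT \<mu> ep ==> x - y \<in> KT \<mu> ep"
 using KT_add[of x \<mu> ep "- y"] KT_uminus by simp

lemma KT_sum: "(!!a. a \<in> S ==> h a \<in> KT \<mu> ep) ==> sum h S \<in> KT \<mu> ep"
 by (induction S rule: infinite_finite_induct) (simp_all add: KT_add)

lemma KT_induct [consumes 1, case_names zero J I add uminus]:
 assumes "x \<in> KT \<mu> ep" and zero: "R 0" and J: "!!s r. s \<in> Jg ==> R (s * r)"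
  and I: "!!s r. s \<in> Ig \<mu> ep ==> R (r * s)"
  and add: "!!x y. R x ==> R y ==> R (x + y)" and uminus: "!!x. R x ==> R (- x)"
 shows "R x"
proof -
 obtain k l where x: "x = k + l" "k \<in> JT" "l \<in> IT \<mu> ep"
  using assms(1) unfolding KT_def by blast
 have "R k" using x(2) unfolding JT_def by induction (use zero J add uminus in auto)
 moreover have "R l" using x(3) unfolding IT_def by induction (use zero I add uminus in auto)
 ultimately show ?thesis using x(1) add by simp
qed

end


lemma Uh_wtd:
 assumes "t \<in> Uh" "wtd w y"
 shows "\<exists>t'\<in>Uh. t * y = y * t'"
proof -
 obtain x where x: "x \<in> Uh_expr m0" "cls x = t" using assms(1) by (auto simp: Uh_eq)
 have "cls (sh (%a. - w a) (sh w x)) = (cls x :: B0)"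
  by (rule Uh_val_cong) (use x in "simp_all add: sh_Uh_expr Uh_val_sh[where m = m0]")
 hence "y * cls (sh w x) = t * y"
  using sh_mult[OF sh_Uh_expr[OF x(1)] assms(2), of w] x(2) by simp
 moreover have "cls (sh w x) \<in> Uh" using x(1) by (auto simp: Uh_eq sh_Uh_expr)
 ultimately show ?thesis by metis
qed

lemma wtd_e: "a \<in> M0 ==> b \<in> M0 ==> wtd (gwt (GE a b)) (ec a b)"
 using wtd_gener[of "GE a b"] by (simp add: ec_def A_gens_def gl_gens_def)

lemma Uh_JT: "x \<in> B.JT ==> t \<in> Uh ==> t * x \<in> B.JT"
 unfolding B.JT_def
proof (erule asp_image)
 fix x assume t: "t \<in> Uh" and "x \<in> {s * r |s r. s \<in> B.Jg}"
 then obtain a b r where x: "x = ec b a * r" "a \<in> M0" "b \<in> M0" "a < b"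
  by (auto simp: B.Jg_def)
 obtain t' where "t * ec b a = ec b a * t'" using Uh_wtd[OF t wtd_e] x by blast
 hence "t * x = ec b a * (t' * r)" unfolding x(1) by (metis mult.assoc)
 thus "t * x \<in> asp {s * r |s r. s \<in> B.Jg}"
  using B.e_JT[OF x(2-4)] by (simp add: B.JT_def)
qed (simp add: distrib_left)

lemma Uh_KT: "x \<in> B.KT \<mu> ep ==> t \<in> Uh ==> t * x \<in> B.KT \<mu> ep"
 unfolding B.KT_def
proof (elim CollectE exE conjE)
 fix k l assume "t \<in> Uh" "x = k + l" "k \<in> B.JT" "l \<in> B.IT \<mu> ep"
 thus "t * x \<in> {k + l |k l. k \<in> B.JT \<and> l \<in> B.IT \<mu> ep}"
  by (intro CollectI exI[of _ "t * k"] exI[of _ "t * l"]) (simp add: Uh_JT B.IT_lmult distrib_left)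
qed

lemma csc_JT: "x \<in> B.JT ==> csc z * x \<in> B.JT"
 by (rule Uh_JT[OF _ Uh_csc])


section \<open>Zhelobenko operators on the localized algebra\<close>

locale simple_root =
 fixes c :: nat
 assumes c: "c \<in> {1..<m0}"
begin

abbreviation F :: B0 where "F \<equiv> ec (Suc c) c"
abbreviation E :: B0 where "E \<equiv> ec c (Suc c)"
abbreviation H :: "nat => B0" where "H s \<equiv> den c (Suc c) (- int s)"

definition \<eta> :: "nat => int" where
 "\<eta> a = (if a = c then 1 else if a = Suc c then - 1 else 0)"

text \<open>The coefficient (s! H (H - 1) ... (H - s + 1))^{-1}, with one factor inverted at each
  step.\<close>

primrec hc :: "nat => B0" where
 "hc 0 = 1"
| "hc (Suc s) = csc (1 / of_nat (Suc s)) * hc s * iv c (Suc c) (- int s)"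

abbreviation ad :: "nat => B0 => B0" where
 "ad s y \<equiv> (cm F ^^ s) y"

text \<open>A representative of \<xi>(y) before reduction modulo J; the term s = 0 is y itself. On
  \<open>B.AA\<close> the index set is finite by local nilpotency, elsewhere the value is
  meaningless.\<close>

definition xiT :: "B0 => B0" where
 "xiT y = (\<Sum>s | ad s y \<noteq> 0. hc s * E ^ s * ad s y)"

lemma c_range: "c \<in> M0" "Suc c \<in> M0"
 using c by auto

lemma hc_Uh: "hc s \<in> Uh"
 by (induction s) (use c_range Uh_csc[of 1] in "auto intro!: Uh_mult Uh_csc iv_Uh")

lemma hc_H: "csc (of_nat (Suc s)) * hc (Suc s) * H s = hc s"
proof -
 have "csc (of_nat (Suc s)) * hc (Suc s) * H s =
   csc (of_nat (Suc s)) * csc (1 / of_nat (Suc s)) * hc s * (iv c (Suc c) (- int s) * H s)"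
  by (simp add: mult.assoc)
 also have "\<dots> = hc s"
  using c_range by (simp add: den_iv del: of_nat_Suc flip: csc_mult)
 finally show ?thesis .
qed

lemma ad_eventually:
 assumes "ad N y = 0" "N \<le> M"
 shows "ad M y = 0"
proof -
 obtain d where "M = d + N" using assms(2) by (metis add.commute le_Suc_ex)
 thus ?thesis using assms(1) by (simp add: funpow_add)
qed

lemma xiT_eq:
 assumes "ad N y = 0" "N \<le> M"
 shows "xiT y = (\<Sum>s<M. hc s * E ^ s * ad s y)"
 unfolding xiT_def
proof (rule sum.mono_neutral_left)
 show "{s. ad s y \<noteq> 0} \<subseteq> {..<M}"
 proof
  fix s assume "s \<in> {s. ad s y \<noteq> 0}"
  hence "\<not> N \<le> s" using ad_eventually[OF assms(1)] by blast
  thus "s \<in> {..<M}" using assms(2) by simp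
 qed
qed auto

lemma nilp: "y \<in> B.AA ==> \<exists>N. ad N y = 0"
 using B.AA_nilpotent[OF _ c] by blast

lemma xiT_add:
 assumes "x \<in> B.AA" "y \<in> B.AA"
 shows "xiT (x + y) = xiT x + xiT y"
proof -
 obtain N M where "ad N x = 0" "ad M y = 0" using nilp assms by blast
 hence *: "ad (max N M) x = 0" "ad (max N M) y = 0" "ad (max N M) (x + y) = 0"
  using ad_eventually[of N x "max N M"] ad_eventually[of M y "max N M"] by (simp_all add: cm_pow_add)
 show ?thesis
  by (simp add: *[THEN xiT_eq[OF _ order_refl]] cm_pow_add distrib_left sum.distrib)
qed

lemma xiT_csc:
 assumes "x \<in> B.AA"
 shows "xiT (csc z * x) = csc z * xiT x"
proof -
 obtain N where "ad N x = 0" using nilp assms by blast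
 hence *: "ad N x = 0" "ad N (csc z * x) = 0"
  by (auto simp: cm_pow_csc_mult)
 have "hc s * E ^ s * (csc z * ad s x) = csc z * (hc s * E ^ s * ad s x)" for s
  by (rule csc_left_comm)
 thus ?thesis
  by (simp add: *[THEN xiT_eq[OF _ order_refl]] cm_pow_csc_mult sum_distrib_left)
qed

lemma xiT_0 [simp]: "xiT 0 = 0"
 by (simp add: xiT_def)

lemma E_den: "E * den c (Suc c) z = den c (Suc c) (z - 2) * E"
proof -
 have "wtd (gwt (GE c (Suc c))) E" using c_range by (rule wtd_e)
 from wtd_den[OF this c_range, of z] show ?thesis by simp
qed

text \<open>The standard sl_2 identity. Its factor (s + 1)(H - s) is the one by which consecutive
  coefficients \<open>hc\<close> differ, see \<open>hc_H\<close>.\<close>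

lemma Epow_F: "E ^ Suc s * F = F * E ^ Suc s + csc (of_nat (Suc s)) * H s * E ^ s"
proof (induction s)
 case 0
 have "E * F = F * E + (ec c c - ec (Suc c) (Suc c))"
  using c_range by (subst cm_swap_mult) (simp add: B.gl)
 thus ?case by (simp add: den_def)
next
 case (Suc s)
 have EF: "E * F = F * E + H 0"
  using c_range by (subst cm_swap_mult) (simp add: B.gl den_def)
 have "E ^ Suc (Suc s) * F = E * (E ^ Suc s * F)"
  by (simp add: mult.assoc)
 also have "\<dots> = (F * E + H 0) * E ^ Suc s + csc (of_nat (Suc s)) * (E * H s) * E ^ s"
  unfolding Suc EF[symmetric] by (simp add: distrib_left mult.assoc csc_left_comm[of E])
 also have "\<dots> = F * E ^ Suc (Suc s) + (H 0 + csc (of_nat (Suc s)) * den c (Suc c) (- int s - 2)) * E ^ Suc s"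
  unfolding E_den by (simp add: distrib_right mult.assoc)
 also have "H 0 + csc (of_nat (Suc s)) * den c (Suc c) (- int s - 2) = csc (of_nat (Suc (Suc s))) * H (Suc s)"
 proof -
  let ?h = "ec c c - ec (Suc c) (Suc c) :: B0" and ?k = "csc (of_nat (Suc s)) :: B0"
  have k: "csc (of_nat (Suc (Suc s))) = 1 + ?k"
   by (simp only: of_nat_Suc[of "Suc s"] csc_add csc_1)
  have "?k * csc (- of_nat s - 2) = csc (of_nat (Suc (Suc s))) * (csc (- 1 - of_nat s) :: B0)"
   unfolding csc_mult[symmetric] by (simp add: algebra_simps)
  hence *: "?k * csc (- of_nat s - 2) = (1 + ?k) * csc (- 1 - of_nat s)"
   unfolding k .
  have "H 0 + ?k * den c (Suc c) (- int s - 2) = (1 + ?k) * ?h + ?k * csc (- of_nat s - 2)"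
   by (simp add: den_def distrib_left distrib_right del: of_nat_Suc)
  also have "\<dots> = (1 + ?k) * H (Suc s)"
   unfolding * by (simp add: den_def distrib_left del: of_nat_Suc) (simp add: algebra_simps)
  finally show ?thesis unfolding k .
 qed
 finally show ?case .
qed

text \<open>Modulo the right ideal \<open>F\<close> lowers the index by one, which makes the series telescope.\<close>

lemma absorb_F: "hc (Suc s) * E ^ Suc s * F * y - hc s * E ^ s * y \<in> B.JT"
proof -
 have "hc (Suc s) * E ^ Suc s * F * y = hc (Suc s) * (F * (E ^ Suc s * y)) + csc (of_nat (Suc s)) * hc (Suc s) * H s * E ^ s * y"
  using Epow_F[of s] by (simp add: distrib_left distrib_right mult.assoc csc_left_comm[of "hc (Suc s)"] del: power_Suc hc.simps of_nat_Suc)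
 hence "hc (Suc s) * E ^ Suc s * F * y - hc s * E ^ s * y = hc (Suc s) * (F * (E ^ Suc s * y))"
  unfolding hc_H by simp
 thus ?thesis
  using c_range by (simp add: Uh_JT hc_Uh B.e_JT del: power_Suc hc.simps)
qed

text \<open>The bracket equals \<open>ad s y * F\<close>, so this is the vanishing of the series on
  y F modulo J, written so that F stands on the left.\<close>

lemma telescope:
 assumes "ad N y = 0"
 shows "(\<Sum>s<Suc N. hc s * E ^ s * (F * ad s y - ad (Suc s) y)) \<in> B.JT"
proof -
 have "(\<Sum>s<Suc N. hc s * E ^ s * (F * ad s y - ad (Suc s) y)) =
   (\<Sum>s<Suc N. hc s * E ^ s * F * ad s y) - (\<Sum>s<Suc N. hc s * E ^ s * ad (Suc s) y)"
  by (simp only: right_diff_distrib sum_subtractf mult.assoc)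
 also have "(\<Sum>s<Suc N. hc s * E ^ s * F * ad s y) = F * y + (\<Sum>s<N. hc (Suc s) * E ^ Suc s * F * ad (Suc s) y)"
  by (simp add: sum.lessThan_Suc_shift del: power_Suc hc.simps(2) funpow.simps(2) sum.lessThan_Suc)
 also have "(\<Sum>s<Suc N. hc s * E ^ s * ad (Suc s) y) = (\<Sum>s<N. hc s * E ^ s * ad (Suc s) y)"
  using assms by simp
 finally have "(\<Sum>s<Suc N. hc s * E ^ s * (F * ad s y - ad (Suc s) y)) =
   F * y + (\<Sum>s<N. hc (Suc s) * E ^ Suc s * F * ad (Suc s) y - hc s * E ^ s * ad (Suc s) y)"
  by (simp add: sum_subtractf)
 moreover have "F * y \<in> B.JT" using c_range by (intro B.e_JT) auto
 ultimately show ?thesis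
  using absorb_F by (simp add: B.JT_add B.JT_sum del: power_Suc hc.simps funpow.simps)
qed

lemma ad_ec:
 assumes "a \<in> M0"
 shows "ad s (ec a a * y) = ec a a * ad s y + csc (of_int (\<eta> a) * of_nat s) * F * ad (s - 1) y"
proof (induction s)
 case (Suc s)
 have F: "cm F (ec a a) = csc (of_int (\<eta> a)) * F"
  using assms c_range by (auto simp: B.gl \<eta>_def csc_uminus)
 have "ad (Suc s) (ec a a * y) = cm F (ec a a * ad s y) + csc (of_int (\<eta> a) * of_nat s) * F * cm F (ad (s - 1) y)"
  using Suc by (simp add: cm_add cm_mult mult.assoc)
 also have "csc (of_int (\<eta> a) * of_nat s) * F * cm F (ad (s - 1) y) = csc (of_int (\<eta> a) * of_nat s) * F * ad s y"
  by (cases s) simp_all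
 finally show ?case by (simp add: cm_mult F csc_add distrib_right distrib_left mult.assoc)
qed simp

lemma Epow_ec:
 assumes "a \<in> M0"
 shows "E ^ s * ec a a = (ec a a - csc (of_nat s * of_int (\<eta> a))) * E ^ s"
proof (induction s)
 case (Suc s)
 have "wtd (gwt (GE c (Suc c))) E" using c_range by (rule wtd_e)
 moreover have "gwt (GE c (Suc c)) a = \<eta> a" by (auto simp: \<eta>_def)
 ultimately have E: "E * ec a a = (ec a a - csc (of_int (\<eta> a))) * E"
  using wtd_ec assms by metis
 have "E ^ Suc s * ec a a = E * (ec a a - csc (of_nat s * of_int (\<eta> a))) * E ^ s"
  using Suc by (simp add: mult.assoc)
 also have "\<dots> = (ec a a - csc (of_int (\<eta> a)) - csc (of_nat s * of_int (\<eta> a))) * E ^ Suc s"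
  by (simp add: right_diff_distrib E left_diff_distrib mult.assoc csc_left_comm[of E] flip: csc_comm[of _ E])
 finally show ?case by (simp add: csc_add distrib_right algebra_simps)
qed simp

text \<open>The origin of the shift by \<eta>. Moving E^s past E_aa contributes -s \<eta>(a), and
  the commutators of F with E_aa contribute (s + 1) \<eta>(a) after \<open>absorb_F\<close>; the sum
  is \<eta>(a) in every term.\<close>

lemma xiT_ec:
 assumes "y \<in> B.AA" "a \<in> M0"
 shows "xiT (ec a a * y) - (ec a a + csc (of_int (\<eta> a))) * xiT y \<in> B.JT"
proof -
 obtain N where N: "ad N y = 0" using nilp assms by blast
 have N': "ad (Suc N) (ec a a * y) = 0" using N by (simp only: ad_ec[OF assms(2)]) simp
 define k where "k = (of_int (\<eta> a) :: complex)"
 have "xiT (ec a a * y) = (\<Sum>s<Suc N. hc s * E ^ s * ad s (ec a a * y))"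
  by (rule xiT_eq[OF N' order_refl])
 also have "\<dots> = (\<Sum>s<Suc N. hc s * E ^ s * ec a a * ad s y) +
   (\<Sum>s<Suc N. csc (k * of_nat s) * (hc s * E ^ s * F * ad (s - 1) y))"
  by (simp only: ad_ec[OF assms(2)] distrib_left sum.distrib mult.assoc k_def csc_left_comm[of "E ^ _"] csc_left_comm[of "hc _"])
 also have "(\<Sum>s<Suc N. hc s * E ^ s * ec a a * ad s y) = (\<Sum>s<N. hc s * E ^ s * ec a a * ad s y)"
  using N by simp
 also have "(\<Sum>s<N. hc s * E ^ s * ec a a * ad s y) = (\<Sum>s<N. (ec a a - csc (of_nat s * k)) * (hc s * E ^ s * ad s y))"
 proof (intro sum.cong refl)
  fix s
  have "hc s * E ^ s * ec a a * ad s y = hc s * (ec a a - csc (of_nat s * k)) * E ^ s * ad s y"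
   using Epow_ec[OF assms(2), of s] by (simp add: mult.assoc k_def)
  also have "hc s * (ec a a - csc (of_nat s * k)) = (ec a a - csc (of_nat s * k)) * hc s"
   using Uh_comm[OF hc_Uh ec_Uh[OF assms(2)], of s] by (simp add: right_diff_distrib left_diff_distrib csc_comm)
  finally show "hc s * E ^ s * ec a a * ad s y = (ec a a - csc (of_nat s * k)) * (hc s * E ^ s * ad s y)"
   by (simp add: mult.assoc)
 qed
 also have "(\<Sum>s<Suc N. csc (k * of_nat s) * (hc s * E ^ s * F * ad (s - 1) y)) =
   (\<Sum>s<N. csc (k * of_nat (Suc s)) * (hc (Suc s) * E ^ Suc s * F * ad s y))"
  by (subst sum.lessThan_Suc_shift) simp
 finally have 1: "xiT (ec a a * y) = (\<Sum>s<N. (ec a a - csc (of_nat s * k)) * (hc s * E ^ s * ad s y)) +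
   (\<Sum>s<N. csc (k * of_nat (Suc s)) * (hc (Suc s) * E ^ Suc s * F * ad s y))" .
 have 2: "(ec a a + csc k) * xiT y = (\<Sum>s<N. (ec a a + csc k) * (hc s * E ^ s * ad s y))"
  unfolding xiT_eq[OF N order_refl] by (rule sum_distrib_left)
 have "xiT (ec a a * y) - (ec a a + csc k) * xiT y =
   (\<Sum>s<N. csc (k * of_nat (Suc s)) * (hc (Suc s) * E ^ Suc s * F * ad s y - hc s * E ^ s * ad s y))"
  unfolding 1 2 sum.distrib[symmetric] sum_subtractf[symmetric]
  by (intro sum.cong refl) (simp add: algebra_simps csc_add csc_mult del: power_Suc hc.simps)
 thus ?thesis
  using absorb_F csc_JT by (simp add: k_def B.JT_sum del: power_Suc hc.simps)
qed

end

context simple_root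
begin

lemma ad_E:
 "ad s (E * y) = E * ad s y - csc (of_nat s) * H 0 * ad (s - 1) y
  - csc (of_nat s * (of_nat s - 1)) * F * ad (s - 2) y"
proof (induction s)
 case (Suc s)
 have FE: "cm F E = - den c (Suc c) 0" and Fh: "cm F (den c (Suc c) 0) = csc 2 * F"
  using c_range csc_add[of 1 1, where 'a = B0]
  by (simp_all add: B.gl den_def cm_diff cm_add distrib_right)
 have 1: "csc (of_nat s) * H 0 * cm F (ad (s - 1) y) = csc (of_nat s) * H 0 * ad s y"
  by (cases s) simp_all
 have 2: "csc (of_nat s * (of_nat s - 1)) * F * cm F (ad (s - 2) y) = csc (of_nat s * (of_nat s - 1)) * F * ad (s - 1) y"
  by (cases s rule: nat.exhaust; cases "s - 1") (auto simp: numeral_2_eq_2)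
 have "ad (Suc s) (E * y) = (- H 0 * ad s y + E * ad (Suc s) y)
   - (csc (of_nat s) * (csc 2 * F * ad (s - 1) y) + csc (of_nat s) * H 0 * cm F (ad (s - 1) y))
   - csc (of_nat s * (of_nat s - 1)) * F * cm F (ad (s - 2) y)"
  using Suc by (simp add: cm_diff cm_mult FE Fh mult.assoc distrib_left)
 also have "\<dots> = E * ad (Suc s) y - csc (of_nat (Suc s)) * H 0 * ad s y
   - csc (of_nat (Suc s) * (of_nat (Suc s) - 1)) * F * ad (s - 1) y"
  unfolding 1 2
 proof -
  have "csc (of_nat (Suc s) * (of_nat (Suc s) - 1)) = csc (of_nat s) * csc 2 + (csc (of_nat s * (of_nat s - 1)) :: B0)"
   unfolding csc_mult[symmetric] csc_add[symmetric] by (simp add: algebra_simps)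
  thus "- H 0 * ad s y + E * ad (Suc s) y -
    (csc (of_nat s) * (csc 2 * F * ad (s - 1) y) + csc (of_nat s) * H 0 * ad s y) -
    csc (of_nat s * (of_nat s - 1)) * F * ad (s - 1) y =
    E * ad (Suc s) y - csc (of_nat (Suc s)) * H 0 * ad s y -
    csc (of_nat (Suc s) * (of_nat (Suc s) - 1)) * F * ad (s - 1) y"
   by (simp add: csc_add algebra_simps del: funpow.simps)
 qed
 also have "s - 1 = Suc s - 2" by simp
 finally show ?case by (simp only: diff_Suc_1)
qed simp

lemma Epow_den: "E ^ s * den c (Suc c) z = den c (Suc c) (z - 2 * int s) * E ^ s"
proof (induction s arbitrary: z)
 case (Suc s)
 have "E ^ Suc s * den c (Suc c) z = E ^ s * (E * den c (Suc c) z)"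
  by (metis mult.assoc power_Suc2)
 also have "\<dots> = (E ^ s * den c (Suc c) (z - 2)) * E"
  by (simp only: E_den mult.assoc)
 also have "\<dots> = den c (Suc c) (z - 2 - 2 * int s) * (E ^ s * E)"
  by (simp only: Suc mult.assoc)
 also have "E ^ s * E = E ^ Suc s"
  by (rule power_Suc2[symmetric])
 also have "z - 2 - 2 * int s = z - 2 * int (Suc s)"
  by simp
 finally show ?case .
qed simp

text \<open>With f and g the two kinds of terms, \<open>absorb_F\<close> gives g = f modulo J. The
  coefficients then cancel because (H - s) - (H - 2 s - 2) = s + 2.\<close>

lemma xiT_E:
 assumes "y \<in> B.AA"
 shows "xiT (E * y) \<in> B.JT"
proof -
 obtain N where N: "ad N y = 0" using nilp assms by blast
 have N': "ad (Suc N) y = 0" "ad (Suc (Suc N)) y = 0" using N by simp_all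
 have NE: "ad (Suc (Suc N)) (E * y) = 0"
  unfolding ad_E using N N' by (simp add: numeral_2_eq_2 del: funpow.simps)
 define f where "f s = hc (Suc s) * E ^ Suc s * ad s y" for s
 define g where "g s = hc (Suc (Suc s)) * E ^ Suc (Suc s) * F * ad s y" for s
 have "xiT (E * y) = (\<Sum>s<Suc (Suc N). hc s * E ^ s * ad s (E * y))"
  by (rule xiT_eq[OF NE order_refl])
 also have "\<dots> = (\<Sum>s<Suc (Suc N). hc s * E ^ s * E * ad s y)
   - (\<Sum>s<Suc (Suc N). csc (of_nat s) * (hc s * E ^ s * H 0 * ad (s - 1) y))
   - (\<Sum>s<Suc (Suc N). csc (of_nat s * (of_nat s - 1)) * (hc s * E ^ s * F * ad (s - 2) y))"
  by (simp only: ad_E right_diff_distrib sum_subtractf mult.assoc csc_left_comm[of "E ^ _"] csc_left_comm[of "hc _"])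
 also have "(\<Sum>s<Suc (Suc N). hc s * E ^ s * E * ad s y) = (\<Sum>s<N. csc (of_nat (Suc s)) * H s * f s)"
 proof -
  have "hc s * E ^ s * E * ad s y = csc (of_nat (Suc s)) * H s * f s" for s
  proof -
   have "hc s * E ^ s * E * ad s y = csc (of_nat (Suc s)) * (hc (Suc s) * H s) * E ^ Suc s * ad s y"
    unfolding hc_H[of s, symmetric] by (simp add: mult.assoc power_commutes del: of_nat_Suc hc.simps)
   also have "hc (Suc s) * H s = H s * hc (Suc s)"
    using Uh_comm[OF hc_Uh den_Uh] c_range by blast
   finally show ?thesis by (simp add: f_def mult.assoc del: of_nat_Suc hc.simps)
  qed
  thus ?thesis using N N' by (simp add: f_def del: of_nat_Suc hc.simps)
 qed
 also have "(\<Sum>s<Suc (Suc N). csc (of_nat s) * (hc s * E ^ s * H 0 * ad (s - 1) y)) =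
   (\<Sum>s<N. csc (of_nat (Suc s)) * den c (Suc c) (- 2 * int (Suc s)) * f s)"
 proof -
  have "csc (of_nat (Suc s)) * (hc (Suc s) * E ^ Suc s * H 0 * ad s y) =
    csc (of_nat (Suc s)) * den c (Suc c) (- 2 * int (Suc s)) * f s" for s
  proof -
   have "hc (Suc s) * E ^ Suc s * H 0 * ad s y = (hc (Suc s) * den c (Suc c) (- 2 * int (Suc s))) * E ^ Suc s * ad s y"
    using Epow_den[of "Suc s" 0] by (simp add: mult.assoc del: power_Suc hc.simps)
   also have "hc (Suc s) * den c (Suc c) (- 2 * int (Suc s)) = den c (Suc c) (- 2 * int (Suc s)) * hc (Suc s)"
    using Uh_comm[OF hc_Uh den_Uh] c_range by blast
   finally show ?thesis by (simp add: f_def mult.assoc del: of_nat_Suc hc.simps power_Suc)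
  qed
  thus ?thesis
   using N by (subst sum.lessThan_Suc_shift) (simp add: f_def del: of_nat_Suc hc.simps power_Suc)
 qed
 also have "(\<Sum>s<Suc (Suc N). csc (of_nat s * (of_nat s - 1)) * (hc s * E ^ s * F * ad (s - 2) y)) =
   (\<Sum>s<N. csc (of_nat (Suc (Suc s)) * of_nat (Suc s)) * g s)"
  by (subst sum.lessThan_Suc_shift, subst sum.lessThan_Suc_shift)
   (simp add: g_def numeral_2_eq_2 del: hc.simps power_Suc)
 finally have "xiT (E * y) = (\<Sum>s<N. csc (of_nat (Suc s)) * H s * f s
   - csc (of_nat (Suc s)) * den c (Suc c) (- 2 * int (Suc s)) * f s
   - csc (of_nat (Suc (Suc s)) * of_nat (Suc s)) * g s)"
  by (simp only: sum_subtractf)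
 also have "\<dots> = (\<Sum>s<N. - (csc (of_nat (Suc (Suc s)) * of_nat (Suc s)) * (g s - f s)))"
 proof (intro sum.cong refl)
  fix s
  have "csc (of_nat (Suc s)) * H s - csc (of_nat (Suc s)) * den c (Suc c) (- 2 * int (Suc s)) =
    (csc (of_nat (Suc (Suc s)) * of_nat (Suc s)) :: B0)"
  proof -
   have "H s - den c (Suc c) (- 2 * int (Suc s)) = (csc (of_nat (Suc (Suc s))) :: B0)"
    by (simp add: den_def add.commute flip: csc_diff)
   thus ?thesis
    by (simp only: right_diff_distrib[symmetric] csc_mult[symmetric] mult.commute)
  qed
  hence "csc (of_nat (Suc s)) * H s * f s - csc (of_nat (Suc s)) * den c (Suc c) (- 2 * int (Suc s)) * f s =
    csc (of_nat (Suc (Suc s)) * of_nat (Suc s)) * f s"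
   by (metis left_diff_distrib)
  thus "csc (of_nat (Suc s)) * H s * f s - csc (of_nat (Suc s)) * den c (Suc c) (- 2 * int (Suc s)) * f s
   - csc (of_nat (Suc (Suc s)) * of_nat (Suc s)) * g s = - (csc (of_nat (Suc (Suc s)) * of_nat (Suc s)) * (g s - f s))"
   by (simp add: right_diff_distrib)
 qed
 finally show ?thesis
  using absorb_F[of "Suc _" "ad _ y"]
  by (auto simp: f_def g_def intro!: B.JT_sum B.JT_uminus csc_JT)
qed

text \<open>The root vectors of n other than F; they span the nilradical of a minimal parabolic
  subalgebra, normalised by both E and F.\<close>

definition Xg :: "B0 set" where
 "Xg = {ec b a |a b. a \<in> M0 \<and> b \<in> M0 \<and> a < b \<and> (a, b) \<noteq> (c, Suc c)}"

text \<open>The right ideal R generated by \<open>Xg\<close> is stable under ad F and under left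
  multiplication by E, and it lies in J. Hence every term of the series stays in J.\<close>

lemma xiT_X:
 assumes "x \<in> Xg" "y \<in> B.AA"
 shows "xiT (x * y) \<in> B.JT"
proof -
 define R where "R = asp {x * r |x r. x \<in> Xg}"
 have base: "x * r \<in> R" if "x \<in> Xg" for x r
  unfolding R_def using that by (intro asp.base) blast
 have closed: "cm (ec a b) x = 0 \<or> cm (ec a b) x \<in> Xg \<or> - cm (ec a b) x \<in> Xg"
  if x: "x \<in> Xg" and ab: "(a, b) = (c, Suc c) \<or> (a, b) = (Suc c, c)" for x a b
 proof -
  obtain u v where x: "x = ec v u" "u \<in> M0" "v \<in> M0" "u < v" "(u, v) \<noteq> (c, Suc c)"
   using x by (auto simp: Xg_def)
  have *: "ec k l \<in> Xg" if "k \<in> M0" "l \<in> M0" "l < k" "(l, k) \<noteq> (c, Suc c)" for k l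
   using that unfolding Xg_def by blast
  from ab show ?thesis
  proof
   assume "(a, b) = (c, Suc c)"
   thus ?thesis using c_range x *[of c u] *[of v "Suc c"] by (auto simp: B.gl)
  next
   assume "(a, b) = (Suc c, c)"
   thus ?thesis using c_range x *[of "Suc c" u] *[of v c] by (auto simp: B.gl)
  qed
 qed
 have step: "cm (ec a b) x \<in> R" if x: "x \<in> R" and ab: "(a, b) = (c, Suc c) \<or> (a, b) = (Suc c, c)" for x a b
  using x unfolding R_def
 proof (rule asp_image)
  fix x assume "x \<in> {x * r |x r. x \<in> Xg}"
  then obtain x' r where x: "x = x' * r" "x' \<in> Xg" by blast
  have "cm (ec a b) x' * r \<in> R"
  proof -
   consider "cm (ec a b) x' = 0" | "cm (ec a b) x' \<in> Xg" | "- cm (ec a b) x' \<in> Xg"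
    using closed[OF x(2) ab] by blast
   thus ?thesis
   proof cases
    case 1
    thus ?thesis by (simp add: R_def asp.zero)
   next
    case 2
    thus ?thesis by (rule base)
   next
    case 3
    thus ?thesis using base[of "- cm (ec a b) x'" "- r"] by simp
   qed
  qed
  thus "cm (ec a b) x \<in> asp {x * r |x r. x \<in> Xg}"
   unfolding x(1) cm_mult R_def using base[OF x(2), unfolded R_def] by (rule asp.add)
 qed (simp add: cm_add)
 have E: "E * x \<in> R" if "x \<in> R" for x
 proof -
  have "x * E \<in> R"
   using that unfolding R_def
  proof (rule asp_image)
   fix y assume "y \<in> {x * r |x r. x \<in> Xg}"
   then obtain x' r where "y = x' * r" "x' \<in> Xg" by blast
   thus "y * E \<in> asp {x * r |x r. x \<in> Xg}"
    using base[of x' "r * E"] by (simp only: mult.assoc R_def)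
  qed (simp add: distrib_right)
  thus ?thesis
   using step[OF that, of c "Suc c"] asp.add[of "E * x - x * E" _ "x * E"] by (simp add: cm_def R_def)
 qed
 have Epow: "E ^ s * x \<in> R" if "x \<in> R" for s x
  by (induction s) (use that in "auto simp: mult.assoc intro: E")
 have ad: "ad s (x * y) \<in> R" for s
  by (induction s) (use assms base step[where a = "Suc c" and b = c] in auto)
 have "R \<subseteq> B.JT"
 proof
  fix x assume "x \<in> R"
  thus "x \<in> B.JT"
   unfolding B.JT_def R_def
  proof (rule asp_mono)
   show "{x * r |x r. x \<in> Xg} \<subseteq> asp {s * r |s r. s \<in> B.Jg}"
   proof
    fix y assume "y \<in> {x * r |x r. x \<in> Xg}"
    then obtain u v r where "y = ec v u * r" "u \<in> M0" "v \<in> M0" "u < v"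
     unfolding Xg_def by blast
    thus "y \<in> asp {s * r |s r. s \<in> B.Jg}"
     using B.e_JT[of u v r] by (simp only: B.JT_def)
   qed
  qed
 qed
 hence "E ^ s * ad s (x * y) \<in> B.JT" for s
  using Epow[OF ad, of s s] by (rule subsetD)
 hence "hc s * (E ^ s * ad s (x * y)) \<in> B.JT" for s
  by (rule Uh_JT[OF _ hc_Uh])
 thus ?thesis
  unfolding xiT_def by (intro B.JT_sum) (simp add: mult.assoc)
qed

end


section \<open>Moving the denominators of a word to the left\<close>

fun isinv :: "gen => bool" where
 "isinv (GInv a b z) = True"
| "isinv g = False"

fun dshift :: "(nat => int) => nat \<times> nat \<times> int => nat \<times> nat \<times> int" where
 "dshift w (a, b, z) = (a, b, z + w a - w b)"

text \<open>The denominators of a word after all of them have been moved to its left end; a letter g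
  that is passed shifts the integer by the weight of g, as in \<open>wtd_iv\<close>. The remaining
  letters are \<open>nlet\<close>.\<close>

fun nden :: "gen list => (nat \<times> nat \<times> int) list" where
 "nden [] = []"
| "nden (GInv a b z # w) = (a, b, z) # nden w"
| "nden (g # w) = map (dshift (%c. - gwt g c)) (nden w)"

definition nlet :: "gen list => gen list" where
 "nlet w = filter (%g. \<not> isinv g) w"

definition wwt :: "gen list => nat => int" where
 "wwt w c = (\<Sum>g\<leftarrow>w. gwt g c)"

lemma wwt_simps [simp]: "wwt [] c = 0" "wwt (g # w) c = gwt g c + wwt w c" "wwt (u @ v) c = wwt u c + wwt v c"
 by (simp_all add: wwt_def)

lemma nlet_simps [simp]: "nlet [] = []" "nlet (u @ v) = nlet u @ nlet v"
 "nlet (g # w) = (if isinv g then nlet w else g # nlet w)"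
 by (simp_all add: nlet_def)

lemma dshift_0: "dshift (%c. 0) x = x"
 by (cases x) simp

lemma nden_Cons: "\<not> isinv g ==> nden (g # w) = map (dshift (%c. - gwt g c)) (nden w)"
 by (cases g) auto

lemma nden_append: "nden (u @ v) = nden u @ map (dshift (%c. - wwt u c)) (nden v)"
proof (induction u)
 case Nil
 have "dshift (%c. - wwt [] c) = id" by (auto simp: dshift_0 fun_eq_iff simp del: dshift.simps)
 thus ?case by simp
next
 case (Cons g u)
 show ?case
 proof (cases "isinv g")
  case True
  then obtain a b z where "g = GInv a b z" by (cases g) auto
  thus ?thesis using Cons by simp
 next
  case False
  have "dshift (%c. - gwt g c) \<circ> dshift (%c. - wwt u c) = dshift (%c. - wwt (g # u) c)"
   by (auto simp: fun_eq_iff)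
  thus ?thesis using Cons False by (simp add: nden_Cons)
 qed
qed

lemma nden_noninv: "\<forall>g\<in>set w. \<not> isinv g ==> nden w = []"
 by (induction w) (simp_all add: nden_Cons)

lemma nlet_noninv: "\<forall>g\<in>set w. \<not> isinv g ==> nlet w = w"
 by (induction w) simp_all

text \<open>\<open>hmg \<kappa>\<close>: homogeneous elements of weight \<open>\<kappa>\<close> without denominators.\<close>

definition hmg :: "(nat => int) => gen falg set" where
 "hmg \<kappa> = {x. \<forall>w\<in>Poly_Mapping.keys x. (\<forall>g\<in>set w. \<not> isinv g) \<and> wwt w = \<kappa>}"

lemma hmg_0: "0 \<in> hmg \<kappa>"
 by (simp add: hmg_def)

lemma hmg_gener: "\<not> isinv g ==> gener g \<in> hmg (gwt g)"
 by (auto simp: hmg_def gener_def)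

lemma hmg_csc: "csc z \<in> hmg (%_. 0)"
 by (auto simp: hmg_def csc_poly_mapping_def zero_list_def)

lemma hmg_scal: "scal z \<in> hmg (%_. 0)"
 by (simp add: scal_eq_csc hmg_csc)

lemma hmg_1: "1 \<in> hmg (%_. 0)"
 using hmg_csc[of 1] by simp

lemma hmg_add: "x \<in> hmg \<kappa> ==> y \<in> hmg \<kappa> ==> x + y \<in> hmg \<kappa>"
 using Poly_Mapping.keys_add[of x y] by (auto simp: hmg_def)

lemma hmg_uminus: "x \<in> hmg \<kappa> ==> - x \<in> hmg \<kappa>"
 by (simp add: hmg_def)

lemma hmg_diff: "x \<in> hmg \<kappa> ==> y \<in> hmg \<kappa> ==> x - y \<in> hmg \<kappa>"
 using hmg_add[of x \<kappa> "- y"] by (simp add: hmg_uminus)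

lemma hmg_sum: "(!!a. a \<in> S ==> h a \<in> hmg \<kappa>) ==> sum h S \<in> hmg \<kappa>"
 by (induction S rule: infinite_finite_induct) (simp_all add: hmg_0 hmg_add)

lemma hmg_mult: "x \<in> hmg \<kappa> ==> y \<in> hmg \<kappa>' ==> (!!c. \<kappa> c + \<kappa>' c = \<pi> c) ==> x * y \<in> hmg \<pi>"
 using keys_mult[of x y] by (fastforce simp: hmg_def plus_list_def fun_eq_iff)

lemma hmg_comm: "x \<in> hmg \<kappa> ==> y \<in> hmg \<kappa>' ==> (!!c. \<kappa> c + \<kappa>' c = \<pi> c) ==> comm x y \<in> hmg \<pi>"
 unfolding comm_def by (intro hmg_diff hmg_mult) (auto simp: add.commute)

lemma hmg_gener_wt: "\<not> isinv g ==> (!!c. gwt g c = \<kappa> c) ==> gener g \<in> hmg \<kappa>"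
 using hmg_gener[of g] ext[of "gwt g" \<kappa>] by simp

lemma hmg_pp: "pp p0 a i \<in> hmg (%c. if c = a then - 1 else 0)"
 unfolding pp_def by (cases "a \<le> p0") (simp_all add: hmg_uminus hmg_gener_wt)

lemma hmg_qq: "qq p0 a i \<in> hmg (%c. if c = a then 1 else 0)"
 unfolding qq_def by (cases "a \<le> p0") (simp_all add: hmg_gener_wt)

lemma hmg_eE: "eE a b \<in> hmg (gwt (GE a b))"
 by (rule hmg_gener) simp

lemma hmg_zeta: "zeta p0 n0 a b \<in> hmg (gwt (GE a b))"
proof -
 have "scal z \<in> hmg (gwt (GE a a))" for z a
 proof -
  have "gwt (GE a a) = (%_. 0)" by (simp add: fun_eq_iff)
  thus ?thesis using hmg_scal[of z] by simp
 qed
 hence "(if a = b then scal (of_nat n0 / 2) else 0) \<in> hmg (gwt (GE a b))"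
  by (auto simp: hmg_0)
 moreover have "qq p0 a k * pp p0 b k \<in> hmg (gwt (GE a b))" for k
  by (rule hmg_mult[OF hmg_qq hmg_pp]) simp
 ultimately show ?thesis
  unfolding zeta_def Ehat_def by (intro hmg_add hmg_sum)
qed

text \<open>All words of one relation of A have the same weight and no denominators. Inside a longer
  word they therefore shift the denominators to their right by the same amount.\<close>

lemma A_rels_hmg: "r \<in> A_rels0 ==> \<exists>\<kappa>. r \<in> hmg \<kappa>"
proof -
 assume "r \<in> A_rels0"
 then consider "r \<in> gl_rels m0" | "r \<in> weyl_rels m0 n0" | "r \<in> cross_rels p0 q0 n0"
  by (auto simp: A_rels_def)
 thus ?thesis
 proof cases
  case 1
  then obtain a b c d where r: "r = comm (eE a b) (eE c d) - ((if b = c then eE a d else 0) - (if d = a then eE c b else 0))"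
   by (auto simp: gl_rels_def)
  let ?k = "%x. gwt (GE a b) x + gwt (GE c d) x"
  have "b = c ==> gwt (GE a d) = ?k" "d = a ==> gwt (GE c b) = ?k"
   by (auto simp: fun_eq_iff)
  hence "r \<in> hmg ?k"
   unfolding r using hmg_eE[of a d] hmg_eE[of c b]
   by (intro hmg_diff hmg_comm[OF hmg_eE hmg_eE]) (auto simp: hmg_0)
  thus ?thesis by blast
 next
  case 2
  thus ?thesis
   unfolding weyl_rels_def
  proof (elim UnE CollectE exE conjE)
   fix a b i j assume "r = comm (eD a i) (eX b j) - (if a = b \<and> i = j then 1 else 0)"
   moreover have "1 \<in> hmg (%x. gwt (GD a i) x + gwt (GX a j) x)"
   proof -
    have "(%x. gwt (GD a i) x + gwt (GX a j) x) = (%_. 0)" by (simp add: fun_eq_iff)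
    thus ?thesis using hmg_1 by (simp only:)
   qed
   ultimately have "r \<in> hmg (%x. gwt (GD a i) x + gwt (GX b j) x)"
    by (auto simp: hmg_0 simp del: gwt.simps intro!: hmg_diff hmg_comm[OF hmg_gener hmg_gener])
   thus ?thesis by blast
  next
   fix a b i j assume "r = comm (eX a i) (eX b j)"
   moreover have "comm (eX a i) (eX b j) \<in> hmg (%x. gwt (GX a i) x + gwt (GX b j) x)"
    by (rule hmg_comm[OF hmg_gener hmg_gener]) auto
   ultimately show ?thesis by blast
  next
   fix a b i j assume "r = comm (eD a i) (eD b j)"
   moreover have "comm (eD a i) (eD b j) \<in> hmg (%x. gwt (GD a i) x + gwt (GD b j) x)"
    by (rule hmg_comm[OF hmg_gener hmg_gener]) auto
   ultimately show ?thesis by blast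
  qed
 next
  case 3
  then obtain a b h where r: "r = comm (eE a b) (gener h) - comm (zeta p0 n0 a b) (gener h)" "h \<in> weyl_gens m0 n0"
   by (auto simp: cross_rels_def)
  hence "\<not> isinv h" by (auto simp: weyl_gens_def)
  hence "r \<in> hmg (%x. gwt (GE a b) x + gwt h x)"
   unfolding r(1) by (intro hmg_diff hmg_comm[OF hmg_eE hmg_gener] hmg_comm[OF hmg_zeta hmg_gener]) auto
  thus ?thesis by blast
 qed
qed

lemma flin_ideal:
 assumes words: "!!u v. flin \<phi> (wrd u * r * wrd v) \<in> J"
  and J: "0 \<in> J" "!!x y. x \<in> J ==> y \<in> J ==> x + y \<in> J" "!!z x. x \<in> J ==> csc z * x \<in> J"
 shows "flin \<phi> (u * r * v) \<in> J"
proof (induction u rule: falg_induct)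
 case (single w c)
 show ?case
 proof (induction v rule: falg_induct)
  case (single w' c')
  have "Poly_Mapping.single w c * r * Poly_Mapping.single w' c' = csc c * (csc c' * (wrd w * r * wrd w'))"
   unfolding single_eq_wrd[of w c] single_eq_wrd[of w' c']
   by (simp only: mult.assoc csc_left_comm[of r] csc_left_comm[of "wrd w"])
  thus ?case using words J(3) by (simp add: flin_scale)
 qed (simp_all add: distrib_left flin_add J)
qed (simp_all add: distrib_right flin_add J)

lemma A_gens_noninv: "g \<in> A_gens p q n ==> \<not> isinv g"
 by (auto simp: A_gens_def gl_gens_def weyl_gens_def)

lemma noninv_AA:
 assumes "\<forall>g\<in>set w. \<not> isinv g"
 shows "(cls (wrd w) :: B0) \<in> B.AA"
 using assms
proof (induction w)
 case Nil
 thus ?case by (simp add: B.AA_def)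
next
 case (Cons g w)
 have "(cls (gener g) :: B0) \<in> B.AA"
 proof (cases "g \<in> A_gens0")
  case True
  thus ?thesis unfolding AA_cls by (auto intro!: imageI alg_gener)
 next
  case False
  hence "g \<notin> pgens TYPE(tB)"
   using Cons.prems by (auto simp: pgens_tB_def Abar_gens_def inv_gens_def)
  thus ?thesis using cls_outside[where 'k = tB] by (simp add: B.AA_def)
 qed
 thus ?case using Cons by (simp add: wrd_Cons cls_mult B.AA_def salg.mult)
qed

lemma nlet_AA: "(cls (wrd (nlet w)) :: B0) \<in> B.AA"
 by (rule noninv_AA) (simp add: nlet_def)

lemma wtd_0: "wtd w 0"
 by (simp add: wtd_def)

lemma wtd_nlet: "wtd (wwt w) (cls (wrd (nlet w)))"
proof (induction w)
 case Nil
 thus ?case by (simp add: wtd_def)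
next
 case (Cons g w)
 show ?case
 proof (cases "isinv g")
  case True
  hence "wwt (g # w) = wwt w" by (cases g) (auto simp: fun_eq_iff)
  thus ?thesis using Cons True by simp
 next
  case False
  have "wtd (gwt g) (cls (gener g))"
  proof (cases "g \<in> A_gens0")
   case True
   thus ?thesis by (rule wtd_gener)
  next
   case outside: False
   hence "g \<notin> pgens TYPE(tB)"
    using False by (auto simp: pgens_tB_def Abar_gens_def inv_gens_def)
   thus ?thesis using cls_outside[where 'k = tB] wtd_0 by metis
  qed
  from wtd_mult[OF this Cons] False show ?thesis
   by (simp add: wrd_Cons cls_mult wwt_def)
 qed
qed

definition ivs :: "(nat \<times> nat \<times> int) list => B0" where
 "ivs l = prod_list (map (%(a, b, z). iv a b z) l)"

lemma ivs_simps [simp]: "ivs [] = 1" "ivs (d # l) = (case d of (a, b, z) => iv a b z) * ivs l"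
 "ivs (l @ l') = ivs l * ivs l'"
 by (simp_all add: ivs_def)

lemma iv_Uh': "iv a b z \<in> Uh"
proof (cases "a \<in> M0 \<and> b \<in> M0 \<and> a \<noteq> b")
 case False
 hence "GInv a b z \<notin> pgens TYPE(tB)"
  by (auto simp: pgens_tB_def Abar_gens_def inv_gens_def A_gens_def gl_gens_def weyl_gens_def)
 thus ?thesis using cls_outside[where 'k = tB] Uh_csc[of 0] by (simp add: iv_def)
qed (simp add: iv_Uh)

lemma ivs_Uh: "ivs l \<in> Uh"
 by (induction l) (use Uh_csc[of 1] in "auto intro: Uh_mult iv_Uh'")


context simple_root
begin

text \<open>The value of \<xi> on a word: the collected denominators are translated by \<eta>, and
  the series is applied to the remaining element of A.\<close>

definition Phi :: "gen list => B0" where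
 "Phi w = ivs (map (dshift \<eta>) (nden w)) * xiT (cls (wrd (nlet w)))"

lemma flin_xiT:
 assumes "\<forall>w\<in>Poly_Mapping.keys x. \<forall>g\<in>set w. \<not> isinv g"
 shows "flin (%w. xiT (cls (wrd (nlet u @ w @ nlet v)))) x = xiT (cls (wrd (nlet u) * x * wrd (nlet v)))
  \<and> (cls (wrd (nlet u) * x * wrd (nlet v)) :: B0) \<in> B.AA"
proof (induction x rule: falg_induct)
 case zero
 show ?case by (simp add: B.AA_def)
next
 case (single w c)
 have AA: "(cls (wrd (nlet u @ w @ nlet v)) :: B0) \<in> B.AA"
  by (rule noninv_AA) (use single assms in "auto simp: nlet_def")
 have "cls (wrd (nlet u) * Poly_Mapping.single w c * wrd (nlet v)) = csc c * (cls (wrd (nlet u @ w @ nlet v)) :: B0)"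
  unfolding single_eq_wrd[of w c] wrd_append cls_mult cls_csc
  by (simp only: mult.assoc csc_left_comm[of "cls (wrd (nlet u))"])
 moreover have "csc c * (cls (wrd (nlet u @ w @ nlet v)) :: B0) \<in> B.AA"
  using AA unfolding B.AA_def by (intro salg.mult salg.csc)
 ultimately show ?case using xiT_csc[OF AA] by simp
next
 case (add f g)
 thus ?case
  by (simp add: flin_add distrib_left distrib_right cls_add xiT_add) (simp add: B.AA_def salg.add)
qed

lemma xiT_diff:
 assumes "x \<in> B.AA" "y \<in> B.AA"
 shows "xiT (x - y) = xiT x - xiT y"
proof -
 have "csc (- 1) * y \<in> B.AA" using assms(2) unfolding B.AA_def by (intro salg.mult salg.csc)
 from xiT_add[OF assms(1) this] show ?thesis
  unfolding xiT_csc[OF assms(2)] by (simp add: csc_uminus)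
qed

text \<open>The denominators D are common to all words of u r v, and what is left is the series
  applied to the class of an element of the ideal, that is to 0.\<close>

lemma Phi_homogeneous:
 assumes "r \<in> hmg \<kappa>" "cls r = (0 :: B0)"
 shows "flin Phi (wrd u * r * wrd v) = 0"
proof -
 define D where "D = ivs (map (dshift \<eta>) (nden u @ map (dshift (%c. - wwt u c)) (map (dshift (%c. - \<kappa> c)) (nden v))))"
 have "flin Phi (wrd u * r * wrd v) = flin (%w. Phi (u @ w @ v)) r"
  by (rule flin_wrd_mult)
 also have "\<dots> = flin (%w. D * xiT (cls (wrd (nlet u @ w @ nlet v)))) r"
 proof (rule flin_cong)
  fix w assume "w \<in> Poly_Mapping.keys r"
  hence w: "\<forall>g\<in>set w. \<not> isinv g" "wwt w = \<kappa>" using assms(1) by (auto simp: hmg_def)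
  thus "Phi (u @ w @ v) = D * xiT (cls (wrd (nlet u @ w @ nlet v)))"
   by (simp add: Phi_def D_def nden_append nden_noninv nlet_noninv)
 qed
 also have "\<dots> = D * xiT (cls (wrd (nlet u) * r * wrd (nlet v)))"
  using flin_xiT[of r u v] assms(1) by (simp add: flin_lmult hmg_def)
 finally show ?thesis using assms(2) by (simp add: cls_mult)
qed

lemma Phi_outside:
 assumes "g \<notin> Abar_gens0"
 shows "Phi (u @ g # v) = 0"
proof (cases "isinv g")
 case True
 then obtain a b z where g: "g = GInv a b z" by (cases g) auto
 have "iv a b z' = 0" for z'
  unfolding iv_def using assms g
  by (intro cls_outside) (auto simp: pgens_tB_def Abar_gens_def inv_gens_def A_gens_def gl_gens_def weyl_gens_def)
 thus ?thesis by (simp add: Phi_def g nden_append)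
next
 case False
 have "cls (gener g) = (0 :: B0)"
  using assms by (intro cls_outside) (simp add: pgens_tB_def)
 thus ?thesis
  using False by (simp add: Phi_def wrd_append wrd_Cons cls_mult)
qed

lemma xiT_den:
 assumes "y \<in> B.AA" "a \<in> M0" "b \<in> M0"
 shows "xiT (den a b z * y) - den a b (z + \<eta> a - \<eta> b) * xiT y \<in> B.JT"
proof -
 have AA: "ec a a * y \<in> B.AA" "ec b b * y \<in> B.AA" "csc (of_int z) * y \<in> B.AA" "- (ec b b * y) \<in> B.AA"
  using assms B.e_AA unfolding B.AA_def by (auto intro!: salg.mult salg.csc salg_uminus)
 have "den a b z * y = ec a a * y + (csc (- 1) * (ec b b * y) + csc (of_int z) * y)"
  by (simp add: den_def algebra_simps csc_uminus)
 hence "xiT (den a b z * y) = xiT (ec a a * y) + (csc (- 1) * xiT (ec b b * y) + csc (of_int z) * xiT y)"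
  using AA assms(1) by (simp add: xiT_add xiT_csc B.AA_def salg_intros)
 also have "\<dots> - den a b (z + \<eta> a - \<eta> b) * xiT y =
   (xiT (ec a a * y) - (ec a a + csc (of_int (\<eta> a))) * xiT y) - (xiT (ec b b * y) - (ec b b + csc (of_int (\<eta> b))) * xiT y)"
  by (simp add: den_def algebra_simps csc_add csc_diff csc_uminus)
 finally show ?thesis
  using xiT_ec assms by (simp add: B.JT_diff)
qed

text \<open>In contrast to the relations of A, the relations between a denominator and its inverse
  are respected only modulo J: the factor E_aa - E_bb + z stays among the letters while its inverse
  is moved out, and \<open>xiT_den\<close> is needed to reunite them.\<close>

lemma Phi_inv:
 assumes "a \<in> M0" "b \<in> M0" "a \<noteq> b"
 shows "flin Phi (wrd u * ((eE a a - eE b b + of_int z) * eInv a b z - 1) * wrd v) \<in> B.JT"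
  and "flin Phi (wrd u * (eInv a b z * (eE a a - eE b b + of_int z) - 1) * wrd v) \<in> B.JT"
proof -
 \<comment> \<open>The integer of the denominator after it has passed the prefix u.\<close>
 define z' where "z' = z - wwt u a + wwt u b"
 define T where "T = ivs (map (dshift \<eta>) (nden (u @ v)))"
 define X where "X = (cls (wrd (nlet u) * wrd (nlet v)) :: B0)"
 have id: "dshift (%c. 0) = id" by (auto simp: dshift_0 fun_eq_iff simp del: dshift.simps)
 have d1: "ivs (map (dshift \<eta>) (nden (u @ GInv a b z # v))) = T * iv a b (z' + \<eta> a - \<eta> b)"
 proof -
  let ?l = "ivs (map (dshift \<eta>) (nden u))"
  let ?r = "ivs (map (dshift \<eta>) (map (dshift (%c. - wwt u c)) (nden v)))"
  have "ivs (map (dshift \<eta>) (nden (u @ GInv a b z # v))) = ?l * (iv a b (z' + \<eta> a - \<eta> b) * ?r)"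
   by (simp add: nden_append z'_def)
  also have "iv a b (z' + \<eta> a - \<eta> b) * ?r = ?r * iv a b (z' + \<eta> a - \<eta> b)"
   by (rule Uh_comm[OF iv_Uh' ivs_Uh])
  finally show ?thesis by (simp add: T_def nden_append mult.assoc)
 qed
 have AA: "X \<in> B.AA"
  using nlet_AA[of "u @ v"] by (simp add: X_def wrd_append)
 have E: "cls (wrd (nlet u @ GE c c # nlet v)) = (ec c c - csc (of_int (wwt u c))) * X" if "c \<in> M0" for c
  using wtd_ec[OF wtd_nlet[of u] that]
  by (simp add: wrd_append wrd_Cons cls_mult X_def ec_def flip: mult.assoc)
 have nd: "nden (u @ GE c c # GInv a b z # v) = nden (u @ GInv a b z # v)"
  "nden (u @ GInv a b z # GE c c # v) = nden (u @ GInv a b z # v)" for c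
  using id by (simp_all add: nden_append)
 have P: "Phi (u @ GE c c # GInv a b z # v) = T * iv a b (z' + \<eta> a - \<eta> b) * xiT ((ec c c - csc (of_int (wwt u c))) * X)"
  "Phi (u @ GInv a b z # GE c c # v) = T * iv a b (z' + \<eta> a - \<eta> b) * xiT ((ec c c - csc (of_int (wwt u c))) * X)"
  if "c \<in> M0" for c
  using E[OF that] by (simp_all add: Phi_def nd d1 del: nden.simps)
 have P0: "Phi (u @ GInv a b z # v) = T * iv a b (z' + \<eta> a - \<eta> b) * xiT X" "Phi (u @ v) = T * xiT X"
  by (simp_all add: Phi_def d1 T_def X_def wrd_append del: nden.simps)
 have AAc: "(ec c c - csc (of_int (wwt u c))) * X \<in> B.AA" if "c \<in> M0" for c
  using that AA B.e_AA unfolding B.AA_def by (auto intro!: salg_intros)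
 have sum: "xiT ((ec a a - csc (of_int (wwt u a))) * X) - xiT ((ec b b - csc (of_int (wwt u b))) * X) + csc (of_int z) * xiT X
   = xiT (den a b z' * X)"
 proof -
  have "den a b z' * X = ((ec a a - csc (of_int (wwt u a))) * X - (ec b b - csc (of_int (wwt u b))) * X)
    + csc (of_int z) * X"
   by (simp add: den_def z'_def algebra_simps csc_add csc_diff)
  moreover have "(ec a a - csc (of_int (wwt u a))) * X - (ec b b - csc (of_int (wwt u b))) * X \<in> B.AA"
   "csc (of_int z) * X \<in> B.AA"
   using AAc[OF assms(1)] AAc[OF assms(2)] AA unfolding B.AA_def by (auto intro!: salg.mult salg.csc salg_diff)
  ultimately show ?thesis
   using AAc[OF assms(1)] AAc[OF assms(2)] AA by (simp only: xiT_add xiT_csc xiT_diff)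
 qed
 have "T * iv a b (z' + \<eta> a - \<eta> b) * xiT (den a b z' * X) - T * xiT X =
   (T * iv a b (z' + \<eta> a - \<eta> b)) * (xiT (den a b z' * X) - den a b (z' + \<eta> a - \<eta> b) * xiT X)"
  using den_iv(2)[OF assms] by (simp add: right_diff_distrib mult.assoc) (simp flip: mult.assoc)
 also have "\<dots> \<in> B.JT"
  by (intro Uh_JT xiT_den Uh_mult ivs_Uh iv_Uh' AA assms) (simp add: T_def ivs_Uh)
 finally have key: "T * iv a b (z' + \<eta> a - \<eta> b) * xiT (den a b z' * X) - T * xiT X \<in> B.JT" .
 have w: "wrd u * (gener g * gener h) * wrd v = wrd (u @ g # h # v)" "wrd u * gener g * wrd v = wrd (u @ g # v)" for g h
  by (simp_all add: wrd_append wrd_Cons mult.assoc)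
 have "wrd u * ((eE a a - eE b b + of_int z) * eInv a b z - 1) * wrd v =
   wrd u * (eE a a * eInv a b z) * wrd v - wrd u * (eE b b * eInv a b z) * wrd v + csc (of_int z) * (wrd u * eInv a b z * wrd v) - wrd (u @ v)"
  by (simp add: algebra_simps falg_of_int wrd_append csc_left_comm[of "wrd u"])
 hence "flin Phi (wrd u * ((eE a a - eE b b + of_int z) * eInv a b z - 1) * wrd v) =
   T * iv a b (z' + \<eta> a - \<eta> b) * xiT (den a b z' * X) - T * xiT X"
  unfolding w sum[symmetric]
  by (simp add: flin_add flin_diff flin_scale P[OF assms(1)] P[OF assms(2)] P0 distrib_left right_diff_distrib csc_left_comm[of "T * _"] mult.assoc del: wrd_Nil)
   (simp add: csc_left_comm[of "iv _ _ _"] csc_left_comm[of T])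
 thus "flin Phi (wrd u * ((eE a a - eE b b + of_int z) * eInv a b z - 1) * wrd v) \<in> B.JT"
  using key by simp
 have "wrd u * (eInv a b z * (eE a a - eE b b + of_int z) - 1) * wrd v =
   wrd u * (eInv a b z * eE a a) * wrd v - wrd u * (eInv a b z * eE b b) * wrd v + csc (of_int z) * (wrd u * eInv a b z * wrd v) - wrd (u @ v)"
  by (simp add: algebra_simps falg_of_int wrd_append csc_left_comm[of "wrd u"] csc_left_comm[of "eInv _ _ _"])
 hence "flin Phi (wrd u * (eInv a b z * (eE a a - eE b b + of_int z) - 1) * wrd v) =
   T * iv a b (z' + \<eta> a - \<eta> b) * xiT (den a b z' * X) - T * xiT X"
  unfolding w sum[symmetric]
  by (simp add: flin_add flin_diff flin_scale P[OF assms(1)] P[OF assms(2)] P0 distrib_left right_diff_distrib csc_left_comm[of "T * _"] mult.assoc del: wrd_Nil)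
   (simp add: csc_left_comm[of "iv _ _ _"] csc_left_comm[of T])
 thus "flin Phi (wrd u * (eInv a b z * (eE a a - eE b b + of_int z) - 1) * wrd v) \<in> B.JT"
  using key by simp
qed

lemma Phi_pideal:
 assumes "x \<in> pideal TYPE(tB)"
 shows "flin Phi x \<in> B.JT"
 using assms unfolding pideal_def
proof induction
 case (rel r u v)
 have "flin Phi (wrd u * r * wrd v) \<in> B.JT" for u v
 proof -
  consider "r \<in> A_rels0" | "r \<in> inv_rels m0" | g where "r = gener g" "g \<notin> Abar_gens0"
   using rel by (auto simp: prels_tB_def pgens_tB_def Abar_rels_def)
  thus ?thesis
  proof cases
   case 1
   then obtain \<kappa> where "r \<in> hmg \<kappa>" using A_rels_hmg by blast
   moreover have "cls r = (0 :: B0)" using 1 by (intro cls_rel) (simp add: prels_tB_def Abar_rels_def)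
   ultimately show ?thesis using Phi_homogeneous by simp
  next
   case 2
   thus ?thesis unfolding inv_rels_def using Phi_inv by auto
  next
   case 3
   have "wrd u * gener g * wrd v = wrd (u @ g # v)"
    by (simp add: wrd_append wrd_Cons mult.assoc)
   thus ?thesis using Phi_outside[OF 3(2)] 3(1) by (simp del: wrd_Nil)
  qed
 qed
 thus ?case by (rule flin_ideal) (simp_all add: B.JT_add csc_JT)
qed (simp_all add: flin_add B.JT_add)

text \<open>The choice of a representative in the free algebra affects the value by an element of J
  only, by \<open>Phi_pideal\<close>. All statements about \<open>xib\<close> are therefore modulo
  \<open>B.JT\<close>.\<close>

definition xib :: "B0 => B0" where
 "xib X = flin Phi (SOME x. cls x = X)"

lemma xib_cls: "flin Phi x - xib (cls x) \<in> B.JT"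
proof -
 define y where "y = (SOME y. cls y = (cls x :: B0))"
 have "cls y = (cls x :: B0)" unfolding y_def by (rule someI) (rule refl)
 hence "x - y \<in> pideal TYPE(tB)" by (simp add: cls_eq_iff[symmetric])
 from Phi_pideal[OF this] show ?thesis by (simp add: flin_diff xib_def y_def)
qed

lemma cls_surj: "\<exists>x. cls x = (X :: B0)"
 using cls_surj_alg by blast

lemma xib_add: "xib (X + Y) - (xib X + xib Y) \<in> B.JT"
proof -
 obtain x y where xy: "cls x = X" "cls y = Y" using cls_surj by metis
 have "xib (X + Y) - (xib X + xib Y) = (flin Phi x - xib X) + (flin Phi y - xib Y) - (flin Phi (x + y) - xib (X + Y))"
  by (simp add: flin_add)
 moreover have "flin Phi x - xib X \<in> B.JT" "flin Phi y - xib Y \<in> B.JT" "flin Phi (x + y) - xib (X + Y) \<in> B.JT"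
  using xib_cls[of x] xib_cls[of y] xib_cls[of "x + y"] xy by (simp_all add: cls_add)
 ultimately show ?thesis by (simp only: B.JT_add B.JT_diff)
qed

lemma xib_AA: "y \<in> B.AA ==> xib y - xiT y \<in> B.JT"
proof -
 assume "y \<in> B.AA"
 then obtain x where x: "x \<in> alg A_gens0" "cls x = y" by (auto simp: AA_cls)
 have noninv: "\<forall>w\<in>Poly_Mapping.keys x. \<forall>g\<in>set w. \<not> isinv g"
  using x(1) A_gens_noninv unfolding alg_def by blast
 have "flin Phi x = flin (%w. xiT (cls (wrd (nlet [] @ w @ nlet [])))) x"
  by (rule flin_cong) (use noninv in "simp add: Phi_def nden_noninv nlet_noninv")
 hence "flin Phi x = xiT y"
  using flin_xiT[OF noninv, of "[]" "[]"] x(2) by simp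
 thus ?thesis using B.JT_uminus[OF xib_cls[of x]] x(2) by simp
qed

lemma Phi_left:
 assumes "g = GE a a \<and> a \<in> M0 \<or> g = GInv a b z"
 shows "flin Phi (gener g * x) - cls (sft \<eta> g) * flin Phi x \<in> B.JT"
proof (induction x rule: falg_induct)
 case (single w k)
 have "Phi (g # w) - cls (sft \<eta> g) * Phi w \<in> B.JT"
  using assms
 proof
  assume g: "g = GE a a \<and> a \<in> M0"
  let ?T = "ivs (map (dshift \<eta>) (nden w))" and ?y = "cls (wrd (nlet w)) :: B0"
  have "dshift (%c. - gwt g c) = id" using g by (auto simp: fun_eq_iff)
  hence 1: "Phi (g # w) = ?T * xiT (ec a a * ?y)"
   using g by (simp add: Phi_def wrd_Cons cls_mult ec_def)
  have 2: "cls (sft \<eta> g) = ec a a + csc (of_int (\<eta> a))"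
   using g by (simp add: cls_add ec_def)
  have 3: "(ec a a + csc (of_int (\<eta> a))) * ?T = ?T * (ec a a + csc (of_int (\<eta> a)))"
   by (intro Uh_comm ivs_Uh Uh_add Uh_csc ec_Uh) (use g in auto)
  have "Phi (g # w) - cls (sft \<eta> g) * Phi w =
    ?T * (xiT (ec a a * ?y) - (ec a a + csc (of_int (\<eta> a))) * xiT ?y)"
   unfolding 1 2 Phi_def[of w] mult.assoc[symmetric] 3 by (simp add: right_diff_distrib mult.assoc)
  thus ?thesis
   using g xiT_ec[OF nlet_AA[of w], of a] by (simp add: Uh_JT ivs_Uh)
 next
  assume "g = GInv a b z"
  thus ?thesis by (simp add: Phi_def iv_def mult.assoc)
 qed
 moreover have "gener g * Poly_Mapping.single w k = Poly_Mapping.single (g # w) k"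
  by (simp add: gener_def mult_single plus_list_def)
 ultimately show ?case
  using csc_JT[of "Phi (g # w) - cls (sft \<eta> g) * Phi w" k]
  by (simp add: right_diff_distrib csc_left_comm[of "cls _"])
next
 case (add f h)
 have "flin Phi (gener g * (f + h)) - cls (sft \<eta> g) * flin Phi (f + h) =
   (flin Phi (gener g * f) - cls (sft \<eta> g) * flin Phi f) + (flin Phi (gener g * h) - cls (sft \<eta> g) * flin Phi h)"
  by (simp add: distrib_left flin_add)
 thus ?case using add B.JT_add by simp
qed simp

lemma Phi_Uh_expr:
 "t \<in> Uh_expr m0 ==> flin Phi (t * x) - cls (sh \<eta> t) * flin Phi x \<in> B.JT"
proof (induction arbitrary: x rule: Uh_expr_induct)
 case (csc z)
 thus ?case by (simp add: sh_def flin_scale)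
next
 case (E a)
 thus ?case using Phi_left[of "GE a a" a] by (simp add: sh_def)
next
 case (Inv a b z)
 thus ?case using Phi_left[of "GInv a b z" a b z] by (simp add: sh_def)
next
 case (add s t)
 have "flin Phi ((s + t) * x) - cls (sh \<eta> (s + t)) * flin Phi x =
   (flin Phi (s * x) - cls (sh \<eta> s) * flin Phi x) + (flin Phi (t * x) - cls (sh \<eta> t) * flin Phi x)"
  by (simp add: sh_def distrib_right flin_add feval_add cls_add)
 thus ?case using add.IH by (simp add: B.JT_add)
next
 case (mult s t)
 have "flin Phi (s * t * x) - cls (sh \<eta> (s * t)) * flin Phi x =
   (flin Phi (s * (t * x)) - cls (sh \<eta> s) * flin Phi (t * x)) + cls (sh \<eta> s) * (flin Phi (t * x) - cls (sh \<eta> t) * flin Phi x)"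
  by (simp add: sh_def mult.assoc feval_mult cls_mult right_diff_distrib)
 moreover have "cls (sh \<eta> s) \<in> Uh" using mult.hyps by (auto simp: Uh_eq sh_Uh_expr)
 ultimately show ?case using mult.IH by (simp add: B.JT_add Uh_JT)
qed

lemma xib_Uh_expr:
 assumes "t \<in> Uh_expr m0"
 shows "xib (cls t * X) - cls (sh \<eta> t) * xib X \<in> B.JT"
proof -
 obtain x where x: "cls x = X" using cls_surj by metis
 have U: "cls (sh \<eta> t) \<in> Uh" using assms by (auto simp: Uh_eq sh_Uh_expr)
 have "xib (cls t * X) - cls (sh \<eta> t) * xib X =
  (flin Phi (t * x) - cls (sh \<eta> t) * flin Phi x) - (flin Phi (t * x) - xib (cls (t * x)))
  + cls (sh \<eta> t) * (flin Phi x - xib X)"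
  using x by (simp add: cls_mult right_diff_distrib)
 moreover have "flin Phi (t * x) - xib (cls (t * x)) \<in> B.JT" "cls (sh \<eta> t) * (flin Phi x - xib X) \<in> B.JT"
  using xib_cls[of "t * x"] Uh_JT[OF xib_cls[of x] U] x by simp_all
 ultimately show ?thesis
  using Phi_Uh_expr[OF assms, of x] by (simp only: B.JT_add B.JT_diff)
qed

lemma xib_csc: "xib (csc z * X) - csc z * xib X \<in> B.JT"
 using xib_Uh_expr[of "csc z" X] by (simp add: sh_def Uh_expr_def)

lemma xib_uminus: "xib (- X) + xib X \<in> B.JT"
 using xib_csc[of "- 1" X] by (simp add: csc_uminus)

lemma xib_0: "xib 0 \<in> B.JT"
 using xib_csc[of 0 0] by simp

text \<open>A condition closed under sums and the action of \<open>Uh\<close> holds for \<open>xib\<close> as soon as it holds for \<open>xiT\<close>.\<close>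

lemma xib_closed:
 assumes K: "B.JT \<subseteq> K" "!!x y. x \<in> K ==> y \<in> K ==> x + y \<in> K" "!!t x. t \<in> Uh ==> x \<in> K ==> t * x \<in> K"
  and gen: "!!y. y \<in> Y ==> y \<in> B.AA \<and> xiT y \<in> K"
  and X: "X \<in> asp {t * y |t y. t \<in> Uh \<and> y \<in> Y}"
 shows "xib X \<in> K"
 using X
proof induction
 case zero
 thus ?case using xib_0 K(1) by blast
next
 case (base x)
 then obtain t y where x: "x = cls t * y" "t \<in> Uh_expr m0" "y \<in> Y" by (auto simp: Uh_eq)
 have U: "cls (sh \<eta> t) \<in> Uh" using x by (auto simp: Uh_eq sh_Uh_expr)
 have "xib x = (xib (cls t * y) - cls (sh \<eta> t) * xib y) + (cls (sh \<eta> t) * (xib y - xiT y) + cls (sh \<eta> t) * xiT y)"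
  by (simp add: x(1) right_diff_distrib)
 also have "\<dots> \<in> K"
  using xib_Uh_expr[OF x(2)] xib_AA gen[OF x(3)] K U by (meson subsetD)
 finally show ?case .
next
 case (add x y)
 have "xib (x + y) = (xib (x + y) - (xib x + xib y)) + (xib x + xib y)" by simp
 also have "\<dots> \<in> K" using xib_add K add.IH by (meson subsetD)
 finally show ?case .
next
 case (uminus x)
 have "xib (- x) = (xib (- x) + xib x) + csc (- 1) * xib x" by (simp add: csc_uminus)
 also have "\<dots> \<in> K" using xib_uminus K uminus.IH Uh_csc by (meson subsetD)
 finally show ?case .
qed

end

section \<open>A spanning set\<close>

abbreviation pinv :: "(nat => nat) => nat => nat" where "pinv \<equiv> inv_into UNIV"

context osc
begin

definition Hh :: "'r set" where
 "Hh = salg {e a a |a. a \<in> {1..m}}"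

definition Wg :: "(nat => nat) => 'r set" where
 "Wg \<sigma> = {eh (\<sigma> a) (\<sigma> b) |a b. a \<in> {1..m} \<and> b \<in> {1..m} \<and> a < b}"

text \<open>A triangular decomposition of A with respect to the Borel subalgebra conjugated by
  \<sigma>: a left factor from the conjugate of n, or Cartan part times oscillator part times a word
  in the conjugate of n', the latter taken in the commuting copy \<open>eh\<close>. It is used for
  the identity and for simple transpositions.\<close>

definition span_gens :: "(nat => nat) => 'r set" where
 "span_gens \<sigma> = {e (\<sigma> b) (\<sigma> a) * y |a b y. a \<in> {1..m} \<and> b \<in> {1..m} \<and> a < b \<and> y \<in> AA} \<union>
  {h * (Y * prod_list w) |h Y w. h \<in> Hh \<and> Y \<in> HD \<and> set w \<subseteq> Wg \<sigma>}"

lemma Hh_e: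
 assumes "h \<in> Hh" "a \<in> {1..m}" "b \<in> {1..m}"
 shows "\<exists>h'\<in>Hh. h * e a b = e a b * h'"
 using assms(1) unfolding Hh_def
proof induction
 case (csc z)
 thus ?case using salg.csc csc_comm by blast
next
 case (base x)
 then obtain d where d: "x = e d d" "d \<in> {1..m}" by blast
 let ?k = "(if d = a then 1 else 0) - (if d = b then 1 else 0) :: complex"
 have "cm (e d d) (e a b) = csc ?k * e a b"
  using d assms(2,3) by (auto simp: gl csc_uminus)
 hence "e d d * e a b = e a b * (e d d + csc ?k)"
  by (simp add: cm_swap_mult[of "e d d"] distrib_left csc_comm)
 moreover have "e d d + csc ?k \<in> salg {e a a |a. a \<in> {1..m}}"
  using d by (intro salg.add salg.csc salg.base) blast
 ultimately show ?case unfolding d(1) by blast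
next
 case (add x y)
 then obtain h k where hk: "h \<in> salg {e a a |a. a \<in> {1..m}}" "k \<in> salg {e a a |a. a \<in> {1..m}}"
  "x * e a b = e a b * h" "y * e a b = e a b * k" by blast
 show ?case
  by (rule bexI[of _ "h + k"], simp only: hk distrib_left distrib_right, rule salg.add[OF hk(1,2)])
next
 case (mult x y)
 then obtain h k where hk: "h \<in> salg {e a a |a. a \<in> {1..m}}" "k \<in> salg {e a a |a. a \<in> {1..m}}"
  "x * e a b = e a b * h" "y * e a b = e a b * k" by blast
 have "x * y * e a b = x * e a b * k" by (simp add: hk(4) mult.assoc)
 thus ?case
  by (intro bexI[of _ "h * k"], simp only: hk mult.assoc, intro salg.mult[OF hk(1,2)])
qed

lemma Hh_AA: "h \<in> Hh ==> h \<in> AA"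
 unfolding Hh_def AA_def by (erule salg_mono) (auto simp: Ag_def intro!: salg.base)

lemma Wg_HD_comm:
 assumes \<sigma>: "\<sigma> permutes {1..m}" and "set w \<subseteq> Wg \<sigma>" "Y \<in> HD"
 shows "prod_list w * Y = Y * prod_list w"
 using assms(2)
proof (induction w)
 case (Cons x w)
 then obtain a b where "x = eh (\<sigma> a) (\<sigma> b)" "a \<in> {1..m}" "b \<in> {1..m}" by (auto simp: Wg_def)
 hence "x * Y = Y * x"
  using eh_HD_comm[OF assms(3)] permutes_in_image[OF \<sigma>] by blast
 thus ?case using Cons by (simp add: mult.assoc) (simp flip: mult.assoc)
qed simp

lemma Wg_AA: "\<sigma> permutes {1..m} ==> set w \<subseteq> Wg \<sigma> ==> prod_list w \<in> AA"
 unfolding AA_def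
 by (rule salg_prod_list)
  (use eh_AA permutes_in_image[of \<sigma> "{1..m}"] in "auto simp: Wg_def AA_def")

lemma span_gens_AA: "\<sigma> permutes {1..m} ==> x \<in> span_gens \<sigma> ==> x \<in> AA"
 using Hh_AA HD_AA Wg_AA e_AA permutes_in_image[of \<sigma> "{1..m}"]
 unfolding span_gens_def by (auto simp: AA_def intro!: salg.mult)

text \<open>The span contains 1 and is stable under right multiplication by HD and by every
  \<open>eh a b\<close>, hence by e = eh + z. For stability, \<open>eh a b\<close> is moved to the
  left through the word by induction on its length. Once the word is exhausted it is either appended
  as a new letter or replaced by e - z; then e is absorbed in the Cartan part or brought to the
  front.\<close>

lemma AA_span:
 assumes \<sigma>: "\<sigma> permutes {1..m}" and x: "x \<in> AA"
 shows "x \<in> asp (span_gens \<sigma>)"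
proof -
 let ?S = "asp (span_gens \<sigma>)"
 note in_range = permutes_in_image[OF \<sigma>]
 have N: "e (\<sigma> b) (\<sigma> a) * y \<in> ?S" if "a \<in> {1..m}" "b \<in> {1..m}" "a < b" "y \<in> AA" for a b y
  using that unfolding span_gens_def by (intro asp.base) blast
 have R: "h * (Y * prod_list w) \<in> ?S" if "h \<in> Hh" "Y \<in> HD" "set w \<subseteq> Wg \<sigma>" for h Y w
  using that unfolding span_gens_def by (intro asp.base) blast
 have closed: "s * x \<in> ?S" if s: "s \<in> ?S" and x: "x \<in> AA"
  and step: "!!h Y w. h \<in> Hh ==> Y \<in> HD ==> set w \<subseteq> Wg \<sigma> ==> h * (Y * prod_list w) * x \<in> ?S" for s x
  using s
 proof (rule asp_image)
  fix v assume "v \<in> span_gens \<sigma>"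
  then consider a b y where "v = e (\<sigma> b) (\<sigma> a) * y" "a \<in> {1..m}" "b \<in> {1..m}" "a < b" "y \<in> AA"
   | h Y w where "v = h * (Y * prod_list w)" "h \<in> Hh" "Y \<in> HD" "set w \<subseteq> Wg \<sigma>"
   unfolding span_gens_def by blast
  thus "v * x \<in> ?S"
  proof cases
   case 1
   thus ?thesis using N[of a b "y * x"] x by (simp add: mult.assoc AA_def salg.mult)
  next
   case 2
   thus ?thesis using step by blast
  qed
 qed (simp add: distrib_right)
 have HDstep: "s * x \<in> ?S" if "s \<in> ?S" "x \<in> HD" for s x
  using that(1) HD_AA[OF that(2)]
 proof (rule closed)
  fix h Y w assume *: "h \<in> Hh" "Y \<in> HD" "set w \<subseteq> Wg \<sigma>"
  hence "h * (Y * prod_list w) * x = h * ((Y * x) * prod_list w)"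
   using Wg_HD_comm[OF \<sigma> _ that(2), of w] by (simp add: mult.assoc)
  thus "h * (Y * prod_list w) * x \<in> ?S"
   using R[of h "Y * x" w] * that(2) by (simp add: HD_def salg.mult)
 qed
 have Wstep: "s * x \<in> ?S" if "s \<in> ?S" "x \<in> Wg \<sigma>" for s x
 proof (rule closed[OF that(1)])
  show "x \<in> AA" using Wg_AA[OF \<sigma>, of "[x]"] that(2) by simp
  fix h Y w assume *: "h \<in> Hh" "Y \<in> HD" "set w \<subseteq> Wg \<sigma>"
  thus "h * (Y * prod_list w) * x \<in> ?S"
   using R[of h Y "w @ [x]"] that(2) by (simp add: mult.assoc)
 qed
 have ehR: "h * (Y * prod_list w) * eh a b \<in> ?S"
  if hY: "h \<in> Hh" "Y \<in> HD" "set w \<subseteq> Wg \<sigma>" "a \<in> {1..m}" "b \<in> {1..m}" for h Y w a b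
  using hY(3-5)
 proof (induction w arbitrary: a b rule: rev_induct)
  case Nil
  define u v where "u = pinv \<sigma> a" and "v = pinv \<sigma> b"
  have uv: "\<sigma> u = a" "\<sigma> v = b" "u \<in> {1..m}" "v \<in> {1..m}"
   using Nil permutes_inverses(1)[OF \<sigma>] permutes_in_image[OF permutes_inv[OF \<sigma>]]
   by (auto simp: u_def v_def)
  have z: "h * (z a b * Y) \<in> ?S"
   using R[of h "z a b * Y" "[]"] hY(1,2) z_HD Nil by (simp add: HD_def salg.mult)
  have eq: "h * Y * eh a b = h * e a b * Y - h * (z a b * Y)"
  proof -
   have "h * Y * eh a b = h * (eh a b * Y)"
    by (simp only: eh_HD_comm[OF hY(2) Nil(2,3)] mult.assoc)
   thus ?thesis by (simp add: eh_def mult.assoc right_diff_distrib left_diff_distrib)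
  qed
  consider "u < v" | "u = v" | "v < u" by linarith
  thus ?case
  proof cases
   case 1
   hence "eh a b \<in> Wg \<sigma>" using uv unfolding Wg_def by blast
   thus ?thesis using R[of h Y "[eh a b]"] hY(1,2) by (simp add: mult.assoc)
  next
   case 2
   hence "e a b \<in> {e a a |a. a \<in> {1..m}}" using uv Nil by auto
   hence "h * e a b \<in> Hh" using hY(1) unfolding Hh_def by (rule salg.mult[OF _ salg.base, rotated])
   hence "h * e a b * Y \<in> ?S" using R[of "h * e a b" Y "[]"] hY(2) by simp
   thus ?thesis using z asp_diff eq by simp
  next
   case 3
   obtain h' where "h' \<in> Hh" "h * e a b = e a b * h'" using Hh_e[OF hY(1) Nil(2,3)] by blast
   hence "h * e a b * Y \<in> ?S"
    using N[of v u "h' * Y"] uv 3 Hh_AA HD_AA[OF hY(2)] by (simp add: mult.assoc AA_def salg.mult)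
   thus ?thesis using z asp_diff eq by simp
  qed
 next
  case (snoc x w)
  hence "x \<in> Wg \<sigma>" by simp
  then obtain c d where x: "x = eh c d" "c \<in> {1..m}" "d \<in> {1..m}" "x \<in> Wg \<sigma>"
   using in_range unfolding Wg_def by blast
  have "h * (Y * prod_list w) * eh a b * x \<in> ?S"
   by (rule Wstep[OF snoc.IH x(4)]) (use snoc.prems in auto)
  moreover have "h * (Y * prod_list w) * (if d = a then eh c b else 0) \<in> ?S"
   "h * (Y * prod_list w) * (if b = c then eh a d else 0) \<in> ?S"
   using snoc x by (auto intro: asp.zero)
  moreover have "h * (Y * prod_list (w @ [x])) * eh a b = h * (Y * prod_list w) * eh a b * x +
    (h * (Y * prod_list w) * (if d = a then eh c b else 0) - h * (Y * prod_list w) * (if b = c then eh a d else 0))"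
  proof -
   have "x * eh a b = eh a b * x + ((if d = a then eh c b else 0) - (if b = c then eh a d else 0))"
    unfolding x(1) using cm_eh_eh[OF x(2,3) snoc.prems(2,3)] by (subst cm_swap_mult) simp
   thus ?thesis
    by (simp add: mult.assoc distrib_left right_diff_distrib)
  qed
  ultimately show ?case by (simp add: asp.add asp_diff)
 qed
 have ehstep: "s * eh a b \<in> ?S" if "s \<in> ?S" "a \<in> {1..m}" "b \<in> {1..m}" for s a b
  using closed[OF that(1) eh_AA[OF that(2,3)]] ehR that(2,3) by blast
 have "s * x \<in> ?S" if "s \<in> ?S" for s
  using x that unfolding AA_def
 proof (induction arbitrary: s)
  case (csc k)
  have "csc k \<in> HD" by (simp add: HD_def salg.csc)
  thus ?case using HDstep csc by blast
 next
  case (base x)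
  then consider a b where "x = e a b" "a \<in> {1..m}" "b \<in> {1..m}" | "x \<in> HD"
   by (auto simp: Ag_def HD_def intro: salg.base)
  thus ?case
  proof cases
   case 1
   have "s * x = s * eh a b + s * z a b" by (simp add: 1 eh_def algebra_simps)
   thus ?thesis using ehstep[OF base.prems 1(2,3)] HDstep[OF base.prems z_HD[OF 1(2,3)]] asp.add by simp
  next
   case 2
   thus ?thesis using HDstep base.prems by blast
  qed
 next
  case (add x y)
  thus ?case by (simp add: distrib_left asp.add)
 next
  case (mult x y)
  thus ?case by (simp flip: mult.assoc)
 qed
 moreover have "1 \<in> ?S"
  using R[of 1 1 "[]"] by (simp add: Hh_def HD_def)
 ultimately have "1 * x \<in> ?S" by blast
 thus ?thesis by simp
qed

end


section \<open>The action of the symmetric group\<close>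

definition sg :: "(nat => nat) => B0 => B0" where
 "sg \<sigma> = plift (%g. cls (perm_gen p0 \<sigma> g))"

lemma sg_gens: "cls (perm_gen p0 \<sigma> (GE a b)) = ec (\<sigma> a) (\<sigma> b)"
 "cls (perm_gen p0 \<sigma> (GX a i)) = (if a \<le> p0 then - Pc (\<sigma> a) i else Qc (\<sigma> a) i)"
 "cls (perm_gen p0 \<sigma> (GD a i)) = (if a \<le> p0 then Qc (\<sigma> a) i else Pc (\<sigma> a) i)"
 "cls (perm_gen p0 \<sigma> (GInv a b z)) = iv (\<sigma> a) (\<sigma> b) z"
 by (simp_all add: ec_def Pc_def Qc_def iv_def cls_uminus)

lemma feval_sg_pp: "feval (%g. cls (perm_gen p0 \<sigma> g)) (pp p0 a i) = (Pc (\<sigma> a) i :: B0)"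
 "feval (%g. cls (perm_gen p0 \<sigma> g)) (qq p0 a i) = (Qc (\<sigma> a) i :: B0)"
 by (auto simp: pp_def qq_def feval_uminus sg_gens simp del: perm_gen.simps)

lemma feval_sg_zeta: "feval (%g. cls (perm_gen p0 \<sigma> g)) (zeta p0 n0 a b) = (if a = b then csc (of_nat n0 / 2) else 0) + (\<Sum>k=1..n0. Qc (\<sigma> a) k * Pc (\<sigma> b) k :: B0)"
 by (simp add: zeta_def Ehat_def feval_add feval_sum feval_mult feval_sg_pp)

lemma sg_kills:
 assumes \<sigma>: "\<sigma> permutes M0"
 shows "kills_rels TYPE(tB) (%g. cls (perm_gen p0 \<sigma> g) :: B0)"
 unfolding kills_rels_def
proof
 note r = permutes_in_image[OF \<sigma>]
 note r' = iffD2[OF r]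
 note inj = inj_eq[OF permutes_inj[OF \<sigma>]]
 let ?f = "feval (%g. cls (perm_gen p0 \<sigma> g)) :: gen falg => B0"
 fix x assume "x \<in> prels TYPE(tB)"
 then consider "x \<in> gl_rels m0" | "x \<in> weyl_rels m0 n0" | "x \<in> cross_rels p0 q0 n0" | "x \<in> inv_rels m0"
  by (auto simp: prels_tB_def Abar_rels_def A_rels_def)
 thus "?f x = 0"
 proof cases
  case 1
  then obtain a b c d where x: "x = comm (eE a b) (eE c d) - ((if b = c then eE a d else 0) - (if d = a then eE c b else 0))"
   "a \<in> M0" "b \<in> M0" "c \<in> M0" "d \<in> M0"
   by (auto simp: gl_rels_def)
  have "cm (ec (\<sigma> a) (\<sigma> b)) (ec (\<sigma> c) (\<sigma> d)) = (if b = c then ec (\<sigma> a) (\<sigma> d) else 0) - (if d = a then ec (\<sigma> c) (\<sigma> b) else 0 :: B0)"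
   using x(2-5)[THEN r'] by (simp add: B.gl inj)
  thus ?thesis
   unfolding x(1) by (auto simp: feval_diff feval_comm sg_gens cm_def simp del: perm_gen.simps)
 next
  case 2
  have *: "cm (Pc (\<sigma> a) i) (Pc (\<sigma> b) j) = (0 :: B0)" "cm (Qc (\<sigma> a) i) (Qc (\<sigma> b) j) = (0 :: B0)"
   "cm (Pc (\<sigma> a) i) (Qc (\<sigma> b) j) = (if a = b \<and> i = j then 1 else 0 :: B0)"
   "cm (Qc (\<sigma> b) j) (Pc (\<sigma> a) i) = - (if a = b \<and> i = j then 1 else 0 :: B0)"
   if "a \<in> M0" "b \<in> M0" "i \<in> N0" "j \<in> N0" for a b i j
   using that(1,2)[THEN r'] that(3,4) by (simp_all add: B.PP B.QQ B.PQ B.QP inj)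
  from 2 show ?thesis
   unfolding weyl_rels_def
   by (auto simp: feval_diff feval_comm sg_gens cm_def[symmetric] * cm_uminus cm_uminus_left simp del: perm_gen.simps)
 next
  case 3
  then obtain a b h where x: "x = comm (eE a b) (gener h) - comm (zeta p0 n0 a b) (gener h)"
   "a \<in> M0" "b \<in> M0" "h \<in> weyl_gens m0 n0"
   by (auto simp: cross_rels_def)
  have z: "?f (zeta p0 n0 a b) = B.z (\<sigma> a) (\<sigma> b)"
   by (simp add: feval_sg_zeta B.z_def inj)
  have "cls (perm_gen p0 \<sigma> h) \<in> B.HD"
   using x(4) B.P_HD B.Q_HD r unfolding weyl_gens_def
   by (auto simp: sg_gens B.HD_def salg_uminus simp del: perm_gen.simps)
  hence "cm (ec (\<sigma> a) (\<sigma> b)) (cls (perm_gen p0 \<sigma> h)) = cm (B.z (\<sigma> a) (\<sigma> b)) (cls (perm_gen p0 \<sigma> h))"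
   using x(2,3) r by (intro B.cm_e_HD) auto
  thus ?thesis
   unfolding x(1) by (simp add: feval_diff feval_comm z sg_gens(1) cm_def del: perm_gen.simps)
 next
  case 4
  thus ?thesis
   unfolding inv_rels_def using den_iv r inj
   by (auto simp: feval_diff feval_add feval_mult sg_gens den_def[symmetric] simp del: perm_gen.simps) 
 qed
qed

lemmas sg_hom = plift_hom[OF sg_kills, folded sg_def]

lemma sg_cls: "\<sigma> permutes M0 ==> x \<in> alg Abar_gens0 ==> sg \<sigma> (cls x) = feval (%g. cls (perm_gen p0 \<sigma> g)) x"
 using plift_cls[OF sg_kills, of \<sigma> x] by (simp add: sg_def pgens_tB_def)

lemma sg_sum: "\<sigma> permutes M0 ==> sg \<sigma> (sum h S) = (\<Sum>x\<in>S. sg \<sigma> (h x))"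
 by (induction S rule: infinite_finite_induct) (simp_all add: sg_hom)

lemma sg_Pc: "\<sigma> permutes M0 ==> a \<in> M0 ==> i \<in> N0 ==> sg \<sigma> (Pc a i) = Pc (\<sigma> a) i"
 unfolding Pc_def[of a] by (subst sg_cls) (auto simp: feval_sg_pp Abar_gens_def A_gens_def intro!: pp_alg[of a m0 i n0])

lemma sg_Qc: "\<sigma> permutes M0 ==> a \<in> M0 ==> i \<in> N0 ==> sg \<sigma> (Qc a i) = Qc (\<sigma> a) i"
 unfolding Qc_def[of a] by (subst sg_cls) (auto simp: feval_sg_pp Abar_gens_def A_gens_def intro!: qq_alg[of a m0 i n0])

lemma sg_ec: "\<sigma> permutes M0 ==> a \<in> M0 ==> b \<in> M0 ==> sg \<sigma> (ec a b) = ec (\<sigma> a) (\<sigma> b)"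
 unfolding ec_def[of a] by (subst sg_cls) (auto simp: sg_gens Abar_gens_def A_gens_def gl_gens_def simp del: perm_gen.simps intro!: alg_gener)

lemma sg_z: "\<sigma> permutes M0 ==> a \<in> M0 ==> b \<in> M0 ==> sg \<sigma> (B.z a b) = B.z (\<sigma> a) (\<sigma> b)"
 by (simp add: B.z_def sg_hom sg_sum sg_Pc sg_Qc inj_eq[OF permutes_inj])

lemma sg_eh: "\<sigma> permutes M0 ==> a \<in> M0 ==> b \<in> M0 ==> sg \<sigma> (B.eh a b) = B.eh (\<sigma> a) (\<sigma> b)"
 by (simp add: B.eh_def sg_hom sg_ec sg_z)

lemma perm_gen_alg:
 assumes \<sigma>: "\<sigma> permutes M0" and "g \<in> Abar_gens0"
 shows "perm_gen p0 \<sigma> g \<in> alg Abar_gens0"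
proof (cases g)
 case (GE a b)
 thus ?thesis
  using assms permutes_in_image[OF \<sigma>]
  by (auto simp: Abar_gens_def A_gens_def gl_gens_def weyl_gens_def inv_gens_def intro!: alg_gener)
next
 case (GInv a b z)
 thus ?thesis
  using assms permutes_in_image[OF \<sigma>] inj_eq[OF permutes_inj[OF \<sigma>]]
  by (auto simp: Abar_gens_def A_gens_def gl_gens_def weyl_gens_def inv_gens_def intro!: alg_gener)
next
 case (GX a i)
 hence "\<sigma> a \<in> M0" "i \<in> N0"
  using assms permutes_in_image[OF \<sigma>, of a] by (auto simp: Abar_gens_def A_gens_def gl_gens_def weyl_gens_def inv_gens_def)
 thus ?thesis
  using GX by (auto simp: Abar_gens_def A_gens_def intro!: alg_uminus pp_alg[of _ m0 _ n0] qq_alg[of _ m0 _ n0])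
next
 case (GD a i)
 hence "\<sigma> a \<in> M0" "i \<in> N0"
  using assms permutes_in_image[OF \<sigma>, of a] by (auto simp: Abar_gens_def A_gens_def gl_gens_def weyl_gens_def inv_gens_def)
 thus ?thesis
  using GD by (auto simp: Abar_gens_def A_gens_def intro!: pp_alg[of _ m0 _ n0] qq_alg[of _ m0 _ n0])
qed

lemma perm_act_emb:
 assumes \<sigma>: "\<sigma> permutes M0"
 shows "perm_act p0 q0 n0 \<sigma> (emb X) = emb (sg \<sigma> X)"
proof -
 obtain x where x: "x \<in> alg Abar_gens0" "cls x = X"
  using cls_surj_alg[of X] by (auto simp: pgens_tB_def)
 have "perm_act p0 q0 n0 \<sigma> (emb X) = phom Abar_gens0 (Abar_rels p0 q0 n0) (perm_gen p0 \<sigma>)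
   (pclass Abar_gens0 (Abar_rels p0 q0 n0) x)"
  using pclass_eq_emb[of x, where 'k = tB] x by (simp add: perm_act_def pgens_tB_def prels_tB_def)
 also have "\<dots> = emb (cls (feval (perm_gen p0 \<sigma>) x) :: B0)"
  unfolding pgens_tB_def[symmetric, of "TYPE(tB)"] prels_tB_def[symmetric, of "TYPE(tB)"]
 proof (rule phom_pclass)
  fix r assume "r \<in> prels TYPE(tB)"
  thus "cls (feval (perm_gen p0 \<sigma>) r) = (0 :: B0)"
   using sg_kills[OF \<sigma>] by (simp add: cls_feval_comp kills_rels_def)
 qed (use x prels_alg[of "TYPE(tB)"] perm_gen_alg[OF \<sigma>] in "auto simp: pgens_tB_def")
 finally show ?thesis using x sg_cls[OF \<sigma> x(1)] by (simp add: cls_feval_comp)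
qed

context simple_root
begin

abbreviation tr :: "nat => nat" where "tr \<equiv> Transposition.transpose c (Suc c)"

lemma tr_permutes: "tr permutes M0"
 using c by (intro permutes_swap_id) auto

lemma tr_less:
 "a < b ==> (a, b) \<noteq> (c, Suc c) ==> tr a < tr b \<and> (tr a, tr b) \<noteq> (c, Suc c)"
 by (auto simp: Transposition.transpose_def)

lemma wtd_span:
 assumes "wtd w g"
 shows "g * x \<in> asp {t * y |t y. t \<in> Uh \<and> y \<in> {g * y |y. y \<in> B.AA}}"
 using B0_span[of x]
proof (rule asp_image)
 fix v assume "v \<in> {t * y |t y. t \<in> Uh \<and> y \<in> B.AA}"
 then obtain t y where v: "v = t * y" "t \<in> Uh" "y \<in> B.AA" by blast
 obtain t' where "t' \<in> Uh" "g * t = t' * g" using wtd_Uh[OF v(2) assms] by blast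
 hence "g * v = t' * (g * y)" using v(1) by (simp flip: mult.assoc)
 thus "g * v \<in> asp {t * y |t y. t \<in> Uh \<and> y \<in> {g * y |y. y \<in> B.AA}}"
  using \<open>t' \<in> Uh\<close> v(3) by (intro asp.base) blast
qed (simp add: distrib_left)

text \<open>The element g has a weight, so the fractions in x can be brought in front of g without
  leaving a span of elements t g y, to which \<open>xiT_E\<close> or \<open>xiT_X\<close>
  applies.\<close>

lemma xib_kills:
 assumes g: "g = E \<or> g \<in> Xg"
 shows "xib (g * x) \<in> B.JT"
proof (rule xib_closed[of _ "{g * y |y. y \<in> B.AA}"])
 have gAA: "g \<in> B.AA" using g c_range B.e_AA by (auto simp: Xg_def)
 show "y \<in> B.AA \<and> xiT y \<in> B.JT" if "y \<in> {g * y |y. y \<in> B.AA}" for y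
  using that g xiT_E xiT_X gAA by (auto simp: B.AA_def salg.mult)
 obtain a b where "g = ec a b" "a \<in> M0" "b \<in> M0"
  using g c_range unfolding Xg_def by blast
 hence "\<exists>w. wtd w g" using wtd_e by blast
 thus "g * x \<in> asp {t * y |t y. t \<in> Uh \<and> y \<in> {g * y |y. y \<in> B.AA}}"
  using wtd_span by blast
qed (auto simp: B.JT_add Uh_JT)

text \<open>A representative of the operator \<xi> composed with \<sigma>_c, again meaningful modulo
  J.\<close>

definition th :: "B0 => B0" where
 "th X = xib (sg tr X)"

lemma th_add: "th (X + Y) - (th X + th Y) \<in> B.JT"
 using xib_add[of "sg tr X" "sg tr Y"] by (simp add: th_def sg_hom tr_permutes)

lemma th_uminus: "th (- X) + th X \<in> B.JT"
 using xib_uminus[of "sg tr X"] by (simp add: th_def sg_hom tr_permutes)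

lemma th_csc: "th (csc z * X) - csc z * th X \<in> B.JT"
 using xib_csc[of z "sg tr X"] by (simp add: th_def sg_hom tr_permutes)

text \<open>\<sigma>_c carries F to E and permutes the other root vectors of n. Both kinds are
  killed, which is why the composite descends to the quotient by J although \<xi> alone is not shown
  to do so.\<close>

lemma th_Jg: "s \<in> B.Jg ==> th (s * r) \<in> B.JT"
proof -
 assume "s \<in> B.Jg"
 then obtain a b where s: "s = ec b a" "a \<in> M0" "b \<in> M0" "a < b"
  by (auto simp: B.Jg_def)
 have "ec (tr b) (tr a) = E \<or> ec (tr b) (tr a) \<in> Xg"
 proof (cases "(a, b) = (c, Suc c)")
  case True
  thus ?thesis by (simp add: Transposition.transpose_def)
 next
  case False
  hence "tr a < tr b" "(tr a, tr b) \<noteq> (c, Suc c)" using tr_less s(4) by blast+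
  thus ?thesis
   using permutes_in_image[OF tr_permutes] s(2,3) unfolding Xg_def by blast
 qed
 thus ?thesis
  using xib_kills[of "ec (tr b) (tr a)" "sg tr r"] s
  by (simp add: th_def sg_hom[OF tr_permutes] sg_ec[OF tr_permutes])
qed

lemma th_JT: "x \<in> B.JT ==> th x \<in> B.JT"
 unfolding B.JT_def
proof (induction rule: asp.induct)
 case zero
 show ?case using xib_0 by (simp add: th_def sg_hom tr_permutes B.JT_def)
next
 case (base x)
 thus ?case using th_Jg by (auto simp: B.JT_def)
next
 case (add x y)
 thus ?case using B.JT_add[OF th_add[of x y] B.JT_add[of "th x" "th y"]] by (simp add: B.JT_def)
next
 case (uminus x)
 thus ?case using B.JT_diff[OF th_uminus[of x], of "th x"] by (simp add: B.JT_def)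
qed

end

section \<open>Compatibility of a simple reflection with the left ideals\<close>

definition lid :: "'r::calg set => 'r set" where
 "lid G = asp {x * g |x g. g \<in> G}"

lemma lid_zero: "0 \<in> lid G" and lid_add: "x \<in> lid G ==> y \<in> lid G ==> x + y \<in> lid G"
 and lid_uminus: "x \<in> lid G ==> - x \<in> lid G" and lid_diff: "x \<in> lid G ==> y \<in> lid G ==> x - y \<in> lid G"
 by (simp_all add: lid_def asp.intros asp_diff)

lemma lid_base: "g \<in> G ==> x * g \<in> lid G"
 unfolding lid_def by (intro asp.base) blast

lemma lid_hom:
 assumes "x \<in> lid G" "!!x g. g \<in> G ==> h (x * g) \<in> lid G" "!!x y. h (x + y) = h x + h y"
 shows "h x \<in> lid G"
 using assms(1) unfolding lid_def by (rule asp_image) (use assms(2,3) in \<open>auto simp: lid_def\<close>)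

lemma lid_lmult: "x \<in> lid G ==> y * x \<in> lid G"
 by (erule lid_hom) (simp_all add: distrib_left lid_base flip: mult.assoc)

lemma lid_rmult:
 assumes "x \<in> lid G" "!!g. g \<in> G ==> cm g y \<in> lid G"
 shows "x * y \<in> lid G"
 using assms(1)
proof (rule lid_hom)
 fix x g assume g: "g \<in> G"
 have "x * g * y = x * y * g + x * cm g y" by (simp add: cm_def algebra_simps)
 thus "x * g * y \<in> lid G" by (simp add: lid_add lid_base[OF g] lid_lmult[OF assms(2)[OF g]])
qed (rule distrib_right)

context simple_root
begin

abbreviation fh :: B0 where "fh \<equiv> B.eh (Suc c) c"
abbreviation zF :: B0 where "zF \<equiv> B.z (Suc c) c"

text \<open>\<open>G1e\<close> spans the nilradical stable under both \<open>E\<close> and \<open>F\<close>.\<close>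

definition G1e :: "B0 set" where
 "G1e = {B.eh a b |a b. a \<in> M0 \<and> b \<in> M0 \<and> a < b \<and> (a, b) \<noteq> (c, Suc c)}"

abbreviation "L1 \<equiv> lid G1e"

lemma L1_fh: "x \<in> L1 ==> x * fh \<in> L1"
proof (erule lid_rmult)
 fix g assume "g \<in> G1e"
 then obtain a b where g: "g = B.eh a b" "a \<in> M0" "b \<in> M0" "a < b" "(a, b) \<noteq> (c, Suc c)"
  unfolding G1e_def by blast
 have 1: "B.eh a c \<in> L1" if "b = Suc c"
 proof -
  have "B.eh a c \<in> G1e" using that g c_range unfolding G1e_def by (intro CollectI exI[of _ a] exI[of _ c]) auto
  from lid_base[OF this, of 1] show ?thesis by simp
 qed
 have 2: "B.eh (Suc c) b \<in> L1" if "c = a"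
 proof -
  have "B.eh (Suc c) b \<in> G1e" using that g c_range unfolding G1e_def by (intro CollectI exI[of _ "Suc c"] exI[of _ b]) auto
  from lid_base[OF this, of 1] show ?thesis by simp
 qed
 have "cm g fh = (if b = Suc c then B.eh a c else 0) - (if c = a then B.eh (Suc c) b else 0)"
  unfolding g(1) using g c_range by (intro B.cm_eh_eh) auto
 moreover have "(if b = Suc c then B.eh a c else 0) \<in> L1" "(if c = a then B.eh (Suc c) b else 0) \<in> L1"
  using 1 2 by (simp_all add: lid_zero)
 ultimately show "cm g fh \<in> L1"
  by (simp only: lid_diff)
qed

lemma L1_h: "x \<in> L1 ==> a \<in> M0 ==> x * (B.eh a a - csc k) \<in> L1"
proof (erule lid_rmult)
 fix g assume a: "a \<in> M0" and g: "g \<in> G1e"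
 then obtain u v where uv: "g = B.eh u v" "u \<in> M0" "v \<in> M0"
  unfolding G1e_def by blast
 have "cm g (B.eh a a - csc k) = (if v = a then g else 0) - (if a = u then g else 0)"
  unfolding uv(1) cm_diff using uv a by (auto simp: B.cm_eh_eh)
 moreover have "g \<in> L1" using lid_base[OF g, of 1] by simp
 ultimately show "cm g (B.eh a a - csc k) \<in> L1"
  by (auto intro: lid_diff lid_uminus lid_zero)
qed

text \<open>Each letter is either \<open>fh\<close> or a generator of the left ideal
  \<open>L1\<close>, and \<open>L1\<close> is stable under right multiplication by
  \<open>fh\<close>. So a word is a power of \<open>fh\<close> unless it falls into
  \<open>L1\<close>.\<close>

lemma fh_pow_span:
 assumes "set w \<subseteq> B.Wg tr"
 shows "prod_list w \<in> asp (L1 \<union> range (%\<beta>. fh ^ \<beta>))"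
 using assms
proof (induction w rule: rev_induct)
 case Nil
 have "fh ^ 0 \<in> asp (L1 \<union> range (%\<beta>. fh ^ \<beta>))" by (intro asp.base) blast
 thus ?case by simp
next
 case (snoc x w)
 obtain a b where x: "x = B.eh (tr a) (tr b)" "a \<in> M0" "b \<in> M0" "a < b"
  using snoc.prems by (auto simp: B.Wg_def)
 show ?case
 proof (cases "(a, b) = (c, Suc c)")
  case True
  hence [simp]: "x = fh" by (simp add: x(1) Transposition.transpose_def)
  have "prod_list w * fh \<in> asp (L1 \<union> range (%\<beta>. fh ^ \<beta>))"
  proof (rule asp_image[where h = "%u. u * fh"])
   fix u assume "u \<in> L1 \<union> range (%\<beta>. fh ^ \<beta>)"
   hence "u * fh \<in> L1 \<or> (\<exists>\<beta>. u * fh = fh ^ Suc \<beta>)"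
    using L1_fh by (auto simp: power_commutes)
   hence "u * fh \<in> L1 \<union> range (%\<beta>. fh ^ \<beta>)" by blast
   thus "u * fh \<in> asp (L1 \<union> range (%\<beta>. fh ^ \<beta>))" by (rule asp.base)
  qed (use snoc in "auto simp: distrib_right")
  thus ?thesis by simp
 next
  case False
  hence "x \<in> G1e"
   unfolding x(1) G1e_def using x tr_less[OF x(4)] permutes_in_image[OF tr_permutes] by blast
  hence "prod_list w * x \<in> L1" by (rule lid_base)
  thus ?thesis using asp.base[of "prod_list w * x"] by simp
 qed
qed

end


text \<open>\<open>\<nu>\<close> and \<open>ep\<close> are the parameters of the target of the
  reflection. By \<open>adm\<close>, every summand of \<open>zF\<close> contains an annihilation
  operator that can be moved to its right end.\<close>

locale simple_root_step = simple_root c for c +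
 fixes \<nu> :: "nat => complex" and ep :: "nat => bool"
 assumes adm: "ep c ==> ep (Suc c)"
begin

text \<open>The generators of I whose commutator with F stays in the left ideal they generate. Left
  out are the Cartan generators and the root vector \<open>eh c (Suc c)\<close>, whose commutators
  with F leave I.\<close>

definition G1 :: "B0 set" where
 "G1 = {Qc a k |a k. a \<in> M0 \<and> k \<in> N0 \<and> ep a} \<union>
  {Pc a k |a k. a \<in> M0 \<and> k \<in> N0 \<and> \<not> ep a} \<union> G1e"

abbreviation "L0 \<equiv> lid G1"

abbreviation I :: "B0 set" where "I \<equiv> B.IT \<nu> ep"
abbreviation K :: "B0 set" where "K \<equiv> B.KT \<nu> ep"

lemma L1_L0: "x \<in> L1 ==> x \<in> L0"
 unfolding lid_def by (rule asp_mono) (auto simp: G1_def intro!: asp.base)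

lemma L0_I: "x \<in> L0 ==> x \<in> I"
 unfolding lid_def B.IT_def
proof (erule asp_mono)
 show "{x * g |x g. g \<in> G1} \<subseteq> asp {r * s |s r. s \<in> B.Ig \<nu> ep}"
 proof
  fix y assume "y \<in> {x * g |x g. g \<in> G1}"
  then obtain x g where y: "y = x * g" "g \<in> G1" by blast
  from y(2) have "g \<in> B.Ig \<nu> ep" unfolding G1_def G1e_def B.Ig_def by blast
  thus "y \<in> asp {r * s |s r. s \<in> B.Ig \<nu> ep}"
   unfolding y(1) by (intro asp.base) blast
 qed
qed

lemma cm_F_G1: "g \<in> G1 ==> cm F g \<in> L0"
proof -
 note 0 = lid_zero[of G1]
 have g1: "g \<in> L0" "- g \<in> L0" if "g \<in> G1" for g
  using lid_base[OF that, of 1] lid_base[OF that, of "- 1"] by simp_all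
 assume "g \<in> G1"
 then consider a k where "g = Qc a k" "a \<in> M0" "k \<in> N0" "ep a"
  | a k where "g = Pc a k" "a \<in> M0" "k \<in> N0" "\<not> ep a"
  | a b where "g = B.eh a b" "a \<in> M0" "b \<in> M0" "a < b" "(a, b) \<noteq> (c, Suc c)"
  unfolding G1_def G1e_def by blast
 thus ?thesis
 proof cases
  case 1
  have "Qc (Suc c) k \<in> G1" if "ep c" using adm[OF that] c_range 1 unfolding G1_def by blast
  thus ?thesis using 1 c_range 0 g1 by (auto simp: B.eQ)
 next
  case 2
  have "Pc c k \<in> G1" if "\<not> ep (Suc c)" using adm that c_range 2 unfolding G1_def by blast
  thus ?thesis using 2 c_range 0 g1 by (auto simp: B.eP)
 next
  case 3
  have *: "B.eh u v \<in> G1" if "u \<in> M0" "v \<in> M0" "u < v" "(u, v) \<noteq> (c, Suc c)" for u v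
   using that unfolding G1_def G1e_def by blast
  show ?thesis
   using 3 c_range 0 g1 *[of "Suc c" b] *[of a c] by (auto simp: B.cm_e_eh)
 qed
qed

lemma cm_F_L0: "x \<in> L0 ==> cm F x \<in> L0"
 by (erule lid_hom) (simp_all add: cm_add cm_mult lid_base lid_lmult lid_add cm_F_G1)

lemma xiT_L0:
 assumes "x \<in> L0"
 shows "xiT x \<in> I"
proof -
 have "ad s x \<in> L0" for s by (induction s) (use assms cm_F_L0 in auto)
 hence "ad s x \<in> I" for s by (rule L0_I)
 thus ?thesis unfolding xiT_def by (intro B.IT_sum B.IT_lmult)
qed

text \<open>If \<open>ep c\<close> holds then so does \<open>ep (Suc c)\<close>, and the factor
  \<open>Qc (Suc c) k\<close>, which commutes with \<open>Pc c k\<close>, annihilates. Otherwise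
  \<open>Pc c k\<close> annihilates and already stands on the right.\<close>

lemma zF_I: "y * zF \<in> I"
proof -
 have "zF \<in> I"
 proof (cases "ep c")
  case True
  hence e: "ep (Suc c)" by (rule adm)
  have "Qc (Suc c) k * Pc c k \<in> I" if k: "k \<in> N0" for k
  proof -
   have "cm (Pc c k) (Qc (Suc c) k) = (0 :: B0)" using k c_range by (simp add: B.PQ)
   hence "Qc (Suc c) k * Pc c k = (Pc c k * Qc (Suc c) k :: B0)" by (simp add: cm_def)
   also have "\<dots> \<in> I" using e k c_range by (intro B.Ig_IT) (auto simp: B.Ig_def)
   finally show ?thesis .
  qed
  thus ?thesis unfolding B.z_def by (auto intro!: B.IT_sum)
 next
  case False
  hence "Qc (Suc c) k * Pc c k \<in> I" if "k \<in> N0" for k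
   using that c_range by (intro B.Ig_IT) (auto simp: B.Ig_def)
  thus ?thesis unfolding B.z_def by (auto intro!: B.IT_sum)
 qed
 thus ?thesis by (rule B.IT_lmult)
qed

context
 fixes Y :: B0 and \<beta> :: nat and Z :: B0
 assumes Y: "Y \<in> B.HD"
 defines "Z \<equiv> Y * fh ^ \<beta>"
begin

lemma ad_Y: "ad s Y \<in> B.HD"
 by (induction s) (use Y c_range B.HD_closed_cm in auto)

lemma cm_F_fh: "cm F fh = 0"
 using c_range by (simp add: B.cm_e_eh)

lemma cm_F_fh_pow: "cm F (fh ^ b) = 0"
 by (induction b) (simp_all add: cm_mult cm_F_fh)

lemma Z_AA: "Z \<in> B.AA"
 using B.HD_AA[OF Y] B.eh_AA[of "Suc c" c] c_range unfolding Z_def B.AA_def by (intro salg.mult salg_power)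

lemma ad_Z: "ad s Z = ad s Y * fh ^ \<beta>"
 by (induction s) (simp_all add: Z_def cm_mult cm_F_fh_pow)

text \<open>Since \<open>fh\<close> commutes with \<open>ad s Z\<close>, it can be written on the
  left as F - zF. Bringing zF back to the right costs \<open>ad (Suc s) Z\<close>, because zF and F
  have the same commutators with oscillator elements.\<close>

lemma ad_Z_fh: "ad s Z * fh = F * ad s Z - ad (Suc s) Z - ad s Z * zF"
proof -
 have fhY: "fh * ad s Y = ad s Y * fh"
  using B.eh_HD_comm[OF ad_Y] c_range by blast
 have zfh: "cm zF fh = 0" using c_range cm_swap[of zF fh] by simp
 have zfhp: "cm zF (fh ^ b) = 0" for b
  by (induction b) (simp_all add: cm_mult zfh)
 have "ad s Z * fh = ad s Y * fh * fh ^ \<beta>"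
  by (simp add: ad_Z mult.assoc power_commutes)
 also have "\<dots> = fh * ad s Z"
  by (simp add: ad_Z fhY[symmetric] mult.assoc)
 also have "\<dots> = F * ad s Z - (ad s Z * zF + cm zF (ad s Z))"
  by (simp add: B.eh_def left_diff_distrib cm_def)
 also have "cm zF (ad s Z) = cm F (ad s Y) * fh ^ \<beta>"
  using B.cm_e_HD[OF ad_Y c_range(2,1)] by (simp add: ad_Z cm_mult zfhp)
 also have "\<dots> = ad (Suc s) Z" using ad_Z[of "Suc s"] by simp
 finally show ?thesis by (simp add: algebra_simps)
qed

text \<open>By \<open>ad_Z_fh\<close> the series splits into the telescoping sum, which lies in J,
  and a sum ending in zF, which lies in I.\<close>

lemma xiT_Z_fh: "xiT (Z * fh) \<in> K"
proof -
 obtain N where N: "ad N Z = 0" using nilp Z_AA by blast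
 have adf: "ad s (Z * fh) = ad s Z * fh" for s
  by (induction s) (simp_all add: cm_mult cm_F_fh)
 have "xiT (Z * fh) = (\<Sum>s<Suc N. hc s * E ^ s * (ad s Z * fh))"
  unfolding adf[symmetric] by (rule xiT_eq[of N]) (use N adf in simp_all)
 also have "\<dots> = (\<Sum>s<Suc N. hc s * E ^ s * (F * ad s Z - ad (Suc s) Z)) - (\<Sum>s<Suc N. hc s * E ^ s * ad s Z * zF)"
  by (simp only: ad_Z_fh right_diff_distrib sum_subtractf mult.assoc)
 finally show ?thesis
  using telescope[OF N] B.IT_sum[of "{..<Suc N}" "%s. hc s * E ^ s * ad s Z * zF" \<nu> ep] zF_I
  by (simp only: B.KT_diff B.JT_KT B.IT_KT)
qed

text \<open>The commutator of F with the Cartan generator is a multiple of \<open>fh\<close>, so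
  \<open>ad_Z_fh\<close> applies again. A summation by parts leaves the multiple k = \<eta>(a) of
  the series itself, which turns the label \<nu> a + \<eta>(a) into \<nu> a; the Cartan factor then
  lies in I.\<close>

lemma xiT_Z_h:
 assumes a: "a \<in> M0"
 shows "xiT (Z * (B.eh a a - csc (\<nu> a + of_int (\<eta> a)))) \<in> K"
proof -
 obtain N where N: "ad N Z = 0" using nilp Z_AA by blast
 define k where "k = (of_int (\<eta> a) :: complex)"
 let ?k = "B.eh a a - csc (\<nu> a + k) :: B0"
 have Fk: "cm F ?k = csc k * fh"
  using a c_range by (auto simp: cm_diff B.cm_e_eh \<eta>_def k_def csc_uminus)
 have adk: "ad s (Z * ?k) = ad s Z * ?k + csc (k * of_nat s) * (ad (s - 1) Z * fh)" for s
 proof (induction s)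
  case (Suc s)
  have "csc (k * of_nat s) * (cm F (ad (s - 1) Z) * fh) = csc (k * of_nat s) * (ad s Z * fh)"
   by (cases s) simp_all
  thus ?case
   using Suc by (simp add: cm_add cm_mult Fk[unfolded csc_add] cm_F_fh csc_add distrib_left distrib_right csc_left_comm[of "ad s Z"])
 qed simp
 have "ad (Suc N) (Z * ?k) = 0"
  unfolding adk using N by simp
 hence "xiT (Z * ?k) = (\<Sum>s<Suc N. hc s * E ^ s * ad s (Z * ?k))"
  by (rule xiT_eq) simp
 also have "\<dots> = (\<Sum>s<Suc N. hc s * E ^ s * ad s Z) * ?k + (\<Sum>s<Suc N. csc (k * of_nat s) * (hc s * E ^ s * (ad (s - 1) Z * fh)))"
  by (simp only: adk distrib_left sum.distrib mult.assoc sum_distrib_right csc_left_comm[of "E ^ _"] csc_left_comm[of "hc _"])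
 also have "(\<Sum>s<Suc N. csc (k * of_nat s) * (hc s * E ^ s * (ad (s - 1) Z * fh))) =
   (\<Sum>s<N. csc (k * of_nat (Suc s)) * (hc (Suc s) * E ^ Suc s * (ad s Z * fh)))"
  by (subst sum.lessThan_Suc_shift) simp
 also have "\<dots> = (\<Sum>s<N. csc (k * of_nat (Suc s)) * (hc (Suc s) * E ^ Suc s * F * ad s Z - hc s * E ^ s * ad s Z)) +
   ((\<Sum>s<N. csc (k * of_nat (Suc s)) * (hc s * E ^ s * ad s Z)) -
   (\<Sum>s<N. csc (k * of_nat (Suc s)) * (hc (Suc s) * E ^ Suc s * ad (Suc s) Z))) -
   (\<Sum>s<N. csc (k * of_nat (Suc s)) * (hc (Suc s) * E ^ Suc s) * ad s Z * zF)"
  by (simp only: ad_Z_fh right_diff_distrib sum_subtractf mult.assoc) (simp add: algebra_simps)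
 also have "(\<Sum>s<N. csc (k * of_nat (Suc s)) * (hc (Suc s) * E ^ Suc s * ad (Suc s) Z)) =
   (\<Sum>s<N. csc (k * of_nat s) * (hc s * E ^ s * ad s Z))"
 proof -
  have "(\<Sum>s<Suc N. csc (k * of_nat s) * (hc s * E ^ s * ad s Z)) =
    (\<Sum>s<N. csc (k * of_nat (Suc s)) * (hc (Suc s) * E ^ Suc s * ad (Suc s) Z))"
   by (subst sum.lessThan_Suc_shift) (simp del: hc.simps power_Suc funpow.simps)
  thus ?thesis using N by simp
 qed
 also have "(\<Sum>s<N. csc (k * of_nat (Suc s)) * (hc s * E ^ s * ad s Z)) - (\<Sum>s<N. csc (k * of_nat s) * (hc s * E ^ s * ad s Z)) =
   csc k * (\<Sum>s<N. hc s * E ^ s * ad s Z)"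
  unfolding sum_subtractf[symmetric] sum_distrib_left
  by (intro sum.cong refl) (simp add: distrib_left csc_add distrib_right)
 also have "(\<Sum>s<Suc N. hc s * E ^ s * ad s Z) * ?k =
   (\<Sum>s<N. hc s * E ^ s * ad s Z) * (B.eh a a - csc (\<nu> a)) - csc k * (\<Sum>s<N. hc s * E ^ s * ad s Z)"
  using N by (simp add: csc_add right_diff_distrib distrib_left csc_comm[of k] algebra_simps)
 finally have "xiT (Z * ?k) = (\<Sum>s<N. hc s * E ^ s * ad s Z) * (B.eh a a - csc (\<nu> a)) +
   (\<Sum>s<N. csc (k * of_nat (Suc s)) * (hc (Suc s) * E ^ Suc s * F * ad s Z - hc s * E ^ s * ad s Z)) -
   (\<Sum>s<N. csc (k * of_nat (Suc s)) * (hc (Suc s) * E ^ Suc s) * ad s Z * zF)"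
  by (simp add: algebra_simps)
 moreover have "(\<Sum>s<N. hc s * E ^ s * ad s Z) * (B.eh a a - csc (\<nu> a)) \<in> K"
  using a by (intro B.IT_KT B.Ig_IT) (auto simp: B.Ig_def)
 moreover have "(\<Sum>s<N. csc (k * of_nat (Suc s)) * (hc (Suc s) * E ^ Suc s * F * ad s Z - hc s * E ^ s * ad s Z)) \<in> K"
  by (intro B.JT_KT B.JT_sum csc_JT absorb_F)
 moreover have "(\<Sum>s<N. csc (k * of_nat (Suc s)) * (hc (Suc s) * E ^ Suc s) * ad s Z * zF) \<in> K"
  by (intro B.IT_KT B.IT_sum zF_I)
 ultimately show ?thesis unfolding k_def by (simp only: B.KT_add B.KT_diff)
qed

end

lemma xiT_Hh:
 assumes "h \<in> B.Hh" "y \<in> B.AA" "xiT y \<in> K"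
 shows "xiT (h * y) \<in> K"
 using assms unfolding B.Hh_def
proof (induction arbitrary: y)
 case (csc z)
 thus ?case using Uh_KT[OF _ Uh_csc, of "xiT y" _ _ z] by (simp add: xiT_csc)
next
 case (base x)
 then obtain a where a: "x = ec a a" "a \<in> M0" by blast
 have "(ec a a + csc (of_int (\<eta> a))) * xiT y \<in> K"
  using a base by (intro Uh_KT Uh_add ec_Uh Uh_csc)
 from B.KT_add[OF B.JT_KT[OF xiT_ec[OF base(2) a(2)]] this] show ?case by (simp add: a(1))
next
 case (add u v)
 hence "u \<in> B.AA" "v \<in> B.AA" using B.Hh_AA by (auto simp: B.Hh_def)
 hence "u * y \<in> B.AA" "v * y \<in> B.AA" using add.prems unfolding B.AA_def by (auto intro: salg.mult)
 thus ?case using add by (simp add: distrib_right xiT_add B.KT_add)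
next
 case (mult u v)
 hence "v \<in> B.AA" using B.Hh_AA by (auto simp: B.Hh_def)
 hence "v * y \<in> B.AA" using mult.prems unfolding B.AA_def by (auto intro: salg.mult)
 thus ?case using mult by (simp add: mult.assoc)
qed

text \<open>Reduction of an arbitrary y to the elements Y fh^\<beta> by the spanning set for the
  reflected Borel subalgebra. Left factors E or from \<open>Xg\<close> send the series into J,
  Cartan factors come out by \<open>xiT_Hh\<close>, and the part of a word in \<open>L1\<close>
  stays there after multiplication by g.\<close>

lemma xiT_AA_gen:
 assumes y: "y \<in> B.AA" and gAA: "g \<in> B.AA"
  and L1: "!!x. x \<in> L1 ==> x * g \<in> L1"
  and Z: "!!Y \<beta>. Y \<in> B.HD ==> xiT (Y * fh ^ \<beta> * g) \<in> K"
 shows "xiT (y * g) \<in> K"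
proof -
 have fhAA: "fh ^ \<beta> \<in> B.AA" for \<beta>
  using B.eh_AA[of "Suc c" c] c_range unfolding B.AA_def by (intro salg_power)
 have mAA: "u * v \<in> B.AA" if "u \<in> B.AA" "v \<in> B.AA" for u v
  using that unfolding B.AA_def by (rule salg.mult)
 have R: "xiT (h * (Y * u) * g) \<in> K"
  if h: "h \<in> B.Hh" and Y: "Y \<in> B.HD" and u: "u \<in> asp (L1 \<union> range (%\<beta>. fh ^ \<beta>))" "u \<in> B.AA" for h Y u
 proof -
  have "\<exists>l v. u = l + v \<and> l \<in> L1 \<and> v \<in> asp (range (%\<beta>. fh ^ \<beta>))"
   using u(1)
  proof induction
   case zero
   show ?case by (rule exI[of _ 0], rule exI[of _ 0]) (simp add: lid_zero asp.zero)
  next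
   case (base x)
   have "0 \<in> L1" by (rule lid_zero)
   with base show ?case
    by (metis UnE add_0 add_0_right asp.base asp.zero)
  next
   case (add x y)
   then obtain l v l' v' where "x = l + v" "y = l' + v'" "l \<in> L1" "l' \<in> L1"
    "v \<in> asp (range (%\<beta>. fh ^ \<beta>))" "v' \<in> asp (range (%\<beta>. fh ^ \<beta>))" by blast
   thus ?case
    by (intro exI[of _ "l + l'"] exI[of _ "v + v'"]) (simp add: lid_add asp.add)
  next
   case (uminus x)
   then obtain l v where "x = l + v" "l \<in> L1" "v \<in> asp (range (%\<beta>. fh ^ \<beta>))" by blast
   thus ?case
    by (intro exI[of _ "- l"] exI[of _ "- v"]) (simp add: lid_uminus asp.uminus)
  qed
  then obtain l v where lv: "u = l + v" "l \<in> L1" "v \<in> asp (range (%\<beta>. fh ^ \<beta>))" by blast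
  have v: "v \<in> B.AA \<and> xiT (Y * v * g) \<in> K"
   using lv(3)
  proof induction
   case zero
   show ?case by (simp add: B.AA_def)
  next
   case (base x)
   thus ?case using fhAA Z[OF Y] by auto
  next
   case (add x y)
   thus ?case
    using B.HD_AA[OF Y] gAA by (simp add: distrib_left distrib_right xiT_add mAA B.KT_add) (simp add: B.AA_def salg.add)
  next
   case (uminus x)
   have "xiT (Y * - x * g) = csc (- 1) * xiT (Y * x * g)"
    using xiT_csc[of "Y * x * g" "- 1"] uminus B.HD_AA[OF Y] gAA by (simp add: mAA csc_uminus)
   thus ?case using uminus Uh_KT[OF _ Uh_csc, of "xiT (Y * x * g)" _ _ "- 1"] by (simp add: B.AA_def salg_uminus)
  qed
  have hAA: "h \<in> B.AA" "Y \<in> B.AA" using h Y B.Hh_AA B.HD_AA by auto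
  have lAA: "l \<in> B.AA" using lv(1) u(2) v salg_diff[of u B.Ag v] by (simp add: B.AA_def)
  have "xiT (h * (Y * v * g)) \<in> K"
   using v hAA gAA by (intro xiT_Hh[OF h]) (auto simp: mAA)
  moreover have "xiT (h * Y * (l * g)) \<in> K"
   by (rule B.IT_KT[OF xiT_L0[OF lid_lmult[OF L1_L0[OF L1[OF lv(2)]]]]])
  moreover have "h * (Y * u) * g = h * Y * (l * g) + h * (Y * v * g)"
   by (simp add: lv(1) algebra_simps)
  moreover have "h * Y * (l * g) \<in> B.AA" "h * (Y * v * g) \<in> B.AA"
   using hAA lAA v gAA by (auto simp: mAA)
  ultimately show ?thesis by (simp add: xiT_add B.KT_add)
 qed
 have "y \<in> B.AA \<and> xiT (y * g) \<in> K"
  using B.AA_span[OF tr_permutes y]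
 proof induction
  case zero
  show ?case by (simp add: B.AA_def)
 next
  case (base x)
  have xAA: "x \<in> B.AA" using B.span_gens_AA[OF tr_permutes base] .
  from base consider a b y where "x = ec (tr b) (tr a) * y" "a \<in> M0" "b \<in> M0" "a < b" "y \<in> B.AA"
   | h Y w where "x = h * (Y * prod_list w)" "h \<in> B.Hh" "Y \<in> B.HD" "set w \<subseteq> B.Wg tr"
   unfolding B.span_gens_def by blast
  hence "xiT (x * g) \<in> K"
  proof cases
   case 1
   have "xiT (ec (tr b) (tr a) * (y * g)) \<in> B.JT"
   proof (cases "(a, b) = (c, Suc c)")
    case True
    thus ?thesis using xiT_E[OF mAA[OF 1(5) gAA]] by (simp add: Transposition.transpose_def)
   next
    case False
    hence "ec (tr b) (tr a) \<in> Xg"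
     unfolding Xg_def using 1 tr_less[OF 1(4)] permutes_in_image[OF tr_permutes] by blast
    thus ?thesis using xiT_X mAA 1(5) gAA by blast
   qed
   thus ?thesis using 1(1) B.JT_KT by (simp add: mult.assoc)
  next
   case 2
   thus ?thesis
    using R[OF 2(2,3) fh_pow_span[OF 2(4)] B.Wg_AA[OF tr_permutes 2(4)]] by simp
  qed
  thus ?case using xAA by simp
 next
  case (add x y)
  thus ?case using gAA by (simp add: distrib_right xiT_add mAA B.KT_add) (simp add: B.AA_def salg.add)
 next
  case (uminus x)
  have "xiT (- x * g) = csc (- 1) * xiT (x * g)"
   using xiT_csc[of "x * g" "- 1"] uminus gAA by (simp add: mAA csc_uminus)
  thus ?case using uminus Uh_KT[OF _ Uh_csc, of "xiT (x * g)" _ _ "- 1"] by (simp add: B.AA_def salg_uminus)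
 qed
 thus ?thesis ..
qed

text \<open>\<sigma>_c sends a generator of I either into \<open>G1\<close>, or to \<open>fh\<close>
  (the image of \<open>eh c (Suc c)\<close>), or to a Cartan generator. The hypothesis on \<mu> says
  that \<nu> is obtained from \<mu> by the dot action of \<sigma>_c.\<close>

lemma th_Ig:
 assumes \<mu>: "!!a. a \<in> M0 ==> \<mu> (tr a) = \<nu> a + of_int (\<eta> a)"
  and s: "s \<in> B.Ig \<mu> (%a. ep (tr a))"
 shows "th (r * s) \<in> K"
proof -
 have tt: "tr (tr a) = a" for a by simp
 have rng: "tr a \<in> M0" if "a \<in> M0" for a
  using permutes_in_image[OF tr_permutes] that by blast
 have sAA: "sg tr s \<in> B.AA" and main: "!!y. y \<in> B.AA ==> xiT (y * sg tr s) \<in> K"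
 proof -
  consider (G1) "sg tr s \<in> G1" | (fh) "sg tr s = fh"
   | (h) a where "a \<in> M0" "sg tr s = B.eh a a - csc (\<nu> a + of_int (\<eta> a))"
  proof -
   consider a k where "s = Qc a k" "a \<in> M0" "k \<in> N0" "ep (tr a)"
    | a k where "s = Pc a k" "a \<in> M0" "k \<in> N0" "\<not> ep (tr a)"
    | a b where "s = B.eh a b" "a \<in> M0" "b \<in> M0" "a < b"
    | a where "s = B.eh a a - csc (\<mu> a)" "a \<in> M0"
    using s unfolding B.Ig_def by blast
   thus thesis
   proof cases
    case 1
    hence "sg tr s \<in> G1"
     unfolding G1_def using rng by (auto simp: sg_Qc[OF tr_permutes])
    thus thesis by (rule that)
   next
    case 2
    hence "sg tr s \<in> G1"
     unfolding G1_def using rng by (auto simp: sg_Pc[OF tr_permutes])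
    thus thesis by (rule that)
   next
    case 3
    show thesis
    proof (cases "(a, b) = (c, Suc c)")
     case True
     hence "sg tr s = fh"
      using 3 by (simp add: sg_eh[OF tr_permutes] Transposition.transpose_def)
     thus thesis by (rule that)
    next
     case False
     hence "sg tr s \<in> G1"
      using 3 tr_less[OF 3(4)] rng unfolding G1_def G1e_def
      by (simp only: sg_eh[OF tr_permutes]) blast
     thus thesis by (rule that)
    qed
   next
    case 4
    have "sg tr s = B.eh (tr a) (tr a) - csc (\<nu> (tr a) + of_int (\<eta> (tr a)))"
     using 4 \<mu>[OF rng[OF 4(2)]] by (simp add: sg_hom[OF tr_permutes] sg_eh[OF tr_permutes])
    thus thesis using that(3) rng[OF 4(2)] by blast
   qed
  qed
  hence "sg tr s \<in> B.AA \<and> (\<forall>y\<in>B.AA. xiT (y * sg tr s) \<in> K)"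
  proof cases
   case G1
   have "g \<in> B.AA" if "g \<in> G1" for g
    using that B.P_HD B.Q_HD B.HD_AA B.eh_AA unfolding G1_def G1e_def by blast
   thus ?thesis using G1 xiT_L0[OF lid_base] B.IT_KT by blast
  next
   case fh
   have AA: "fh \<in> B.AA" using B.eh_AA c_range by blast
   show ?thesis
    unfolding fh using AA xiT_AA_gen[OF _ AA L1_fh xiT_Z_fh] by blast
  next
   case h
   have AA: "B.eh a a - csc (\<nu> a + of_int (\<eta> a)) \<in> B.AA"
    using B.eh_AA[OF h(1,1)] unfolding B.AA_def by (intro salg_diff salg.csc)
   show ?thesis
    unfolding h(2) using AA xiT_AA_gen[OF _ AA L1_h[OF _ h(1)] xiT_Z_h[OF _ h(1)]] by blast
  qed
  thus "sg tr s \<in> B.AA" "!!y. y \<in> B.AA ==> xiT (y * sg tr s) \<in> K" by auto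
 qed
 have "xib (sg tr r * sg tr s) \<in> K"
 proof (rule xib_closed[of _ "{y * sg tr s |y. y \<in> B.AA}"])
  show "y \<in> B.AA \<and> xiT y \<in> K" if "y \<in> {y * sg tr s |y. y \<in> B.AA}" for y
   using that main sAA by (auto simp: B.AA_def salg.mult)
  show "sg tr r * sg tr s \<in> asp {t * y |t y. t \<in> Uh \<and> y \<in> {y * sg tr s |y. y \<in> B.AA}}"
   using B0_span[of "sg tr r"]
  proof (rule asp_image)
   fix x assume "x \<in> {t * y |t y. t \<in> Uh \<and> y \<in> B.AA}"
   then obtain t y where "x = t * y" "t \<in> Uh" "y \<in> B.AA" by blast
   hence "x * sg tr s = t * (y * sg tr s)" "t \<in> Uh" "y \<in> B.AA" by (simp_all add: mult.assoc)
   thus "x * sg tr s \<in> asp {t * y |t y. t \<in> Uh \<and> y \<in> {y * sg tr s |y. y \<in> B.AA}}"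
    by (intro asp.base) blast
  qed (simp add: distrib_right)
 qed (auto simp: B.KT_add Uh_KT B.JT_KT)
 thus ?thesis by (simp add: th_def sg_hom[OF tr_permutes])
qed

lemma th_KT:
 assumes \<mu>: "!!a. a \<in> M0 ==> \<mu> (tr a) = \<nu> a + of_int (\<eta> a)"
  and x: "x \<in> B.KT \<mu> (%a. ep (tr a))"
 shows "th x \<in> K"
 using x
proof (induction rule: B.KT_induct)
 case zero
 show ?case using th_JT[of 0] B.JT_KT by simp
next
 case (J s r)
 thus ?case using th_Jg B.JT_KT by blast
next
 case (I s r)
 thus ?case using th_Ig \<mu> by blast
next
 case (add x y)
 thus ?case using B.KT_add[OF B.JT_KT[OF th_add[of x y]] B.KT_add[of "th x" \<nu> ep "th y"]] by simp
next
 case (uminus x)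
 thus ?case using B.KT_diff[OF B.JT_KT[OF th_uminus[of x]], of "th x"] by simp
qed

end

section \<open>Highest weight vectors\<close>

lemma prod_list_mset_cong:
 fixes f :: "'b => 'r::monoid_mult"
 assumes "mset xs = mset ys" "!!x y. x \<in> set xs ==> y \<in> set xs ==> f x * f y = f y * f x"
 shows "prod_list (map f xs) = prod_list (map f ys)"
 using assms
proof (induction xs arbitrary: ys)
 case (Cons x xs)
 hence "x \<in> set ys" by (metis list.set_intros(1) set_mset_mset)
 then obtain us vs where ys: "ys = us @ x # vs" by (meson split_list)
 have "mset xs = mset (us @ vs)" using Cons.prems(1) ys by simp
 moreover have "set (us @ vs) \<subseteq> set xs" using calculation by (metis order_refl set_mset_mset)
 hence "set us \<subseteq> set xs" by simp
 hence "prod_list (map f us) * f x = f x * prod_list (map f us)"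
 proof (induction us)
  case (Cons u us)
  hence "f u * f x = f x * f u" using \<open>!!x' y. x' \<in> set (x # xs) ==> y \<in> set (x # xs) ==> f x' * f y = f y * f x'\<close> by simp
  thus ?case using Cons by (simp add: mult.assoc) (simp flip: mult.assoc)
 qed simp
 moreover have "prod_list (map f xs) = prod_list (map f (us @ vs))"
  using calculation(1) Cons.prems(2) by (intro Cons.IH) auto
 ultimately show ?case by (simp add: ys mult.assoc) (simp flip: mult.assoc)
qed simp

context osc
begin

text \<open>Creation operators for the pattern \<open>ep\<close>: the rows marked by
  \<open>ep\<close> are annihilated by \<open>Q\<close>, hence created by \<open>P\<close>, and the
  others conversely.\<close>

definition cr :: "(nat => bool) => nat \<times> nat => 'r" where
 "cr ep x = (if ep (fst x) then P (fst x) (snd x) else Q (fst x) (snd x))"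

definition an :: "(nat => bool) => nat \<times> nat => 'r" where
 "an ep x = (if ep (fst x) then Q (fst x) (snd x) else P (fst x) (snd x))"

definition mon :: "(nat => bool) => (nat \<times> nat) list => 'r" where
 "mon ep w = prod_list (map (cr ep) w)"

abbreviation idx :: "(nat \<times> nat) set" where
 "idx \<equiv> {1..m} \<times> {1..n}"

definition sgnep :: "(nat => bool) => nat => complex" where
 "sgnep ep a = (if ep a then - 1 else 1)"

definition cnt :: "nat => (nat \<times> nat) list => nat" where
 "cnt a w = length (filter (%x. fst x = a) w)"

lemma mon_Nil [simp]: "mon ep [] = 1" and mon_Cons [simp]: "mon ep (x # w) = cr ep x * mon ep w"
 and mon_append: "mon ep (u @ w) = mon ep u * mon ep w"
 by (simp_all add: mon_def)

lemma cr_comm: "x \<in> idx ==> y \<in> idx ==> cr ep x * cr ep y = cr ep y * cr ep x"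
 by (auto simp: cr_def PP QQ PQ QP simp flip: cm_eq_0_iff)

lemma mon_mset:
 assumes "mset u = mset w" "set u \<subseteq> idx"
 shows "mon ep u = mon ep w"
 unfolding mon_def using assms by (intro prod_list_mset_cong cr_comm) (blast intro: subsetD)+

lemma cr_HD: "x \<in> idx ==> cr ep x \<in> HD"
 by (auto simp: cr_def P_HD Q_HD)

lemma mon_HD: "set w \<subseteq> idx ==> mon ep w \<in> HD"
 by (induction w) (use cr_HD in "auto simp: HD_def salg.mult")

lemma an_IT: "x \<in> idx ==> y * an ep x \<in> IT \<mu> ep"
 by (rule Ig_IT) (auto simp: an_def Ig_def)

lemma an_cr: "x \<in> idx ==> y \<in> idx ==> \<exists>k. cm (an ep x) (cr ep y) = csc k"
proof -
 assume "x \<in> idx" "y \<in> idx"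
 hence "cm (an ep x) (cr ep y) = csc (if x = y then if ep (fst y) then - 1 else 1 else 0)"
  by (auto simp: an_def cr_def PP QQ PQ QP csc_uminus prod_eq_iff)
 thus ?thesis ..
qed

definition monspan :: "(nat => complex) => (nat => bool) => 'r set" where
 "monspan \<mu> ep = asp ({csc k * mon ep w |k w. set w \<subseteq> idx} \<union> KT \<mu> ep)"

lemma monspan_KT: "x \<in> KT \<mu> ep ==> x \<in> monspan \<mu> ep"
 unfolding monspan_def by (rule asp.base) blast

lemma monspan_add: "x \<in> monspan \<mu> ep ==> y \<in> monspan \<mu> ep ==> x + y \<in> monspan \<mu> ep"
 by (simp add: monspan_def asp.add)

text \<open>Normal ordering: an annihilation operator passes a creation operator up to a scalar and
  lies in I when it arrives at the right end.\<close>

lemma HD_monspan: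
 assumes "y \<in> HD"
 shows "y \<in> asp ({csc k * mon ep w |k w. set w \<subseteq> idx} \<union> IT \<mu> ep)" (is "_ \<in> ?S")
proof -
 have mon: "csc k * mon ep w \<in> ?S" if "set w \<subseteq> idx" for k w
  using that by (intro asp.base) blast
 have IT: "x \<in> ?S" if "x \<in> IT \<mu> ep" for x
  using that by (intro asp.base) blast
 have closed: "x * s \<in> ?S" if s: "s \<in> ?S" and x: "!!w. set w \<subseteq> idx ==> x * mon ep w \<in> ?S" for s x
  using s
 proof (rule asp_image)
  fix u assume "u \<in> {csc k * mon ep w |k w. set w \<subseteq> idx} \<union> IT \<mu> ep"
  then consider k w where "u = csc k * mon ep w" "set w \<subseteq> idx" | "u \<in> IT \<mu> ep" by blast
  thus "x * u \<in> ?S"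
  proof cases
   case 1
   have "csc k * (x * mon ep w) \<in> ?S"
    using x[OF 1(2)]
   proof (rule asp_image)
    fix v assume "v \<in> {csc k * mon ep w |k w. set w \<subseteq> idx} \<union> IT \<mu> ep"
    then consider l w where "v = csc l * mon ep w" "set w \<subseteq> idx" | "v \<in> IT \<mu> ep" by blast
    thus "csc k * v \<in> ?S"
    proof cases
     case 1
     thus ?thesis using mon[of w "k * l"] by (simp add: csc_mult mult.assoc)
    next
     case 2
     thus ?thesis by (intro IT IT_lmult)
    qed
   qed (simp add: distrib_left)
   thus ?thesis unfolding 1(1) by (simp add: csc_left_comm)
  next
   case 2
   thus ?thesis by (intro IT IT_lmult)
  qed
 qed (simp add: distrib_left)
 have cr: "cr ep x * s \<in> ?S" if "x \<in> idx" "s \<in> ?S" for x s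
  using that(2)
 proof (rule closed)
  fix w assume "set w \<subseteq> idx"
  thus "cr ep x * mon ep w \<in> ?S" using mon[of "x # w" 1] that(1) by simp
 qed
 have an: "an ep x * s \<in> ?S" if x: "x \<in> idx" and "s \<in> ?S" for x s
  using that(2)
 proof (rule closed)
  fix w assume "set w \<subseteq> idx"
  thus "an ep x * mon ep w \<in> ?S"
  proof (induction w)
   case Nil
   show ?case using IT[OF an_IT[OF x, of 1]] by simp
  next
   case (Cons y w)
   then obtain k where k: "cm (an ep x) (cr ep y) = csc k" using an_cr[OF x, of y] by auto
   have "an ep x * mon ep (y # w) = cr ep y * (an ep x * mon ep w) + csc k * mon ep w"
    using cm_swap_mult[of "an ep x" "cr ep y"] k by (simp add: distrib_right flip: mult.assoc)
   moreover have "cr ep y * (an ep x * mon ep w) \<in> ?S" "csc k * mon ep w \<in> ?S"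
    using Cons mon cr by auto
   ultimately show ?case by (simp only: asp.add)
  qed
 qed
 have "y * s \<in> ?S" if "s \<in> ?S" for s
  using assms that unfolding HD_def
 proof (induction arbitrary: s)
  case (csc k)
  show ?case
   using csc by (rule closed) (rule mon)
 next
  case (base x)
  then obtain a where "a \<in> idx" "x = cr ep a \<or> x = an ep a"
   unfolding HDg_def by (auto simp: cr_def an_def)
  thus ?case using cr an base.prems by blast
 next
  case (add x y)
  thus ?case by (simp add: distrib_right asp.add)
 next
  case (mult x y)
  thus ?case by (simp add: mult.assoc)
 qed
 moreover have "1 \<in> ?S" using mon[of "[]" 1] by simp
 ultimately have "y * 1 \<in> ?S" by blast
 thus ?thesis by simp
qed

lemma HD_monspan': "y \<in> HD ==> y \<in> monspan \<mu> ep"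
 unfolding monspan_def by (rule asp_mono[OF HD_monspan[of y ep \<mu>]]) (use IT_KT in "auto intro: asp.base")

lemma e_HD:
 assumes "Y \<in> HD" "a \<in> {1..m}"
 shows "e a a * Y - (csc (\<mu> a) * Y + z a a * Y) \<in> IT \<mu> ep"
proof -
 have "e a a * Y = eh a a * Y + z a a * Y" by (simp add: eh_def algebra_simps)
 also have "eh a a * Y = Y * eh a a" using eh_HD_comm assms by blast
 finally have "e a a * Y - (csc (\<mu> a) * Y + z a a * Y) = Y * (eh a a - csc (\<mu> a))"
  by (simp add: right_diff_distrib csc_comm)
 also have "\<dots> \<in> IT \<mu> ep" using assms by (intro Ig_IT) (auto simp: Ig_def)
 finally show ?thesis .
qed

lemma Hh_HD:
 assumes "h \<in> Hh" "Y \<in> HD"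
 shows "\<exists>Y'\<in>HD. h * Y - Y' \<in> IT \<mu> ep"
 using assms unfolding Hh_def
proof (induction arbitrary: Y)
 case (csc k)
 hence "csc k * Y \<in> HD" unfolding HD_def by (intro salg.mult salg.csc)
 thus ?case by (intro bexI[of _ "csc k * Y"]) auto
next
 case (base x)
 then obtain a where a: "x = e a a" "a \<in> {1..m}" by blast
 have "csc (\<mu> a) * Y + z a a * Y \<in> HD"
  using z_HD[OF a(2,2)] base unfolding HD_def by (intro salg.add salg.mult salg.csc)
 thus ?case using e_HD[OF base(2) a(2)] a(1) by blast
next
 case (add x y)
 then obtain Y1 Y2 where "Y1 \<in> HD" "Y2 \<in> HD" "x * Y - Y1 \<in> IT \<mu> ep" "y * Y - Y2 \<in> IT \<mu> ep" by blast
 moreover have "(x + y) * Y - (Y1 + Y2) = (x * Y - Y1) + (y * Y - Y2)" by (simp add: algebra_simps)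
 ultimately show ?case
  by (intro bexI[of _ "Y1 + Y2"]) (simp_all only: IT_add HD_def salg.add)
next
 case (mult x y)
 then obtain Y1 where "Y1 \<in> HD" "y * Y - Y1 \<in> IT \<mu> ep" by blast
 moreover then obtain Y2 where "Y2 \<in> HD" "x * Y1 - Y2 \<in> IT \<mu> ep" using mult.IH by blast
 moreover have "x * y * Y - Y2 = x * (y * Y - Y1) + (x * Y1 - Y2)" by (simp add: algebra_simps)
 ultimately show ?case
  by (intro bexI[of _ Y2]) (simp_all only: IT_add IT_lmult)
qed

text \<open>In the spanning set for the identity, a left factor from n lies in J and a word ending
  in an element of n' lies in I. What remains is a Cartan factor times an oscillator element, and
  the former acts through scalars and HD by \<open>Hh_HD\<close>.\<close>

lemma AA_monspan:
 assumes "y \<in> AA"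
 shows "y \<in> monspan \<mu> ep"
 unfolding monspan_def
proof (rule asp_mono[OF AA_span[OF permutes_id assms]], rule subsetI, fold monspan_def)
 fix x assume "x \<in> span_gens id"
 then consider a b y where "x = e b a * y" "a \<in> {1..m}" "b \<in> {1..m}" "a < b" "y \<in> AA"
  | h Y w where "x = h * (Y * prod_list w)" "h \<in> Hh" "Y \<in> HD" "set w \<subseteq> Wg id"
  unfolding span_gens_def by auto
 thus "x \<in> monspan \<mu> ep"
 proof cases
  case 1
  thus ?thesis using e_JT[of a b y] JT_KT monspan_KT by blast
 next
  case 2
  show ?thesis
  proof (cases w rule: rev_cases)
   case Nil
   obtain Y' where Y': "Y' \<in> HD" "h * Y - Y' \<in> IT \<mu> ep" using Hh_HD[OF 2(2,3)] by blast
   have "x = Y' + (h * Y - Y')" using 2(1) Nil by simp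
   thus ?thesis
    using HD_monspan'[OF Y'(1)] monspan_KT[OF IT_KT[OF Y'(2)]] by (simp only: monspan_add)
  next
   case (snoc u g)
   hence "g \<in> Ig \<mu> ep" using 2(4) by (auto simp: Wg_def Ig_def)
   hence "x \<in> IT \<mu> ep"
    using Ig_IT[of g \<mu> ep "h * (Y * prod_list u)"] 2(1) snoc by (simp add: mult.assoc)
   thus ?thesis by (intro monspan_KT IT_KT)
  qed
 qed
qed

text \<open>The grading element \<open>Dg\<close> gives \<open>Q a i\<close> degree \<open>i\<close> and \<open>P a i\<close> degree \<open>- i\<close>.\<close>

definition Dg :: 'r where
 "Dg = (\<Sum>a=1..m. \<Sum>i=1..n. csc (of_nat i) * (Q a i * P a i))"

lemma cm_Dg_Q: "a \<in> {1..m} ==> i \<in> {1..n} ==> cm Dg (Q a i) = csc (of_nat i) * Q a i"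
 and cm_Dg_P: "a \<in> {1..m} ==> i \<in> {1..n} ==> cm Dg (P a i) = - (csc (of_nat i) * P a i)"
proof -
 assume r: "a \<in> {1..m}" "i \<in> {1..n}"
 have "cm Dg (Q a i) = (\<Sum>b=1..m. \<Sum>j=1..n. if b = a then (if j = i then csc (of_nat i) * Q a i else 0) else 0)"
  unfolding Dg_def cm_sum_left
  by (intro sum.cong refl) (use r in "auto simp: cm_mult_left PQ QQ")
 also have "\<dots> = (\<Sum>b=1..m. if b = a then csc (of_nat i) * Q a i else 0)"
  by (intro sum.cong refl) (use r in auto)
 finally show "cm Dg (Q a i) = csc (of_nat i) * Q a i" using r by simp
 have "cm Dg (P a i) = (\<Sum>b=1..m. \<Sum>j=1..n. if b = a then (if j = i then - (csc (of_nat i) * P a i) else 0) else 0)"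
  unfolding Dg_def cm_sum_left
  by (intro sum.cong refl) (use r in "auto simp: cm_mult_left QP PP")
 also have "\<dots> = (\<Sum>b=1..m. if b = a then - (csc (of_nat i) * P a i) else 0)"
  by (intro sum.cong refl) (use r in auto)
 finally show "cm Dg (P a i) = - (csc (of_nat i) * P a i)" using r by simp
qed

lemma Dg_HD: "Dg \<in> HD"
 using P_HD Q_HD unfolding Dg_def HD_def by (auto intro!: salg_intros)

text \<open>gl_m acts on the row indices while \<open>Dg\<close> measures the column index; and
  \<open>Dg\<close>, being an oscillator element, commutes with \<open>eh\<close>.\<close>

lemma cm_Dg_e:
 assumes "a \<in> {1..m}" "b \<in> {1..m}"
 shows "cm Dg (e a b) = 0"
proof -
 have "cm Dg (z a b) = (\<Sum>k=1..n. cm Dg (Q a k) * P b k + Q a k * cm Dg (P b k))"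
  by (simp add: z_def cm_add cm_sum cm_mult)
 also have "\<dots> = 0"
  by (intro sum.neutral ballI) (use assms in \<open>simp add: cm_Dg_Q cm_Dg_P mult.assoc csc_left_comm[of "Q a _"]\<close>)
 finally have "cm Dg (z a b) = 0" .
 moreover have "cm Dg (eh a b) = 0"
  using cm_eh_HD[OF Dg_HD assms] cm_swap[of Dg] by simp
 ultimately show ?thesis by (simp add: eh_def cm_diff)
qed

lemma mon_eigen:
 assumes cr: "!!x. x \<in> idx ==> cm u (cr ep x) = csc (ev x) * cr ep x"
  and vac: "!!y. y \<in> HD ==> y * u - csc k * y \<in> IT \<mu> ep" and w: "set w \<subseteq> idx"
 shows "u * mon ep w - csc (k + sum_list (map ev w)) * mon ep w \<in> IT \<mu> ep"
proof -
 have "cm u (mon ep w) = csc (sum_list (map ev w)) * mon ep w"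
  using w by (induction w) (simp_all add: cm_mult cr csc_add distrib_right mult.assoc csc_left_comm[of "cr _ _"])
 hence "u * mon ep w - csc (k + sum_list (map ev w)) * mon ep w = mon ep w * u - csc k * mon ep w"
  using cm_swap_mult[of u "mon ep w"] by (simp add: csc_add distrib_right)
 thus ?thesis using vac[OF mon_HD[OF w]] by simp
qed

text \<open>For \<open>ep a\<close> the annihilator is the left factor, and Q P = P Q - 1 produces
  the eigenvalue -1 on the vacuum.\<close>

lemma QP_vac:
 assumes "a \<in> {1..m}" "i \<in> {1..n}"
 shows "y * (Q a i * P a i) - csc (if ep a then - 1 else 0) * y \<in> IT \<mu> ep"
proof (cases "ep a")
 case True
 have "y * (Q a i * P a i) - csc (- 1) * y = (y * P a i) * an ep (a, i)"
  using True PQ[OF assms(1,1,2,2)] by (simp add: an_def cm_def csc_uminus algebra_simps)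
 thus ?thesis using an_IT[of "(a, i)" "y * P a i"] True assms by simp
next
 case False
 have "y * (Q a i * P a i) = (y * Q a i) * an ep (a, i)"
  using False by (simp add: an_def mult.assoc)
 thus ?thesis using an_IT[of "(a, i)" "y * Q a i"] False assms by simp
qed

text \<open>Weight of a monomial with k factors from row a. For \<open>ep a\<close> the n vacuum
  values -1 turn the constant n/2 in \<zeta> into -n/2, so the constant and the contribution of the
  factors have the same sign.\<close>

definition hwt :: "(nat => complex) => (nat => bool) => nat => nat => complex" where
 "hwt \<mu> ep a k = \<mu> a + sgnep ep a * (of_nat n / 2 + of_nat k)"

lemma e_mon:
 assumes w: "set w \<subseteq> idx" and a: "a \<in> {1..m}"
 shows "e a a * mon ep w - csc (hwt \<mu> ep a (cnt a w)) * mon ep w \<in> IT \<mu> ep"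
proof -
 let ?ev = "%x. if fst x = a then sgnep ep a else 0"
 have vac: "y * e a a - csc (\<mu> a + sgnep ep a * (of_nat n / 2)) * y \<in> IT \<mu> ep" for y
 proof -
  have "y * e a a - csc (\<mu> a + sgnep ep a * (of_nat n / 2)) * y =
    y * (eh a a - csc (\<mu> a)) + (\<Sum>k=1..n. y * (Q a k * P a k) - csc (if ep a then - 1 else 0) * y)"
  proof -
   have "csc (sgnep ep a * (of_nat n / 2)) * y = csc (of_nat n / 2) * y + (\<Sum>k=1..n. csc (if ep a then - 1 else 0) * y)"
    by (simp add: sgnep_def sum_distrib_right[symmetric] csc_sum[symmetric] distrib_right[symmetric] csc_add[symmetric])
   thus ?thesis
    by (simp add: eh_def z_def algebra_simps sum_subtractf sum_distrib_left csc_add csc_comm[of _ y])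
  qed
  moreover have "y * (eh a a - csc (\<mu> a)) \<in> IT \<mu> ep"
   using a by (intro Ig_IT) (auto simp: Ig_def)
  moreover have "(\<Sum>k=1..n. y * (Q a k * P a k) - csc (if ep a then - 1 else 0) * y) \<in> IT \<mu> ep"
   using QP_vac a by (intro IT_sum) blast
  ultimately show ?thesis by (simp only: IT_add)
 qed
 have "e a a * mon ep w - csc (\<mu> a + sgnep ep a * (of_nat n / 2) + sum_list (map ?ev w)) * mon ep w \<in> IT \<mu> ep"
  using vac w by (intro mon_eigen)
   (use a in "auto simp: cr_def eQ eP sgnep_def csc_uminus")
 moreover have "sum_list (map ?ev w) = sgnep ep a * of_nat (cnt a w)"
  by (induction w) (simp_all add: cnt_def algebra_simps)
 ultimately show ?thesis by (simp add: hwt_def algebra_simps)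
qed

definition dvac :: "(nat => bool) => complex" where
 "dvac ep = (\<Sum>a=1..m. \<Sum>i=1..n. of_nat i * (if ep a then - 1 else 0))"

definition dgw :: "(nat => bool) => (nat \<times> nat) list => complex" where
 "dgw ep w = (\<Sum>x\<leftarrow>w. sgnep ep (fst x) * of_nat (snd x))"

lemma Dg_mon:
 assumes w: "set w \<subseteq> idx"
 shows "Dg * mon ep w - csc (dvac ep + dgw ep w) * mon ep w \<in> IT \<mu> ep"
 unfolding dgw_def
proof (rule mon_eigen[OF _ _ w])
 show "cm Dg (cr ep x) = csc (sgnep ep (fst x) * of_nat (snd x)) * cr ep x" if "x \<in> idx" for x
  using that by (auto simp: cr_def cm_Dg_Q cm_Dg_P sgnep_def csc_uminus)
 fix y
 have "y * Dg - csc (dvac ep) * y =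
   (\<Sum>a=1..m. \<Sum>i=1..n. csc (of_nat i) * (y * (Q a i * P a i) - csc (if ep a then - 1 else 0) * y))"
  unfolding Dg_def dvac_def csc_sum sum_distrib_left sum_distrib_right sum_subtractf[symmetric]
  by (intro sum.cong refl) (simp add: right_diff_distrib csc_mult mult.assoc csc_left_comm[of y])
 also have "\<dots> \<in> IT \<mu> ep"
  using QP_vac by (intro IT_sum IT_lmult) blast
 finally show "y * Dg - csc (dvac ep) * y \<in> IT \<mu> ep" .
qed

lemma KT_lmult_comm:
 assumes "!!a b. a \<in> {1..m} ==> b \<in> {1..m} ==> cm u (e a b) = 0" "x \<in> KT \<mu> ep"
 shows "u * x \<in> KT \<mu> ep"
 using assms(2)
proof (induction rule: KT_induct)
 case (J s r)
 then obtain a b where s: "s = e b a" "a \<in> {1..m}" "b \<in> {1..m}" "a < b" unfolding Jg_def by blast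
 hence "u * (s * r) = e b a * (u * r)"
  using assms(1)[of b a] by (simp add: cm_eq_0_iff) (simp flip: mult.assoc)
 thus ?case using e_JT[of a b "u * r"] s JT_KT by simp
next
 case (I s r)
 thus ?case using Ig_IT[of s \<mu> ep "u * r"] IT_KT by (simp add: mult.assoc)
qed (simp_all add: distrib_left KT_add KT_uminus)

lemma e_KT:
 assumes "a \<in> {1..m}" "x \<in> KT \<mu> ep"
 shows "e a a * x \<in> KT \<mu> ep"
 using assms(2)
proof (induction rule: KT_induct)
 case (J s r)
 then obtain b d where s: "s = e d b" "b \<in> {1..m}" "d \<in> {1..m}" "b < d" unfolding Jg_def by blast
 have "e a a * s = s * e a a + cm (e a a) s" by (rule cm_swap_mult)
 also have "cm (e a a) s = s * csc ((if a = d then 1 else 0) - (if a = b then 1 else 0))"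
  using s assms(1) by (auto simp: gl csc_uminus)
 finally have "e a a * (s * r) = s * (e a a * r + csc ((if a = d then 1 else 0) - (if a = b then 1 else 0)) * r)"
  by (simp add: distrib_left distrib_right flip: mult.assoc)
 thus ?case using e_JT[OF s(2-4)] s(1) JT_KT by simp
next
 case (I s r)
 thus ?case using Ig_IT[of s \<mu> ep "e a a * r"] IT_KT by (simp add: mult.assoc)
qed (simp_all add: distrib_left KT_add KT_uminus)

text \<open>A joint eigenvector for operators preserving \<open>KT\<close> is congruent to a combination of the
 monomials with the same eigenvalues: all others are removed by factors \<open>(u - ev)/(\<theta> - ev)\<close>.\<close>

lemma eigen_separation:
 fixes opr :: "'i => 'r"
 assumes "x \<in> monspan \<mu> ep"
  and ops: "!!u w. u \<in> U ==> set w \<subseteq> idx ==> opr u * mon ep w - csc (ev u w) * mon ep w \<in> KT \<mu> ep"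
  and KT: "!!u x. u \<in> U ==> x \<in> KT \<mu> ep ==> opr u * x \<in> KT \<mu> ep"
  and x: "!!u. u \<in> U ==> opr u * x - csc (\<theta> u) * x \<in> KT \<mu> ep"
 shows "\<exists>S c. finite S \<and> (\<forall>w\<in>S. set w \<subseteq> idx \<and> (\<forall>u\<in>U. ev u w = \<theta> u)) \<and>
  x - (\<Sum>w\<in>S. csc (c w) * mon ep w) \<in> KT \<mu> ep"
proof -
 have "\<exists>S c. finite S \<and> (\<forall>w\<in>S. set w \<subseteq> idx) \<and> x - (\<Sum>w\<in>S. csc (c w) * mon ep w) \<in> KT \<mu> ep"
  using assms(1) unfolding monspan_def
 proof induction
  case zero
  show ?case by (rule exI[of _ "{}"]) simp
 next
  case (base x)
  thus ?case
  proof
   assume "x \<in> {csc k * mon ep w |k w. set w \<subseteq> idx}"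
   then obtain k w where "x = csc k * mon ep w" "set w \<subseteq> idx" by blast
   thus ?thesis by (intro exI[of _ "{w}"] exI[of _ "%_. k"]) simp
  next
   assume "x \<in> KT \<mu> ep"
   thus ?thesis by (intro exI[of _ "{}"]) simp
  qed
 next
  case (add x y)
  then obtain S c T d where *: "finite S" "\<forall>w\<in>S. set w \<subseteq> idx" "x - (\<Sum>w\<in>S. csc (c w) * mon ep w) \<in> KT \<mu> ep"
   "finite T" "\<forall>w\<in>T. set w \<subseteq> idx" "y - (\<Sum>w\<in>T. csc (d w) * mon ep w) \<in> KT \<mu> ep"
   by blast
  define f where "f w = (if w \<in> S then c w else 0) + (if w \<in> T then d w else 0)" for w
  have "(\<Sum>w\<in>S. csc (c w) * mon ep w) = (\<Sum>w\<in>S \<union> T. csc (if w \<in> S then c w else 0) * mon ep w)"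
   "(\<Sum>w\<in>T. csc (d w) * mon ep w) = (\<Sum>w\<in>S \<union> T. csc (if w \<in> T then d w else 0) * mon ep w)"
   using * by (auto intro!: sum.mono_neutral_cong_left)
  hence "x + y - (\<Sum>w\<in>S \<union> T. csc (f w) * mon ep w) =
    (x - (\<Sum>w\<in>S. csc (c w) * mon ep w)) + (y - (\<Sum>w\<in>T. csc (d w) * mon ep w))"
   by (simp add: f_def csc_add distrib_right sum.distrib)
  with KT_add[OF *(3,6)] have "x + y - (\<Sum>w\<in>S \<union> T. csc (f w) * mon ep w) \<in> KT \<mu> ep"
   by (simp only:)
  thus ?case using * by (intro exI[of _ "S \<union> T"] exI[of _ f]) auto
 next
  case (uminus x)
  then obtain S c where "finite S" "\<forall>w\<in>S. set w \<subseteq> idx" "x - (\<Sum>w\<in>S. csc (c w) * mon ep w) \<in> KT \<mu> ep" by blast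
  moreover from KT_uminus[OF this(3)] have "- x - (\<Sum>w\<in>S. csc (- c w) * mon ep w) \<in> KT \<mu> ep"
   by (simp add: csc_uminus sum_negf)
  ultimately show ?case by (intro exI[of _ S] exI[of _ "%w. - c w"]) simp
 qed
 then obtain S0 c0 where S0: "finite S0" "\<forall>w\<in>S0. set w \<subseteq> idx" "x - (\<Sum>w\<in>S0. csc (c0 w) * mon ep w) \<in> KT \<mu> ep"
  by blast
 have csc_KT: "csc k * y \<in> KT \<mu> ep" if "y \<in> KT \<mu> ep" for k y
  by (rule KT_lmult_comm[OF _ that]) simp
 have "\<exists>S c. finite S \<and> S \<subseteq> S0 \<and> (\<forall>w\<in>S. \<forall>u\<in>U. ev u w = \<theta> u) \<and> x - (\<Sum>w\<in>S. csc (c w) * mon ep w) \<in> KT \<mu> ep"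
  if "finite S" "S \<subseteq> S0" "x - (\<Sum>w\<in>S. csc (c w) * mon ep w) \<in> KT \<mu> ep" for S c
  using that
 proof (induction "card S" arbitrary: S c rule: less_induct)
  case less
  show ?case
  proof (cases "\<forall>w\<in>S. \<forall>u\<in>U. ev u w = \<theta> u")
   case True
   thus ?thesis using less.prems by blast
  next
   case False
   then obtain v u where vu: "v \<in> S" "u \<in> U" "ev u v \<noteq> \<theta> u" by blast
   define r where "r = x - (\<Sum>w\<in>S. csc (c w) * mon ep w)"
   \<comment> \<open>Normalises the factor that removes the word v: x keeps the coefficient 1 while
     the coefficient of v becomes 0. No new words appear, so the number of words drops.\<close>
   define k where "k = inverse (\<theta> u - ev u v)"
   have k: "k * (\<theta> u - ev u v) = 1" using vu(3) by (simp add: k_def)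
   define d where "d w = k * ((ev u w - ev u v) * c w)" for w
   have idx: "set w \<subseteq> idx" if "w \<in> S" for w using that less.prems S0 by blast
   have rK: "r \<in> KT \<mu> ep" using less.prems by (simp add: r_def)
   have sK: "(\<Sum>w\<in>S. csc (c w) * (opr u * mon ep w - csc (ev u w) * mon ep w)) \<in> KT \<mu> ep" (is "?s \<in> _")
    using vu(2) idx ops by (intro KT_sum csc_KT) blast
   have "csc k * (- (opr u * x - csc (\<theta> u) * x) + opr u * r + ?s - csc (ev u v) * r) = x - (\<Sum>w\<in>S. csc (d w) * mon ep w)"
   proof -
    have ux: "opr u * x = opr u * r + (\<Sum>w\<in>S. csc (c w) * (opr u * mon ep w))"
     by (simp add: r_def right_diff_distrib sum_distrib_left csc_left_comm[of "opr u"])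
    have s: "?s = (\<Sum>w\<in>S. csc (c w) * (opr u * mon ep w)) - (\<Sum>w\<in>S. csc (ev u w * c w) * mon ep w)"
     by (simp add: right_diff_distrib sum_subtractf csc_mult mult.assoc csc_left_comm[of "csc (ev _ _)"])
    have "- (opr u * x - csc (\<theta> u) * x) + opr u * r + ?s - csc (ev u v) * r =
      csc (\<theta> u) * x - csc (ev u v) * x - ((\<Sum>w\<in>S. csc (ev u w * c w) * mon ep w) - csc (ev u v) * (\<Sum>w\<in>S. csc (c w) * mon ep w))"
     unfolding ux s by (simp add: r_def algebra_simps)
    also have "csc (ev u v) * (\<Sum>w\<in>S. csc (c w) * mon ep w) = (\<Sum>w\<in>S. csc (ev u v * c w) * mon ep w)"
     by (simp add: sum_distrib_left csc_mult mult.assoc)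
    also have "(\<Sum>w\<in>S. csc (ev u w * c w) * mon ep w) - (\<Sum>w\<in>S. csc (ev u v * c w) * mon ep w) =
      (\<Sum>w\<in>S. csc ((ev u w - ev u v) * c w) * mon ep w)"
     by (simp add: sum_subtractf[symmetric] left_diff_distrib csc_diff)
    also have "csc (\<theta> u) * x - csc (ev u v) * x = csc (\<theta> u - ev u v) * x"
     by (simp add: csc_diff left_diff_distrib)
    finally have R: "- (opr u * x - csc (\<theta> u) * x) + opr u * r + ?s - csc (ev u v) * r =
      csc (\<theta> u - ev u v) * x - (\<Sum>w\<in>S. csc ((ev u w - ev u v) * c w) * mon ep w)" .
    have "csc k * (csc (\<theta> u - ev u v) * x) = csc (k * (\<theta> u - ev u v)) * x"
     by (simp only: csc_mult mult.assoc)
    also have "\<dots> = x" unfolding k by simp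
    finally have kx: "csc k * (csc (\<theta> u - ev u v) * x) = x" .
    have ks: "csc k * (\<Sum>w\<in>S. csc ((ev u w - ev u v) * c w) * mon ep w) = (\<Sum>w\<in>S. csc (d w) * mon ep w)"
     unfolding d_def sum_distrib_left csc_mult by (simp only: mult.assoc)
    show ?thesis unfolding R right_diff_distrib[of "csc k"] by (rule arg_cong2[OF kx ks])
   qed
   moreover have "csc k * (- (opr u * x - csc (\<theta> u) * x) + opr u * r + ?s - csc (ev u v) * r) \<in> KT \<mu> ep"
    by (intro csc_KT KT_diff KT_add KT_uminus x KT sK rK vu)
   ultimately have "x - (\<Sum>w\<in>S. csc (d w) * mon ep w) \<in> KT \<mu> ep" by (simp only:)
   moreover have "(\<Sum>w\<in>S. csc (d w) * mon ep w) = (\<Sum>w\<in>S - {v}. csc (d w) * mon ep w)"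
    unfolding sum.remove[OF less.prems(1) vu(1)] by (simp add: d_def)
   ultimately have "x - (\<Sum>w\<in>S - {v}. csc (d w) * mon ep w) \<in> KT \<mu> ep" by (simp only:)
   thus ?thesis
    by (intro less.hyps[OF card_Diff1_less[OF less.prems(1) vu(1)]]) (use less.prems in blast)+
  qed
 qed
 from this[OF S0(1) order_refl S0(3)] obtain S c where "finite S" "S \<subseteq> S0" "\<forall>w\<in>S. \<forall>u\<in>U. ev u w = \<theta> u"
  and K: "x - (\<Sum>w\<in>S. csc (c w) * mon ep w) \<in> KT \<mu> ep"
  by blast
 hence "finite S" "\<forall>w\<in>S. set w \<subseteq> idx \<and> (\<forall>u\<in>U. ev u w = \<theta> u)"
  using S0(2) by blast+
 with K show ?thesis by (intro exI[of _ S] exI[of _ c] conjI)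
qed

end

section \<open>Extremal monomials and the Yangian\<close>

context osc
begin

lemma hat_Gp_eh: "hat.Gp s a b \<in> salg {eh c d |c d. c \<in> {1..m} \<and> d \<in> {1..m}}" if "a \<in> {1..m}"
 using that
 by (induction s arbitrary: a) (auto simp: hat.G_def intro!: salg_intros intro: salg.base simp del: atLeastAtMost_iff)

lemma hat_TT_facts:
 assumes ij: "i \<in> {1..n}" "j \<in> {1..n}"
 shows hat_TT_AA: "hat.TT s i j \<in> AA"
  and cm_Dg_TT: "cm Dg (hat.TT s i j) = csc (of_nat i - of_nat j) * hat.TT s i j"
  and cm_TT_e: "a \<in> {1..m} ==> b \<in> {1..m} ==> cm (hat.TT s i j) (e a b) = 0"
proof -
 have Gp_AA: "hat.Gp s a b \<in> AA" if "a \<in> {1..m}" for s a b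
  unfolding AA_def by (rule salg_mono[OF hat_Gp_eh[OF that]]) (use eh_AA in "auto simp: AA_def")
 hence tt: "hat.tt s i j \<in> AA" for s
  using assms HD_AA[OF P_HD] HD_AA[OF Q_HD] unfolding hat.tt_def AA_def by (auto intro!: salg_intros)
 thus "hat.TT s i j \<in> AA" by (cases s) (auto simp: hat.TT_def AA_def)
 have Gp: "cm Dg (hat.Gp s a b) = 0" if "a \<in> {1..m}" for s a b
  by (rule salg_cm_0[OF hat_Gp_eh[OF that]]) (use cm_eh_HD[OF Dg_HD] in "auto simp: cm_eq_0_iff")
 have "cm Dg (hat.tt s i j) = csc (of_nat i - of_nat j) * hat.tt s i j" for s
  unfolding hat.tt_def cm_sum sum_distrib_left
  by (intro sum.cong refl) (use ij in \<open>simp add: cm_mult Gp cm_Dg_Q cm_Dg_P csc_diff left_diff_distrib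
   mult.assoc csc_left_comm[of "Q _ _"] csc_left_comm[of "hat.Gp _ _ _"] right_diff_distrib\<close>)
 thus "cm Dg (hat.TT s i j) = csc (of_nat i - of_nat j) * hat.TT s i j"
  by (cases s) (auto simp: hat.TT_def)
 show "cm (hat.TT s i j) (e a b) = 0" if "a \<in> {1..m}" "b \<in> {1..m}"
  using cm_e_tt[OF that ij] by (cases s) (auto simp: hat.TT_def cm_eq_0_iff)
qed

text \<open>The column in which a creation operator of row a has the lowest degree:
  \<open>P a i\<close> has degree -i, lowest for i = n, and \<open>Q a i\<close> has degree i,
  lowest for i = 1.\<close>

definition ext :: "(nat => bool) => nat => nat" where
 "ext ep a = (if ep a then n else 1)"

definition hword :: "(nat => bool) => (nat => nat) => (nat \<times> nat) list" where
 "hword ep \<nu> = concat (map (%a. replicate (\<nu> a) (a, ext ep a)) [1..<m + 1])"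

lemma hword_idx: "1 \<le> n ==> set (hword ep \<nu>) \<subseteq> idx"
 by (auto simp: hword_def ext_def)

lemma hword_ext: "x \<in> set (hword ep \<nu>) ==> snd x = ext ep (fst x)"
 by (auto simp: hword_def)

lemma cnt_hword: "a \<in> {1..m} ==> cnt a (hword ep \<nu>) = \<nu> a"
proof -
 assume a: "a \<in> {1..m}"
 have "cnt a (concat (map (%a. replicate (\<nu> a) (a, ext ep a)) xs)) = (if a \<in> set xs then \<nu> a else 0)"
  if "distinct xs" for xs
  using that by (induction xs) (auto simp: cnt_def filter_empty_conv)
 from this[of "[1..<m + 1]"] show ?thesis using a by (simp add: hword_def)
qed

lemma count_fst: "count (mset (map fst w)) a = cnt a w"
 by (induction w) (auto simp: cnt_def)

lemma mset_ext:
 assumes "!!x. x \<in> set u ==> snd x = ext ep (fst x)" "!!x. x \<in> set v ==> snd x = ext ep (fst x)"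
  and "mset (map fst u) = mset (map fst v)"
 shows "mset u = mset v"
proof -
 have "mset u = image_mset (%a. (a, ext ep a)) (mset (map fst u))"
  if "!!x. x \<in> set u ==> snd x = ext ep (fst x)" for u
  using that by (induction u) (auto simp: prod_eq_iff)
 thus ?thesis using assms by metis
qed

lemma sgn_ext: "a \<in> {1..m} ==> i \<in> {1..n} ==> Re (sgnep ep a) * real (ext ep a) \<le> Re (sgnep ep a) * real i"
 by (auto simp: ext_def sgnep_def)

text \<open>Each letter has at least the degree of the extremal letter of its row, and the row
  counts agree. Equality of the totals therefore forces equality letter by letter.\<close>

lemma extremal:
 assumes w: "set w \<subseteq> idx" and v: "!!x. x \<in> set v ==> snd x = ext ep (fst x)"
  and "mset (map fst w) = mset (map fst v)"
 shows "Re (dgw ep v) \<le> Re (dgw ep w)" and "Re (dgw ep w) \<le> Re (dgw ep v) ==> mset w = mset v"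
proof -
 define g where "g a = Re (sgnep ep a) * real (ext ep a)" for a
 define h where "h x = Re (sgnep ep (fst x)) * real (snd x) - g (fst x)" for x
 have Re: "Re (dgw ep w) = (\<Sum>x\<leftarrow>w. h x) + (\<Sum>a\<leftarrow>map fst w. g a)" for w
  unfolding dgw_def by (induction w) (simp_all add: h_def sgnep_def)
 have "(\<Sum>a\<leftarrow>map fst w. g a) = (\<Sum>a\<leftarrow>map fst v. g a)"
  using assms(3) by (metis mset_map sum_mset_sum_list)
 moreover have "(\<Sum>x\<leftarrow>v. h x) = 0"
  using v by (induction v) (simp_all add: h_def g_def)
 ultimately have diff: "Re (dgw ep w) = (\<Sum>x\<leftarrow>w. h x) + Re (dgw ep v)"
  by (simp add: Re)
 have h: "0 \<le> h x" if "x \<in> set w" for x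
  using sgn_ext[of "fst x" "snd x"] w that by (force simp: h_def g_def)
 thus "Re (dgw ep v) \<le> Re (dgw ep w)"
  using diff by (auto intro!: sum_list_nonneg)
 assume "Re (dgw ep w) \<le> Re (dgw ep v)"
 hence "(\<Sum>x\<leftarrow>w. h x) = 0"
  using diff h by (intro antisym sum_list_nonneg) auto
 hence "h x = 0" if "x \<in> set w" for x
  using h that by (subst (asm) sum_list_nonneg_eq_0_iff) auto
 hence "snd x = ext ep (fst x)" if "x \<in> set w" for x
  using that by (fastforce simp: h_def g_def sgnep_def split: if_splits)
 thus "mset w = mset v" using v assms(3) by (rule mset_ext)
qed

text \<open>An operator commuting with gl_m keeps the Cartan weights, and these determine the number
  of letters in each row. Among monomials with given row counts the extremal one has the lowest
  degree, so nothing is left below it, and only itself in the same degree.\<close>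

lemma singular_vector:
 assumes n: "1 \<le> n" and y: "y \<in> AA" "!!a b. a \<in> {1..m} ==> b \<in> {1..m} ==> cm y (e a b) = 0"
  and d: "cm Dg y = csc (of_real d) * y" "d \<le> 0"
 shows "\<exists>c. y * mon ep (hword ep \<nu>) - csc c * mon ep (hword ep \<nu>) \<in> KT \<mu> ep \<and> (d < 0 --> c = 0)"
proof -
 let ?v = "hword ep \<nu>"
 let ?x = "y * mon ep ?v"
 \<comment> \<open>Index 0 stands for the grading element and 1, ..., m for the Cartan elements, so
   that both kinds of eigenvalues are separated at once.\<close>
 define opr where "opr a = (if a = 0 then Dg else e a a)" for a
 define ev where "ev a w = (if a = 0 then dvac ep + dgw ep w else hwt \<mu> ep a (cnt a w))" for a w
 define \<theta> where "\<theta> a = (if a = 0 then of_real d else 0) + ev a ?v" for a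
 note v = hword_idx[OF n, of ep \<nu>]
 have "\<exists>S c. finite S \<and> (\<forall>w\<in>S. set w \<subseteq> idx \<and> (\<forall>u\<in>{0..m}. ev u w = \<theta> u)) \<and>
  ?x - (\<Sum>w\<in>S. csc (c w) * mon ep w) \<in> KT \<mu> ep"
 proof (rule eigen_separation[where opr = opr])
  show "?x \<in> monspan \<mu> ep"
   using y(1) HD_AA[OF mon_HD[OF v]] by (intro AA_monspan) (simp add: AA_def salg.mult)
  show eig: "opr u * mon ep w - csc (ev u w) * mon ep w \<in> KT \<mu> ep"
   if "u \<in> {0..m}" "set w \<subseteq> idx" for u w
   using that Dg_mon[OF that(2), of ep \<mu>] e_mon[OF that(2), of u ep \<mu>]
   by (auto simp: opr_def ev_def intro!: IT_KT)
  show "opr u * x \<in> KT \<mu> ep" if "u \<in> {0..m}" "x \<in> KT \<mu> ep" for u x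
   using that KT_lmult_comm[OF cm_Dg_e that(2)] e_KT[of u x] by (auto simp: opr_def)
  show "opr u * ?x - csc (\<theta> u) * ?x \<in> KT \<mu> ep" if u: "u \<in> {0..m}" for u
  proof -
   have "cm (opr u) y = csc (if u = 0 then of_real d else 0) * y"
    using u d y(2)[of u u] by (auto simp: opr_def cm_eq_0_iff)
   hence "opr u * ?x = y * (opr u * mon ep ?v) + csc (if u = 0 then of_real d else 0) * ?x"
    using cm_swap_mult[of "opr u" y] by (simp add: distrib_right flip: mult.assoc)
   hence "opr u * ?x - csc (\<theta> u) * ?x = y * (opr u * mon ep ?v - csc (ev u ?v) * mon ep ?v)"
    by (simp add: \<theta>_def csc_add distrib_right right_diff_distrib csc_left_comm[of y])
   also have "\<dots> \<in> KT \<mu> ep"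
    by (rule KT_lmult_comm[OF y(2) eig[OF u v]])
   finally show ?thesis .
  qed
 qed
 then obtain S c where S: "finite S" "!!w. w \<in> S ==> set w \<subseteq> idx"
  "!!u w. u \<in> {0..m} ==> w \<in> S ==> ev u w = \<theta> u"
  and K: "?x - (\<Sum>w\<in>S. csc (c w) * mon ep w) \<in> KT \<mu> ep" by blast
 have fst: "mset (map fst w) = mset (map fst ?v)" if "w \<in> S" for w
 proof (rule multiset_eqI, unfold count_fst)
  fix a show "cnt a w = cnt a ?v"
  proof (cases "a \<in> {1..m}")
   case True
   hence "ev a w = ev a ?v" using S(3)[of a w] that by (auto simp: \<theta>_def)
   thus ?thesis using True by (auto simp: ev_def hwt_def sgnep_def split: if_splits)
  next
   case False
   have "cnt a w = 0" if "set w \<subseteq> idx" for w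
    using that False by (auto simp: cnt_def filter_empty_conv)
   thus ?thesis using v S(2)[OF that] by simp
  qed
 qed
 have dg: "Re (dgw ep w) = d + Re (dgw ep ?v)" if "w \<in> S" for w
  using arg_cong[OF S(3)[OF _ that, of 0], of Re] by (simp add: \<theta>_def ev_def)
 have "mon ep w = mon ep ?v" if "w \<in> S" for w
  using dg[OF that] extremal(2)[OF S(2)[OF that] hword_ext fst[OF that]] d(2) mon_mset[OF _ S(2)[OF that]]
  by simp
 hence "(\<Sum>w\<in>S. csc (c w) * mon ep w) = csc (sum c S) * mon ep ?v"
  by (simp add: csc_sum sum_distrib_right)
 moreover have "S = {}" if "d < 0"
  using dg extremal(1)[OF S(2) hword_ext fst] that by force
 ultimately show ?thesis using K by (intro exI[of _ "sum c S"]) auto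
qed

end

section \<open>A module detecting the vector\<close>

text \<open>\<open>Kt r i\<close> with i < r is a coordinate of the Verma module, one for each root
  vector of n; \<open>Kx a i\<close> is an oscillator variable.\<close>

datatype key = Kt nat nat | Kx nat nat

type_synonym fock = "(key => nat) => complex"

text \<open>A function on exponents is a linear functional on polynomials. Differential operators act on
 such functionals from the right, so the product of two operators is their reversed composition.\<close>

typedef endo = "{f :: fock => fock. \<forall>x y c. f (%\<alpha>. c * x \<alpha> + y \<alpha>) = (%\<alpha>. c * f x \<alpha> + f y \<alpha>)}"
 morphisms app Endo
 by (rule exI[of _ "%x. x"]) simp

lemma app_lin: "app f (%\<alpha>. c * x \<alpha> + y \<alpha>) = (%\<alpha>. c * app f x \<alpha> + app f y \<alpha>)"
 using app[of f] by simp

lemma app_0 [simp]: "app f (%_. 0) = (%_. 0)"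
 using app_lin[of f "-1" "%_. 0" "%_. 0"] by simp

lemma app_scale: "app f (%\<alpha>. c * x \<alpha>) = (%\<alpha>. c * app f x \<alpha>)"
 using app_lin[of f c x "%_. 0"] by simp

lemma app_add: "app f (%\<alpha>. x \<alpha> + y \<alpha>) = (%\<alpha>. app f x \<alpha> + app f y \<alpha>)"
 using app_lin[of f 1 x y] by simp

lemma endo_eqI: "(!!x \<alpha>. app f x \<alpha> = app g x \<alpha>) ==> f = g"
 by (simp add: app_inject[symmetric] fun_eq_iff)

instantiation endo :: calg
begin

definition "0 = Endo (%x \<alpha>. 0)"
definition "1 = Endo (%x. x)"
definition "f + g = Endo (%x \<alpha>. app f x \<alpha> + app g x \<alpha>)"
definition "- f = Endo (%x \<alpha>. - app f x \<alpha>)" for f :: endo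
definition "f - g = Endo (%x \<alpha>. app f x \<alpha> - app g x \<alpha>)"
definition "f * g = Endo (%x. app g (app f x))"
definition "csc c = Endo (%x \<alpha>. c * x \<alpha>)"

lemma app_simps [simp]: "app 0 x = (%_. 0)" "app 1 x = x" "app (f + g) x = (%\<alpha>. app f x \<alpha> + app g x \<alpha>)"
 "app (- f) x = (%\<alpha>. - app f x \<alpha>)" "app (f - g) x = (%\<alpha>. app f x \<alpha> - app g x \<alpha>)"
 "app (f * g) x = app g (app f x)" "app (csc c) x = (%\<alpha>. c * x \<alpha>)"
 unfolding zero_endo_def one_endo_def plus_endo_def uminus_endo_def minus_endo_def times_endo_def csc_endo_def
 by (subst Endo_inverse, simp only: mem_Collect_eq app_lin, simp add: algebra_simps, rule refl)+

instance
 by standard (rule endo_eqI, simp add: app_add app_scale algebra_simps app_lin[where c = "- 1", simplified])+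

end

lemma app_sum: "app (sum h S) x \<alpha> = (\<Sum>a\<in>S. app (h a) x \<alpha>)"
 by (induction S rule: infinite_finite_induct) simp_all

text \<open>The transpose of multiplication by the variable k; \<open>dd\<close> is the transpose of
  the derivation. As products are reversed as well, the relations of the Weyl algebra hold
  unchanged.\<close>

definition mu :: "key => endo" where
 "mu k = Endo (%x \<alpha>. x (\<alpha>(k := Suc (\<alpha> k))))"

definition dd :: "key => endo" where
 "dd k = Endo (%x \<alpha>. of_nat (\<alpha> k) * x (\<alpha>(k := \<alpha> k - 1)))"

lemma app_mu [simp]: "app (mu k) x \<alpha> = x (\<alpha>(k := Suc (\<alpha> k)))"
 and app_dd [simp]: "app (dd k) x \<alpha> = of_nat (\<alpha> k) * x (\<alpha>(k := \<alpha> k - 1))"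
 by (simp_all add: mu_def dd_def Endo_inverse algebra_simps)

lemma cm_mu_dd: "cm (mu k) (mu l) = 0" "cm (dd k) (dd l) = 0" "cm (dd k) (mu l) = (if k = l then 1 else 0)"
 "cm (mu l) (dd k) = - (if k = l then 1 else 0)"
proof -
 show *: "cm (dd k) (mu l) = (if k = l then 1 else 0)"
 proof (rule endo_eqI)
  fix x :: fock and \<alpha>
  have "of_nat (\<alpha> l) * x (\<alpha>(l := Suc (\<alpha> l - 1))) = of_nat (\<alpha> l) * x \<alpha>"
   by (cases "\<alpha> l = 0") simp_all
  thus "app (cm (dd k) (mu l)) x \<alpha> = app (if k = l then 1 else 0) x \<alpha>"
   by (auto simp: cm_def fun_upd_twist algebra_simps)
 qed
 show "cm (mu k) (mu l) = 0" "cm (dd k) (dd l) = 0"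
  by (rule endo_eqI, cases "k = l"; simp add: cm_def fun_upd_twist)+
 show "cm (mu l) (dd k) = - (if k = l then 1 else 0)"
  using * cm_swap[of "mu l"] by simp
qed

text \<open>Passing from \<open>gl\<close> of rank \<open>m\<close> to rank \<open>m + 1\<close>: with \<open>m\<close> further variables \<open>t\<close> this turns the
 Verma module for the first into the Verma module for the second.\<close>

definition gl_ext :: "nat => (nat => 'r) => (nat => 'r) => complex => (nat => nat => 'r) => nat => nat => 'r::calg" where
 "gl_ext m t d c e i j =
  (if i \<le> m then if j \<le> m then e i j - t j * d i
   else (\<Sum>k=1..m. (e i k - t k * d i) * d k) - csc c * d i
  else if j \<le> m then t j else csc c + (\<Sum>k=1..m. t k * d k))"

text \<open>Parabolic induction in coordinates: the t_j act as the lowering elements E_{m+1,j}, and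
  the elements E_{i,m+1} become operators of second order in them. The relations are checked block
  by block, according to which indices equal m + 1.\<close>

lemma gl_action_ext:
 fixes e :: "nat => nat => 'r::calg"
 assumes "gl_action m e"
  and tt: "!!i j. cm (t i) (t j) = 0" and dd: "!!i j. cm (d i) (d j) = 0"
  and dt: "!!i j. cm (d i) (t j) = (if i = j then 1 else 0)"
  and et: "!!i j k. i \<in> {1..m} ==> j \<in> {1..m} ==> cm (e i j) (t k) = 0"
  and ed: "!!i j k. i \<in> {1..m} ==> j \<in> {1..m} ==> cm (e i j) (d k) = 0"
 shows "gl_action (Suc m) (gl_ext m t d c e)"
proof -
 interpret gl_action m e by fact
 have td: "cm (t i) (d j) = - (if i = j then 1 else 0)" for i j
  using dt[of j i] cm_swap[of "t i" "d j"] by simp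
 \<comment> \<open>E is gl_m acting in addition on the t_j by vector fields, S is the Euler
   operator, and D gives the raising elements E_{i,m+1}.\<close>
 define E where "E i j = e i j - t j * d i" for i j
 define S where "S = (\<Sum>k=1..m. t k * d k)"
 define D where "D i = (\<Sum>k=1..m. E i k * d k) - csc c * d i" for i
 have ddc: "d i * d j = d j * d i" for i j using dd[of i j] by (simp add: cm_eq_0_iff)
 have Et: "cm (E i j) (t k) = - (if i = k then t j else 0)" if "i \<in> {1..m}" "j \<in> {1..m}" for i j k
  using et[OF that] by (simp add: E_def cm_diff_left cm_mult_left dt tt)
 have Ed: "cm (E i j) (d k) = (if j = k then d i else 0)" if "i \<in> {1..m}" "j \<in> {1..m}" for i j k
  using ed[OF that] by (simp add: E_def cm_diff_left cm_mult_left dd td)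
 have EE: "cm (E i j) (E k l) = (if j = k then E i l else 0) - (if l = i then E k j else 0)"
  if r: "i \<in> {1..m}" "j \<in> {1..m}" "k \<in> {1..m}" "l \<in> {1..m}" for i j k l
 proof -
  have "cm (e k l) (t j) = 0" "cm (e k l) (d i) = 0" using et ed r by blast+
  hence "cm (t j) (e k l) = 0" "cm (d i) (e k l) = 0" by (simp_all add: cm_eq_0_iff)
  hence "cm (E i j) (E k l) = cm (e i j) (e k l) - cm (E i j) (t l * d k)"
   by (simp add: E_def cm_diff cm_diff_left cm_mult_left)
  thus ?thesis
   using gl[OF r] Et[OF r(1,2)] Ed[OF r(1,2)] by (auto simp: cm_mult E_def)
 qed
 have ES: "cm (E i j) S = 0" if "i \<in> {1..m}" "j \<in> {1..m}" for i j
 proof -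
  have "cm (E i j) S = (\<Sum>k=1..m. (if k = j then t j * d i else 0) - (if k = i then t j * d i else 0))"
   unfolding S_def cm_sum by (intro sum.cong refl) (use that in "auto simp: cm_mult Et Ed")
  thus ?thesis using that by (simp add: sum_subtractf)
 qed
 have ED: "cm (E i j) (D k) = (if j = k then D i else 0)" if r: "i \<in> {1..m}" "j \<in> {1..m}" "k \<in> {1..m}" for i j k
 proof -
  have "cm (E i j) (D k) = (\<Sum>s=1..m. (if j = k then E i s * d s else 0) - (if s = i then E k j * d i else 0)
    + (if s = j then E k j * d i else 0)) - (if j = k then csc c * d i else 0)"
   unfolding D_def cm_diff cm_sum
   by (intro arg_cong2[of _ _ _ _ minus] sum.cong refl) (use r in "auto simp: cm_mult EE Ed left_diff_distrib")
  also have "\<dots> = (if j = k then D i else 0)"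
   using r by (simp add: sum.distrib sum_subtractf D_def)
  finally show ?thesis .
 qed
 have dE: "cm (d k) (E i j) = - (if j = k then d i else 0)" if "i \<in> {1..m}" "j \<in> {1..m}" for i j k
  using Ed[OF that, of k] cm_swap[of "d k"] by simp
 have tE: "cm (t k) (E i j) = (if i = k then t j else 0)" if "i \<in> {1..m}" "j \<in> {1..m}" for i j k
  using Et[OF that, of k] cm_swap[of "t k"] by simp
 have dD: "cm (d s) (D j) = - (d j * d s)" if "s \<in> {1..m}" "j \<in> {1..m}" for s j
 proof -
  have "cm (d s) (D j) = (\<Sum>u=1..m. if u = s then - (d j * d s) else 0) - 0"
   unfolding D_def cm_diff cm_sum
   by (intro arg_cong2[of _ _ _ _ minus] sum.cong refl) (use that in "auto simp: cm_mult dE dd")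
  thus ?thesis using that by simp
 qed
 have DD: "cm (D i) (D j) = 0" if r: "i \<in> {1..m}" "j \<in> {1..m}" for i j
 proof -
  have "cm (D i) (D j) = (\<Sum>s=1..m. cm (E i s * d s) (D j)) - cm (csc c * d i) (D j)"
   by (simp add: D_def[of i] cm_diff_left cm_sum_left)
  also have "\<dots> = (\<Sum>s=1..m. (if s = j then D i * d s else 0) - E i s * d s * d j) - - (csc c * d i * d j)"
   by (intro arg_cong2[of _ _ _ _ minus] sum.cong refl)
    (use r in "auto simp: cm_mult_left ED dD ddc[of j] mult.assoc")
  also have "\<dots> = D i * d j - D i * d j"
   using r unfolding sum_subtractf sum_distrib_right[symmetric] by (simp add: D_def algebra_simps)
  finally show ?thesis by simp
 qed
 have tD: "cm (t j) (D i) = (if i = j then csc c + S else 0) - E i j" if r: "i \<in> {1..m}" "j \<in> {1..m}" for i j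
 proof -
  have "cm (t j) (D i) = (\<Sum>s=1..m. (if i = j then t s * d s else 0) - (if s = j then E i j else 0)) - - (if i = j then csc c else 0)"
   unfolding D_def cm_diff cm_sum
   by (intro arg_cong2[of _ _ _ _ minus] sum.cong refl) (use r in "auto simp: cm_mult tE td")
  thus ?thesis using r by (simp add: sum_subtractf S_def)
 qed
 have tS: "cm (t j) S = - t j" and dS: "cm (d j) S = d j" if "j \<in> {1..m}" for j
  using that by (auto simp: S_def cm_sum cm_mult tt td dt dd if_distrib[of "%x. _ * x"] if_distrib[of "%x. x * _"] sum_negf cong: if_cong)
 have SD: "cm S (D i) = - D i" if "i \<in> {1..m}" for i
 proof -
  have "cm (E i s) S = 0" if "s \<in> {1..m}" for s using ES \<open>i \<in> {1..m}\<close> that by blast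
  hence "cm S (E i s) = 0" if "s \<in> {1..m}" for s using that by (simp add: cm_eq_0_iff)
  moreover have "cm S (d s) = - d s" if "s \<in> {1..m}" for s using dS[OF that] cm_swap[of S] by simp
  ultimately show ?thesis using that
   by (simp add: D_def cm_diff cm_sum cm_mult sum_negf)
 qed
 have g: "gl_ext m t d c e i j =
  (if i \<in> {1..m} then if j \<in> {1..m} then E i j else D i else if j \<in> {1..m} then t j else csc c + S)"
  if "i \<in> {1..Suc m}" "j \<in> {1..Suc m}" for i j
  using that by (simp add: gl_ext_def E_def D_def S_def)
 have Dt: "cm (D i) (t j) = E i j - (if i = j then csc c + S else 0)" if "i \<in> {1..m}" "j \<in> {1..m}" for i j
  using tD[OF that] cm_swap[of "D i"] by simp
 have sw: "cm S (E i j) = 0" "cm S (t j) = t j" "cm (D i) S = D i" "cm (D k) (E i j) = - (if j = k then D i else 0)"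
  if "i \<in> {1..m}" "j \<in> {1..m}" "k \<in> {1..m}" for i j k
  using ES[of i j] tS[of j] SD[of i] ED[of i j k] that cm_swap[of S "E i j"] cm_swap[of S "t j"] cm_swap[of "D i" S]
   cm_swap[of "D k" "E i j"] by simp_all
 show ?thesis
 proof
  fix i j k l assume r: "i \<in> {1..Suc m}" "j \<in> {1..Suc m}" "k \<in> {1..Suc m}" "l \<in> {1..Suc m}"
  have top: "a = Suc m \<longleftrightarrow> a \<notin> {1..m}" if "a \<in> {1..Suc m}" for a using that by auto
  show "cm (gl_ext m t d c e i j) (gl_ext m t d c e k l) =
   (if j = k then gl_ext m t d c e i l else 0) - (if l = i then gl_ext m t d c e k j else 0)"
   unfolding g[OF r(1,2)] g[OF r(3,4)] g[OF r(1,4)] g[OF r(3,2)]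
   using top[OF r(1)] top[OF r(2)] top[OF r(3)] top[OF r(4)]
   by (cases "i \<in> {1..m}"; cases "j \<in> {1..m}"; cases "k \<in> {1..m}"; cases "l \<in> {1..m}")
    (auto simp: EE ES Et ED tE tt tD Dt DD tS SD sw cm_add cm_add_left simp del: atLeastAtMost_iff)
 qed
qed

definition cp :: "(nat => 'r) => (nat => nat) => nat list => 'r::monoid_mult" where
 "cp F g xs = prod_list (map (%j. F j ^ g j) xs)"

lemma cp_comm:
 assumes "!!j k. j \<in> I ==> k \<in> I ==> F j * F k = F k * F j" "set xs \<subseteq> I" "k \<in> I"
 shows "F k * cp F g xs = cp F g xs * F k"
 using assms(2)
proof (induction xs)
 case (Cons x xs)
 hence "F k * F x ^ g x = F x ^ g x * F k"
  using assms(1)[of x k] assms(3) by (intro power_commuting_commutes[symmetric]) auto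
 moreover have "F k * cp F g xs = cp F g xs * F k" using Cons by simp
 ultimately show ?case by (simp add: cp_def) (metis mult.assoc)
qed (simp add: cp_def)

lemma cp_Suc:
 assumes "!!j k. j \<in> I ==> k \<in> I ==> F j * F k = F k * F j" "set xs \<subseteq> I" "distinct xs" "i \<in> set xs"
 shows "cp F (g(i := Suc (g i))) xs = F i * cp F g xs"
 using assms(2-)
proof (induction xs)
 case (Cons x xs)
 show ?case
 proof (cases "x = i")
  case True
  hence "map (%j. F j ^ (g(i := Suc (g i))) j) xs = map (%j. F j ^ g j) xs" using Cons.prems by auto
  thus ?thesis using True by (simp only: cp_def list.map prod_list.Cons) (simp add: mult.assoc)
 next
  case False
  have "F x ^ g x * F i = F i * F x ^ g x"
   using Cons.prems assms(1)[of x i] by (intro power_commuting_commutes) auto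
  thus ?thesis using False Cons by (simp add: cp_def flip: mult.assoc)
 qed
qed simp

text \<open>The commutator with z is a derivation that replaces one factor F_l by F_i and kills the
  other factors; all of them commute among themselves.\<close>

lemma cm_cp:
 fixes F :: "nat => 'r::calg"
 assumes F: "!!j k. j \<in> I ==> k \<in> I ==> F j * F k = F k * F j" and xs: "set xs \<subseteq> I" "distinct xs"
  and z: "!!k. k \<in> I ==> cm (F k) z = (if k = l then F i else 0)" and "i \<in> I"
 shows "cm (cp F g xs) z = (if l \<in> set xs then csc (of_nat (g l)) * (F i * cp F (g(l := g l - 1)) xs) else 0)"
 using xs
proof (induction xs)
 case (Cons x xs)
 have x: "cm (F x ^ k) z = (if x = l then csc (of_nat k) * (F i * F x ^ (k - 1)) else 0)" for k
 proof (induction k)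
  case (Suc k)
  have "F x * (F i * F x ^ (k - 1)) = F i * F x ^ k" if "k > 0"
   using that F[of x i] Cons.prems(1) \<open>i \<in> I\<close> by (cases k) (auto simp flip: mult.assoc)
  thus ?case
   using Suc z[of x] Cons.prems(1)
   by (cases "k = 0") (auto simp: cm_mult_left csc_left_comm[of "F _"] csc_add distrib_right)
 qed simp
 have cp: "cp F g (x # xs) = F x ^ g x * cp F g xs" for g by (simp add: cp_def)
 have upd: "cp F (g(x := g x - 1)) xs = cp F g xs"
  using Cons.prems by (auto simp: cp_def intro!: arg_cong[of _ _ prod_list])
 have "F x ^ g x * F i = F i * F x ^ g x"
  using Cons.prems F[of x i] \<open>i \<in> I\<close> by (intro power_commuting_commutes) auto
 hence "F x ^ g x * (F i * y) = F i * (F x ^ g x * y)" for y by (simp flip: mult.assoc)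
 moreover have "cp F (g(l := g l - 1)) (x # xs) =
   (if x = l then F l ^ (g l - 1) * cp F g xs else F x ^ g x * cp F (g(l := g l - 1)) xs)"
  unfolding cp using upd by auto
 moreover have "cm (cp F g xs) z = (if l \<in> set xs then csc (of_nat (g l)) * (F i * cp F (g(l := g l - 1)) xs) else 0)"
  using Cons by simp
 ultimately show ?case
  unfolding cp[of g] cm_mult_left x
  using Cons.prems by (auto simp: fun_upd_def mult.assoc csc_left_comm[of "F _ ^ _"])
qed (simp add: cp_def)

definition Pm :: "nat => nat => endo" where
 "Pm a i = (if a \<le> p0 then - mu (Kx a i) else dd (Kx a i))"

definition Qm :: "nat => nat => endo" where
 "Qm a i = (if a \<le> p0 then dd (Kx a i) else mu (Kx a i))"

interpretation W: weyl m0 n0 Pm Qm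
 by standard (auto simp: Pm_def Qm_def cm_uminus cm_uminus_left cm_mu_dd)

text \<open>The Verma module of highest weight \<mu>, built by increasing rank. The step to rank l +
  1 brings in the variables \<open>Kt (Suc l) i\<close> with i \<le> l.\<close>

primrec Lm :: "weight => nat => nat => nat => endo" where
 "Lm \<mu> 0 = (%i j. 0)"
| "Lm \<mu> (Suc l) = gl_ext l (%i. mu (Kt (Suc l) i)) (%i. dd (Kt (Suc l) i)) (\<mu> (Suc l)) (Lm \<mu> l)"

definition lvl :: "nat => endo set" where
 "lvl l = {mu (Kt r k) |r k. r \<le> l} \<union> {dd (Kt r k) |r k. r \<le> l}"

lemma Lm_lvl: "Lm \<mu> l i j \<in> salg (lvl l)"
proof (induction l arbitrary: i j)
 case (Suc l)
 have "Lm \<mu> l i j \<in> salg (lvl (Suc l))" for i j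
  by (rule salg_mono[OF Suc]) (auto simp: lvl_def intro!: salg.base)
 moreover have "mu (Kt (Suc l) i) \<in> salg (lvl (Suc l))" "dd (Kt (Suc l) i) \<in> salg (lvl (Suc l))" for i
  by (auto simp: lvl_def intro!: salg.base)
 ultimately show ?case by (auto simp: gl_ext_def intro!: salg_intros)
qed simp

lemma Lm_comm:
 assumes "case k of Kt r i => l < r | Kx a i => True"
 shows "cm (Lm \<mu> l i j) (mu k) = 0" "cm (Lm \<mu> l i j) (dd k) = 0"
proof -
 have "cm (mu k) (Lm \<mu> l i j) = 0" "cm (dd k) (Lm \<mu> l i j) = 0"
  by (rule salg_cm_0[OF Lm_lvl]; use assms in "auto simp: lvl_def cm_mu_dd")+
 thus "cm (Lm \<mu> l i j) (mu k) = 0" "cm (Lm \<mu> l i j) (dd k) = 0" by (simp_all add: cm_eq_0_iff)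
qed

lemma Lm_gl: "gl_action l (Lm \<mu> l)"
proof (induction l)
 case 0
 show ?case by standard auto
next
 case (Suc l)
 thus ?case
  unfolding Lm.simps by (rule gl_action_ext) (simp_all add: cm_mu_dd Lm_comm)
qed

definition em :: "weight => nat => nat => endo" where
 "em \<mu> a b = Lm \<mu> m0 a b + W.z a b"

lemma cm_Lm_PQ: "cm (Lm \<mu> l a b) (Pm c i) = 0" "cm (Lm \<mu> l a b) (Qm c i) = 0"
 by (simp_all add: Pm_def Qm_def Lm_comm cm_uminus)

interpretation M: osc m0 n0 Pm Qm "em \<mu>" for \<mu>
proof -
 interpret L: gl_action m0 "Lm \<mu> m0" by (rule Lm_gl)
 have Lz: "cm (Lm \<mu> m0 a b) (W.z c d) = 0" for a b c d
  by (simp add: W.z_def cm_add cm_sum cm_mult cm_Lm_PQ)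
 hence "cm (W.z c d) (Lm \<mu> m0 a b) = 0" for a b c d by (simp add: cm_eq_0_iff)
 thus "osc m0 n0 Pm Qm (em \<mu>)"
  by unfold_locales (simp_all add: em_def cm_add cm_add_left Lz L.gl W.cm_z_z W.cm_z_Q W.cm_z_P cm_Lm_PQ)
qed

definition dg :: "((key => nat) => complex) => endo" where
 "dg g = Endo (%x \<alpha>. g \<alpha> * x \<alpha>)"

lemma app_dg [simp]: "app (dg g) x = (%\<alpha>. g \<alpha> * x \<alpha>)"
 by (simp add: dg_def Endo_inverse algebra_simps)

text \<open>Diagonal operators whose eigenvalues lie in c plus the integers; this class modulo
  integers is all that genericity of the weight can see.\<close>

definition dint :: "complex => endo => bool" where
 "dint c x \<longleftrightarrow> (\<exists>g. \<forall>\<psi> \<alpha>. app x \<psi> \<alpha> = (c + of_int (g \<alpha>)) * \<psi> \<alpha>)"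

lemma dint_csc: "dint c (csc c)"
 unfolding dint_def by (rule exI[of _ "%_. 0"]) simp

lemma dint_add: "dint c x ==> dint d y ==> dint (c + d) (x + y)"
proof -
 assume "dint c x" "dint d y"
 then obtain g h where "!!\<psi> \<alpha>. app x \<psi> \<alpha> = (c + of_int (g \<alpha>)) * \<psi> \<alpha>" "!!\<psi> \<alpha>. app y \<psi> \<alpha> = (d + of_int (h \<alpha>)) * \<psi> \<alpha>"
  unfolding dint_def by blast
 thus ?thesis
  unfolding dint_def by (intro exI[of _ "%\<alpha>. g \<alpha> + h \<alpha>"]) (simp add: algebra_simps)
qed

lemma dint_uminus: "dint c x ==> dint (- c) (- x)"
proof -
 assume "dint c x"
 then obtain g where "!!\<psi> \<alpha>. app x \<psi> \<alpha> = (c + of_int (g \<alpha>)) * \<psi> \<alpha>" unfolding dint_def by blast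
 thus ?thesis
  unfolding dint_def by (intro exI[of _ "%\<alpha>. - g \<alpha>"]) (simp add: algebra_simps)
qed

lemma dint_int: "dint c (csc (c + of_int k))"
 unfolding dint_def by (rule exI[of _ "%_. k"]) simp

lemma dint_mu_dd: "dint 0 (mu k * dd k)"
 unfolding dint_def
proof (intro exI[of _ "%\<alpha>. int (\<alpha> k)"] allI)
 fix \<psi> \<alpha> show "app (mu k * dd k) \<psi> \<alpha> = (0 + of_int (int (\<alpha> k))) * \<psi> \<alpha>"
  by (cases "\<alpha> k = 0") simp_all
qed

lemma dint_dd_mu: "dint 0 (dd k * mu k)"
 using dint_add[OF dint_mu_dd dint_int[of 0 1]] cm_mu_dd(3)[of k k] by (simp add: cm_def algebra_simps)

lemma dint_sum: "(!!a. a \<in> S ==> dint 0 (h a)) ==> dint 0 (sum h S)"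
proof (induction S rule: infinite_finite_induct)
 case (insert x F)
 thus ?case using dint_add[of 0 "h x" 0 "sum h F"] by simp
qed (use dint_csc[of 0] in simp_all)

lemma dint_Lm: "a \<in> {1..l} ==> dint (\<mu> a) (Lm \<mu> l a a)"
proof (induction l)
 case (Suc l)
 show ?case
 proof (cases "a \<le> l")
  case True
  thus ?thesis using Suc dint_add[OF _ dint_uminus[OF dint_mu_dd]] by (simp add: gl_ext_def)
 next
  case False
  hence "a = Suc l" using Suc by simp
  thus ?thesis
   using dint_add[OF dint_csc dint_sum[OF dint_mu_dd]] by (simp add: gl_ext_def)
 qed
qed simp

lemma dint_em: "a \<in> M0 ==> dint (\<mu> a + of_nat n0 / 2) (em \<mu> a a)"
proof -
 assume "a \<in> M0"
 have "dint 0 (Qm a k * Pm a k)" for k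
  using dint_mu_dd[of "Kx a k"] dint_uminus[OF dint_dd_mu[of "Kx a k"]] by (simp add: Pm_def Qm_def)
 hence "dint (of_nat n0 / 2) (W.z a a)"
  using dint_add[OF dint_csc dint_sum, of "N0" "%k. Qm a k * Pm a k" "of_nat n0 / 2"] by (simp add: W.z_def)
 with dint_Lm[OF \<open>a \<in> M0\<close>] show ?thesis unfolding em_def by (rule dint_add)
qed

text \<open>Denominators act diagonally, with eigenvalues \<mu> a - \<mu> b plus integers, which do
  not vanish for generic \<mu>. The eigenvalue is read off by applying the operator to the constant
  function 1.\<close>

fun gm :: "weight => gen => endo" where
 "gm \<mu> (GE a b) = em \<mu> a b"
| "gm \<mu> (GX a i) = mu (Kx a i)"
| "gm \<mu> (GD a i) = dd (Kx a i)"
| "gm \<mu> (GInv a b z) = dg (%\<alpha>. inverse (app (em \<mu> a a - em \<mu> b b + csc (of_int z)) (%_. 1) \<alpha>))"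

lemma feval_gm: "feval (gm \<mu>) (pp p0 a i) = Pm a i" "feval (gm \<mu>) (qq p0 a i) = Qm a i"
 "feval (gm \<mu>) (zeta p0 n0 a b) = W.z a b"
proof -
 show *: "feval (gm \<mu>) (pp p0 a i) = Pm a i" "feval (gm \<mu>) (qq p0 a i) = Qm a i" for a i
  by (simp_all add: pp_def qq_def Pm_def Qm_def feval_simps)
 show "feval (gm \<mu>) (zeta p0 n0 a b) = W.z a b"
  by (simp add: zeta_def Ehat_def W.z_def feval_simps *)
qed

lemma gm_weyl:
 assumes "h \<in> weyl_gens m0 n0" "a \<in> M0" "b \<in> M0"
 shows "cm (em \<mu> a b) (gm \<mu> h) = cm (W.z a b) (gm \<mu> h)"
proof -
 obtain c i where "c \<in> M0" "i \<in> N0" "gm \<mu> h = Pm c i \<or> gm \<mu> h = - Pm c i \<or> gm \<mu> h = Qm c i"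
  using assms(1) by (auto simp: weyl_gens_def Pm_def Qm_def)
 thus ?thesis
  by (auto simp: em_def cm_add_left cm_Lm_PQ cm_uminus simp del: atLeastAtMost_iff)
qed

lemma gm_kills:
 assumes \<mu>: "generic m0 \<mu>"
 shows "kills_rels TYPE(tB) (gm \<mu>)"
 unfolding kills_rels_def prels_tB_def Abar_rels_def A_rels_def
proof (intro ballI)
 fix r assume "r \<in> gl_rels m0 \<union> weyl_rels m0 n0 \<union> cross_rels p0 q0 n0 \<union> inv_rels m0"
 then consider "r \<in> gl_rels m0" | "r \<in> weyl_rels m0 n0" | "r \<in> cross_rels p0 q0 n0" | "r \<in> inv_rels m0" by blast
 thus "feval (gm \<mu>) r = 0"
 proof cases
  case 1
  then obtain a b c d where r: "r = comm (eE a b) (eE c d) - ((if b = c then eE a d else 0) - (if d = a then eE c b else 0))"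
   "a \<in> M0" "b \<in> M0" "c \<in> M0" "d \<in> M0" unfolding gl_rels_def by blast
  show ?thesis unfolding r(1) using M.gl[OF r(2-), of \<mu>] by (auto simp: feval_simps cm_def)
 next
  case 2
  thus ?thesis
   using cm_mu_dd by (auto simp: weyl_rels_def feval_simps cm_def)
 next
  case 3
  then obtain a b h where r: "r = comm (eE a b) (gener h) - comm (zeta p0 n0 a b) (gener h)"
   "h \<in> weyl_gens m0 n0" "a \<in> M0" "b \<in> M0" unfolding cross_rels_def by blast
  show ?thesis unfolding r(1) using gm_weyl[OF r(2-), of \<mu>] by (simp add: feval_simps feval_gm cm_def)
 next
  case 4
  then obtain a b z where ab: "a \<in> M0" "b \<in> M0" "a \<noteq> b"
   and r: "r = (eE a a - eE b b + of_int z) * eInv a b z - 1 \<or> r = eInv a b z * (eE a a - eE b b + of_int z) - 1"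
   unfolding inv_rels_def by blast
  have "dint (\<mu> a + of_nat n0 / 2 + - (\<mu> b + of_nat n0 / 2)) (em \<mu> a a + - em \<mu> b b)"
   by (intro dint_add dint_uminus dint_em ab)
  from dint_add[OF this dint_int[of 0 z]]
  obtain g where g: "app (em \<mu> a a - em \<mu> b b + csc (of_int z)) \<psi> \<alpha> = (\<mu> a - \<mu> b + of_int (g \<alpha>)) * \<psi> \<alpha>" for \<psi> \<alpha>
   unfolding dint_def by auto
  have "\<mu> a - \<mu> b + of_int k \<noteq> 0" for k
   using \<mu> ab unfolding generic_def by (metis Ints_minus Ints_of_int eq_neg_iff_add_eq_0)
  hence "feval (gm \<mu>) ((eE a a - eE b b + of_int z) * eInv a b z) = 1"
   "feval (gm \<mu>) (eInv a b z * (eE a a - eE b b + of_int z)) = 1"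
   by (auto simp: feval_simps g simp del: app_simps(3,5) intro!: endo_eqI)
  thus ?thesis using r by (auto simp: feval_simps)
 qed
qed

section \<open>A functional invariant under n\<close>

text \<open>The operator on the oscillator factor that corresponds to the monomial in the variables
  \<open>Kt r i\<close> of one row r: each root vector is replaced by the negative of its action
  there. \<open>rws\<close> multiplies the rows in the given order.\<close>

definition rw :: "nat => (nat => nat) => endo" where
 "rw r g = cp (%i. - W.z r i) g [1..<r]"

definition rws :: "nat list => (key => nat) => endo" where
 "rws rs \<alpha> = prod_list (map (%r. rw r (%i. \<alpha> (Kt r i))) rs)"

lemma rw_comm:
 assumes "r \<le> m0" "j \<in> {1..<r}" "k \<in> {1..<r}"
 shows "- W.z r j * - W.z r k = - W.z r k * - W.z r j"
 using W.cm_z_z[of r j r k] assms by (auto simp: cm_def)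

lemma rw_Suc:
 assumes "r \<le> m0" "i \<in> {1..<r}"
 shows "rw r (g(i := Suc (g i))) = - W.z r i * rw r g" and "rw r g * W.z r i = W.z r i * rw r g"
proof -
 show "rw r (g(i := Suc (g i))) = - W.z r i * rw r g"
  unfolding rw_def using assms by (intro cp_Suc[of "{1..<r}"] rw_comm) auto
 show "rw r g * W.z r i = W.z r i * rw r g"
  unfolding rw_def using cp_comm[of "{1..<r}" "%i. - W.z r i" "[1..<r]" i g] rw_comm[OF assms(1)] assms by auto
qed

lemma cm_rw:
 assumes "i \<in> {1..<l}" "l < r" "r \<le> m0"
 shows "cm (rw r g) (W.z l i) = csc (of_nat (g l)) * rw r (g(l := g l - 1, i := Suc (g i)))"
proof -
 have "cm (rw r g) (W.z l i) =
   (if l \<in> set [1..<r] then csc (of_nat (g l)) * (- W.z r i * cp (%i. - W.z r i) (g(l := g l - 1)) [1..<r]) else 0)"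
  unfolding rw_def
  by (rule cm_cp[of "{1..<r}"]) (use assms in "auto simp: rw_comm[simplified] cm_uminus_left W.cm_z_z")
 thus ?thesis
  using assms rw_Suc(1)[of r i "g(l := g l - 1)"] by (simp add: rw_def)
qed

abbreviation mv :: "nat => nat => nat => (key => nat) => key => nat" where
 "mv r l i \<alpha> \<equiv> \<alpha>(Kt r l := \<alpha> (Kt r l) - 1, Kt r i := Suc (\<alpha> (Kt r i)))"

lemma rws_upd: "r \<notin> set rs ==> rws rs (\<alpha>(Kt r i := c)) = rws rs \<alpha>"
 unfolding rws_def
 by (intro arg_cong[of _ _ prod_list] map_cong refl arg_cong[of _ _ "rw _"] ext) auto

text \<open>When \<open>W.z l i\<close> is commuted past the rows r > l, each row contributes a
  derivation replacing one factor \<open>z r l\<close> by \<open>z r i\<close>; on exponents this is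
  \<open>mv r l i\<close>.\<close>

lemma cm_rws:
 assumes "i \<in> {1..<l}" "distinct rs" "set rs \<subseteq> {l<..m0}"
 shows "cm (rws rs \<alpha>) (W.z l i) = (\<Sum>r\<in>set rs. csc (of_nat (\<alpha> (Kt r l))) * rws rs (mv r l i \<alpha>))"
 using assms(2,3)
proof (induction rs)
 case Nil
 show ?case by (simp add: rws_def)
next
 case (Cons r rs)
 have rws: "rws (r # rs) \<beta> = rw r (%i. \<beta> (Kt r i)) * rws rs \<beta>" for \<beta> by (simp add: rws_def)
 have "cm (rw r (%i. \<alpha> (Kt r i))) (W.z l i) * rws rs \<alpha> = csc (of_nat (\<alpha> (Kt r l))) * rws (r # rs) (mv r l i \<alpha>)"
 proof -
  have "(%j. mv r l i \<alpha> (Kt r j)) = (%j. \<alpha> (Kt r j))(l := \<alpha> (Kt r l) - 1, i := Suc (\<alpha> (Kt r i)))"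
   by auto
  thus ?thesis
   using assms(1) Cons.prems by (simp add: rws cm_rw rws_upd mult.assoc del: fun_upd_apply)
 qed
 moreover have "rw r (%i. \<alpha> (Kt r i)) * cm (rws rs \<alpha>) (W.z l i) =
   (\<Sum>r'\<in>set rs. csc (of_nat (\<alpha> (Kt r' l))) * rws (r # rs) (mv r' l i \<alpha>))"
  using Cons unfolding sum_distrib_left rws
  by (auto simp: sum_distrib_left csc_left_comm[of "rw _ _"] fun_upd_def intro!: sum.cong arg_cong2[of _ _ _ _ "(*)"] arg_cong[of _ _ "rw r"])
 ultimately show ?case
  unfolding rws cm_mult_left using Cons.prems by (simp add: rws)
qed

text \<open>The operator does not move the exponents of the auxiliary variables. This is needed
  because \<open>psi\<close> applies an operator which itself depends on these exponents;
  \<open>tloc\<close> allows it to be frozen.\<close>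

definition tloc :: "endo => bool" where
 "tloc x \<longleftrightarrow> (\<forall>\<chi> \<chi>' \<alpha>. (\<forall>\<alpha>'. (\<forall>r k. \<alpha>' (Kt r k) = \<alpha> (Kt r k)) --> \<chi> \<alpha>' = \<chi>' \<alpha>') --> app x \<chi> \<alpha> = app x \<chi>' \<alpha>)"

lemma HD_tloc: "x \<in> M.HD ==> tloc x"
 unfolding M.HD_def
proof (induction rule: salg.induct)
 case (base x)
 have *: "tloc (mu (Kx a i))" "tloc (dd (Kx a i))" "tloc (- mu (Kx a i))" for a i
  by (auto simp: tloc_def)
 thus ?case using base by (auto simp: M.HDg_def Pm_def Qm_def)
next
 case (mult x y)
 thus ?case unfolding tloc_def app_simps by (metis (no_types, lifting))
next
 case (add x y)
 thus ?case unfolding tloc_def app_simps by (metis (no_types, lifting))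
qed (auto simp: tloc_def)

text \<open>The functional that is 1 on the oscillator monomial with exponents \<beta>, whatever the
  auxiliary exponents, and 0 on all other oscillator monomials.\<close>

definition vac :: "(nat => nat => nat) => fock" where
 "vac \<beta> \<alpha> = (if \<forall>a k. \<alpha> (Kx a k) = \<beta> a k then 1 else 0)"

lemma HD_vac:
 assumes "x \<in> M.HD"
 shows "app x (vac \<beta>) (\<alpha>(Kt r k := c)) = app x (vac \<beta>) \<alpha>"
proof -
 have "cm (mu (Kt r k)) x = 0"
  by (rule salg_cm_0[OF assms[unfolded M.HD_def]])
   (auto simp: M.HDg_def Pm_def Qm_def cm_mu_dd cm_uminus)
 hence "app (mu (Kt r k) * x) (vac \<beta>) = app (x * mu (Kt r k)) (vac \<beta>)"
  by (simp only: cm_eq_0_iff)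
 moreover have "app (mu (Kt r k)) (vac \<beta>) = vac \<beta>" by (rule ext) (simp add: vac_def)
 ultimately have *: "app x (vac \<beta>) \<alpha> = app x (vac \<beta>) (\<alpha>(Kt r k := Suc (\<alpha> (Kt r k))))" for \<alpha>
  by (simp add: fun_eq_iff)
 have "app x (vac \<beta>) (\<alpha>(Kt r k := c)) = app x (vac \<beta>) (\<alpha>(Kt r k := 0))" for c
 proof (induction c)
  case (Suc c)
  thus ?case using *[of "\<alpha>(Kt r k := c)"] by (simp only: fun_upd_same fun_upd_upd)
 qed simp
 from this[of c] this[of "\<alpha> (Kt r k)"] show ?thesis by simp
qed

lemma rws_HD: "set rs \<subseteq> M0 ==> rws rs \<alpha> \<in> M.HD"
proof -
 assume rs: "set rs \<subseteq> M0"
 have "W.z r i \<in> M.HD" if "r \<in> M0" "i \<in> M0" for r i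
  using M.z_HD that .
 thus ?thesis
  unfolding rws_def rw_def cp_def M.HD_def using rs by (fastforce intro!: salg_intros)
qed

text \<open>Invariance under n means that a root vector acting on the Verma factor may be traded for
  its negative on the oscillator factor. As the Verma module is free over U(n), this determines the
  functional from its restriction \<open>vac \<beta>\<close> to the highest weight vector.\<close>

definition psi :: "(nat => nat => nat) => fock" where
 "psi \<beta> \<alpha> = app (rws [1..<m0 + 1] \<alpha>) (vac \<beta>) \<alpha>"

lemma HD_psi: "x \<in> M.HD ==> app x (psi \<beta>) \<alpha> = app (rws [1..<m0 + 1] \<alpha> * x) (vac \<beta>) \<alpha>"
proof -
 assume "x \<in> M.HD"
 hence "app x (psi \<beta>) \<alpha> = app x (app (rws [1..<m0 + 1] \<alpha>) (vac \<beta>)) \<alpha>"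
  using HD_tloc[unfolded tloc_def] by (auto simp: psi_def rws_def)
 thus ?thesis by simp
qed

text \<open>The root vector E_{li} acts by multiplication on the level where it was introduced; each
  later level r adds the vector field that moves \<open>Kt r l\<close> to
  \<open>Kt r i\<close>.\<close>

lemma Lm_lower: "i < l ==> 1 \<le> i ==> l \<le> m ==> Lm \<mu> m l i = mu (Kt l i) - (\<Sum>r\<in>{l<..m}. mu (Kt r i) * dd (Kt r l))"
proof (induction m)
 case (Suc m)
 show ?case
 proof (cases "l = Suc m")
  case True
  thus ?thesis using Suc.prems by (simp add: gl_ext_def)
 next
  case False
  hence "{l<..Suc m} = insert (Suc m) {l<..m}" using Suc.prems by auto
  thus ?thesis using Suc False by (simp add: gl_ext_def)
 qed
qed simp

text \<open>The multiplication term of \<open>Lm_lower\<close> and \<open>W.z l i\<close> combine to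
  the commutator of \<open>W.z l i\<close> with the later rows. By \<open>cm_rws\<close> this is the
  sum of the vector fields occurring with the opposite sign in \<open>Lm_lower\<close>.\<close>

lemma psi_lower:
 assumes "1 \<le> i" "i < l" "l \<le> m0"
 shows "app (em \<mu> l i) (psi \<beta>) = (%_. 0)"
proof
 fix \<alpha>
 let ?R = "rws [1..<m0 + 1]"
 have split: "[1..<m0 + 1] = [1..<l] @ l # [l + 1..<m0 + 1]"
  using upt_add_eq_append[of 1 l "m0 + 1 - l"] upt_conv_Cons[of l "m0 + 1"] assms by (simp flip: Suc_eq_plus1)
 have R: "?R \<alpha> = rws [1..<l] \<alpha> * rw l (%i. \<alpha> (Kt l i)) * rws [l + 1..<m0 + 1] \<alpha>" for \<alpha>
  unfolding split by (simp add: rws_def mult.assoc)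
 have HD: "?R \<gamma> \<in> M.HD" "W.z l i \<in> M.HD" for \<gamma>
  by (rule rws_HD, auto) (rule M.z_HD, use assms in auto)
 have mu: "app (mu (Kt r k)) (psi \<beta>) \<gamma> = app (?R (\<gamma>(Kt r k := Suc (\<gamma> (Kt r k))))) (vac \<beta>) \<gamma>" for r k \<gamma>
  by (simp add: psi_def HD_vac[OF HD(1)] del: fun_upd_apply)
 have mv: "app (mu (Kt r i) * dd (Kt r l)) (psi \<beta>) \<alpha> = of_nat (\<alpha> (Kt r l)) * app (?R (mv r l i \<alpha>)) (vac \<beta>) \<alpha>" for r
  using assms by (simp add: psi_def HD_vac[OF HD(1)] del: fun_upd_apply) (simp add: fun_upd_def)
 have Suc: "?R (\<alpha>(Kt l i := Suc (\<alpha> (Kt l i)))) = rws [1..<l] \<alpha> * (- (rw l (%i. \<alpha> (Kt l i)) * W.z l i)) * rws [l + 1..<m0 + 1] \<alpha>"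
 proof -
  have "(%j. (\<alpha>(Kt l i := Suc (\<alpha> (Kt l i)))) (Kt l j)) = (%j. \<alpha> (Kt l j))(i := Suc (\<alpha> (Kt l i)))" by auto
  thus ?thesis
   unfolding R using rw_Suc[of l i "%i. \<alpha> (Kt l i)"] assms by (simp add: rws_upd del: fun_upd_apply)
 qed
 have mvR: "?R (mv r l i \<alpha>) = rws [1..<l] \<alpha> * rw l (%i. \<alpha> (Kt l i)) * rws [l + 1..<m0 + 1] (mv r l i \<alpha>)"
  if "r \<in> set [l + 1..<m0 + 1]" for r
  using that by (simp add: R rws_upd)
 have "?R (\<alpha>(Kt l i := Suc (\<alpha> (Kt l i)))) + ?R \<alpha> * W.z l i =
   rws [1..<l] \<alpha> * rw l (%i. \<alpha> (Kt l i)) * cm (rws [l + 1..<m0 + 1] \<alpha>) (W.z l i)"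
  unfolding Suc R[of \<alpha>] by (simp add: cm_def algebra_simps)
 also have "\<dots> = (\<Sum>r\<in>set [l + 1..<m0 + 1]. csc (of_nat (\<alpha> (Kt r l))) * ?R (mv r l i \<alpha>))"
 proof -
  have C: "cm (rws [l + 1..<m0 + 1] \<alpha>) (W.z l i) =
    (\<Sum>r\<in>set [l + 1..<m0 + 1]. csc (of_nat (\<alpha> (Kt r l))) * rws [l + 1..<m0 + 1] (mv r l i \<alpha>))"
   by (rule cm_rws) (use assms in auto)
  show ?thesis
   unfolding C sum_distrib_left by (intro sum.cong refl) (simp only: mvR csc_left_comm[of "_ * _"])
 qed
 finally have "?R (\<alpha>(Kt l i := Suc (\<alpha> (Kt l i)))) + ?R \<alpha> * W.z l i =
   (\<Sum>r\<in>set [l + 1..<m0 + 1]. csc (of_nat (\<alpha> (Kt r l))) * ?R (mv r l i \<alpha>))" .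
 from arg_cong[OF this, of "%x. app x (vac \<beta>) \<alpha>"]
 have "app (mu (Kt l i)) (psi \<beta>) \<alpha> + app (W.z l i) (psi \<beta>) \<alpha> =
   (\<Sum>r\<in>set [l + 1..<m0 + 1]. app (mu (Kt r i) * dd (Kt r l)) (psi \<beta>) \<alpha>)"
  unfolding mv mu HD_psi[OF HD(2)] app_sum by (simp add: app_sum app_scale del: fun_upd_apply)
 moreover have "set [l + 1..<m0 + 1] = {l<..m0}" by auto
 ultimately show "app (em \<mu> l i) (psi \<beta>) \<alpha> = 0"
  using assms by (simp add: em_def Lm_lower app_sum diff_add_eq del: app_mu app_dd)
qed

text \<open>Evaluation at \<open>0\<close> pairs a functional with the highest weight vector of the Verma module
 tensored with the vacuum.\<close>

lemma Lm_0: "a \<in> {1..l} ==> b \<in> {1..l} ==> a \<le> b ==> app (Lm \<mu> l a b) \<psi> (%_. 0) = (if a = b then \<mu> a else 0) * \<psi> (%_. 0)"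
 by (induction l arbitrary: b) (auto simp: gl_ext_def app_sum le_Suc_eq)

definition mdl :: "weight => B0 => endo" where
 "mdl \<mu> = plift (gm \<mu>)"

lemma mdl_gens:
 assumes \<mu>: "generic m0 \<mu>" and a: "a \<in> M0"
 shows mdl_ec: "b \<in> M0 ==> mdl \<mu> (ec a b) = em \<mu> a b"
  and mdl_Pc: "i \<in> N0 ==> mdl \<mu> (Pc a i) = Pm a i"
  and mdl_Qc: "i \<in> N0 ==> mdl \<mu> (Qc a i) = Qm a i"
  and mdl_eh: "b \<in> M0 ==> mdl \<mu> (B.eh a b) = Lm \<mu> m0 a b"
proof -
 note pl = plift_cls[OF gm_kills[OF \<mu>], folded mdl_def]
 note alg = pgens_tB_def Abar_gens_def A_gens_def
 have ec: "mdl \<mu> (ec a b) = em \<mu> a b" if "b \<in> M0" for b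
  using a that unfolding ec_def by (subst pl) (auto simp: alg gl_gens_def intro!: alg_gener)
 have PQ: "mdl \<mu> (Pc a i) = Pm a i" "mdl \<mu> (Qc a i) = Qm a i" if "i \<in> N0" "a \<in> M0" for i a
  using that unfolding Pc_def Qc_def
  by (subst pl; auto simp: alg feval_gm intro!: pp_alg[of _ m0 _ n0] qq_alg[of _ m0 _ n0])+
 show "b \<in> M0 ==> mdl \<mu> (ec a b) = em \<mu> a b" "i \<in> N0 ==> mdl \<mu> (Pc a i) = Pm a i"
  "i \<in> N0 ==> mdl \<mu> (Qc a i) = Qm a i" using ec PQ a by auto
 show "mdl \<mu> (B.eh a b) = Lm \<mu> m0 a b" if "b \<in> M0"
 proof -
  have "mdl \<mu> (sum h S) = (\<Sum>x\<in>S. mdl \<mu> (h x))" for h and S :: "nat set"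
   by (induction S rule: infinite_finite_induct) (simp_all add: mdl_def plift_hom[OF gm_kills[OF \<mu>]])
  hence "mdl \<mu> (B.z a b) = W.z a b"
   using a that PQ by (auto simp: B.z_def W.z_def mdl_def plift_hom[OF gm_kills[OF \<mu>]] intro!: sum.cong)
  thus ?thesis
   using ec[OF that] by (simp add: B.eh_def em_def mdl_def plift_hom[OF gm_kills[OF \<mu>]])
 qed
qed

text \<open>Products act in reversed order. A generator of J thus meets the functional before
  anything else and kills it, while a generator of I acts last and gives 0 at the zero exponent,
  being an annihilator of the highest weight vector there.\<close>

lemma KT_killed:
 assumes \<mu>: "generic m0 \<mu>" and "x \<in> B.KT \<mu> (%a. a \<le> p0)"
 shows "app (mdl \<mu> x) (psi \<beta>) (%_. 0) = 0"
 using assms(2)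
proof (induction rule: B.KT_induct)
 note hom = plift_hom[OF gm_kills[OF \<mu>], folded mdl_def]
 {
  case (J s r)
  then obtain a b where s: "s = ec b a" "a \<in> M0" "b \<in> M0" "a < b" unfolding B.Jg_def by blast
  thus ?case by (simp add: hom mdl_ec[OF \<mu>] psi_lower)
 next
  case (I s r)
  then consider a k where "s = Qc a k" "a \<in> M0" "k \<in> N0" "a \<le> p0"
   | a k where "s = Pc a k" "a \<in> M0" "k \<in> N0" "\<not> a \<le> p0"
   | a b where "s = B.eh a b" "a \<in> M0" "b \<in> M0" "a < b"
   | a where "s = B.eh a a - csc (\<mu> a)" "a \<in> M0"
   unfolding B.Ig_def by blast
  thus ?case
   by cases (simp_all add: hom mdl_Pc[OF \<mu>] mdl_Qc[OF \<mu>] mdl_eh[OF \<mu>] Pm_def Qm_def Lm_0)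
 }
qed (simp_all add: plift_hom[OF gm_kills[OF \<mu>], folded mdl_def])

lemma app_mon:
 assumes "set w \<subseteq> M0 \<times> N0"
 shows "\<exists>s\<noteq>0. \<forall>\<chi> \<alpha>. app (M.mon (%a. a \<le> p0) w) \<chi> \<alpha> =
  s * \<chi> (%k. \<alpha> k + (case k of Kt _ _ => 0 | Kx a i => count_list w (a, i)))"
 using assms
proof (induction w)
 case Nil
 have "(%k. \<alpha> k + (case k of Kt _ _ => 0 | Kx a i => count_list [] (a, i))) = \<alpha>" for \<alpha>
  by (rule ext) (simp split: key.split)
 thus ?case by (intro exI[of _ 1]) simp
next
 case (Cons x w)
 then obtain s where s: "s \<noteq> 0" "!!\<chi> \<alpha>. app (M.mon (%a. a \<le> p0) w) \<chi> \<alpha> =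
  s * \<chi> (%k. \<alpha> k + (case k of Kt _ _ => 0 | Kx a i => count_list w (a, i)))" by auto
 define t :: complex where "t = (if fst x \<le> p0 then - 1 else 1)"
 have t: "app (M.cr (%a. a \<le> p0) x) \<chi> \<alpha> = t * \<chi> (\<alpha>(Kx (fst x) (snd x) := Suc (\<alpha> (Kx (fst x) (snd x)))))" for \<chi> \<alpha>
  by (simp add: M.cr_def Pm_def Qm_def t_def)
 have "(%k. \<alpha> k + (case k of Kt _ _ => 0 | Kx a i => count_list w (a, i)))
   (Kx (fst x) (snd x) := Suc (\<alpha> (Kx (fst x) (snd x)) + count_list w x)) =
  (%k. \<alpha> k + (case k of Kt _ _ => 0 | Kx a i => count_list (x # w) (a, i)))" for \<alpha>
  by (rule ext) (auto split: key.split)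
 thus ?case
  using s(1) by (intro exI[of _ "s * t"]) (simp add: s(2) t t_def del: fun_upd_apply)
qed

text \<open>With \<beta> the exponents of w, the functional sees the monomial with a non-zero
  coefficient; at the zero exponent the correction \<open>rws\<close> is 1.\<close>

lemma mon_not_KT:
 assumes \<mu>: "generic m0 \<mu>" and w: "set w \<subseteq> M0 \<times> N0"
 shows "B.mon (%a. a \<le> p0) w \<notin> B.KT \<mu> (%a. a \<le> p0)"
proof
 assume K: "B.mon (%a. a \<le> p0) w \<in> B.KT \<mu> (%a. a \<le> p0)"
 let ?\<beta> = "%a i. count_list w (a, i)"
 note hom = plift_hom[OF gm_kills[OF \<mu>], folded mdl_def]
 have "mdl \<mu> (B.mon (%a. a \<le> p0) w) = M.mon (%a. a \<le> p0) w"
  using w by (induction w) (auto simp: hom B.cr_def M.cr_def mdl_Pc[OF \<mu>] mdl_Qc[OF \<mu>])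
 hence "app (M.mon (%a. a \<le> p0) w) (psi ?\<beta>) (%_. 0) = 0"
  using KT_killed[OF \<mu> K, of ?\<beta>] by simp
 moreover have "rws [1..<m0 + 1] (%_. 0) = 1"
 proof -
  have "cp F (%_. 0) xs = 1" for F :: "nat => endo" and xs by (induction xs) (simp_all add: cp_def)
  hence "rws rs (%_. 0) = 1" for rs by (induction rs) (simp_all add: rws_def rw_def)
  thus ?thesis .
 qed
 ultimately have "app (M.mon (%a. a \<le> p0) w) (vac ?\<beta>) (%_. 0) = 0"
  using HD_psi[OF M.mon_HD[OF w]] by simp
 thus False
  using app_mon[OF w] by (auto simp: vac_def)
qed

section \<open>Zhelobenko operators on the vector\<close>

definition ff :: "complex => nat => complex" where
 "ff h s = (\<Prod>r<s. h - of_nat r)"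

lemma ff_0 [simp]: "ff h 0 = 1" and ff_Suc: "ff h (Suc s) = ff h s * (h - of_nat s)"
 by (simp_all add: ff_def)

lemma ff_Suc': "ff h (Suc s) = h * ff (h - 1) s"
 by (induction s) (simp_all add: ff_Suc algebra_simps)

lemma ff_nz: "(!!r::nat. h \<noteq> of_nat r) ==> ff h s \<noteq> 0"
 by (simp add: ff_def)

lemma ff_nat: "ff (of_nat b) (Suc s) = ff (of_nat b) s * of_nat (b - s)"
proof (cases "s \<le> b")
 case False
 hence "ff (of_nat b) s = 0" unfolding ff_def by (intro prod_zero) (auto intro!: bexI[of _ b])
 thus ?thesis by (simp add: ff_Suc)
qed (simp add: ff_Suc of_nat_diff)

lemma ff_choose: "ff (of_nat b) s = fact s * of_nat (b choose s)"
 unfolding binomial_gbinomial gbinomial_prod_rev by (simp add: ff_def atLeast0LessThan)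

lemma pochhammer_neg: "pochhammer (- x) s = (- 1) ^ s * ff x s"
 by (induction s) (simp_all add: pochhammer_Suc ff_Suc algebra_simps)

text \<open>The Chu-Vandermonde identity, by Pascal's rule: one part of the sum is the case b for
  the same h and x, the other the case b for h - 1 and x + 1. The upper limit M is arbitrary above
  b, since the Zhelobenko series is cut off at an unrelated place.\<close>

lemma vandermonde_quotient:
 assumes "!!r::nat. h \<noteq> of_nat r" "b < M"
 shows "(\<Sum>s<M. of_nat (b choose s) * pochhammer x s / ff h s) = ff (h + x) b / ff h b"
proof -
 have "(\<Sum>s<M. of_nat (b choose s) * pochhammer x s / ff h s) = (\<Sum>s\<le>b. of_nat (b choose s) * pochhammer x s / ff h s)"
  using assms(2) by (intro sum.mono_neutral_right) auto
 also have "\<dots> = ff (h + x) b / ff h b"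
  using assms(1)
 proof (induction b arbitrary: x h)
  case (Suc b)
  have h: "h \<noteq> of_nat r" "h - 1 \<noteq> of_nat r" for r
   using Suc.prems[of r] Suc.prems[of "Suc r"] by (auto simp: algebra_simps)
  have "h \<noteq> 0" using h(1)[of 0] by simp
  let ?f = "%b s. of_nat (b choose s) * pochhammer x s / ff h s"
  have "(\<Sum>s\<le>Suc b. ?f (Suc b) s) = 1 + (\<Sum>s\<le>b. of_nat (b choose s) * pochhammer x (Suc s) / ff h (Suc s))
    + (\<Sum>s\<le>b. of_nat (b choose Suc s) * pochhammer x (Suc s) / ff h (Suc s))"
   unfolding sum.atMost_Suc_shift by (simp add: add_divide_distrib distrib_right sum.distrib)
  also have "(\<Sum>s\<le>b. of_nat (b choose Suc s) * pochhammer x (Suc s) / ff h (Suc s)) = (\<Sum>s\<le>Suc b. ?f b s) - 1"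
   unfolding sum.atMost_Suc_shift by simp
  also have "(\<Sum>s\<le>Suc b. ?f b s) = ff (h + x) b / ff h b"
   using Suc.IH[OF h(1)] by simp
  also have "(\<Sum>s\<le>b. of_nat (b choose s) * pochhammer x (Suc s) / ff h (Suc s)) =
    x / h * (\<Sum>s\<le>b. of_nat (b choose s) * pochhammer (x + 1) s / ff (h - 1) s)"
   by (simp add: sum_distrib_left pochhammer_rec ff_Suc' mult_ac)
  also have "\<dots> = x * (ff (h + x) b / ff h (Suc b))"
   using Suc.IH[OF h(2), of "x + 1"] by (simp add: ff_Suc')
  finally have "(\<Sum>s\<le>Suc b. ?f (Suc b) s) = ff (h + x) b / ff h b + x * (ff (h + x) b / ff h (Suc b))" by simp
  also have "\<dots> = ff (h + x) (Suc b) / ff h (Suc b)"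
   using h(1)[of b] ff_nz[of h b] h(1) by (simp add: ff_Suc field_simps)
  finally show ?case .
 qed simp
 finally show ?thesis .
qed

lemma pow_cm_const:
 fixes x y :: "'r::calg"
 assumes "cm x y = csc k"
 shows "x * y ^ A = y ^ A * x + csc (k * of_nat A) * y ^ (A - 1)"
proof (induction A)
 case (Suc A)
 have "x * y ^ Suc A = (y * x + csc k) * y ^ A"
  using assms cm_swap_mult[of x y] by (simp flip: mult.assoc)
 also have "\<dots> = y * (x * y ^ A) + csc k * y ^ A" by (simp add: distrib_right mult.assoc)
 also have "\<dots> = y ^ Suc A * x + (csc (k * of_nat A) * (y * y ^ (A - 1)) + csc k * y ^ A)"
  by (simp add: Suc distrib_left mult.assoc csc_left_comm[of y])
 also have "csc (k * of_nat A) * (y * y ^ (A - 1)) + csc k * y ^ A = csc (k * of_nat (Suc A)) * y ^ A"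
 proof -
  have "csc (k * of_nat A) * (y * y ^ (A - 1)) = csc (k * of_nat A) * y ^ A" by (cases A) simp_all
  thus ?thesis by (simp add: distrib_left csc_add distrib_right add.commute)
 qed
 finally show ?case by simp
qed simp

context simple_root_step
begin

lemma hc_eigen:
 assumes H: "H 0 * y - csc h * y \<in> I" and h: "!!r::nat. h \<noteq> of_nat r"
 shows "hc s * y - csc (1 / (fact s * ff h s)) * y \<in> I"
proof (induction s)
 case (Suc s)
 let ?i = "iv c (Suc c) (- int s)"
 have "H s * y - csc (h - of_nat s) * y = H 0 * y - csc h * y"
  by (simp add: den_def csc_diff csc_uminus algebra_simps)
 hence "- (csc (1 / (h - of_nat s)) * ?i * (H s * y - csc (h - of_nat s) * y)) \<in> I"
  using H by (simp add: B.IT_uminus B.IT_lmult)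
 moreover have "csc (1 / (h - of_nat s)) * ?i * (H s * y - csc (h - of_nat s) * y) = csc (1 / (h - of_nat s)) * y - ?i * y"
 proof -
  have "?i * (H s * y) = y" using den_iv(2)[of c "Suc c" "- int s"] c_range by (simp flip: mult.assoc)
  moreover have "csc (1 / (h - of_nat s)) * (?i * (csc (h - of_nat s) * y)) = ?i * y"
   using h[of s] csc_cancel[of "h - of_nat s" "?i * y"] by (simp add: csc_left_comm[of ?i] inverse_eq_divide)
  ultimately show ?thesis by (simp add: right_diff_distrib mult.assoc)
 qed
 ultimately have i: "?i * y - csc (1 / (h - of_nat s)) * y \<in> I" by simp
 have "hc (Suc s) * y - csc (1 / (fact (Suc s) * ff h (Suc s))) * y =
   csc (1 / of_nat (Suc s)) * (hc s * (?i * y - csc (1 / (h - of_nat s)) * y) +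
    csc (1 / (h - of_nat s)) * (hc s * y - csc (1 / (fact s * ff h s)) * y))"
 proof -
  have "1 / (fact (Suc s) * ff h (Suc s)) = 1 / of_nat (Suc s) * (1 / (h - of_nat s) * (1 / (fact s * ff h s)))"
   by (simp add: ff_Suc mult_ac)
  hence "csc (1 / (fact (Suc s) * ff h (Suc s))) * y =
    csc (1 / of_nat (Suc s)) * (csc (1 / (h - of_nat s)) * (csc (1 / (fact s * ff h s)) * y))"
   by (simp only: csc_mult mult.assoc)
  thus ?thesis
   by (simp add: right_diff_distrib distrib_left mult.assoc csc_left_comm[of "hc s"] del: of_nat_Suc)
 qed
 thus ?case
  using i Suc by (simp add: B.IT_add B.IT_lmult del: hc.simps of_nat_Suc)
qed simp

text \<open>If each E^s ad(F)^s y is a multiple of y modulo I, then so is the whole series, because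
  \<open>hc s\<close> acts on y by the scalar obtained from H = h. The factorials cancel, and \<xi>
  becomes a scalar sum.\<close>

lemma xiT_eigen:
 assumes y: "y \<in> B.AA" and k: "!!s. E ^ s * ad s y - csc (fact s * k s) * y \<in> I"
  and H: "H 0 * y - csc h * y \<in> I" and h: "!!r::nat. h \<noteq> of_nat r"
  and l: "!!M. M1 \<le> M ==> (\<Sum>s<M. k s / ff h s) = l"
 shows "xiT y - csc l * y \<in> I"
proof -
 obtain N where N: "ad N y = 0" using nilp y by blast
 define M where "M = max N M1"
 have "xiT y = (\<Sum>s<M. hc s * E ^ s * ad s y)"
  by (rule xiT_eq[OF N]) (simp add: M_def)
 moreover have "csc l * y = (\<Sum>s<M. csc (k s / ff h s) * y)"
  unfolding sum_distrib_right[symmetric] csc_sum[symmetric] using l[of M] by (simp add: M_def)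
 ultimately have "xiT y - csc l * y = (\<Sum>s<M. hc s * (E ^ s * ad s y) - csc (k s / ff h s) * y)"
  by (simp add: sum_subtractf mult.assoc)
 also have "\<dots> = (\<Sum>s<M. hc s * (E ^ s * ad s y - csc (fact s * k s) * y) +
   csc (fact s * k s) * (hc s * y - csc (1 / (fact s * ff h s)) * y))"
 proof (intro sum.cong refl)
  fix s
  have "k s / ff h s = fact s * k s * (1 / (fact s * ff h s))" by simp
  hence "csc (k s / ff h s) * y = csc (fact s * k s) * (csc (1 / (fact s * ff h s)) * y)"
   by (simp only: csc_mult mult.assoc)
  thus "hc s * (E ^ s * ad s y) - csc (k s / ff h s) * y = hc s * (E ^ s * ad s y - csc (fact s * k s) * y) +
   csc (fact s * k s) * (hc s * y - csc (1 / (fact s * ff h s)) * y)"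
   by (simp add: right_diff_distrib csc_left_comm[of "hc s"])
 qed
 also have "\<dots> \<in> I"
  by (intro B.IT_sum B.IT_add B.IT_lmult k hc_eigen[OF H h])
 finally show ?thesis .
qed

text \<open>Two rows of the same type: u and v are the creation operators of one column, F turns v
  into u, and E turns u back into v modulo I. The signs \<kappa> occur in pairs. The resulting terms
  are C(b, s) times the rising factorial of a + 1, so Vandermonde applies with x = a + 1.\<close>

lemma string:
 assumes uv: "u * v = v * u" and F: "cm F u = 0" "cm F v = csc \<kappa> * u" "cm F R = 0" and \<kappa>: "\<kappa> * \<kappa> = 1"
  and E: "!!A B. E * (u ^ A * v ^ B * R) - csc (\<kappa> * of_nat A) * (u ^ (A - 1) * v ^ (B + 1) * R) \<in> I"
  and AA: "u ^ a * v ^ b * R \<in> B.AA"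
  and H: "H 0 * (u ^ a * v ^ b * R) - csc h * (u ^ a * v ^ b * R) \<in> I" and h: "!!r::nat. h \<noteq> of_nat r"
 shows "xiT (u ^ a * v ^ b * R) - csc (ff (h + (of_nat a + 1)) b / ff h b) * (u ^ a * v ^ b * R) \<in> I"
proof (rule xiT_eigen[OF AA _ H h])
 define Y where "Y A B = u ^ A * v ^ B * R" for A B
 have uvp: "v ^ B * u = u * v ^ B" for B using uv by (intro power_commuting_commutes) simp
 have Fv: "cm F (v ^ B) = csc (\<kappa> * of_nat B) * (u * v ^ (B - 1))" for B
 proof (induction B)
  case (Suc B)
  have "v * (u * v ^ (B - 1)) = u * v ^ B" if "B > 0"
   using that uv by (cases B) (auto simp flip: mult.assoc)
  thus ?case
   by (cases "B = 0") (simp_all add: cm_mult F Suc csc_left_comm[of v] mult.assoc distrib_left csc_add distrib_right)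
 qed simp
 have Fu: "cm F (u ^ A) = 0" for A
  by (induction A) (simp_all add: cm_mult F)
 have FY: "cm F (Y A B) = csc (\<kappa> * of_nat B) * Y (Suc A) (B - 1)" for A B
  by (simp add: Y_def cm_mult Fu Fv F mult.assoc csc_left_comm[of "u ^ _"])
   (simp add: power_commutes flip: mult.assoc)
 have ad: "ad s (Y a b) = csc (\<kappa> ^ s * ff (of_nat b) s) * Y (a + s) (b - s)" for s
 proof (induction s)
  case (Suc s)
  have "ad (Suc s) (Y a b) = csc (\<kappa> ^ s * ff (of_nat b) s) * (csc (\<kappa> * of_nat (b - s)) * Y (Suc (a + s)) (b - s - 1))"
   by (simp add: Suc cm_csc_mult FY)
  also have "\<dots> = csc (\<kappa> ^ Suc s * ff (of_nat b) (Suc s)) * Y (a + Suc s) (b - Suc s)"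
  proof -
   have "csc (\<kappa> ^ s * ff (of_nat b) s) * (csc (\<kappa> * of_nat (b - s)) * y) = csc (\<kappa> ^ Suc s * ff (of_nat b) (Suc s)) * y" for y :: B0
    unfolding mult.assoc[symmetric, of "csc _"] csc_mult[symmetric] ff_nat by (simp add: mult_ac)
   moreover have "b - s - 1 = b - Suc s" by simp
   ultimately show ?thesis by (simp only: add_Suc_right)
  qed
  finally show ?case .
 qed simp
 have EY: "E ^ s * Y (a + s) B - csc (\<kappa> ^ s * pochhammer (of_nat a + 1) s) * Y a (B + s) \<in> I" for s B
 proof (induction s arbitrary: B)
  case (Suc s)
  let ?k = "\<kappa> * of_nat (a + Suc s)" and ?l = "\<kappa> ^ s * pochhammer (of_nat a + 1) s"
  have "E ^ s * (E * Y (a + Suc s) B - csc ?k * Y (a + s) (B + 1)) +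
    csc ?k * (E ^ s * Y (a + s) (B + 1) - csc ?l * Y a (B + 1 + s)) \<in> I"
   using E[of "a + Suc s" B] Suc[of "B + 1"] by (intro B.IT_add B.IT_lmult) (simp_all add: Y_def)
  moreover have "\<kappa> ^ Suc s * pochhammer (of_nat a + 1) (Suc s) = ?k * ?l"
   by (simp add: pochhammer_Suc algebra_simps)
  hence "csc (\<kappa> ^ Suc s * pochhammer (of_nat a + 1) (Suc s)) * Y a (B + Suc s) = csc ?k * (csc ?l * Y a (B + 1 + s))"
   using add.commute[of 1 s] by (simp only: csc_mult mult.assoc add.assoc Suc_eq_plus1)
  hence "E ^ Suc s * Y (a + Suc s) B - csc (\<kappa> ^ Suc s * pochhammer (of_nat a + 1) (Suc s)) * Y a (B + Suc s) =
    E ^ s * (E * Y (a + Suc s) B - csc ?k * Y (a + s) (B + 1)) +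
    csc ?k * (E ^ s * Y (a + s) (B + 1) - csc ?l * Y a (B + 1 + s))"
   unfolding power_Suc2 mult.assoc right_diff_distrib csc_left_comm[of "E ^ s"] by simp
  ultimately show ?case by (simp only:)
 qed simp
 show "E ^ s * ad s (u ^ a * v ^ b * R) - csc (fact s * (of_nat (b choose s) * pochhammer (of_nat a + 1) s)) * (u ^ a * v ^ b * R) \<in> I" for s
 proof -
  let ?l = "\<kappa> ^ s * pochhammer (of_nat a + 1) s" and ?k = "\<kappa> ^ s * ff (of_nat b) s"
  have "fact s * (of_nat (b choose s) * pochhammer (of_nat a + 1) s) = ?k * ?l"
   using \<kappa> by (simp add: ff_choose mult_ac flip: power_mult_distrib)
  hence *: "csc (fact s * (of_nat (b choose s) * pochhammer (of_nat a + 1) s)) * Y a b = csc ?k * (csc ?l * Y a b)"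
   by (simp only: csc_mult mult.assoc)
  have "csc ?k * (E ^ s * Y (a + s) (b - s) - csc ?l * Y a (b - s + s)) \<in> I"
   using EY by (rule B.IT_lmult)
  moreover have "csc ?k * (csc ?l * Y a (b - s + s)) = csc ?k * (csc ?l * Y a b)"
   by (cases "s \<le> b") (simp_all add: ff_choose binomial_eq_0 not_le)
  ultimately show ?thesis
   unfolding Y_def[symmetric] ad * by (simp add: right_diff_distrib csc_left_comm[of "E ^ s"])
 qed
 show "(\<Sum>s<M. of_nat (b choose s) * pochhammer (of_nat a + 1) s / ff h s) = ff (h + (of_nat a + 1)) b / ff h b"
  if "Suc b \<le> M" for M
  using that by (intro vandermonde_quotient h) auto
qed

end

context simple_root_step
begin

abbreviation P1 :: "nat => B0" where "P1 \<equiv> Pc c"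
abbreviation P2 :: "nat => B0" where "P2 \<equiv> Pc (Suc c)"
abbreviation Q1 :: "nat => B0" where "Q1 \<equiv> Qc c"
abbreviation Q2 :: "nat => B0" where "Q2 \<equiv> Qc (Suc c)"

lemma E_HD:
 assumes "y \<in> B.HD"
 shows "E * y - B.z c (Suc c) * y \<in> I"
proof -
 have "E * y - B.z c (Suc c) * y = B.eh c (Suc c) * y" by (simp add: B.eh_def left_diff_distrib)
 also have "\<dots> = y * B.eh c (Suc c)" using B.eh_HD_comm assms c_range by blast
 also have "B.eh c (Suc c) \<in> B.Ig \<nu> ep" unfolding B.Ig_def using c_range by blast
 hence "y * B.eh c (Suc c) \<in> I" by (rule B.Ig_IT)
 finally show ?thesis .
qed

definition away :: "B0 => bool" where
 "away R \<longleftrightarrow> R \<in> B.HD \<and> cm F R = 0 \<and> (\<forall>k\<in>N0. \<forall>a\<in>{c, Suc c}. Pc a k * R = R * Pc a k \<and> Qc a k * R = R * Qc a k)"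

lemma away_mon:
 assumes "set w \<subseteq> M0 \<times> N0" "!!x. x \<in> set w ==> fst x \<noteq> c \<and> fst x \<noteq> Suc c"
 shows "away (B.mon ep w)"
proof -
 have "cm F (B.mon ep w) = 0 \<and> (\<forall>k\<in>N0. \<forall>a\<in>{c, Suc c}. cm (Pc a k) (B.mon ep w) = 0 \<and> cm (Qc a k) (B.mon ep w) = 0)"
  using assms
 proof (induction w)
  case (Cons x w)
  hence "x \<in> M0 \<times> N0" "fst x \<noteq> c" "fst x \<noteq> Suc c" by auto
  hence "cm F (B.cr ep x) = 0 \<and> (\<forall>k\<in>N0. \<forall>a\<in>{c, Suc c}. cm (Pc a k) (B.cr ep x) = 0 \<and> cm (Qc a k) (B.cr ep x) = 0)"
   using c_range by (auto simp: B.cr_def B.eP B.eQ B.PP B.QQ B.PQ B.QP)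
  thus ?case using Cons by (simp add: cm_mult)
 qed simp
 thus ?thesis using B.mon_HD[OF assms(1)] by (simp add: away_def cm_eq_0_iff)
qed

lemma Qc_I: "a \<in> M0 ==> k \<in> N0 ==> ep a ==> y * Qc a k \<in> I"
 and Pc_I: "a \<in> M0 ==> k \<in> N0 ==> \<not> ep a ==> y * Pc a k \<in> I"
 by (rule B.Ig_IT, auto simp: B.Ig_def)+

lemma swap_pow: "cm x y = csc k ==> x * (y ^ A * r) = y ^ A * (x * r) + csc (k * of_nat A) * (y ^ (A - 1) * r)" for x y r :: B0
 using pow_cm_const[of x y k A] by (simp add: distrib_right flip: mult.assoc)

lemma swap_0: "cm x y = 0 ==> x * (y ^ A * r) = y ^ A * (x * r)" for x y r :: B0
 using swap_pow[of x y 0 A r] by simp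

text \<open>Modulo I, E acts on an oscillator element as the sum over the columns of Q1 P2; only
  column j may contribute.\<close>

lemma E_sum:
 assumes "y \<in> B.HD" "j \<in> N0" "Y0 = csc k * Y"
  and "!!k. k \<in> N0 ==> Q1 k * (P2 k * y) - (if k = j then Y0 else 0) \<in> I"
 shows "E * y - csc k * Y \<in> I"
proof -
 have "B.z c (Suc c) * y - Y0 = (\<Sum>k=1..n0. Q1 k * (P2 k * y) - (if k = j then Y0 else 0))"
  using assms(2) by (simp add: B.z_def sum_distrib_right sum_subtractf mult.assoc)
 also have "\<dots> \<in> I" using assms(4) by (rule B.IT_sum)
 finally have "E * y - B.z c (Suc c) * y + (B.z c (Suc c) * y - Y0) \<in> I"
  by (rule B.IT_add[OF E_HD[OF assms(1)]])
 thus ?thesis using assms(3) by simp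
qed

lemma HD_prod: "x \<in> B.HD ==> y \<in> B.HD ==> r \<in> B.HD ==> x ^ A * y ^ B * r \<in> B.HD"
 unfolding B.HD_def by (intro salg.mult salg_power)

text \<open>Here F turns \<open>P2\<close> into -\<open>P1\<close>, so u = \<open>P1\<close>, v =
  \<open>P2\<close> and \<kappa> = -1. Terms in which \<open>Q1\<close> reaches the right end lie in
  I.\<close>

lemma xiT_PP:
 assumes ep: "ep c" "ep (Suc c)" and j: "j \<in> N0" and R: "away R"
  and H: "H 0 * (P1 j ^ a * P2 j ^ b * R) - csc h * (P1 j ^ a * P2 j ^ b * R) \<in> I"
  and h: "!!r::nat. h \<noteq> of_nat r"
 shows "xiT (P1 j ^ a * P2 j ^ b * R) -
  csc (ff (h + (of_nat a + 1)) b / ff h b) * (P1 j ^ a * P2 j ^ b * R) \<in> I"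
proof (rule string[where \<kappa> = "- 1"])
 have HD: "P1 j ^ A * P2 j ^ B * R \<in> B.HD" for A B
  using c_range j R by (intro HD_prod B.P_HD) (auto simp: away_def)
 thus "P1 j ^ a * P2 j ^ b * R \<in> B.AA" by (rule B.HD_AA)
 show "P1 j * P2 j = (P2 j * P1 j :: B0)"
  using B.PP[of c "Suc c" j j] c_range j by (simp add: cm_eq_0_iff)
 show "cm F (P1 j) = 0" "cm F (P2 j) = csc (- 1) * P1 j" "cm F R = 0"
  using c_range j R by (auto simp: B.eP csc_uminus away_def)
 fix A B
 have PP: "cm (P2 k) (Pc a j) = (0 :: B0)" if "a \<in> {c, Suc c}" "k \<in> N0" for a k
  using B.PP[of "Suc c" a k j] c_range j that by auto
 show "E * (P1 j ^ A * P2 j ^ B * R) - csc (- 1 * of_nat A) * (P1 j ^ (A - 1) * P2 j ^ (B + 1) * R) \<in> I"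
 proof (rule E_sum[OF HD j refl])
  fix k assume k: "k \<in> N0"
  have Q: "cm (Q1 k) (P2 l) = (0 :: B0)" "cm (Q1 k) (P1 j) = (csc (- (if k = j then 1 else 0)) :: B0)"
   if "l \<in> N0" for l
   using c_range k j that by (auto simp: B.QP csc_uminus)
  have "Q1 k * (P2 k * (P1 j ^ A * P2 j ^ B * R)) =
    P2 k * (Q1 k * (P1 j ^ A * (P2 j ^ B * R)))"
   using swap_0[OF Q(1)[OF k], of 1] by (simp add: mult.assoc)
  also have "Q1 k * (P1 j ^ A * (P2 j ^ B * R)) = P1 j ^ A * (P2 j ^ B * R) * Q1 k
    + csc (- (if k = j then of_nat A else 0)) * (P1 j ^ (A - 1) * (P2 j ^ B * R))"
   using R k swap_pow[OF Q(2)[OF j], of A] swap_0[OF Q(1)[OF j], of B] by (auto simp: away_def mult.assoc)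
  also have "P2 k * (P1 j ^ A * (P2 j ^ B * R) * Q1 k +
    csc (- (if k = j then of_nat A else 0)) * (P1 j ^ (A - 1) * (P2 j ^ B * R))) =
   P2 k * P1 j ^ A * (P2 j ^ B * R) * Q1 k +
    (if k = j then csc (- 1 * of_nat A) * (P1 j ^ (A - 1) * P2 j ^ (B + 1) * R) else 0)"
   using swap_0[OF PP[of c j], of "A - 1"] j
   by (simp add: distrib_left mult.assoc csc_left_comm[of "Pc _ _"] flip: Suc_eq_plus1)
  finally show "Q1 k * (P2 k * (P1 j ^ A * P2 j ^ B * R)) -
    (if k = j then csc (- 1 * of_nat A) * (P1 j ^ (A - 1) * P2 j ^ (B + 1) * R) else 0) \<in> I"
   using c_range k ep by (simp add: Qc_I del: mult_minus1)
 qed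
qed (use H h in auto)

lemma xiT_QQ:
 assumes ep: "\<not> ep c" "\<not> ep (Suc c)" and j: "j \<in> N0" and R: "away R"
  and H: "H 0 * (Q2 j ^ a * Q1 j ^ b * R) - csc h * (Q2 j ^ a * Q1 j ^ b * R) \<in> I"
  and h: "!!r::nat. h \<noteq> of_nat r"
 shows "xiT (Q2 j ^ a * Q1 j ^ b * R) -
  csc (ff (h + (of_nat a + 1)) b / ff h b) * (Q2 j ^ a * Q1 j ^ b * R) \<in> I"
proof (rule string[where \<kappa> = 1])
 have HD: "Q2 j ^ A * Q1 j ^ B * R \<in> B.HD" for A B
  using c_range j R by (intro HD_prod B.Q_HD) (auto simp: away_def)
 thus "Q2 j ^ a * Q1 j ^ b * R \<in> B.AA" by (rule B.HD_AA)
 show "Q2 j * Q1 j = (Q1 j * Q2 j :: B0)"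
  using B.QQ[of "Suc c" c j j] c_range j by (simp add: cm_eq_0_iff)
 show "cm F (Q2 j) = 0" "cm F (Q1 j) = csc 1 * Q2 j" "cm F R = 0"
  using c_range j R by (auto simp: B.eQ away_def)
 fix A B
 show "E * (Q2 j ^ A * Q1 j ^ B * R) - csc (1 * of_nat A) * (Q2 j ^ (A - 1) * Q1 j ^ (B + 1) * R) \<in> I"
 proof (rule E_sum[OF HD j refl])
  fix k assume k: "k \<in> N0"
  have P: "cm (P2 k) (Q1 j) = (0 :: B0)" "cm (P2 k) (Q2 j) = (csc (if k = j then 1 else 0) :: B0)"
   using c_range k j by (auto simp: B.PQ)
  have QQ: "cm (Q1 j) (Q2 j) = (0 :: B0)"
   using B.QQ[of c "Suc c" j j] c_range j by simp
  have "P2 k * (Q2 j ^ A * Q1 j ^ B * R) = Q2 j ^ A * (Q1 j ^ B * R) * P2 k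
    + csc (if k = j then of_nat A else 0) * (Q2 j ^ (A - 1) * (Q1 j ^ B * R))"
   using R k swap_pow[OF P(2), of A] swap_0[OF P(1), of B] by (auto simp: away_def mult.assoc)
  hence "Q1 k * (P2 k * (Q2 j ^ A * Q1 j ^ B * R)) =
   Q1 k * (Q2 j ^ A * (Q1 j ^ B * R)) * P2 k +
    (if k = j then csc (1 * of_nat A) * (Q2 j ^ (A - 1) * Q1 j ^ (B + 1) * R) else 0)"
   using swap_0[OF QQ, of "A - 1"]
   by (simp add: distrib_left mult.assoc csc_left_comm[of "Qc _ _"] flip: Suc_eq_plus1)
  thus "Q1 k * (P2 k * (Q2 j ^ A * Q1 j ^ B * R)) -
    (if k = j then csc (1 * of_nat A) * (Q2 j ^ (A - 1) * Q1 j ^ (B + 1) * R) else 0) \<in> I"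
   using c_range k ep by (simp add: Pc_I del: mult_1)
 qed
qed (use H h in auto)

text \<open>In mixed rows both factors of a summand of zF annihilate, so zF removes one
  \<open>Q1\<close> and one \<open>P2\<close> from the same column; with different columns nothing
  survives modulo I.\<close>

lemma zF_mixed:
 assumes ep: "\<not> ep c" "ep (Suc c)" and ij: "i \<in> N0" "j \<in> N0" and R: "away R"
 shows "zF * (Q1 i ^ A * P2 j ^ B * R) -
  csc (- (if i = j then of_nat A * of_nat B else 0)) * (Q1 i ^ (A - 1) * P2 j ^ (B - 1) * R) \<in> I"
proof -
 let ?Y = "csc (- (if i = j then of_nat A * of_nat B else 0)) * (Q1 i ^ (A - 1) * P2 j ^ (B - 1) * R)"
 have "Q2 k * (P1 k * (Q1 i ^ A * P2 j ^ B * R)) - (if k = i then ?Y else 0) \<in> I"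
  if k: "k \<in> N0" for k
 proof -
  have P: "cm (P1 k) (Q1 i) = (csc (if k = i then 1 else 0) :: B0)" "cm (P1 k) (P2 j) = (0 :: B0)"
   and Q: "cm (Q2 k) (Q1 i) = (0 :: B0)" "cm (Q2 k) (P2 j) = (csc (- (if k = j then 1 else 0)) :: B0)"
   using c_range k ij by (auto simp: B.PQ B.PP B.QQ B.QP csc_uminus)
  have "P1 k * (Q1 i ^ A * P2 j ^ B * R) = Q1 i ^ A * (P2 j ^ B * R) * P1 k
    + csc (if k = i then of_nat A else 0) * (Q1 i ^ (A - 1) * (P2 j ^ B * R))"
   using R k swap_pow[OF P(1), of A] swap_0[OF P(2), of B] by (auto simp: away_def mult.assoc)
  moreover have "Q2 k * (Q1 i ^ (A - 1) * (P2 j ^ B * R)) =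
    Q1 i ^ (A - 1) * (P2 j ^ B * R) * Q2 k +
    csc (- (if k = j then of_nat B else 0)) * (Q1 i ^ (A - 1) * (P2 j ^ (B - 1) * R))"
   using R k swap_0[OF Q(1), of "A - 1"] swap_pow[OF Q(2), of B]
   by (auto simp: away_def mult.assoc distrib_left csc_left_comm[of "Q1 i ^ _"])
  ultimately have "Q2 k * (P1 k * (Q1 i ^ A * P2 j ^ B * R)) - (if k = i then ?Y else 0) =
   Q2 k * (Q1 i ^ A * (P2 j ^ B * R)) * P1 k +
    csc (if k = i then of_nat A else 0) * (Q1 i ^ (A - 1) * (P2 j ^ B * R)) * Q2 k"
   by (auto simp: distrib_left mult.assoc csc_left_comm[of "Qc _ _"] csc_uminus csc_mult right_diff_distrib)
  also have "\<dots> \<in> I" using c_range k ep by (intro B.IT_add Pc_I Qc_I)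
  finally show ?thesis .
 qed
 hence "(\<Sum>k=1..n0. Q2 k * (P1 k * (Q1 i ^ A * P2 j ^ B * R)) - (if k = i then ?Y else 0)) \<in> I"
  by (rule B.IT_sum)
 thus ?thesis using ij by (simp add: B.z_def sum_distrib_right sum_subtractf mult.assoc)
qed

text \<open>For different columns F cannot remove anything and only the term s = 0 remains. For a
  single column, F^s removes s pairs and E^s restores them. The sum is symmetric in a and b, and
  Vandermonde may be applied in either variable; both forms are kept because the factor in the
  theorem involves the smaller exponent.\<close>

lemma xiT_QP:
 assumes ep: "\<not> ep c" "ep (Suc c)" and ij: "i \<in> N0" "j \<in> N0" and R: "away R"
  and H: "H 0 * (Q1 i ^ a * P2 j ^ b * R) - csc h * (Q1 i ^ a * P2 j ^ b * R) \<in> I"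
  and h: "!!r::nat. h \<noteq> of_nat r"
 shows "i \<noteq> j ==> xiT (Q1 i ^ a * P2 j ^ b * R) - Q1 i ^ a * P2 j ^ b * R \<in> I"
  and "n0 = 1 ==> xiT (Q1 i ^ a * P2 j ^ b * R) -
   csc (ff (h - of_nat a) b / ff h b) * (Q1 i ^ a * P2 j ^ b * R) \<in> I"
  and "n0 = 1 ==> xiT (Q1 i ^ a * P2 j ^ b * R) -
   csc (ff (h - of_nat b) a / ff h a) * (Q1 i ^ a * P2 j ^ b * R) \<in> I"
proof -
 let ?v = "Q1 i ^ a * P2 j ^ b * R"
 define Y where "Y A B = Q1 i ^ A * P2 j ^ B * R" for A B
 \<comment> \<open>Coefficient left after s applications of zF, each of which multiplies by minus
   the product of the current exponents.\<close>
 define t where "t s = (if i = j \<or> s = 0 then (- 1) ^ s * ff (of_nat a) s * ff (of_nat b) s else 0)" for s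
 have HD: "Y A B \<in> B.HD" for A B
  using c_range ij R unfolding Y_def by (intro HD_prod B.P_HD B.Q_HD) (auto simp: away_def)
 hence AA: "?v \<in> B.AA"
  unfolding Y_def by (intro B.HD_AA)
 have ad_HD: "ad s (Y a b) \<in> B.HD" for s
  by (induction s) (use HD B.HD_closed_cm c_range in auto)
 have zF: "zF * Y A B - csc (- (if i = j then of_nat A * of_nat B else 0)) * Y (A - 1) (B - 1) \<in> I" for A B
  unfolding Y_def by (rule zF_mixed[OF ep ij R])
 have ad: "ad s (Y a b) - csc (t s) * Y (a - s) (b - s) \<in> I" for s
 proof (induction s)
  case (Suc s)
  let ?k = "- (if i = j then of_nat (a - s) * of_nat (b - s) else 0)"
  have "ad (Suc s) (Y a b) = zF * ad s (Y a b) - ad s (Y a b) * zF"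
   using B.cm_e_HD[OF ad_HD] c_range by (simp add: cm_def)
  hence "ad (Suc s) (Y a b) - csc (t s) * (csc ?k * Y (a - s - 1) (b - s - 1)) =
   zF * (ad s (Y a b) - csc (t s) * Y (a - s) (b - s)) - ad s (Y a b) * zF +
    csc (t s) * (zF * Y (a - s) (b - s) - csc ?k * Y (a - s - 1) (b - s - 1))"
   by (simp add: right_diff_distrib csc_left_comm[of zF])
  also have "\<dots> \<in> I" by (intro B.IT_add B.IT_diff B.IT_lmult zF zF_I Suc)
  also have "csc (t s) * (csc ?k * Y (a - s - 1) (b - s - 1)) = csc (t (Suc s)) * Y (a - Suc s) (b - Suc s)"
  proof -
   have "t (Suc s) = t s * ?k" by (simp add: t_def ff_nat)
   moreover have "a - s - 1 = a - Suc s" "b - s - 1 = b - Suc s" by simp_all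
   ultimately show ?thesis by (simp only: csc_mult mult.assoc)
  qed
  finally show ?case .
 qed (simp add: t_def)
 have EY: "E ^ s * Y A B - Y (A + s) (B + s) \<in> I" if "n0 = 1" for s A B
 proof (induction s arbitrary: A B)
  case (Suc s)
  have i: "i = 1" "j = 1" using ij that by auto
  have "cm (P2 1) (Q1 1) = (0 :: B0)" using c_range that by (simp add: B.PQ)
  from swap_0[OF this, of A] have Y1: "Q1 1 * (P2 1 * Y A B) = Y (A + 1) (B + 1)"
   by (simp add: Y_def i mult.assoc flip: Suc_eq_plus1)
  have "E * Y A B - csc 1 * Y (A + 1) (B + 1) \<in> I"
  proof (rule E_sum[OF HD, of 1 "Y (A + 1) (B + 1)"])
   fix k assume "k \<in> N0"
   hence "k = 1" using that by simp
   with Y1 show "Q1 k * (P2 k * Y A B) - (if k = 1 then Y (A + 1) (B + 1) else 0) \<in> I" by simp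
  qed (simp_all add: that)
  hence "E ^ s * (E * Y A B - Y (A + 1) (B + 1)) + (E ^ s * Y (A + 1) (B + 1) - Y (A + 1 + s) (B + 1 + s)) \<in> I"
   using Suc by (intro B.IT_add B.IT_lmult) simp_all
  thus ?case
   unfolding power_Suc2 mult.assoc by (simp add: right_diff_distrib flip: Suc_eq_plus1)
 qed simp
 have "E ^ s * ad s (Y a b) - csc (t s) * Y a b \<in> I" if "n0 = 1 \<or> i \<noteq> j" for s
 proof -
  have *: "E ^ s * ad s (Y a b) - csc (t s) * (E ^ s * Y (a - s) (b - s)) \<in> I"
   using B.IT_lmult[OF ad[of s], of "E ^ s"] by (simp add: right_diff_distrib csc_left_comm[of "E ^ s"])
  show ?thesis
  proof (cases "t s = 0")
   case True
   thus ?thesis using * by simp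
  next
   case False
   hence "s = 0 \<or> n0 = 1" "s \<le> a" "s \<le> b"
    using that by (auto simp: t_def ff_choose split: if_splits)
   hence "E ^ s * Y (a - s) (b - s) - Y a b \<in> I"
    using EY[of s "a - s" "b - s"] by auto
   from B.IT_add[OF * B.IT_lmult[OF this, of "csc (t s)"]] show ?thesis by (simp add: right_diff_distrib)
  qed
 qed
 note E = this[unfolded Y_def]
 show "xiT ?v - ?v \<in> I" if "i \<noteq> j"
 proof -
  have "xiT ?v - csc 1 * ?v \<in> I"
  proof (rule xiT_eigen[OF AA _ H h])
   show "E ^ s * ad s ?v -
     csc (fact s * (if s = 0 then 1 else 0)) * ?v \<in> I" for s
    using E[of s] that by (cases "s = 0") (simp_all add: t_def)
   show "(\<Sum>s<M. (if s = 0 then 1 else 0) / ff h s) = 1" if "1 \<le> M" for M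
    using that by (simp add: if_distrib[of "%x. x / _"] cong: if_cong)
  qed
  thus ?thesis by simp
 qed
 assume n: "n0 = 1"
 hence [simp]: "i = j" using ij by auto
 show "xiT ?v -
   csc (ff (h - of_nat a) b / ff h b) * ?v \<in> I"
 proof (rule xiT_eigen[OF AA _ H h])
  show "E ^ s * ad s ?v -
    csc (fact s * (of_nat (b choose s) * pochhammer (- of_nat a) s)) * ?v \<in> I" for s
   using E[of s] n by (simp add: t_def pochhammer_neg ff_choose mult_ac)
  show "(\<Sum>s<M. of_nat (b choose s) * pochhammer (- of_nat a) s / ff h s) = ff (h - of_nat a) b / ff h b" if "Suc b \<le> M" for M
   using vandermonde_quotient[OF h, of b M "- of_nat a"] that by simp
 qed
 show "xiT ?v -
   csc (ff (h - of_nat b) a / ff h a) * ?v \<in> I"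
 proof (rule xiT_eigen[OF AA _ H h])
  show "E ^ s * ad s ?v -
    csc (fact s * (of_nat (a choose s) * pochhammer (- of_nat b) s)) * ?v \<in> I" for s
   using E[of s] n by (simp add: t_def pochhammer_neg ff_choose mult_ac)
  show "(\<Sum>s<M. of_nat (a choose s) * pochhammer (- of_nat b) s / ff h s) = ff (h - of_nat b) a / ff h a" if "Suc a \<le> M" for M
   using vandermonde_quotient[OF h, of a M "- of_nat b"] that by simp
 qed
qed

end

context osc
begin

lemma filter_ext:
 assumes "!!x. x \<in> set w ==> snd x = ext ep (fst x)"
 shows "filter (%x. fst x = a) w = replicate (cnt a w) (a, ext ep a)"
 using assms by (induction w) (auto simp: cnt_def prod_eq_iff)

lemma mon_replicate: "mon ep (replicate k x) = cr ep x ^ k"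
 by (induction k) simp_all

lemma mon_two_rows:
 assumes "1 \<le> n" "a \<in> {1..m}" "b \<in> {1..m}" "a \<noteq> b"
 shows "mon ep (hword ep N) = cr ep (a, ext ep a) ^ N a * cr ep (b, ext ep b) ^ N b *
  mon ep (filter (%x. fst x \<noteq> a \<and> fst x \<noteq> b) (hword ep N))"
proof -
 let ?w = "hword ep N"
 have "mset w = mset (filter (%x. fst x = a) w @ filter (%x. fst x = b) w @ filter (%x. fst x \<noteq> a \<and> fst x \<noteq> b) w)"
  for w :: "(nat \<times> nat) list"
  using assms(4) by (induction w) auto
 hence "mon ep ?w = mon ep (filter (%x. fst x = a) ?w @ filter (%x. fst x = b) ?w @ filter (%x. fst x \<noteq> a \<and> fst x \<noteq> b) ?w)"
  by (rule mon_mset) (rule hword_idx[OF assms(1)])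
 thus ?thesis
  using assms by (simp add: filter_ext[OF hword_ext] cnt_hword mon_append mon_replicate mult.assoc)
qed

end

context simple_root_step
begin

text \<open>The scalar by which the series acts on the extremal monomial with row exponents N, for
  each pattern allowed by \<open>adm\<close>; h is the eigenvalue of H on that monomial.\<close>

definition stepz :: "(nat => nat) => complex => complex" where
 "stepz N h =
  (if ep (Suc c) then
   if ep c then ff (h + (of_nat (N c) + 1)) (N (Suc c)) / ff h (N (Suc c))
   else if n0 = 1 then ff (h - of_nat (max (N c) (N (Suc c)))) (min (N c) (N (Suc c))) / ff h (min (N c) (N (Suc c)))
   else 1
  else ff (h + (of_nat (N (Suc c)) + 1)) (N c) / ff h (N c))"

lemma xiT_hword:
 fixes N :: "nat => nat"
 defines "h \<equiv> B.hwt \<nu> ep c (N c) - B.hwt \<nu> ep (Suc c) (N (Suc c))"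
 assumes n: "1 \<le> n0" and h: "!!r::nat. h \<noteq> of_nat r"
 shows "xiT (B.mon ep (B.hword ep N)) - csc (stepz N h) * B.mon ep (B.hword ep N) \<in> I"
proof -
 let ?v = "B.mon ep (B.hword ep N)" and ?rest = "%a b. filter (%x. fst x \<noteq> a \<and> fst x \<noteq> b) (B.hword ep N)"
 note idx = B.hword_idx[OF n, of ep N]
 have "ec a a * ?v - csc (B.hwt \<nu> ep a (N a)) * ?v \<in> I" if "a \<in> M0" for a
  using B.e_mon[OF idx that, of ep \<nu>] that by (simp add: B.cnt_hword)
 from B.IT_diff[OF this[OF c_range(1)] this[OF c_range(2)]]
 have H: "H 0 * ?v - csc h * ?v \<in> I"
  by (simp add: den_def h_def csc_diff algebra_simps)
 have R: "away (B.mon ep (?rest c (Suc c)))" "away (B.mon ep (?rest (Suc c) c))"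
  by (rule away_mon; use idx in auto)+
 have v: "?v = B.cr ep (c, B.ext ep c) ^ N c * B.cr ep (Suc c, B.ext ep (Suc c)) ^ N (Suc c) * B.mon ep (?rest c (Suc c))"
  "?v = B.cr ep (Suc c, B.ext ep (Suc c)) ^ N (Suc c) * B.cr ep (c, B.ext ep c) ^ N c * B.mon ep (?rest (Suc c) c)"
  using c_range by (intro B.mon_two_rows n; simp)+
 have cols: "1 \<in> N0" "n0 \<in> N0" using n by auto
 consider "ep c" "ep (Suc c)" | "\<not> ep c" "ep (Suc c)" | "\<not> ep c" "\<not> ep (Suc c)" using adm by blast
 thus ?thesis
 proof cases
  case 1
  hence v': "?v = Pc c n0 ^ N c * Pc (Suc c) n0 ^ N (Suc c) * B.mon ep (?rest c (Suc c))"
   using v(1) by (simp add: B.cr_def B.ext_def)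
  show ?thesis
   using xiT_PP[OF 1 cols(2) R(1) H[unfolded v'] h] 1 unfolding v'[symmetric] by (simp add: stepz_def)
 next
  case 2
  hence v': "?v = Qc c 1 ^ N c * Pc (Suc c) n0 ^ N (Suc c) * B.mon ep (?rest c (Suc c))"
   using v(1) by (simp add: B.cr_def B.ext_def)
  note QP = xiT_QP[OF 2 cols R(1) H[unfolded v'] h, unfolded v'[symmetric]]
  show ?thesis
   using QP 2 by (cases "n0 = 1"; cases "N c \<le> N (Suc c)") (auto simp: stepz_def max_def min_def)
 next
  case 3
  hence v': "?v = Qc (Suc c) 1 ^ N (Suc c) * Qc c 1 ^ N c * B.mon ep (?rest (Suc c) c)"
   using v(2) by (simp add: B.cr_def B.ext_def)
  show ?thesis
   using xiT_QQ[OF 3 cols(1) R(2) H[unfolded v'] h] 3 unfolding v'[symmetric] by (simp add: stepz_def)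
 qed
qed

end

section \<open>Comparison of the scalars with the factors of the theorem\<close>

text \<open>The numerator is reversed and negated, the denominator negated; the two signs (-1)^b
  cancel.\<close>

lemma prod_ff:
 "(\<Prod>r=1..b. (M - of_nat r) / (L + of_nat r)) = ff (of_nat b - M) b / ff (- L - 1) b"
proof -
 have "(\<Prod>r=1..b. M - of_nat r) = (- 1) ^ b * ff (of_nat b - M) b"
 proof -
  have "ff (of_nat b - M) b = (\<Prod>r<b. - (M - of_nat (b - r)))"
   unfolding ff_def by (intro prod.cong) (auto simp: of_nat_diff)
  also have "\<dots> = (\<Prod>r=1..b. - (M - of_nat r))"
   by (rule prod.reindex_bij_witness[of _ "%r. b - r" "%r. b - r"]) auto
  also have "\<dots> = (- 1) ^ b * (\<Prod>r=1..b. M - of_nat r)"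
   using prod.distrib[of "%_. - 1" "%r. M - of_nat r" "{1..b}"] by (simp add: algebra_simps)
  finally show ?thesis by (simp flip: mult.assoc power_mult_distrib)
 qed
 moreover have "(\<Prod>r=1..b. L + of_nat r) = (- 1) ^ b * ff (- L - 1) b"
  by (induction b) (simp_all add: ff_Suc algebra_simps)
 ultimately show ?thesis by (simp add: prod_dividef)
qed

text \<open>The two integrality conditions on \<mu> and the weight of the vector are merged:
  \<open>lam\<close> is the weight \<open>hwt\<close> of the monomial with exponents N.\<close>

locale weights =
 fixes \<mu> lam :: weight and N :: "nat => nat"
 assumes n: "1 \<le> n0" and gen: "generic m0 \<mu>"
  and lam: "a \<in> M0 ==> lam a = B.hwt \<mu> (%a. a \<le> p0) a (N a)"
begin

text \<open>After a permutation \<tau>, row a carries the data of the index \<tau>^{-1}(a);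
  \<open>epp\<close>, \<open>Np\<close>, \<open>vp\<close> and \<open>Kp\<close> are the pattern,
  the exponents, the vector and the ideal transported in this way.\<close>

definition epp :: "(nat => nat) => nat => bool" where
 "epp \<tau> a \<longleftrightarrow> pinv \<tau> a \<le> p0"

definition Np :: "(nat => nat) => nat => nat" where
 "Np \<tau> a = N (pinv \<tau> a)"

definition vp :: "(nat => nat) => B0" where
 "vp \<tau> = B.mon (epp \<tau>) (B.hword (epp \<tau>) (Np \<tau>))"

definition Kp :: "(nat => nat) => B0 set" where
 "Kp \<tau> = B.KT (dot_wt \<tau> \<mu>) (epp \<tau>)"

lemma hwt_p:
 assumes "\<tau> permutes M0" "a \<in> M0"
 shows "B.hwt (dot_wt \<tau> \<mu>) (epp \<tau>) a (Np \<tau> a) = lam (pinv \<tau> a) + rho (pinv \<tau> a) - rho a"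
proof -
 have "pinv \<tau> a \<in> M0"
  using permutes_in_image[OF permutes_inv[OF assms(1)]] assms(2) by blast
 from lam[OF this] show ?thesis
  by (simp add: B.hwt_def dot_wt_def perm_wt_def epp_def Np_def B.sgnep_def)
qed

text \<open>The two signs are equal or opposite, so the half-integers n/2 contribute an integer to
  the difference of labels, and genericity passes from \<mu> to \<open>lam\<close>.\<close>

lemma lam_diff_int:
 assumes "a \<in> M0" "b \<in> M0" "a \<noteq> b"
 shows "lam a - lam b \<notin> \<int>"
proof
 assume "lam a - lam b \<in> \<int>"
 define s t :: complex where "s = B.sgnep (%a. a \<le> p0) a" and "t = B.sgnep (%a. a \<le> p0) b"
 have "\<mu> a - \<mu> b = lam a - lam b - (s - t) * (of_nat n0 / 2) - s * of_nat (N a) + t * of_nat (N b)"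
  using lam[OF assms(1)] lam[OF assms(2)] by (simp add: B.hwt_def s_def t_def algebra_simps)
 also have "\<dots> \<in> \<int>"
 proof -
  have "(s - t) * (of_nat n0 / 2) \<in> \<int>" "s * of_nat (N a) \<in> \<int>" "t * of_nat (N b) \<in> \<int>"
   by (auto simp: s_def t_def B.sgnep_def)
  thus ?thesis using \<open>lam a - lam b \<in> \<int>\<close> by (intro Ints_add[OF Ints_diff[OF Ints_diff]])
 qed
 finally show False using gen assms unfolding generic_def by blast
qed

context
 fixes \<tau> c
 assumes \<tau>: "\<tau> permutes M0" and c: "c \<in> {1..<m0}" and less: "pinv \<tau> c < pinv \<tau> (Suc c)"
begin

abbreviation "\<tau>' \<equiv> Transposition.transpose c (Suc c) \<circ> \<tau>"
abbreviation "ic \<equiv> pinv \<tau> c"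
abbreviation "jc \<equiv> pinv \<tau> (Suc c)"

lemma \<tau>'_permutes: "\<tau>' permutes M0"
 using c by (intro permutes_compose[OF \<tau>] permutes_swap_id) auto

lemma inv_\<tau>': "pinv \<tau>' a = pinv \<tau> (Transposition.transpose c (Suc c) a)"
 using o_inv_distrib[OF bij_transpose permutes_bij[OF \<tau>], of c "Suc c"] by (simp add: fun_eq_iff)

lemma ij: "ic \<in> M0" "jc \<in> M0" "ic < jc"
 by (rule iffD2[OF permutes_in_image[OF permutes_inv[OF \<tau>]]], use c in simp)+ (rule less)

lemma step: "simple_root_step c (epp \<tau>')"
 using c less by unfold_locales (auto simp: epp_def inv_\<tau>')

text \<open>After the reflection row c carries the index \<open>jc\<close> and row c + 1 the index
  \<open>ic\<close>, and h = -D - 1, where D is the difference of lam + \<rho> at \<open>ic\<close>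
  and \<open>jc\<close>. With \<open>prod_ff\<close> the products become quotients of falling
  factorials. In the mixed case \<open>lam_star\<close> adds n to D, which for n = 1 accounts for
  the shift in the third formula.\<close>

lemma z_match:
 fixes h :: complex
 defines "h \<equiv> B.hwt (dot_wt \<tau>' \<mu>) (epp \<tau>') c (Np \<tau>' c) - B.hwt (dot_wt \<tau>' \<mu>) (epp \<tau>') (Suc c) (Np \<tau>' (Suc c))"
 shows "simple_root_step.stepz c (epp \<tau>') (Np \<tau>') h = z_factor p0 n0 \<mu> lam N (ic, jc)" and "!!r::nat. h \<noteq> of_nat r"
proof -
 interpret simple_root_step c "dot_wt \<tau>' \<mu>" "epp \<tau>'" by (rule step)
 define D where "D = (lam ic + rho ic) - (lam jc + rho jc)"
 have h: "h = - D - 1"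
  using c by (simp add: h_def hwt_p[OF \<tau>'_permutes] inv_\<tau>' D_def rho_def)
 show "h \<noteq> of_nat r" for r :: nat
 proof
  assume "h = of_nat r"
  hence "lam ic - lam jc = of_int (- int r - 1 + int ic - int jc)"
   by (simp add: h D_def rho_def algebra_simps)
  thus False using lam_diff_int[of ic jc] ij by (metis Ints_of_int less_irrefl)
 qed
 note l = lam[OF ij(1), unfolded B.hwt_def] lam[OF ij(2), unfolded B.hwt_def]
 have M: "mu_star p0 n0 \<mu> ic - mu_star p0 n0 \<mu> jc =
   D + (if ic \<le> p0 then of_nat (N ic) else - of_nat (N ic)) - (if jc \<le> p0 then of_nat (N jc) else - of_nat (N jc))"
  using l by (simp add: mu_star_def D_def sbar_def delta_plus_def B.sgnep_def algebra_simps)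
 have L: "lam_star p0 n0 lam ic - lam_star p0 n0 lam jc = D + (if ic \<le> p0 \<and> \<not> jc \<le> p0 then of_nat n0 else 0)"
  using ij(3) by (simp add: lam_star_def D_def sbar_def delta_plus_def algebra_simps)
 consider "jc \<le> p0" "ic \<le> p0" | "\<not> jc \<le> p0" "ic \<le> p0" | "\<not> jc \<le> p0" "\<not> ic \<le> p0" using ij(3) by linarith
 thus "stepz (Np \<tau>') h = z_factor p0 n0 \<mu> lam N (ic, jc)"
 proof cases
  case 1
  thus ?thesis
   using prod_ff[of "D + of_nat (N ic) - of_nat (N jc)" D "N ic"]
   by (simp add: z_factor_def stepz_def epp_def Np_def inv_\<tau>' M L h algebra_simps)
 next
  case 2
  have "(\<Prod>r=1..min (N ic) (N jc). (D + of_nat (N ic) + of_nat (N jc) - of_nat r + 1) / (D + 1 + of_nat r - 1)) =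
    ff (- D - 1 - of_nat (max (N jc) (N ic))) (min (N jc) (N ic)) / ff (- D - 1) (min (N jc) (N ic))"
  proof -
   have "of_nat (N ic) + of_nat (N jc) = (of_nat (min (N jc) (N ic)) + of_nat (max (N jc) (N ic)) :: complex)"
    by (simp add: min_def max_def)
   thus ?thesis
    using prod_ff[of "D + of_nat (N ic) + of_nat (N jc) + 1" D "min (N jc) (N ic)"]
    by (simp add: algebra_simps min.commute)
  qed
  thus ?thesis
   using 2 by (simp add: z_factor_def stepz_def epp_def Np_def inv_\<tau>' M L h add.commute add.left_commute)
 next
  case 3
  thus ?thesis
   using prod_ff[of "D - of_nat (N ic) + of_nat (N jc)" D "N jc"] ij(3)
   by (simp add: z_factor_def stepz_def epp_def Np_def inv_\<tau>' M L h algebra_simps)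
 qed
qed

end

end

section \<open>Reduced words and inversions\<close>

lemma word_perm_simps [simp]: "word_perm [] = id" "word_perm (c # cs) = Transposition.transpose c (Suc c) \<circ> word_perm cs"
 by (simp_all add: word_perm_def)

lemma word_perm_permutes: "set cs \<subseteq> {1..<m} ==> word_perm cs permutes {1..m}"
proof (induction cs)
 case (Cons c cs)
 hence "word_perm cs permutes {1..m}" by simp
 thus ?case unfolding word_perm_simps using Cons.prems by (intro permutes_compose permutes_swap_id) auto
qed (simp add: permutes_id)

lemma Delta_inv_iff:
 assumes "\<tau> permutes {1..m}"
 shows "(a, b) \<in> Delta_inv m \<tau> \<longleftrightarrow> a \<in> {1..m} \<and> b \<in> {1..m} \<and> a < b \<and> \<tau> b < \<tau> a"
 using permutes_in_image[OF assms, of a] permutes_in_image[OF assms, of b] inj_eq[OF permutes_inj[OF assms], of a b]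
 unfolding Delta_inv_def pos_roots_def by (simp del: atLeastAtMost_iff) linarith

lemma finite_Delta_inv: "finite (Delta_inv m \<tau>)"
 by (rule finite_subset[of _ "{1..m} \<times> {1..m}"]) (auto simp: Delta_inv_def pos_roots_def)

text \<open>Composing with \<sigma>_c on the left exchanges the values c and c + 1, so only the
  order of the two indices carrying these values changes.\<close>

lemma Delta_inv_step:
 assumes \<tau>: "\<tau> permutes {1..m}" and c: "c \<in> {1..<m}" and less: "pinv \<tau> c < pinv \<tau> (Suc c)"
 shows "Delta_inv m (Transposition.transpose c (Suc c) \<circ> \<tau>) = insert (pinv \<tau> c, pinv \<tau> (Suc c)) (Delta_inv m \<tau>)"
  and "(pinv \<tau> c, pinv \<tau> (Suc c)) \<notin> Delta_inv m \<tau>"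
proof -
 let ?t = "Transposition.transpose c (Suc c)"
 have t: "?t \<circ> \<tau> permutes {1..m}"
  using c by (intro permutes_compose[OF \<tau>] permutes_swap_id) auto
 have in_range: "pinv \<tau> c \<in> {1..m}" "pinv \<tau> (Suc c) \<in> {1..m}"
  by (rule iffD2[OF permutes_in_image[OF permutes_inv[OF \<tau>]]], use c in simp)+
 show "(pinv \<tau> c, pinv \<tau> (Suc c)) \<notin> Delta_inv m \<tau>"
  by (simp add: Delta_inv_iff[OF \<tau>] permutes_inverses(1)[OF \<tau>])
 have *: "(a, b) \<in> Delta_inv m (?t \<circ> \<tau>) \<longleftrightarrow>
   (a, b) \<in> insert (pinv \<tau> c, pinv \<tau> (Suc c)) (Delta_inv m \<tau>)" for a b
 proof -
  have inv: "a = pinv \<tau> x \<longleftrightarrow> \<tau> a = x" for a x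
   using permutes_inv_eq[OF \<tau>, of x a] by auto
  have no: "\<not> (\<tau> a = Suc c \<and> \<tau> b = c)" if "a < b"
   using that less inv[of a "Suc c"] inv[of b c] by auto
  have ne: "\<tau> a \<noteq> \<tau> b" if "a < b"
   using that inj_eq[OF permutes_inj[OF \<tau>], of a b] by auto
  have "?t (\<tau> b) < ?t (\<tau> a) \<longleftrightarrow> \<tau> b < \<tau> a \<or> \<tau> a = c \<and> \<tau> b = Suc c" if "a < b"
   using no[OF that] ne[OF that] by (auto simp: transpose_def)
  moreover have "a \<in> {1..m} \<and> b \<in> {1..m} \<and> a < b" if "\<tau> a = c" "\<tau> b = Suc c"
   using that in_range less inv[of a c] inv[of b "Suc c"] by auto
  ultimately show ?thesis
   unfolding insert_iff Delta_inv_iff[OF \<tau>] Delta_inv_iff[OF t] prod.inject inv comp_apply by blast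
 qed
 show "Delta_inv m (?t \<circ> \<tau>) = insert (pinv \<tau> c, pinv \<tau> (Suc c)) (Delta_inv m \<tau>)"
  by (rule Set.set_eqI) (use * in "metis surj_pair")
qed

lemma card_Delta_inv_step:
 assumes \<tau>: "\<tau> permutes {1..m}" and c: "c \<in> {1..<m}"
 shows "pinv \<tau> c < pinv \<tau> (Suc c) ==>
   card (Delta_inv m (Transposition.transpose c (Suc c) \<circ> \<tau>)) = Suc (card (Delta_inv m \<tau>))"
  and "\<not> pinv \<tau> c < pinv \<tau> (Suc c) ==>
   card (Delta_inv m \<tau>) = Suc (card (Delta_inv m (Transposition.transpose c (Suc c) \<circ> \<tau>)))"
proof -
 let ?t = "Transposition.transpose c (Suc c)"
 have up: "card (Delta_inv m (?t \<circ> \<tau>)) = Suc (card (Delta_inv m \<tau>))"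
  if "\<tau> permutes {1..m}" "pinv \<tau> c < pinv \<tau> (Suc c)" for \<tau>
  using Delta_inv_step[OF that(1) c that(2)] finite_Delta_inv by simp
 show "card (Delta_inv m (?t \<circ> \<tau>)) = Suc (card (Delta_inv m \<tau>))" if "pinv \<tau> c < pinv \<tau> (Suc c)"
  by (rule up[OF \<tau> that])
 assume no: "\<not> pinv \<tau> c < pinv \<tau> (Suc c)"
 have "?t \<circ> \<tau> permutes {1..m}"
  using c by (intro permutes_compose[OF \<tau>] permutes_swap_id) auto
 moreover have "pinv (?t \<circ> \<tau>) = pinv \<tau> \<circ> ?t"
  using o_inv_distrib[OF bij_transpose permutes_bij[OF \<tau>], of c "Suc c"] by simp
 moreover have "pinv \<tau> c \<noteq> pinv \<tau> (Suc c)"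
  using inj_eq[OF permutes_inj[OF permutes_inv[OF \<tau>]], of c "Suc c"] by simp
 moreover have "?t \<circ> (?t \<circ> \<tau>) = \<tau>" by (simp add: fun_eq_iff)
 ultimately show "card (Delta_inv m \<tau>) = Suc (card (Delta_inv m (?t \<circ> \<tau>)))"
  using up[of "?t \<circ> \<tau>"] no by simp
qed

lemma Delta_inv_id: "Delta_inv m id = {}"
 using Delta_inv_iff[OF permutes_id[of "{1..m}"]] by (auto simp: not_less)

lemma increasing_permutation:
 assumes \<sigma>: "\<sigma> permutes {1..m}" and inc: "!!c. c \<in> {1..<m} ==> \<sigma> c < \<sigma> (Suc c)"
 shows "\<sigma> = id"
proof
 note im = permutes_in_image[OF \<sigma>]
 fix a
 show "\<sigma> a = id a"
 proof (cases "a \<in> {1..m}")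
  case True
  hence "1 \<le> a" "a \<le> m" by simp_all
  have "a \<le> \<sigma> a"
   using \<open>1 \<le> a\<close> \<open>a \<le> m\<close>
  proof (induction a rule: dec_induct)
   case base
   thus ?case using im[of 1] by simp
  next
   case (step a)
   thus ?case using inc[of a] by simp
  qed
  moreover have "\<sigma> a \<le> a"
   using \<open>a \<le> m\<close> \<open>1 \<le> a\<close>
  proof (induction a rule: inc_induct)
   case base
   thus ?case using im[of m] by simp
  next
   case (step a)
   thus ?case using inc[of a] by simp
  qed
  ultimately show ?thesis by simp
 next
  case False
  thus ?thesis using \<sigma> by (simp add: permutes_def)
 qed
qed

text \<open>Sorting by adjacent transpositions: a permutation other than the identity has a descent
  of its inverse, and removing it lowers the number of inversions by one.\<close>

lemma word_exists:
 assumes "\<sigma> permutes {1..m}"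
 shows "\<exists>ds. set ds \<subseteq> {1..<m} \<and> word_perm ds = \<sigma> \<and> length ds = card (Delta_inv m \<sigma>)"
 using assms
proof (induction "card (Delta_inv m \<sigma>)" arbitrary: \<sigma> rule: less_induct)
 case less
 note \<sigma> = less.prems
 show ?case
 proof (cases "\<forall>c\<in>{1..<m}. pinv \<sigma> c < pinv \<sigma> (Suc c)")
  case True
  hence "pinv \<sigma> = id" by (intro increasing_permutation[OF permutes_inv[OF \<sigma>]]) blast
  hence "\<sigma> = id" by (metis \<sigma> inv_id permutes_inv_inv)
  thus ?thesis by (intro exI[of _ "[]"]) (simp only: word_perm_simps Delta_inv_id, simp)
 next
  case False
  then obtain c where c: "c \<in> {1..<m}" "\<not> pinv \<sigma> c < pinv \<sigma> (Suc c)" by blast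
  define \<sigma>' where "\<sigma>' = Transposition.transpose c (Suc c) \<circ> \<sigma>"
  have \<sigma>': "\<sigma>' permutes {1..m}"
   unfolding \<sigma>'_def using c by (intro permutes_compose[OF \<sigma>] permutes_swap_id) auto
  have card: "card (Delta_inv m \<sigma>) = Suc (card (Delta_inv m \<sigma>'))"
   unfolding \<sigma>'_def by (rule card_Delta_inv_step(2)[OF \<sigma> c])
  have t: "Transposition.transpose c (Suc c) \<circ> \<sigma>' = \<sigma>" unfolding \<sigma>'_def by (simp add: fun_eq_iff)
  with less.hyps[of \<sigma>'] \<sigma>' card obtain ds where "set ds \<subseteq> {1..<m}" "word_perm ds = \<sigma>'" "length ds = card (Delta_inv m \<sigma>')"
   by auto
  thus ?thesis using c(1) t card by (intro exI[of _ "c # ds"]) simp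
 qed
qed

text \<open>Every letter adds an inversion to the permutation of the letters to its right; the head
  of the list acts last.\<close>

primrec red :: "nat list => bool" where
 "red [] \<longleftrightarrow> True"
| "red (c # cs) \<longleftrightarrow> pinv (word_perm cs) c < pinv (word_perm cs) (Suc c) \<and> red cs"

text \<open>A letter changes the number of inversions by exactly one, up or down. The length is
  attained only if every letter goes up.\<close>

lemma red_length:
 assumes "set cs \<subseteq> {1..<m}"
 shows "card (Delta_inv m (word_perm cs)) \<le> length cs \<and> (length cs \<le> card (Delta_inv m (word_perm cs)) --> red cs)"
 using assms
proof (induction cs)
 case Nil
 show ?case unfolding word_perm_simps Delta_inv_id by simp
next
 case (Cons c cs)
 let ?\<tau> = "word_perm cs" and ?t = "Transposition.transpose c (Suc c)"
 have c: "c \<in> {1..<m}" and cs: "set cs \<subseteq> {1..<m}" using Cons.prems by simp_all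
 note \<tau> = word_perm_permutes[OF cs]
 have "card (Delta_inv m (word_perm (c # cs))) = card (Delta_inv m (?t \<circ> ?\<tau>))"
  by (simp only: word_perm_simps)
 thus ?case
  using card_Delta_inv_step[OF \<tau> c] Cons.IH[OF cs]
  by (cases "pinv ?\<tau> c < pinv ?\<tau> (Suc c)") (simp_all del: word_perm_simps(2))
qed

lemma reduced_red:
 assumes "reduced_decomposition m \<sigma> cs"
 shows "red cs"
proof -
 have cs: "set cs \<subseteq> {1..<m}" "word_perm cs = \<sigma>" using assms by (auto simp: reduced_decomposition_def)
 hence "\<sigma> permutes {1..m}" using word_perm_permutes by blast
 then obtain ds where "set ds \<subseteq> {1..<m}" "word_perm ds = \<sigma>" "length ds = card (Delta_inv m \<sigma>)"
  using word_exists by blast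
 hence "length cs \<le> card (Delta_inv m (word_perm cs))"
  using assms cs unfolding reduced_decomposition_def by metis
 thus ?thesis using red_length[OF cs(1)] by blast
qed

section \<open>Composition along a reduced word\<close>

definition thw :: "nat list => B0 => B0" where
 "thw cs = foldr (%c g. simple_root.th c \<circ> g) cs id"

lemma thw_simps [simp]: "thw [] x = x" "thw (c # cs) x = simple_root.th c (thw cs x)"
 by (simp_all add: thw_def)

lemma thw_add:
 assumes "set cs \<subseteq> {1..<m0}"
 shows "x \<in> B.JT ==> thw cs x \<in> B.JT" and "thw cs (x + y) - (thw cs x + thw cs y) \<in> B.JT"
 using assms
proof (induction cs arbitrary: x y)
 case (Cons c cs)
 {
  case 1
  then interpret simple_root c by unfold_locales auto
  show ?case using 1 Cons th_JT by simp
 }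
 case 2
 then interpret simple_root c by unfold_locales auto
 let ?d = "thw cs (x + y) - (thw cs x + thw cs y)"
 have "?d \<in> B.JT" using Cons 2 by simp
 hence "th ?d \<in> B.JT" by (rule th_JT)
 moreover have "th (?d + (thw cs x + thw cs y)) - (th ?d + th (thw cs x + thw cs y)) \<in> B.JT"
  "th (thw cs x + thw cs y) - (th (thw cs x) + th (thw cs y)) \<in> B.JT" by (rule th_add)+
 ultimately have "th ?d + (th (?d + (thw cs x + thw cs y)) - (th ?d + th (thw cs x + thw cs y)) +
   (th (thw cs x + thw cs y) - (th (thw cs x) + th (thw cs y)))) \<in> B.JT"
  by (intro B.JT_add)
 thus ?case by (simp add: algebra_simps)
qed simp_all

lemma sg_mon:
 assumes \<sigma>: "\<sigma> permutes M0" and "set w \<subseteq> M0 \<times> N0"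
 shows "sg \<sigma> (B.mon ep w) = B.mon (%a. ep (pinv \<sigma> a)) (map (%x. (\<sigma> (fst x), snd x)) w)"
 using assms(2)
 by (induction w) (auto simp: sg_hom[OF \<sigma>] B.cr_def sg_Pc[OF \<sigma>] sg_Qc[OF \<sigma>] permutes_inverses(2)[OF \<sigma>])

context weights
begin

text \<open>The extremal column depends only on the pattern, which is carried along with the rows,
  so \<sigma> sends extremal monomials to extremal monomials. The order of the factors changes, but
  creation operators commute.\<close>

lemma sg_vp:
 assumes \<sigma>: "\<sigma> permutes M0" and \<tau>: "\<tau> permutes M0"
 shows "sg \<sigma> (vp \<tau>) = vp (\<sigma> \<circ> \<tau>)"
proof -
 let ?w = "B.hword (epp \<tau>) (Np \<tau>)" and ?u = "B.hword (epp (\<sigma> \<circ> \<tau>)) (Np (\<sigma> \<circ> \<tau>))"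
 let ?s = "map (%x. (\<sigma> (fst x), snd x))"
 have inv: "pinv (\<sigma> \<circ> \<tau>) a = pinv \<tau> (pinv \<sigma> a)" for a
  using o_inv_distrib[OF permutes_bij[OF \<sigma>] permutes_bij[OF \<tau>]] by simp
 have ep: "(%a. epp \<tau> (pinv \<sigma> a)) = epp (\<sigma> \<circ> \<tau>)"
  by (simp add: epp_def fun_eq_iff inv)
 have w: "set ?w \<subseteq> M0 \<times> N0" and u: "set ?u \<subseteq> M0 \<times> N0" by (rule B.hword_idx[OF n])+
 have sw: "set (?s ?w) \<subseteq> M0 \<times> N0"
 proof
  fix y assume "y \<in> set (?s ?w)"
  then obtain x where "x \<in> set ?w" "y = (\<sigma> (fst x), snd x)" by auto
  thus "y \<in> M0 \<times> N0" using w permutes_in_image[OF \<sigma>, of "fst x"] by auto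
 qed
 have "mset (?s ?w) = mset ?u"
 proof (rule B.mset_ext[where ep = "epp (\<sigma> \<circ> \<tau>)"])
  fix y assume "y \<in> set (?s ?w)"
  then obtain x where "x \<in> set ?w" "y = (\<sigma> (fst x), snd x)" by auto
  thus "snd y = B.ext (epp (\<sigma> \<circ> \<tau>)) (fst y)"
   using B.hword_ext[of x "epp \<tau>"] by (simp add: B.ext_def epp_def inv permutes_inverses(2)[OF \<sigma>])
 next
  fix x assume "x \<in> set ?u"
  thus "snd x = B.ext (epp (\<sigma> \<circ> \<tau>)) (fst x)" by (rule B.hword_ext)
 next
  show "mset (map fst (?s ?w)) = mset (map fst ?u)"
  proof (rule multiset_eqI, unfold B.count_fst)
   fix a
   have 0: "B.cnt a v = 0" if "set v \<subseteq> M0 \<times> N0" "a \<notin> M0" for v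
    using that by (auto simp: B.cnt_def filter_empty_conv)
   have "B.cnt a (?s v) = B.cnt (pinv \<sigma> a) v" for v
    by (induction v) (auto simp: B.cnt_def permutes_inverses[OF \<sigma>])
   thus "B.cnt a (?s ?w) = B.cnt a ?u"
    using 0[OF sw] 0[OF u] permutes_in_image[OF permutes_inv[OF \<sigma>], of a]
    by (cases "a \<in> M0") (simp_all add: B.cnt_hword Np_def inv)
  qed
 qed
 thus ?thesis
  unfolding vp_def sg_mon[OF \<sigma> w] ep by (rule B.mon_mset) (rule sw)
qed

text \<open>Well-definedness on the quotient and the value on the vector are proved along the same
  induction: the error term of the shorter word must be mapped into the next ideal. The new scalar
  is the factor at the inversion added by the letter.\<close>

lemma thw_KT:
 assumes "set cs \<subseteq> {1..<m0}" "red cs" "x \<in> B.KT \<mu> (%a. a \<le> p0)"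
 shows "thw cs x \<in> Kp (word_perm cs)"
  and "thw cs (vp id) - csc (\<Prod>\<eta>\<in>Delta_inv m0 (word_perm cs). z_factor p0 n0 \<mu> lam N \<eta>) * vp (word_perm cs) \<in> Kp (word_perm cs)"
 using assms(1,2)
proof (induction cs)
 case Nil
 {
  case 1
  have "dot_wt id \<mu> = \<mu>" "epp id = (%a. a \<le> p0)"
   by (simp_all only: epp_def dot_wt_def perm_wt_def inv_id fun_eq_iff id_apply) simp_all
  thus ?case using assms(3) by (simp only: Kp_def word_perm_simps thw_simps)
 next
  case 2
  show ?case unfolding word_perm_simps Delta_inv_id by (simp add: Kp_def)
 }
next
 case (Cons c cs)
 let ?\<tau> = "word_perm cs"
 have \<tau>: "?\<tau> permutes M0" and c: "c \<in> {1..<m0}" and less: "pinv ?\<tau> c < pinv ?\<tau> (Suc c)"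
  if "set (c # cs) \<subseteq> {1..<m0}" "red (c # cs)"
  using that word_perm_permutes[of cs m0] by auto
 let ?\<tau>' = "Transposition.transpose c (Suc c) \<circ> ?\<tau>"
 {
  assume prems: "set (c # cs) \<subseteq> {1..<m0}" "red (c # cs)"
  note \<tau> = \<tau>[OF prems] and c = c[OF prems] and less = less[OF prems]
  interpret simple_root_step c "dot_wt ?\<tau>' \<mu>" "epp ?\<tau>'" by (rule step[OF \<tau> c less])
  note inv = inv_\<tau>'[OF \<tau> c less]
  have "epp ?\<tau> = (%a. epp ?\<tau>' (tr a))"
   by (simp add: epp_def inv fun_eq_iff)
  \<comment> \<open>Exchanging the rows c and c + 1 changes \<rho> by 1, and this is exactly the
    shift by \<eta> in the hypothesis of \<open>th_KT\<close>.\<close>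
  moreover have "dot_wt ?\<tau> \<mu> (tr a) = dot_wt ?\<tau>' \<mu> a + of_int (\<eta> a)" for a
   by (auto simp: dot_wt_def perm_wt_def inv \<eta>_def rho_def transpose_def)
  ultimately have th: "th x \<in> Kp ?\<tau>'" if "x \<in> Kp ?\<tau>" for x
   using th_KT[of "dot_wt ?\<tau> \<mu>" x] that by (simp add: Kp_def)
  show "thw (c # cs) x \<in> Kp (word_perm (c # cs))"
   using th Cons.IH(1) prems by simp
  let ?z = "%\<tau>. \<Prod>\<eta>\<in>Delta_inv m0 \<tau>. z_factor p0 n0 \<mu> lam N \<eta>"
  let ?d = "thw cs (vp id) - csc (?z ?\<tau>) * vp ?\<tau>"
  define s where "s = z_factor p0 n0 \<mu> lam N (pinv ?\<tau> c, pinv ?\<tau> (Suc c))"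
  have J: "x \<in> B.JT ==> x \<in> Kp ?\<tau>'" for x unfolding Kp_def by (rule B.JT_KT)
  have add: "x \<in> Kp ?\<tau>' ==> y \<in> Kp ?\<tau>' ==> x + y \<in> Kp ?\<tau>'" for x y unfolding Kp_def by (rule B.KT_add)
  have "th ?d \<in> Kp ?\<tau>'" by (rule th, rule Cons.IH(2)) (use prems in simp_all)
  moreover have "th (?d + csc (?z ?\<tau>) * vp ?\<tau>) - (th ?d + th (csc (?z ?\<tau>) * vp ?\<tau>)) \<in> Kp ?\<tau>'"
   by (rule J[OF th_add])
  moreover have "th (csc (?z ?\<tau>) * vp ?\<tau>) - csc (?z ?\<tau>) * th (vp ?\<tau>) \<in> Kp ?\<tau>'"
   by (rule J[OF th_csc])
  moreover have "csc (?z ?\<tau>) * (th (vp ?\<tau>) - csc s * vp ?\<tau>') \<in> Kp ?\<tau>'"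
  proof -
   have "th (vp ?\<tau>) = xib (vp ?\<tau>')" by (simp add: th_def sg_vp[OF tr_permutes \<tau>])
   moreover have "xib (vp ?\<tau>') - xiT (vp ?\<tau>') \<in> Kp ?\<tau>'"
    unfolding vp_def by (intro J xib_AA B.HD_AA B.mon_HD B.hword_idx n)
   moreover have "xiT (vp ?\<tau>') - csc s * vp ?\<tau>' \<in> Kp ?\<tau>'"
    unfolding vp_def s_def Kp_def z_match(1)[OF \<tau> c less, symmetric]
    by (rule B.IT_KT[OF xiT_hword[OF n z_match(2)[OF \<tau> c less]]])
   ultimately have "th (vp ?\<tau>) - csc s * vp ?\<tau>' \<in> Kp ?\<tau>'"
    using add[of "xib (vp ?\<tau>') - xiT (vp ?\<tau>')" "xiT (vp ?\<tau>') - csc s * vp ?\<tau>'"] by simp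
   thus ?thesis unfolding Kp_def by (rule Uh_KT) (rule Uh_csc)
  qed
  ultimately have "th ?d + (th (?d + csc (?z ?\<tau>) * vp ?\<tau>) - (th ?d + th (csc (?z ?\<tau>) * vp ?\<tau>)) +
    (th (csc (?z ?\<tau>) * vp ?\<tau>) - csc (?z ?\<tau>) * th (vp ?\<tau>) + csc (?z ?\<tau>) * (th (vp ?\<tau>) - csc s * vp ?\<tau>'))) \<in> Kp ?\<tau>'"
   by (intro add)
  moreover have "?z ?\<tau>' = ?z ?\<tau> * s"
   using Delta_inv_step[OF \<tau> c less] finite_Delta_inv by (simp add: s_def mult.commute)
  ultimately show "thw (c # cs) (vp id) - csc (?z (word_perm (c # cs))) * vp (word_perm (c # cs)) \<in> Kp (word_perm (c # cs))"
   by (simp add: right_diff_distrib csc_mult mult.assoc)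
 }
qed

end

section \<open>Cosets\<close>

lemma Abar_pres: "Abar0 = pres TYPE(tB)"
 and A_pres: "A_alg0 = pres TYPE(tA)"
 by (simp_all add: Abar_def A_alg_def pgens_tB_def prels_tB_def pgens_tA_def prels_tA_def)

lemma Abar_class_emb: "f \<in> alg Abar_gens0 ==> Abar_class0 f = emb (cls f :: B0)"
 using pclass_eq_emb[of f, where 'k = tB] by (simp add: Abar_class_def pgens_tB_def prels_tB_def)

lemma A_class_emb: "f \<in> alg A_gens0 ==> A_class p0 q0 n0 f = emb (cls f :: A0)"
 using pclass_eq_emb[of f, where 'k = tA] by (simp add: A_class_def pgens_tA_def prels_tA_def)

lemma A_gens_Abar: "f \<in> alg A_gens0 ==> f \<in> alg Abar_gens0"
 using alg_mono[of "A_gens0" "Abar_gens0"] by (auto simp: Abar_gens_def)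

lemma A_gens_alg:
 shows eE_alg: "a \<in> M0 ==> b \<in> M0 ==> eE a b \<in> alg A_gens0"
  and eX_alg: "a \<in> M0 ==> i \<in> N0 ==> eX a i \<in> alg A_gens0"
  and eD_alg: "a \<in> M0 ==> i \<in> N0 ==> eD a i \<in> alg A_gens0"
  and zeta_A_alg: "a \<in> M0 ==> b \<in> M0 ==> zeta p0 n0 a b \<in> alg A_gens0"
  and pp_A_alg: "a \<in> M0 ==> i \<in> N0 ==> pp p0 a i \<in> alg A_gens0"
  and qq_A_alg: "a \<in> M0 ==> i \<in> N0 ==> qq p0 a i \<in> alg A_gens0"
proof -
 have "weyl_gens m0 n0 \<subseteq> A_gens0" by (simp add: A_gens_def)
 thus "a \<in> M0 ==> b \<in> M0 ==> zeta p0 n0 a b \<in> alg A_gens0"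
  "a \<in> M0 ==> i \<in> N0 ==> pp p0 a i \<in> alg A_gens0"
  "a \<in> M0 ==> i \<in> N0 ==> qq p0 a i \<in> alg A_gens0"
  by (simp_all only: zeta_alg[of a m0 b n0] pp_alg[of a m0 i n0] qq_alg[of a m0 i n0])
qed (rule alg_gener, simp add: A_gens_def gl_gens_def weyl_gens_def)+

lemma Jbar_emb: "Jbar0 = emb ` B.JT"
proof -
 have "{Abar_class0 (eE b a) |a b. a \<in> M0 \<and> b \<in> M0 \<and> a < b} = emb ` B.Jg"
  (is "?L = ?R")
 proof (intro equalityI subsetI)
  fix x assume "x \<in> ?L"
  then obtain a b where ab: "a \<in> M0" "b \<in> M0" "a < b" "x = Abar_class0 (eE b a)" by blast
  hence "x = emb (ec b a :: B0)"
   using Abar_class_emb[OF A_gens_Abar[OF eE_alg[of b a]]] by (simp add: ec_def)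
  thus "x \<in> ?R" using ab unfolding B.Jg_def by blast
 next
  fix x assume "x \<in> ?R"
  then obtain a b where ab: "a \<in> M0" "b \<in> M0" "a < b" "x = emb (ec b a :: B0)" unfolding B.Jg_def by blast
  hence "x = Abar_class0 (eE b a)"
   using Abar_class_emb[OF A_gens_Abar[OF eE_alg[of b a]]] by (simp add: ec_def)
  thus "x \<in> ?L" using ab by blast
 qed
 thus ?thesis
  unfolding Jbar_def Abar_pres B.JT_def by (simp only: right_ideal_gen_emb)
qed

text \<open>The pattern of the barred sign sequence: it marks the rows in which q
  annihilates.\<close>

definition eps :: "(nat => int) => nat => bool" where
 "eps \<delta> a \<longleftrightarrow> sbar p0 \<delta> a = 1"

text \<open>In the rows up to \<open>p0\<close> the variable x is -p, so the two descriptions of the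
  generators of I agree only up to sign.\<close>

lemma asp_left_sign:
 assumes "!!s. s \<in> X ==> s \<in> Y \<or> - s \<in> Y" "x \<in> asp {r * s |r s. s \<in> (X :: 'r::ring set)}"
 shows "x \<in> asp {r * s |r s. s \<in> Y}"
 using assms(2)
proof (rule asp_mono, intro subsetI)
 fix y assume "y \<in> {r * s |r s. s \<in> X}"
 then obtain r s where y: "y = r * s" "s \<in> X" by blast
 hence "y = r * s \<and> s \<in> Y \<or> y = (- r) * (- s) \<and> - s \<in> Y" using assms(1) by auto
 thus "y \<in> asp {r * s |r s. s \<in> Y}" by (intro asp.base) blast
qed

lemma I_ideal_emb:
 assumes \<delta>: "!!a. a \<in> M0 ==> \<delta> a = 1 \<or> \<delta> a = - 1"
 shows "I_ideal p0 q0 n0 \<mu> \<delta> = emb ` A.IT \<mu> (eps \<delta>)"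
proof -
 define S where "S = {eX a k |a k. a \<in> M0 \<and> k \<in> N0 \<and> \<delta> a = -1} \<union>
   {eD a k |a k. a \<in> M0 \<and> k \<in> N0 \<and> \<delta> a = 1} \<union>
   {eE a b - zeta p0 n0 a b |a b. a \<in> M0 \<and> b \<in> M0 \<and> a < b} \<union>
   {eE a a - zeta p0 n0 a a - scal (\<mu> a) |a. a \<in> M0}"
 have S_alg: "S \<subseteq> alg A_gens0"
  unfolding S_def by (auto intro!: alg_diff eE_alg eX_alg eD_alg zeta_A_alg)
 have "A_class p0 q0 n0 ` S = emb ` (cls ` S :: A0 set)"
  using S_alg A_class_emb by (auto simp: image_iff subset_iff)
 hence "I_ideal p0 q0 n0 \<mu> \<delta> = emb ` asp {r * s |s r. s \<in> (cls ` S :: A0 set)}"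
  unfolding I_ideal_def A_pres S_def[symmetric] by (simp only: left_ideal_gen_emb)
 also have "asp {r * s |s r. s \<in> (cls ` S :: A0 set)} = A.IT \<mu> (eps \<delta>)"
 proof -
  have comm: "{r * s |s r. s \<in> X} = {r * s |r s. s \<in> X}" for X :: "A0 set" by blast
  have eh: "cls (eE a b - zeta p0 n0 a b) = A.eh a b" for a b
   by (simp add: cls_diff cls_zeta A.eh_def ec_def)
  have eps: "eps \<delta> a \<longleftrightarrow> (if a \<le> p0 then \<delta> a = 1 else \<delta> a = - 1)" for a
   by (auto simp: eps_def sbar_def)
  have PI: "Pc a k \<in> A.Ig \<mu> (eps \<delta>)" if "a \<in> M0" "k \<in> N0" "\<not> eps \<delta> a" for a k
   unfolding A.Ig_def using that by blast
  have QI: "Qc a k \<in> A.Ig \<mu> (eps \<delta>)" if "a \<in> M0" "k \<in> N0" "eps \<delta> a" for a k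
   unfolding A.Ig_def using that by blast
  have 1: "cls x \<in> A.Ig \<mu> (eps \<delta>) \<or> - cls x \<in> A.Ig \<mu> (eps \<delta>)" if "x \<in> S" for x
  proof -
   consider a k where "x = eX a k" "a \<in> M0" "k \<in> N0" "\<delta> a = - 1"
    | a k where "x = eD a k" "a \<in> M0" "k \<in> N0" "\<delta> a = 1"
    | a b where "x = eE a b - zeta p0 n0 a b" "a \<in> M0" "b \<in> M0" "a < b"
    | a where "x = eE a a - zeta p0 n0 a a - scal (\<mu> a)" "a \<in> M0"
    using \<open>x \<in> S\<close> unfolding S_def by blast
   thus ?thesis
   proof cases
    case (1 a k)
    hence "(if a \<le> p0 then Pc a k else Qc a k) \<in> A.Ig \<mu> (eps \<delta>)" using PI QI by (simp add: eps)
    thus ?thesis using 1(1) by (auto simp: XD_PQ split: if_splits)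
   next
    case (2 a k)
    hence "(if a \<le> p0 then Qc a k else Pc a k) \<in> A.Ig \<mu> (eps \<delta>)" using PI QI by (simp add: eps)
    thus ?thesis using 2(1) by (auto simp: XD_PQ split: if_splits)
   next
    case (3 a b)
    hence "A.eh a b \<in> A.Ig \<mu> (eps \<delta>)" unfolding A.Ig_def by blast
    thus ?thesis using 3(1) eh by simp
   next
    case (4 a)
    hence "A.eh a a - csc (\<mu> a) \<in> A.Ig \<mu> (eps \<delta>)" unfolding A.Ig_def by blast
    thus ?thesis unfolding 4(1) cls_diff[of _ "scal (\<mu> a)"] eh by simp
   qed
  qed
  have 2: "s \<in> cls ` S \<or> - s \<in> cls ` S" if s: "s \<in> A.Ig \<mu> (eps \<delta>)" for s :: A0
  proof -
   consider a k where "s = Qc a k" "a \<in> M0" "k \<in> N0" "eps \<delta> a"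
    | a k where "s = Pc a k" "a \<in> M0" "k \<in> N0" "\<not> eps \<delta> a"
    | a b where "s = A.eh a b" "a \<in> M0" "b \<in> M0" "a < b"
    | a where "s = A.eh a a - csc (\<mu> a)" "a \<in> M0"
    using s unfolding A.Ig_def by blast
   thus ?thesis
   proof cases
    case (1 a k)
    hence "(if a \<le> p0 then eD a k else eX a k) \<in> S"
     unfolding S_def eps by (auto split: if_splits)
    from imageI[OF this, of "cls :: _ => A0"] show ?thesis
     using 1(1) by (auto simp: XD_PQ split: if_splits)
   next
    case (2 a k)
    hence "(if a \<le> p0 then eX a k else eD a k) \<in> S"
     using \<delta>[of a] unfolding S_def eps by (auto split: if_splits)
    from imageI[OF this, of "cls :: _ => A0"] show ?thesis
     using 2(1) by (auto simp: XD_PQ split: if_splits)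
   next
    case (3 a b)
    hence "eE a b - zeta p0 n0 a b \<in> S" unfolding S_def by blast
    from imageI[OF this, of "cls :: _ => A0"] show ?thesis using 3(1) eh by simp
   next
    case (4 a)
    hence "eE a a - zeta p0 n0 a a - scal (\<mu> a) \<in> S" unfolding S_def by blast
    from imageI[OF this, of "cls :: _ => A0"] show ?thesis
     unfolding 4(1) cls_diff[of _ "scal (\<mu> a)"] eh by simp
   qed
  qed
  have "s \<in> A.Ig \<mu> (eps \<delta>) \<or> - s \<in> A.Ig \<mu> (eps \<delta>)" if "s \<in> cls ` S" for s
   using that 1 by blast
  thus ?thesis
   unfolding A.IT_def comm using asp_left_sign[of "cls ` S"] asp_left_sign[OF 2] by blast
 qed
 finally show ?thesis .
qed

lemma iota_AA: "\<exists>Y. y = iota Y" if "y \<in> B.AA"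
proof -
 from that obtain f where "f \<in> alg A_gens0" "y = cls f" unfolding AA_cls by blast
 thus ?thesis using iota_cls[of f] by metis
qed

lemma iota_in_AA: "iota Y \<in> B.AA"
proof -
 obtain f where "f \<in> alg A_gens0" "Y = cls f"
  using cls_surj_alg[of Y] by (auto simp: pgens_tA_def)
 thus ?thesis unfolding AA_cls using iota_cls[of f] by auto
qed

lemma iota_Ig: "s \<in> A.Ig \<mu> ep ==> iota s \<in> B.Ig \<mu> ep"
 unfolding A.Ig_def B.Ig_def
 by (elim UnE CollectE exE conjE; simp only: iota_Pc iota_Qc iota_eh iota_hom; blast)

lemma Ig_iota: "s \<in> B.Ig \<mu> ep ==> \<exists>s'\<in>A.Ig \<mu> ep. s = iota s'"
 unfolding A.Ig_def B.Ig_def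
 by (elim UnE CollectE exE conjE; simp only: iota_Pc[symmetric] iota_Qc[symmetric] iota_eh[symmetric] iota_hom[symmetric]; blast)

text \<open>Fractions times the left ideal of A already form the left ideal of the localized algebra
  generated by the same elements, since every multiplier is a sum of fractions times elements of A
  (\<open>B0_span\<close>).\<close>

lemma Ibar_emb:
 assumes \<delta>: "!!a. a \<in> M0 ==> \<delta> a = 1 \<or> \<delta> a = - 1"
 shows "Ibar p0 q0 n0 \<mu> \<delta> = emb ` B.IT \<mu> (eps \<delta>)"
proof -
 let ?X = "{u * iota Y |u Y. u \<in> Uh \<and> Y \<in> A.IT \<mu> (eps \<delta>)}"
 have "Abar_class0 t \<otimes>\<^bsub>Abar0\<^esub> A_to_Abar0 (emb Y) = emb (cls t * iota Y)"
  if "t \<in> Uh_expr m0" for t and Y :: A0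
 proof -
  have "t \<in> alg Abar_gens0"
   by (rule alg_mono[OF _ that[unfolded Uh_expr_def]]) (auto simp: Abar_gens_def A_gens_def gl_gens_def)
  thus ?thesis by (simp add: Abar_class_emb A_to_Abar_emb Abar_pres emb_mult)
 qed
 note * = this
 have I: "I_ideal p0 q0 n0 \<mu> \<delta> = emb ` A.IT \<mu> (eps \<delta>)" by (rule I_ideal_emb) (rule \<delta>)
 have "{Abar_class0 t \<otimes>\<^bsub>Abar0\<^esub> A_to_Abar0 Y |t Y.
    t \<in> Uh_expr m0 \<and> Y \<in> I_ideal p0 q0 n0 \<mu> \<delta>} = emb ` ?X" (is "?L = _")
 proof (intro equalityI subsetI)
  fix x assume "x \<in> ?L"
  then obtain t Y where "x = Abar_class0 t \<otimes>\<^bsub>Abar0\<^esub> A_to_Abar0 (emb Y)"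
   "t \<in> Uh_expr m0" "Y \<in> A.IT \<mu> (eps \<delta>)" unfolding I by blast
  hence "x = emb (cls t * iota Y)" "cls t \<in> Uh" "Y \<in> A.IT \<mu> (eps \<delta>)" using * by (auto simp: Uh_eq)
  thus "x \<in> emb ` ?X" by blast
 next
  fix x assume "x \<in> emb ` ?X"
  then obtain t Y where "x = emb (cls t * iota Y)" "t \<in> Uh_expr m0" "Y \<in> A.IT \<mu> (eps \<delta>)"
   unfolding Uh_eq by blast
  thus "x \<in> ?L" unfolding I using *[of t Y] by blast
 qed
 hence "Ibar p0 q0 n0 \<mu> \<delta> = emb ` asp ?X"
  unfolding Ibar_def Abar_pres by (simp only: generate_emb)
 also have "asp ?X = B.IT \<mu> (eps \<delta>)"
 proof (intro equalityI subsetI)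
  fix x assume "x \<in> asp ?X"
  thus "x \<in> B.IT \<mu> (eps \<delta>)"
   unfolding B.IT_def
  proof (rule asp_mono, fold B.IT_def, intro subsetI)
   fix x assume "x \<in> ?X"
   then obtain u Y where x: "x = u * iota Y" "Y \<in> A.IT \<mu> (eps \<delta>)" by blast
   from x(2) have "iota Y \<in> B.IT \<mu> (eps \<delta>)"
    unfolding A.IT_def B.IT_def
   proof (rule asp_image)
    fix y assume "y \<in> {r * s |s r. s \<in> A.Ig \<mu> (eps \<delta>)}"
    then obtain r s where "y = r * s" "s \<in> A.Ig \<mu> (eps \<delta>)" by blast
    thus "iota y \<in> asp {r * s |s r. s \<in> B.Ig \<mu> (eps \<delta>)}"
     using B.Ig_IT[OF iota_Ig] unfolding B.IT_def by (simp add: iota_hom)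
   qed (simp add: iota_hom)
   thus "x \<in> B.IT \<mu> (eps \<delta>)" unfolding x(1) by (rule B.IT_lmult)
  qed
 next
  fix x assume "x \<in> B.IT \<mu> (eps \<delta>)"
  thus "x \<in> asp ?X"
   unfolding B.IT_def
  proof (rule asp_mono, intro subsetI)
   fix x assume "x \<in> {r * s |s r. s \<in> B.Ig \<mu> (eps \<delta>)}"
   then obtain r s where x: "x = r * s" "s \<in> B.Ig \<mu> (eps \<delta>)" by blast
   then obtain s' where s': "s' \<in> A.Ig \<mu> (eps \<delta>)" "s = iota s'" using Ig_iota by blast
   have "r * s \<in> asp ?X"
    using B0_span[of r]
   proof (rule asp_image)
    fix y assume "y \<in> {t * y |t y. t \<in> Uh \<and> y \<in> B.AA}"
    then obtain t z where y: "y = t * z" "t \<in> Uh" "z \<in> B.AA" by blast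
    then obtain Y where "z = iota Y" using iota_AA by blast
    hence "y * s = t * iota (Y * s')" using y s' by (simp add: iota_hom mult.assoc)
    thus "y * s \<in> asp ?X" using y(2) A.Ig_IT[OF s'(1)] by (intro asp.base) blast
   qed (simp add: distrib_right)
   thus "x \<in> asp ?X" using x(1) by simp
  qed
 qed
 finally show ?thesis .
qed

definition dcs :: "B0 set => B0 => gen falg set set" where
 "dcs K x = emb ` (%k. k + x) ` K"

definition subgrp :: "B0 set => bool" where
 "subgrp K \<longleftrightarrow> 0 \<in> K \<and> (\<forall>x\<in>K. \<forall>y\<in>K. x + y \<in> K \<and> x - y \<in> K)"

lemma subgrp_JT: "subgrp B.JT" and subgrp_KT: "subgrp (B.KT \<mu> ep)"
 by (simp_all add: subgrp_def B.JT_add B.JT_diff B.KT_add B.KT_diff)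

lemma dcs_cong:
 assumes "subgrp K" "x - y \<in> K"
 shows "dcs K x = dcs K y"
proof -
 have "dcs K x \<subseteq> dcs K y" if "x - y \<in> K" for x y
 proof
  fix C assume "C \<in> dcs K x"
  then obtain k where "C = emb (k + x)" "k \<in> K" by (auto simp: dcs_def)
  hence "C = emb ((k + (x - y)) + y)" "k + (x - y) \<in> K" using that assms(1) by (auto simp: subgrp_def)
  thus "C \<in> dcs K y" unfolding dcs_def by blast
 qed
 moreover have "y - x \<in> K" using assms by (metis diff_self minus_diff_eq subgrp_def verit_minus_simplify(3))
 ultimately show ?thesis using assms(2) by blast
qed

lemma dcs_eqD:
 assumes "subgrp K" "dcs K x = dcs K y"
 shows "x - y \<in> K"
proof -
 have "emb (0 + x) \<in> dcs K x" using assms(1) unfolding dcs_def subgrp_def by blast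
 then obtain k where "0 + x = k + y" "k \<in> K" using assms(2) by (auto simp: dcs_def)
 thus ?thesis by (metis add_0 add_diff_cancel_right')
qed

lemma dcs_rcos: "emb ` K +>\<^bsub>Abar0\<^esub> emb x = dcs K x"
 by (simp add: Abar_pres emb_rcos dcs_def)

lemma dcs_add:
 assumes "subgrp K" "J \<subseteq> K" "0 \<in> J"
 shows "dcs K x <+>\<^bsub>Abar0\<^esub> dcs J y = dcs K (x + y)"
 unfolding dcs_def Abar_pres emb_set_add
proof (rule arg_cong[of _ _ "image emb"], intro equalityI subsetI)
 fix z assume "z \<in> {k + l |k l. k \<in> (%k. k + x) ` K \<and> l \<in> (%k. k + y) ` J}"
 then obtain k l where "z = (k + l) + (x + y)" "k \<in> K" "l \<in> J" by (auto simp: algebra_simps)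
 moreover hence "k + l \<in> K" using assms by (auto simp: subgrp_def)
 ultimately show "z \<in> (%k. k + (x + y)) ` K" by blast
next
 fix z assume "z \<in> (%k. k + (x + y)) ` K"
 then obtain k where "z = (k + x) + (0 + y)" "k \<in> K" by (auto simp: algebra_simps)
 thus "z \<in> {k + l |k l. k \<in> (%k. k + x) ` K \<and> l \<in> (%k. k + y) ` J}" using assms(3) by blast
qed

lemma dcs_act:
 assumes "subgrp K" "!!k. k \<in> K ==> y * k \<in> K"
 shows "coset_act Abar0 (emb ` K) (emb y) (dcs K x) = dcs K (y * x)"
 unfolding coset_act_def Abar_pres dcs_def emb_lcos emb_set_add
proof (rule arg_cong[of _ _ "image emb"], intro equalityI subsetI)
 fix z assume "z \<in> {k + l |k l. k \<in> K \<and> l \<in> (%c. y * c) ` (%k. k + x) ` K}"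
 then obtain k l where "z = (k + y * l) + y * x" "k \<in> K" "l \<in> K" by (auto simp: algebra_simps)
 moreover hence "k + y * l \<in> K" using assms by (auto simp: subgrp_def)
 ultimately show "z \<in> (%k. k + y * x) ` K" by blast
next
 fix z assume "z \<in> (%k. k + y * x) ` K"
 then obtain k where "z = k + y * (0 + x)" "k \<in> K" by auto
 moreover have "0 \<in> K" using assms(1) by (simp add: subgrp_def)
 ultimately show "z \<in> {k + l |k l. k \<in> K \<and> l \<in> (%c. y * c) ` (%k. k + x) ` K}" by blast
qed

context
 fixes \<mu> :: weight and \<delta> :: "nat => int"
 assumes \<delta>: "!!a. a \<in> M0 ==> \<delta> a = 1 \<or> \<delta> a = - 1"
begin

lemma JIbar_emb: "JIbar p0 q0 n0 \<mu> \<delta> = emb ` B.KT \<mu> (eps \<delta>)"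
proof -
 have I: "Ibar p0 q0 n0 \<mu> \<delta> = emb ` B.IT \<mu> (eps \<delta>)" by (rule Ibar_emb) (rule \<delta>)
 show ?thesis unfolding JIbar_def Jbar_emb I B.KT_def unfolding Abar_pres by (rule emb_set_add)
qed

lemma double_coset_emb: "double_coset p0 q0 n0 \<mu> \<delta> (emb x) = dcs (B.KT \<mu> (eps \<delta>)) x"
 unfolding double_coset_def JIbar_emb by (rule dcs_rcos)

lemma dc_zero_emb: "dc_zero0 \<mu> \<delta> = dcs (B.KT \<mu> (eps \<delta>)) 0"
 unfolding dc_zero_def double_coset_emb[symmetric] by (simp add: Abar_pres emb_0)

lemma dc_act_emb:
 "(!!k. k \<in> B.KT \<mu> (eps \<delta>) ==> y * k \<in> B.KT \<mu> (eps \<delta>)) ==>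
  dc_act p0 q0 n0 \<mu> \<delta> (emb y) (dcs (B.KT \<mu> (eps \<delta>)) x) = dcs (B.KT \<mu> (eps \<delta>)) (y * x)"
 unfolding dc_act_def JIbar_emb by (rule dcs_act[OF subgrp_KT])

lemma dc_smul_emb: "dc_smul0 \<mu> \<delta> z (dcs (B.KT \<mu> (eps \<delta>)) x) = dcs (B.KT \<mu> (eps \<delta>)) (csc z * x)"
 unfolding dc_smul_def by (simp add: Abar_class_emb dc_act_emb Uh_KT Uh_csc)

end

section \<open>Identification of the Zhelobenko operators\<close>

lemma iota_ad: "c \<in> {1..<m0} ==> iota ((cm (ec (Suc c) c) ^^ s) Y) = (cm (ec (Suc c) c) ^^ s) (iota Y)"
 by (induction s) (simp_all add: cm_def iota_hom iota_ec)

lemma the_elem_const: "A \<noteq> {} ==> (!!x. x \<in> A ==> f x = y) ==> the_elem (f ` A) = y"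
proof -
 assume "A \<noteq> {}" "!!x. x \<in> A ==> f x = y"
 hence "f ` A = {y}" by auto
 thus ?thesis by simp
qed

context simple_root
begin

definition fall :: "nat => B0" where
 "fall s = csc (fact s) * prod_list (map H [0..<s])"

lemma fall_Suc: "fall (Suc s) = csc (of_nat (Suc s)) * fall s * H s"
 by (simp add: fall_def csc_mult mult.assoc)

lemma hc_fall: "hc s * fall s = 1" "fall s * hc s = 1"
proof -
 have H: "H s \<in> Uh" for s using c_range by (intro den_Uh)
 have fall: "fall s \<in> Uh" for s
  by (induction s) (use Uh_csc[of 1] H in "auto simp: fall_Suc fall_def[of 0] intro!: Uh_mult Uh_csc simp del: of_nat_Suc")
 show 1: "hc s * fall s = 1"
 proof (induction s)
  case (Suc s)
  have "hc (Suc s) * fall (Suc s) = csc (of_nat (Suc s)) * hc (Suc s) * (fall s * H s)"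
   unfolding fall_Suc by (simp add: mult.assoc csc_left_comm[of "hc (Suc s)"] del: hc.simps of_nat_Suc)
  also have "\<dots> = csc (of_nat (Suc s)) * hc (Suc s) * H s * fall s"
   unfolding Uh_comm[OF fall H] by (simp only: mult.assoc)
  also have "\<dots> = hc s * fall s" unfolding hc_H ..
  finally show ?case using Suc by simp
 qed (simp add: fall_def)
 thus "fall s * hc s = 1" using Uh_comm[OF fall hc_Uh, of s s] by simp
qed

text \<open>The defining sum omits s = 0 and runs over the non-vanishing terms; local nilpotency in
  A makes it finite, and \<open>hc_fall\<close> identifies the inverse of s! H (H - 1) ... (H - s +
  1) with \<open>hc s\<close>.\<close>

lemma xi_emb: "xi0 c (emb Y) = emb (xiT (iota Y))"
proof -
 let ?F = "ec (Suc c) c :: A0"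
 have F: "Fhat p0 q0 n0 c (emb Y) = emb (cm ?F Y)" for Y
  using c_range by (simp add: Fhat_def A_class_emb eE_alg A_pres emb_mult emb_diff cm_def ec_def)
 hence Fs: "(Fhat p0 q0 n0 c ^^ s) (emb Y) = emb ((cm ?F ^^ s) Y)" for s
  by (induction s) simp_all
 obtain N where N: "(cm ?F ^^ N) Y = 0"
 proof -
  obtain x where "x \<in> alg A_gens0" "cls x = Y"
   using cls_surj_alg[of Y] by (auto simp: pgens_tA_def)
  hence "Y \<in> A.AA" unfolding AA_cls by (intro image_eqI[of Y cls x]) simp_all
  show ?thesis by (rule exE[OF A.AA_nilpotent[OF \<open>Y \<in> A.AA\<close> c]]) (rule that)
 qed
 have N': "(cm ?F ^^ s) Y = 0" if "N \<le> s" for s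
 proof -
  have "(cm ?F ^^ ((s - N) + N)) Y = 0" unfolding funpow_add using N by simp
  thus ?thesis using that by simp
 qed
 define S where "S = {s. 1 \<le> s \<and> (cm ?F ^^ s) Y \<noteq> 0}"
 have S: "S \<subseteq> {1..<Suc N}"
 proof
  fix s assume "s \<in> S"
  hence "1 \<le> s" "\<not> N \<le> s" using N' unfolding S_def by blast+
  thus "s \<in> {1..<Suc N}" by simp
 qed
 hence fin: "finite S" by (rule finite_subset) simp
 have tm: "m_inv Abar0 (Abar_class0 (of_nat (fact s) * Hfall c s))
     \<otimes>\<^bsub>Abar0\<^esub> Abar_class0 (eE c (Suc c) ^ s)
     \<otimes>\<^bsub>Abar0\<^esub> A_to_Abar0 ((Fhat p0 q0 n0 c ^^ s) (emb Y)) =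
   emb (hc s * E ^ s * ad s (iota Y))" for s
 proof -
  note alg = A_gens_Abar[OF eE_alg[OF c_range(1,1)]] A_gens_Abar[OF eE_alg[OF c_range(2,2)]] A_gens_Abar[OF eE_alg[OF c_range]]
  have Hf: "Hfall c s \<in> alg Abar_gens0"
   unfolding Hfall_def using alg by (intro alg_prod_list) (auto intro!: alg_intros)
  hence alg': "of_nat (fact s) * Hfall c s \<in> alg Abar_gens0" by (intro alg_mult alg_of_nat)
  have "cls (of_nat (fact s) * Hfall c s) = fall s"
   using cls_of_nat[of "fact s", where 'a = tB] unfolding fall_def Hfall_def
   by (simp add: cls_mult cls_prod_list o_def cls_diff den_def ec_def csc_uminus)
  hence "m_inv Abar0 (Abar_class0 (of_nat (fact s) * Hfall c s)) = emb (hc s)"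
   unfolding Abar_class_emb[OF alg'] Abar_pres by (simp add: emb_m_inv hc_fall)
  moreover have "Abar_class0 (eE c (Suc c) ^ s) = emb (E ^ s)"
   using alg(3) by (simp add: Abar_class_emb alg_power cls_power ec_def)
  ultimately show ?thesis
   unfolding Fs A_to_Abar_emb iota_ad[OF c] Abar_pres by (simp add: emb_mult)
 qed
 have "xi0 c (emb Y) = emb (iota Y) \<oplus>\<^bsub>Abar0\<^esub> (\<Oplus>\<^bsub>Abar0\<^esub>s\<in>S. emb (hc s * E ^ s * ad s (iota Y)))"
  unfolding xi_def A_to_Abar_emb tm unfolding Fs A_pres emb_0 emb_inject S_def ..
 also have "\<dots> = emb (iota Y + (\<Sum>s\<in>S. hc s * E ^ s * ad s (iota Y)))"
  unfolding Abar_pres by (simp add: emb_finsum[OF fin] emb_add)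
 also have "(\<Sum>s\<in>S. hc s * E ^ s * ad s (iota Y)) = (\<Sum>s\<in>{1..<Suc N}. hc s * E ^ s * ad s (iota Y))"
 proof (rule sum.mono_neutral_left[OF _ S], simp, intro ballI)
  fix s assume "s \<in> {1..<Suc N} - S"
  hence "(cm ?F ^^ s) Y = 0" by (auto simp: S_def)
  hence "ad s (iota Y) = 0" by (simp add: iota_hom flip: iota_ad[OF c])
  thus "hc s * E ^ s * ad s (iota Y) = 0" by simp
 qed
 also have "iota Y + (\<Sum>s\<in>{1..<Suc N}. hc s * E ^ s * ad s (iota Y)) = (\<Sum>s<Suc N. hc s * E ^ s * ad s (iota Y))"
 proof -
  have "{..<Suc N} = insert 0 {1..<Suc N}" by auto
  thus ?thesis by simp
 qed
 also have "\<dots> = xiT (iota Y)"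
 proof (rule xiT_eq[symmetric, of N])
  show "ad N (iota Y) = 0" using N by (simp add: iota_hom flip: iota_ad[OF c])
 qed simp
 finally show ?thesis .
qed

text \<open>The expression t' is given only through its values; by \<open>Uh_val_cong\<close> these
  fix its class, which is that of the translated expression.\<close>

lemma sh_eta:
 assumes "t \<in> Uh_expr m0" "t' \<in> Uh_expr m0"
  and "\<forall>\<mu>. generic m0 \<mu> --> Uh_val \<mu> t' = Uh_val (%a. \<mu> a + eta_wt c a) t"
 shows "cls (sh \<eta> t) = (cls t' :: B0)"
proof (rule Uh_val_cong)
 fix \<mu> assume "generic m0 \<mu>"
 moreover have "(%a. \<mu> a + eta_wt c a) = (%a. \<mu> a + of_int (\<eta> a))"
  by (auto simp: eta_wt_def \<eta>_def)
 ultimately show "Uh_val \<mu> (sh \<eta> t) = Uh_val \<mu> t'"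
  using assms by (simp add: Uh_val_sh[where m = m0])
qed (use assms in "simp_all add: sh_Uh_expr")

definition fx :: "gen falg set => gen falg set set" where
 "fx = (\<lambda>x\<in>carrier Abar0. dcs B.JT (xib (inv_into UNIV emb x)))"

lemma fx_emb: "fx (emb X) = dcs B.JT (xib X)"
 by (simp add: fx_def Abar_pres inv_f_f[OF inj_emb])

lemma J_act: "coset_act Abar0 Jbar0 (Abar_class0 (scal z)) (dcs B.JT x) = dcs B.JT (csc z * x)"
 unfolding Jbar_emb by (simp add: Abar_class_emb dcs_act subgrp_JT csc_JT)

lemma Uh_expr_alg: "t \<in> Uh_expr m0 ==> t \<in> alg Abar_gens0"
 unfolding Uh_expr_def by (erule alg_mono[rotated]) (auto simp: Abar_gens_def A_gens_def gl_gens_def)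

lemma Uh_mult_emb: "t \<in> Uh_expr m0 ==> Abar_class0 t \<otimes>\<^bsub>Abar0\<^esub> A_to_Abar0 (emb Y) = emb (cls t * iota Y)"
 "t \<in> Uh_expr m0 ==> Abar_class0 t \<otimes>\<^bsub>Abar0\<^esub> xi0 c (emb Y) = emb (cls t * xiT (iota Y))"
 unfolding xi_emb A_to_Abar_emb Abar_class_emb[OF Uh_expr_alg] Abar_pres by (simp_all add: emb_mult)

lemma xib_Uh_iota:
 assumes "t \<in> Uh_expr m0" "t' \<in> Uh_expr m0" "cls (sh \<eta> t) = (cls t' :: B0)"
 shows "dcs B.JT (xib (cls t * iota Y)) = dcs B.JT (cls t' * xiT (iota Y))"
proof (rule dcs_cong[OF subgrp_JT])
 have "xib (cls t * iota Y) - cls t' * xib (iota Y) \<in> B.JT"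
  using xib_Uh_expr[OF assms(1), of "iota Y"] assms(3) by simp
 moreover have "cls t' * (xib (iota Y) - xiT (iota Y)) \<in> B.JT"
  using assms(2) by (intro Uh_JT xib_AA iota_in_AA) (auto simp: Uh_eq)
 ultimately have "xib (cls t * iota Y) - cls t' * xib (iota Y) + cls t' * (xib (iota Y) - xiT (iota Y)) \<in> B.JT"
  by (rule B.JT_add)
 thus "xib (cls t * iota Y) - cls t' * xiT (iota Y) \<in> B.JT" by (simp add: right_diff_distrib)
qed

text \<open>The operator is a definite description, so existence and uniqueness are both due.
  Existence is the map \<open>fx\<close> obtained from words; uniqueness holds because the last
  clause fixes the values on fractions times elements of A, and these span additively.\<close>

lemma xi_bar_emb: "xi_bar p0 q0 n0 c (emb X) = dcs B.JT (xib X)"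
proof -
 let ?C = "carrier Abar0"
 let ?P1 = "%f. f \<in> ?C \<rightarrow>\<^sub>E a_rcosets\<^bsub>Abar0\<^esub> Jbar0"
 let ?P2 = "%f. \<forall>x\<in>?C. \<forall>y\<in>?C. f (x \<oplus>\<^bsub>Abar0\<^esub> y) = f x <+>\<^bsub>Abar0\<^esub> f y"
 let ?P3 = "%f. \<forall>x\<in>?C. \<forall>z. f (Abar_class0 (scal z) \<otimes>\<^bsub>Abar0\<^esub> x) =
   coset_act Abar0 Jbar0 (Abar_class0 (scal z)) (f x)"
 let ?P4 = "%f. \<forall>t\<in>Uh_expr m0. \<forall>t'\<in>Uh_expr m0.
   (\<forall>\<mu>. generic m0 \<mu> --> Uh_val \<mu> t' = Uh_val (%a. \<mu> a + eta_wt c a) t) -->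
   (\<forall>Y\<in>carrier A_alg0. f (Abar_class0 t \<otimes>\<^bsub>Abar0\<^esub> A_to_Abar0 Y) =
    Jbar0 +>\<^bsub>Abar0\<^esub> (Abar_class0 t' \<otimes>\<^bsub>Abar0\<^esub> xi0 c Y))"
 have C: "?C = range (emb :: B0 => _)" and A: "carrier A_alg0 = range (emb :: A0 => _)"
  by (simp_all add: Abar_pres A_pres carrier_pres)
 have "xi_bar p0 q0 n0 c = fx"
  unfolding xi_bar_def
 proof (rule the_equality)
  have "?P1 fx"
  proof
   fix x assume "x \<in> ?C"
   then obtain X where x: "x = emb (X :: B0)" unfolding C by blast
   show "fx x \<in> a_rcosets\<^bsub>Abar0\<^esub> Jbar0"
    unfolding x fx_emb A_RCOSETS_def' Jbar_emb using dcs_rcos[of B.JT "xib X"] C by auto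
  qed (simp add: fx_def)
  moreover have "?P2 fx"
  proof (intro ballI)
   fix x y assume "x \<in> ?C" "y \<in> ?C"
   then obtain X Y where xy: "x = emb (X :: B0)" "y = emb (Y :: B0)" unfolding C by blast
   have "x \<oplus>\<^bsub>Abar0\<^esub> y = emb (X + Y)" unfolding xy Abar_pres by (rule emb_add)
   thus "fx (x \<oplus>\<^bsub>Abar0\<^esub> y) = fx x <+>\<^bsub>Abar0\<^esub> fx y"
    using dcs_add[OF subgrp_JT order_refl B.JT_0, of "xib X" "xib Y"] dcs_cong[OF subgrp_JT xib_add[of X Y]]
    by (simp add: xy fx_emb)
  qed
  moreover have "?P3 fx"
  proof (intro ballI allI)
   fix x z assume "x \<in> ?C"
   then obtain X where x: "x = emb (X :: B0)" unfolding C by blast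
   have "Abar_class0 (scal z) \<otimes>\<^bsub>Abar0\<^esub> x = emb (csc z * X)"
    unfolding x Abar_pres by (simp add: Abar_class_emb emb_mult)
   thus "fx (Abar_class0 (scal z) \<otimes>\<^bsub>Abar0\<^esub> x) =
    coset_act Abar0 Jbar0 (Abar_class0 (scal z)) (fx x)"
    using dcs_cong[OF subgrp_JT xib_csc[of z X]] by (simp add: x fx_emb J_act)
  qed
  moreover have "?P4 fx"
  proof (intro ballI impI)
   fix t t' Y assume *: "t \<in> Uh_expr m0" "t' \<in> Uh_expr m0"
    "\<forall>\<mu>. generic m0 \<mu> --> Uh_val \<mu> t' = Uh_val (%a. \<mu> a + eta_wt c a) t" "Y \<in> carrier A_alg0"
   then obtain Y' where Y: "Y = emb (Y' :: A0)" unfolding A by blast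
   show "fx (Abar_class0 t \<otimes>\<^bsub>Abar0\<^esub> A_to_Abar0 Y)
      = Jbar0 +>\<^bsub>Abar0\<^esub> (Abar_class0 t' \<otimes>\<^bsub>Abar0\<^esub> xi0 c Y)"
    unfolding Y Uh_mult_emb(1)[OF *(1)] Uh_mult_emb(2)[OF *(2)] fx_emb Jbar_emb dcs_rcos
    by (rule xib_Uh_iota[OF *(1,2) sh_eta[OF *(1-3)]])
  qed
  ultimately show "?P1 fx \<and> ?P2 fx \<and> ?P3 fx \<and> ?P4 fx"
   by blast
 next
  fix f assume f: "?P1 f \<and> ?P2 f \<and> ?P3 f \<and> ?P4 f"
  note f_add = f[THEN conjunct2, THEN conjunct1, rule_format]
   and f_csc = f[THEN conjunct2, THEN conjunct2, THEN conjunct1, rule_format]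
   and f_Uh = f[THEN conjunct2, THEN conjunct2, THEN conjunct2, rule_format]
  have Cx: "emb x \<in> ?C" for x :: B0 unfolding C by (rule rangeI)
  \<comment> \<open>For every t the translate \<open>sh \<eta> t\<close> is a possible choice of t',
    so the last clause determines f on such products.\<close>
  have gen: "f (emb (cls t * iota Y)) = dcs B.JT (xib (cls t * iota Y))" if t: "t \<in> Uh_expr m0" for t Y
  proof -
   have eta: "(%a. \<mu> a + eta_wt c a) = (%a. \<mu> a + of_int (\<eta> a))" for \<mu>
    by (auto simp: eta_wt_def \<eta>_def)
   have "\<forall>\<mu>. generic m0 \<mu> --> Uh_val \<mu> (sh \<eta> t) = Uh_val (%a. \<mu> a + eta_wt c a) t"
    unfolding eta using Uh_val_sh[OF t] by simp
   moreover have "emb Y \<in> carrier A_alg0" unfolding A by blast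
   ultimately have "f (Abar_class0 t \<otimes>\<^bsub>Abar0\<^esub> A_to_Abar0 (emb Y))
      = Jbar0 +>\<^bsub>Abar0\<^esub> (Abar_class0 (sh \<eta> t) \<otimes>\<^bsub>Abar0\<^esub> xi0 c (emb Y))"
    by (intro f_Uh t sh_Uh_expr) blast+
   thus ?thesis
    unfolding Uh_mult_emb(1)[OF t] Uh_mult_emb(2)[OF sh_Uh_expr[OF t]] Jbar_emb dcs_rcos
    using xib_Uh_iota[OF t sh_Uh_expr[OF t] refl] by simp
  qed
  have "f (emb X) = dcs B.JT (xib X)" for X
   using B0_span[of X]
  proof induction
   case zero
   have "(0 :: gen falg) \<in> Uh_expr m0" by (simp add: Uh_expr_def)
   from gen[OF this, of 0] show ?case by simp
  next
   case (base x)
   then obtain t y where "x = t * y" "t \<in> Uh" "y \<in> B.AA" by blast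
   thus ?case using gen iota_AA[of y] by (auto simp: Uh_eq)
  next
   case (add x y)
   have "f (emb x \<oplus>\<^bsub>Abar0\<^esub> emb y) = f (emb x) <+>\<^bsub>Abar0\<^esub> f (emb y)"
    by (rule f_add[OF Cx Cx])
   moreover have "emb x \<oplus>\<^bsub>Abar0\<^esub> emb y = emb (x + y)" unfolding Abar_pres by (rule emb_add)
   ultimately show ?case
    using dcs_add[OF subgrp_JT order_refl B.JT_0, of "xib x" "xib y"] dcs_cong[OF subgrp_JT xib_add[of x y]] add.IH
    by simp
  next
   case (uminus x)
   have "f (Abar_class0 (scal (- 1)) \<otimes>\<^bsub>Abar0\<^esub> emb x) =
     coset_act Abar0 Jbar0 (Abar_class0 (scal (- 1))) (f (emb x))"
    by (rule f_csc[OF Cx])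
   moreover have "Abar_class0 (scal (- 1)) \<otimes>\<^bsub>Abar0\<^esub> emb x = emb (- x)"
    unfolding Abar_pres by (simp add: Abar_class_emb emb_mult csc_uminus)
   ultimately show ?case
    using dcs_cong[OF subgrp_JT, of "xib (- x)" "- xib x"] xib_uminus[of x] uminus.IH
    by (simp add: J_act csc_uminus)
  qed
  hence "f x = fx x" if x: "x \<in> ?C" for x
  proof -
   obtain X where "x = emb (X :: B0)" using x unfolding C by blast
   thus ?thesis using \<open>!!X. f (emb X) = dcs B.JT (xib X)\<close> fx_emb by simp
  qed
  moreover have "f \<in> extensional ?C" "fx \<in> extensional ?C"
   using f by (auto simp: PiE_def fx_def)
  ultimately show "f = fx" by (intro extensionalityI[of f ?C])
 qed
 thus ?thesis by (simp add: fx_emb)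
qed

text \<open>The value does not depend on the representative of the coset, because \<open>th\<close>
  is additive modulo J and preserves J.\<close>

lemma xi_check_dcs: "xi_check p0 q0 n0 c (dcs B.JT x) = dcs B.JT (th x)"
 unfolding xi_check_def
proof (rule the_elem_const)
 show "dcs B.JT x \<noteq> {}" using B.JT_0 unfolding dcs_def by blast
 fix C assume "C \<in> dcs B.JT x"
 then obtain k where k: "C = emb (k + x)" "k \<in> B.JT" by (auto simp: dcs_def)
 have "th (k + x) - (th k + th x) + th k \<in> B.JT" using th_add th_JT[OF k(2)] by (rule B.JT_add)
 thus "xi_bar p0 q0 n0 c (perm_act p0 q0 n0 tr C) = dcs B.JT (th x)"
  unfolding k(1) perm_act_emb[OF tr_permutes] xi_bar_emb th_def[symmetric]
  by (intro dcs_cong[OF subgrp_JT]) simp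
qed

end

lemma xi_check_word_dcs: "set cs \<subseteq> {1..<m0} ==> xi_check_word p0 q0 n0 cs (dcs B.JT x) = dcs B.JT (thw cs x)"
proof (induction cs)
 case (Cons c cs)
 then interpret simple_root c by unfold_locales auto
 show ?case using Cons xi_check_dcs by (simp add: xi_check_word_def)
qed (simp add: xi_check_word_def)

section \<open>The three assertions for the coset of the vector\<close>

lemma (in osc) mon_hword: "mon ep (hword ep N) = prod_list (map (%a. cr ep (a, ext ep a) ^ N a) [1..<m + 1])"
proof -
 have "mon ep (concat (map (%a. replicate (N a) (a, ext ep a)) xs)) = prod_list (map (%a. cr ep (a, ext ep a) ^ N a) xs)" for xs
  by (induction xs) (simp_all add: mon_append mon_replicate)
 thus ?thesis by (simp only: hword_def)
qed

lemma eps_delta_plus: "eps delta_plus = (%a. a \<le> p0)"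
 by (auto simp: eps_def sbar_def delta_plus_def fun_eq_iff)

lemma eps_perm_sign: "eps (perm_sign p0 \<sigma> delta_plus) = (%a. pinv \<sigma> a \<le> p0)"
 by (auto simp: eps_def sbar_def perm_sign_def delta_plus_def fun_eq_iff)

context weights
begin

abbreviation K where "K \<equiv> B.KT \<mu> (%a. a \<le> p0)"

lemma epp_id: "epp id = (%a. a \<le> p0)"
 unfolding epp_def inv_id by (simp add: fun_eq_iff)

lemma Np_id: "Np id = N"
 unfolding Np_def inv_id by (simp add: fun_eq_iff)

lemma Abar_ec: "a \<in> M0 ==> Abar_class0 (eE a a) = emb (ec a a :: B0)"
 using Abar_class_emb[OF A_gens_Abar[OF eE_alg[of a a]]] by (simp add: ec_def)

text \<open>For the pattern a \<le> p0 the extremal columns are n in the first p rows and 1 in the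
  others, so the vector of the theorem is the extremal monomial of the identity permutation.\<close>

lemma v_elt_emb: "v_elt p0 q0 n0 N = emb (vp id)"
proof -
 let ?f = "prod_list (map (%a. pp p0 a n0 ^ N a) [1..<p0 + 1]) * prod_list (map (%a. qq p0 a 1 ^ N a) [p0 + 1..<p0 + q0 + 1])"
 have "?f \<in> alg A_gens0"
  by (intro alg_mult alg_prod_list; clarsimp; intro alg_power pp_A_alg qq_A_alg; use n in simp)
 hence "v_elt p0 q0 n0 N = emb (cls ?f :: B0)"
  unfolding v_elt_def by (intro Abar_class_emb A_gens_Abar)
 also have "cls ?f = prod_list (map (%a. B.cr (epp id) (a, B.ext (epp id) a) ^ N a) ([1..<p0 + 1] @ [p0 + 1..<m0 + 1]))"
  unfolding epp_id cls_mult cls_prod_list map_map map_append prod_list.append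
  by (intro arg_cong2[of _ _ _ _ "(*)"] arg_cong[of _ _ prod_list] map_cong refl)
   (auto simp: cls_power B.cr_def B.ext_def Pc_def Qc_def)
 also have "[1..<p0 + 1] @ [p0 + 1..<m0 + 1] = [1..<m0 + 1]"
  using upt_add_eq_append[of 1 "p0 + 1" q0] by (simp add: add.assoc add.commute[of 1 q0])
 finally show ?thesis unfolding vp_def B.mon_hword Np_id .
qed

lemma v_coset_emb: "v_coset0 \<mu> N = dcs K (vp id)"
 unfolding v_coset_def v_elt_emb by (simp add: double_coset_emb delta_plus_def[abs_def] flip: eps_delta_plus)

lemma vp_KT: "vp id \<notin> K"
 unfolding vp_def epp_id by (rule mon_not_KT[OF gen B.hword_idx[OF n]])

lemma nonzero: "v_coset0 \<mu> N \<noteq> dc_zero0 \<mu> delta_plus"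
proof
 assume "v_coset0 \<mu> N = dc_zero0 \<mu> delta_plus"
 hence "dcs K (vp id) = dcs K 0"
  unfolding v_coset_emb by (simp add: dc_zero_emb delta_plus_def eps_delta_plus)
 from dcs_eqD[OF subgrp_KT this] show False using vp_KT by simp
qed

lemma has_weight: "dc_has_weight p0 q0 n0 \<mu> delta_plus lam (v_coset0 \<mu> N)"
 unfolding dc_has_weight_def
proof
 fix a assume a: "a \<in> M0"
 have "ec a a * vp id - csc (lam a) * vp id \<in> K"
  using B.IT_KT[OF B.e_mon[OF B.hword_idx[OF n, of "%a. a \<le> p0" N] a, of "%a. a \<le> p0" \<mu>]] lam[OF a] a
  unfolding vp_def epp_id Np_id by (simp add: B.cnt_hword)
 hence "dcs K (ec a a * vp id) = dcs K (csc (lam a) * vp id)" by (rule dcs_cong[OF subgrp_KT])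
 moreover have "dc_act p0 q0 n0 \<mu> delta_plus (emb (ec a a :: B0)) (dcs (B.KT \<mu> (eps delta_plus)) (vp id)) =
   dcs (B.KT \<mu> (eps delta_plus)) (ec a a * vp id)"
  by (rule dc_act_emb) (simp add: delta_plus_def, rule B.e_KT[OF a])
 moreover have "dc_smul0 \<mu> delta_plus (lam a) (dcs (B.KT \<mu> (eps delta_plus)) (vp id)) =
   dcs (B.KT \<mu> (eps delta_plus)) (csc (lam a) * vp id)"
  by (rule dc_smul_emb) (simp add: delta_plus_def)
 ultimately show "dc_act p0 q0 n0 \<mu> delta_plus (Abar_class0 (eE a a)) (v_coset0 \<mu> N) =
   dc_smul0 \<mu> delta_plus (lam a) (v_coset0 \<mu> N)"
  unfolding v_coset_emb Abar_ec[OF a] eps_delta_plus by simp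
qed

lemma yangian_act:
 assumes ij: "i \<in> N0" "j \<in> N0"
 shows "dc_yangian_act p0 q0 n0 \<mu> delta_plus (yangian_T n0 i j s) (v_coset0 \<mu> N) = dcs K (B.hat.TT s i j * vp id)"
proof -
 have "dc_act p0 q0 n0 \<mu> delta_plus (emb (B.hat.TT s i j)) (dcs (B.KT \<mu> (eps delta_plus)) (vp id)) =
   dcs (B.KT \<mu> (eps delta_plus)) (B.hat.TT s i j * vp id)"
  by (rule dc_act_emb) (simp add: delta_plus_def, rule B.KT_lmult_comm[OF B.cm_TT_e[OF ij]])
 thus ?thesis
  unfolding dc_yangian_act_def alpha_Abar[OF ij] v_coset_emb eps_delta_plus .
qed

lemma highest_weight:
 "yangian_highest_weight n0 (dc_yangian_act p0 q0 n0 \<mu> delta_plus) (dc_zero0 \<mu> delta_plus)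
  (dc_smul0 \<mu> delta_plus) (v_coset0 \<mu> N)"
proof -
 have sing: "\<exists>c. B.hat.TT s i j * vp id - csc c * vp id \<in> K \<and> (i < j --> c = 0)"
  if ij: "i \<in> N0" "j \<in> N0" "i \<le> j" for i j s
 proof -
  have "cm B.Dg (B.hat.TT s i j) = csc (of_real (real i - real j)) * B.hat.TT s i j"
   using B.cm_Dg_TT[OF ij(1,2)] by simp
  from B.singular_vector[OF n B.hat_TT_AA[OF ij(1,2)] B.cm_TT_e[OF ij(1,2)] this, of "%a. a \<le> p0" N \<mu>]
  show ?thesis using ij(3) unfolding vp_def epp_id Np_id by simp
 qed
 have zero: "dc_zero0 \<mu> delta_plus = dcs K 0"
  by (simp add: dc_zero_emb delta_plus_def flip: eps_delta_plus)
 have smul: "dc_smul0 \<mu> delta_plus t (v_coset0 \<mu> N) = dcs K (csc t * vp id)" for t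
 proof -
  have "dc_smul0 \<mu> delta_plus t (dcs (B.KT \<mu> (eps delta_plus)) (vp id)) =
    dcs (B.KT \<mu> (eps delta_plus)) (csc t * vp id)"
   by (rule dc_smul_emb) (simp add: delta_plus_def)
  thus ?thesis unfolding v_coset_emb eps_delta_plus .
 qed
 show ?thesis
  unfolding yangian_highest_weight_def
 proof (intro conjI ballI impI allI nonzero)
  fix i j s assume ij: "i \<in> N0" "j \<in> N0" "i < j"
  obtain c where "B.hat.TT s i j * vp id - csc c * vp id \<in> K" "c = 0"
   using sing[OF ij(1,2), of s] ij(3) by auto
  hence "B.hat.TT s i j * vp id - 0 \<in> K" by simp
  thus "dc_yangian_act p0 q0 n0 \<mu> delta_plus (yangian_T n0 i j s) (v_coset0 \<mu> N) = dc_zero0 \<mu> delta_plus"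
   unfolding yangian_act[OF ij(1,2)] zero by (rule dcs_cong[OF subgrp_KT])
 next
  fix i s assume i: "i \<in> N0"
  obtain c where "B.hat.TT s i i * vp id - csc c * vp id \<in> K"
   using sing[OF i i order_refl, of s] by blast
  thus "\<exists>t. dc_yangian_act p0 q0 n0 \<mu> delta_plus (yangian_T n0 i i s) (v_coset0 \<mu> N) =
    dc_smul0 \<mu> delta_plus t (v_coset0 \<mu> N)"
   unfolding yangian_act[OF i i] smul by (intro exI[of _ c] dcs_cong[OF subgrp_KT])
 qed
qed

lemma zhelobenko:
 assumes \<sigma>: "\<sigma> permutes M0" and cs: "reduced_decomposition m0 \<sigma> cs"
 shows "xi_check_induced p0 q0 n0 cs (dot_wt \<sigma> \<mu>) (perm_sign p0 \<sigma> delta_plus) (v_coset0 \<mu> N) =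
   dc_smul0 (dot_wt \<sigma> \<mu>) (perm_sign p0 \<sigma> delta_plus)
    (\<Prod>\<eta>\<in>Delta_inv m0 \<sigma>. z_factor p0 n0 \<mu> lam N \<eta>)
    (double_coset p0 q0 n0 (dot_wt \<sigma> \<mu>) (perm_sign p0 \<sigma> delta_plus)
     (perm_act p0 q0 n0 \<sigma> (v_elt p0 q0 n0 N)))"
proof -
 have set_cs: "set cs \<subseteq> {1..<m0}" and w: "word_perm cs = \<sigma>"
  using cs by (auto simp: reduced_decomposition_def)
 let ?z = "\<Prod>\<eta>\<in>Delta_inv m0 \<sigma>. z_factor p0 n0 \<mu> lam N \<eta>" and ?\<delta> = "perm_sign p0 \<sigma> delta_plus"
 have \<delta>: "?\<delta> a = 1 \<or> ?\<delta> a = - 1" for a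
  by (auto simp: perm_sign_def sbar_def delta_plus_def)
 have Kp: "B.KT (dot_wt \<sigma> \<mu>) (eps ?\<delta>) = Kp \<sigma>"
  unfolding Kp_def eps_perm_sign epp_def ..
 have K: "subgrp (Kp \<sigma>)" unfolding Kp_def by (rule subgrp_KT)
 have J: "B.JT \<subseteq> Kp \<sigma>" unfolding Kp_def using B.JT_KT by blast
 have "xi_check_induced p0 q0 n0 cs (dot_wt \<sigma> \<mu>) ?\<delta> (v_coset0 \<mu> N) = dcs (Kp \<sigma>) (csc ?z * vp \<sigma>)"
  unfolding xi_check_induced_def v_coset_emb
 proof (rule the_elem_const)
  show "dcs K (vp id) \<noteq> {}" using B.KT_0 unfolding dcs_def by blast
  fix C assume "C \<in> dcs K (vp id)"
  then obtain k where k: "C = emb (k + vp id)" "k \<in> K" by (auto simp: dcs_def)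
  have "emb ` Kp \<sigma> = dcs (Kp \<sigma>) 0" by (simp add: dcs_def)
  hence "JIbar p0 q0 n0 (dot_wt \<sigma> \<mu>) ?\<delta> = dcs (Kp \<sigma>) 0"
   unfolding Kp[symmetric] by (subst JIbar_emb) (rule \<delta>, simp)
  hence "JIbar p0 q0 n0 (dot_wt \<sigma> \<mu>) ?\<delta> <+>\<^bsub>Abar0\<^esub>
    xi_check_word p0 q0 n0 cs (Jbar0 +>\<^bsub>Abar0\<^esub> C) = dcs (Kp \<sigma>) (thw cs (k + vp id))"
   unfolding k(1) Jbar_emb dcs_rcos xi_check_word_dcs[OF set_cs] using dcs_add[OF K J B.JT_0, of 0] by simp
  also have "\<dots> = dcs (Kp \<sigma>) (csc ?z * vp \<sigma>)"
  proof (rule dcs_cong[OF K])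
   note KT = thw_KT[OF set_cs reduced_red[OF cs] k(2), unfolded w]
   have "thw cs (k + vp id) - (thw cs k + thw cs (vp id)) \<in> Kp \<sigma>"
    using thw_add(2)[OF set_cs] J by blast
   hence "thw cs (k + vp id) - (thw cs k + thw cs (vp id)) + (thw cs k + (thw cs (vp id) - csc ?z * vp \<sigma>)) \<in> Kp \<sigma>"
    using KT K unfolding subgrp_def by blast
   thus "thw cs (k + vp id) - csc ?z * vp \<sigma> \<in> Kp \<sigma>" by (simp add: algebra_simps)
  qed
  finally show "JIbar p0 q0 n0 (dot_wt \<sigma> \<mu>) ?\<delta> <+>\<^bsub>Abar0\<^esub>
    xi_check_word p0 q0 n0 cs (Jbar0 +>\<^bsub>Abar0\<^esub> C) = dcs (Kp \<sigma>) (csc ?z * vp \<sigma>)" .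
 qed
 moreover have "perm_act p0 q0 n0 \<sigma> (v_elt p0 q0 n0 N) = emb (vp \<sigma>)"
  unfolding v_elt_emb perm_act_emb[OF \<sigma>] sg_vp[OF \<sigma> permutes_id] o_id ..
 moreover have "dc_smul0 (dot_wt \<sigma> \<mu>) ?\<delta> ?z (dcs (B.KT (dot_wt \<sigma> \<mu>) (eps ?\<delta>)) (vp \<sigma>)) =
   dcs (B.KT (dot_wt \<sigma> \<mu>) (eps ?\<delta>)) (csc ?z * vp \<sigma>)"
  by (rule dc_smul_emb) (rule \<delta>)
 moreover have "double_coset p0 q0 n0 (dot_wt \<sigma> \<mu>) ?\<delta> (emb (vp \<sigma>)) = dcs (B.KT (dot_wt \<sigma> \<mu>) (eps ?\<delta>)) (vp \<sigma>)"
  by (rule double_coset_emb) (rule \<delta>)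
 ultimately show ?thesis by (simp only: Kp)
qed

end

lemma claim_params: "claim p0 q0 n0"
 unfolding claim_def
proof (intro allI impI)
 fix \<mu> lam :: weight and \<nu> :: "nat => nat"
 assume n: "1 \<le> n0" and "1 \<le> m0"
  and gen: "\<forall>a\<in>M0. \<forall>b\<in>M0. a \<noteq> b --> \<mu> a - \<mu> b \<notin> \<int>"
  and P: "\<forall>a\<in>{1..p0}. of_nat (\<nu> a) = \<mu> a - lam a - of_nat n0 / 2"
  and Q: "\<forall>a\<in>{p0 + 1..m0}. of_nat (\<nu> a) = lam a - \<mu> a - of_nat n0 / 2"
 interpret weights \<mu> lam \<nu>
 proof
  show "1 \<le> n0" by fact
  show "generic m0 \<mu>" using gen by (simp only: generic_def)
  fix a assume a: "a \<in> M0"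
  show "lam a = B.hwt \<mu> (%a. a \<le> p0) a (\<nu> a)"
   using a P[rule_format, of a] Q[rule_format, of a] by (cases "a \<le> p0") (simp_all add: B.hwt_def B.sgnep_def)

 qed
 show "conclusion p0 q0 n0 \<mu> lam \<nu>"
  unfolding conclusion_def using nonzero has_weight highest_weight zhelobenko by blast
qed

theorem proposition4p4:
  fixes p q n :: nat and \<mu> lam :: weight and \<nu> :: "nat \<Rightarrow> nat"
  assumes "1 \<le> n" and "1 \<le> p + q"
    and "\<forall>a\<in>{1..p + q}. \<forall>b\<in>{1..p + q}. a \<noteq> b \<longrightarrow> \<mu> a - \<mu> b \<notin> \<int>"
    and "\<forall>a\<in>{1..p}. of_nat (\<nu> a) = \<mu> a - lam a - of_nat n / 2"
    and "\<forall>a\<in>{p + 1..p + q}. of_nat (\<nu> a) = lam a - \<mu> a - of_nat n / 2"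
  shows "v_coset p q n \<mu> \<nu> \<noteq> dc_zero p q n \<mu> delta_plus \<and>
    (dc_has_weight p q n \<mu> delta_plus lam (v_coset p q n \<mu> \<nu>) \<and>
     yangian_highest_weight n (dc_yangian_act p q n \<mu> delta_plus) (dc_zero p q n \<mu> delta_plus)
       (dc_smul p q n \<mu> delta_plus) (v_coset p q n \<mu> \<nu>)) \<and>
    (\<forall>\<sigma> cs. \<sigma> permutes {1..p + q} \<and> reduced_decomposition (p + q) \<sigma> cs \<longrightarrow>
       xi_check_induced p q n cs (dot_wt \<sigma> \<mu>) (perm_sign p \<sigma> delta_plus) (v_coset p q n \<mu> \<nu>) =
       dc_smul p q n (dot_wt \<sigma> \<mu>) (perm_sign p \<sigma> delta_plus)
         (\<Prod>\<eta>\<in>Delta_inv (p + q) \<sigma>. z_factor p n \<mu> lam \<nu> \<eta>)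
         (double_coset p q n (dot_wt \<sigma> \<mu>) (perm_sign p \<sigma> delta_plus)
           (perm_act p q n \<sigma> (v_elt p q n \<nu>))))"
  by (rule claim_generic[OF claim_params, unfolded claim_def conclusion_def, THEN spec[of _ \<mu>], THEN spec[of _ lam],
    THEN spec[of _ \<nu>], THEN mp, THEN mp, THEN mp, THEN mp, THEN mp, OF assms])

end
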